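(* Let $\gamma_f=\gamma_h=0$ and let $(\bar f_0,\bar g_0)=(f_0-\langle f_0\rangle,\,g_0-\langle g_0\rangle)\in(\dot A(\mathbb T))^2$ be the initial datum for the system $$\partial_t\bar f=\partial_x\big[(\bar f+\langle f_0\rangle)(b_\rho\partial_x\bar f+b\,\partial_x\bar g)\big],\qquad \partial_t\bar g=\partial_x\big[(\bar g+\langle g_0\rangle)(b_\mu\partial_x\bar f+b_\mu\partial_x\bar g)\big]\qquad(\mathrm M_0)$$ on $\mathbb T$, satisfying $$\mathcal E_0(\bar f_0,\bar g_0)<\min\{\langle f_0\rangle,\langle g_0\rangle\},\qquad\min\{\sigma_{1,b},\sigma_{2,b}\}>0.$$ Then: (a) (Existence) There exists at least one global weak solution $(\bar f,\bar g)$ of $(\mathrm M_0)$ with this initial datum such that for every $T>0$ and every $\alpha\in[0,\tfrac12)$ $$(\bar f,\bar g)\in\Big(L^\infty([0,T]\times\mathbb T)\cap L^2(0,T;W^{1,\infty}(\mathbb T))\cap L^1(0,T;C^{1+\alpha}(\mathbb T))\cap\mathcal M(0,T;W^{2,\infty}(\mathbb T))\cap L^2(0,T;\dot H^1(\mathbb T))\Big)^2.$$ (b) (Exponential decay) This solution satisfies, for almost every $T>0$, $$\|\bar f(T)\|_{L^\infty}+\|\bar g(T)\|_{L^\infty}\le\mathcal E_0(\bar f_0,\bar g_0)\,e^{-\delta_bT},$$ where $\delta_b=\delta_b(\bar f_0,\bar g_0,\rho_\pm,\mu_\pm)>0$ is a constant depending on the initial datum and the physical parameters. (c) (Uniqueness)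 Weak solutions are unique in the class $(L^1(0,T;\dot A^2(\mathbb T)))^2$: two weak solutions on $[0,T]$ with the initial datum $(\bar f_0,\bar g_0)$ which both belong to $(L^1(0,T;\dot A^2(\mathbb T)))^2$ coincide.
   Context: $\mathbb T=[-\pi,\pi]$ with periodic boundary conditions; $\langle u\rangle=\frac1{2\pi}\int_{-\pi}^{\pi}u\,dx$; $\hat u(k)=\frac1{2\pi}\int_{\mathbb T}u(x)e^{-ikx}dx$. For $\alpha\ge0$, $A^\alpha(\mathbb T)=\{u\in L^1(\mathbb T):\sum_{k\in\mathbb Z}(1+|k|^\alpha)|\hat u(k)|<\infty\}$, $A=A^0$, and $\dot A^\alpha(\mathbb T)$, $\dot H^\alpha(\mathbb T)$ are the subspaces of zero-mean functions of $A^\alpha(\mathbb T)$ and of the Sobolev space $H^\alpha(\mathbb T)$, with norms $\|u\|_{\dot A^\alpha}=\sum_k|k|^\alpha|\hat u(k)|$ and $\|u\|_{\dot H^\alpha}^2=\sum_k|k|^{2\alpha}|\hat u(k)|^2$; $\dot A=\dot A^0$. $\mathcal M(0,T;X)$ is the space of Radon measures on $[0,T]$ with values in the Banach space $X$. $\mathcal E_s(\bar f,\bar g)=\|\bar f\|_{\dot A^s}+\|\bar g\|_{\dot A^s}$. Parameters: $\mu_\pm,\rho_\pm>0$ (viscosities, densities); $b=\rho_+$, $b_\mu=\frac{\mu_-}{\mu_+}b$, $b_\rho=\frac{\rho_-}{\rho_+}b=\rho_-$. $f_0,g_0$ are positive $2\pi$-periodic functions (initial thicknesses of the two fluid layers).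 Moreover $$\sigma_{1,b}=\langle f_0\rangle b_\rho-\langle g_0\rangle b_\mu-\mathcal E_0(\bar f_0,\bar g_0)(2b_\rho+2b+4b_\mu),$$ $$\sigma_{2,b}=\langle g_0\rangle b_\mu-\langle f_0\rangle b-\mathcal E_0(\bar f_0,\bar g_0)(2b_\rho+2b+4b_\mu).$$ Weak solution (without surface tension): a pair of zero-mean functions $(\bar f,\bar g)\in(L^1(0,T;W^{1,1}(\mathbb T)))^2$ is a weak solution of $(\mathrm M_0)$ on $[0,T]$ with initial datum $(\bar f_0,\bar g_0)$ if for all $\phi,\psi\in C^1_c([0,T)\times\mathbb T)$ $$-\int_{\mathbb T}\bar f_0\phi(0)dx-\int_0^T\!\!\int_{\mathbb T}\bar f\,\partial_t\phi\,dxdt=-\int_0^T\!\!\int_{\mathbb T}(\bar f+\langle f_0\rangle)(b_\rho\partial_x\bar f+b\partial_x\bar g)\partial_x\phi\,dxdt,$$ $$-\int_{\mathbb T}\bar g_0\psi(0)dx-\int_0^T\!\!\int_{\mathbb T}\bar g\,\partial_t\psi\,dxdt=-\int_0^T\!\!\int_{\mathbb T}(\bar g+\langle g_0\rangle)b_\mu(\partial_x\bar f+\partial_x\bar g)\partial_x\psi\,dxdt.$$ A global weak solution is a pair on $(0,\infty)\times\mathbb T$ that is a weak solution on $[0,T]$ for every $T>0$. *)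

theory Defs
  imports "HOL-Probability.Essential_Supremum"
begin

text \<open>
  A function on the torus is represented by a function \<open>u :: real \<Rightarrow> real\<close>, of which only the values
  on \<open>[-\<pi>, \<pi>]\<close> matter, and these only up to null sets. The periodic boundary conditions enter through
  the periodic test functions in the weak derivative and through the periodic representative in
  the Hoelder spaces.
\<close>

definition torus :: "real measure" where
  "torus = lebesgue_on {- pi..pi}"

definition periodic :: "(real \<Rightarrow> real) \<Rightarrow> bool" where
  "periodic u \<longleftrightarrow> (\<forall>x. u (x + 2 * pi) = u x)"

definition mean :: "(real \<Rightarrow> real) \<Rightarrow> real" where
  "mean u = 1 / (2 * pi) * (\<integral>x. u x \<partial>torus)"

definition fourier :: "(real \<Rightarrow> real) \<Rightarrow> int \<Rightarrow> complex" where
  "fourier u k = 1 / (2 * of_real pi) *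
     (\<integral>x. of_real (u x) * exp (- \<i> * of_int k * of_real x) \<partial>torus)"

definition linf_enorm :: "(real \<Rightarrow> real) \<Rightarrow> ennreal" where
  "linf_enorm u = esssup torus (\<lambda>x. ennreal \<bar>u x\<bar>)"

definition smooth_periodic :: "(real \<Rightarrow> real) \<Rightarrow> bool" where
  "smooth_periodic \<eta> \<longleftrightarrow> periodic \<eta> \<and> (\<forall>n x. (deriv ^^ n) \<eta> field_differentiable (at x))"

definition has_weak_deriv :: "(real \<Rightarrow> real) \<Rightarrow> (real \<Rightarrow> real) \<Rightarrow> bool" where
  "has_weak_deriv u v \<longleftrightarrow> integrable torus u \<and> integrable torus v \<and>
     (\<forall>\<eta>. smooth_periodic \<eta> \<longrightarrow> (\<integral>x. u x * deriv \<eta> x \<partial>torus) = - (\<integral>x. v x * \<eta> x \<partial>torus))"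

text \<open>The weak derivative is unique almost everywhere, so the norms below do not depend on the choice.\<close>

definition weak_deriv :: "(real \<Rightarrow> real) \<Rightarrow> real \<Rightarrow> real" where
  "weak_deriv u = (SOME v. has_weak_deriv u v)"

record fun_space =
  elems :: "(real \<Rightarrow> real) set"
  fnorm :: "(real \<Rightarrow> real) \<Rightarrow> real"

definition L1 :: fun_space where
  "L1 = \<lparr>elems = {u. integrable torus u}, fnorm = (\<lambda>u. \<integral>x. \<bar>u x\<bar> \<partial>torus)\<rparr>"

definition Linf :: fun_space where
  "Linf = \<lparr>elems = {u. u \<in> borel_measurable torus \<and> linf_enorm u < \<infinity>},
           fnorm = (\<lambda>u. enn2real (linf_enorm u))\<rparr>"

text \<open>\<open>sobolev k L1\<close> is \<open>W\<^sup>k\<^sup>,\<^sup>1\<close> and \<open>sobolev k Linf\<close> is \<open>W\<^sup>k\<^sup>,\<^sup>\<infinity>\<close>.\<close>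

primrec sobolev :: "nat \<Rightarrow> fun_space \<Rightarrow> fun_space" where
  "sobolev 0 X = X"
| "sobolev (Suc k) X =
     \<lparr>elems = {u \<in> elems X. \<exists>v \<in> elems (sobolev k X). has_weak_deriv u v},
      fnorm = (\<lambda>u. fnorm X u + fnorm (sobolev k X) (weak_deriv u))\<rparr>"

text \<open>
  \<open>C1_rep \<alpha> u v\<close>: \<open>v\<close> is the periodic \<open>C\<^sup>1\<^sup>+\<^sup>\<alpha>\<close> representative of the class of \<open>u\<close>; it is unique.
  For \<open>\<alpha> = 0\<close> the Hoelder condition only says that \<open>v'\<close> is bounded, and the space is \<open>C\<^sup>1\<close>.
\<close>

definition C1_rep :: "real \<Rightarrow> (real \<Rightarrow> real) \<Rightarrow> (real \<Rightarrow> real) \<Rightarrow> bool" where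
  "C1_rep \<alpha> u v \<longleftrightarrow> (AE x in torus. u x = v x) \<and> periodic v \<and>
     (\<forall>x. v field_differentiable (at x)) \<and> continuous_on UNIV (deriv v) \<and>
     (\<exists>C. \<forall>x y. \<bar>deriv v x - deriv v y\<bar> \<le> C * \<bar>x - y\<bar> powr \<alpha>)"

definition C1_norm :: "real \<Rightarrow> (real \<Rightarrow> real) \<Rightarrow> real" where
  "C1_norm \<alpha> v = (SUP x. \<bar>v x\<bar>) + (SUP x. \<bar>deriv v x\<bar>) +
     (SUP (x, y) \<in> {(x, y). x \<noteq> y}. \<bar>deriv v x - deriv v y\<bar> / \<bar>x - y\<bar> powr \<alpha>)"

definition holder_C1 :: "real \<Rightarrow> fun_space" where
  "holder_C1 \<alpha> = \<lparr>elems = {u. \<exists>v. C1_rep \<alpha> u v},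
                  fnorm = (\<lambda>u. C1_norm \<alpha> (THE v. C1_rep \<alpha> u v))\<rparr>"

text \<open>
  In the next two definitions the mode \<open>k = 0\<close> does not contribute to the homogeneous norm, because the
  mean vanishes; the value \<open>0 powr 0 = 0\<close> is therefore harmless.
\<close>

definition Adot :: "real \<Rightarrow> fun_space" where
  "Adot \<alpha> =
     \<lparr>elems = {u. integrable torus u \<and> mean u = 0 \<and>
        (\<lambda>k::int. (1 + \<bar>real_of_int k\<bar> powr \<alpha>) * cmod (fourier u k)) summable_on UNIV},
      fnorm = (\<lambda>u. \<Sum>\<^sub>\<infinity>k::int. \<bar>real_of_int k\<bar> powr \<alpha> * cmod (fourier u k))\<rparr>"

definition Hdot :: "real \<Rightarrow> fun_space" where
  "Hdot \<alpha> =
     \<lparr>elems = {u. integrable torus u \<and> integrable torus (\<lambda>x. (u x)\<^sup>2) \<and> mean u = 0 \<and>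
        (\<lambda>k::int. (1 + \<bar>real_of_int k\<bar> powr (2 * \<alpha>)) * (cmod (fourier u k))\<^sup>2) summable_on UNIV},
      fnorm = (\<lambda>u. sqrt (\<Sum>\<^sub>\<infinity>k::int. \<bar>real_of_int k\<bar> powr (2 * \<alpha>) * (cmod (fourier u k))\<^sup>2))\<rparr>"

text \<open>
  A function of \<open>(t, x)\<close> is a curried \<open>f :: real \<Rightarrow> real \<Rightarrow> real\<close>, jointly Lebesgue measurable on the
  cylinder; \<open>f t\<close> is its slice at time \<open>t\<close>.
\<close>

definition cylinder :: "real \<Rightarrow> (real \<times> real) measure" where
  "cylinder T = lebesgue_on ({0..T} \<times> {- pi..pi})"

definition Linf_cylinder :: "real \<Rightarrow> (real \<Rightarrow> real \<Rightarrow> real) set" where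
  "Linf_cylinder T = {f. (\<lambda>(t, x). f t x) \<in> borel_measurable (cylinder T) \<and>
     esssup (cylinder T) (\<lambda>(t, x). ennreal \<bar>f t x\<bar>) < \<infinity>}"

definition strongly_measurable ::
    "real \<Rightarrow> fun_space \<Rightarrow> (real \<Rightarrow> real \<Rightarrow> real) \<Rightarrow> bool" where
  "strongly_measurable T X f \<longleftrightarrow>
     (\<exists>s :: nat \<Rightarrow> real \<Rightarrow> real \<Rightarrow> real.
        (\<forall>n. simple_function (lebesgue_on {0..T}) (s n) \<and> s n ` {0..T} \<subseteq> elems X) \<and>
        (AE t in lebesgue_on {0..T}. f t \<in> elems X \<and>
           (\<lambda>n. fnorm X (\<lambda>x. f t x - s n t x)) \<longlonglongrightarrow> 0))"

definition bochner :: "nat \<Rightarrow> real \<Rightarrow> fun_space \<Rightarrow> (real \<Rightarrow> real \<Rightarrow> real) set" where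
  "bochner p T X = {f. (\<lambda>(t, x). f t x) \<in> borel_measurable (cylinder T) \<and>
     strongly_measurable T X f \<and>
     integrable (lebesgue_on {0..T}) (\<lambda>t. fnorm X (f t) ^ p)}"

text \<open>
  \<open>X\<close>-valued Radon measures on \<open>[0,T]\<close>: countably additive in the norm of \<open>X\<close> and of bounded variation.
  Regularity is automatic, since the variation is a finite Borel measure on a compact interval.
\<close>

definition radon_measure :: "real \<Rightarrow> fun_space \<Rightarrow> (real set \<Rightarrow> real \<Rightarrow> real) \<Rightarrow> bool" where
  "radon_measure T X \<nu> \<longleftrightarrow>
     (\<forall>B \<in> sets (restrict_space borel {0..T}). \<nu> B \<in> elems X) \<and>
     (\<forall>B :: nat \<Rightarrow> real set. range B \<subseteq> sets (restrict_space borel {0..T}) \<longrightarrow> disjoint_family B \<longrightarrow>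
        (\<lambda>n. fnorm X (\<lambda>x. \<nu> (\<Union>i. B i) x - (\<Sum>i<n. \<nu> (B i) x))) \<longlonglongrightarrow> 0) \<and>
     (\<exists>C. \<forall>\<B>. finite \<B> \<longrightarrow> \<B> \<subseteq> sets (restrict_space borel {0..T}) \<longrightarrow> disjoint \<B> \<longrightarrow>
        (\<Sum>B\<in>\<B>. fnorm X (\<nu> B)) \<le> C)"

text \<open>A function \<open>f\<close> belongs to \<open>\<M>(0,T;X)\<close> if the measure \<open>f(t) dt\<close> is an \<open>X\<close>-valued Radon measure.\<close>

definition measures_valued :: "real \<Rightarrow> fun_space \<Rightarrow> (real \<Rightarrow> real \<Rightarrow> real) set" where
  "measures_valued T X = {f. integrable (cylinder T) (\<lambda>(t, x). f t x) \<and>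
     (\<exists>\<nu>. radon_measure T X \<nu> \<and>
        (\<forall>B \<in> sets (restrict_space borel {0..T}).
           AE x in torus. \<nu> B x = (\<integral>t. f t x \<partial>lebesgue_on B)))}"

text \<open>
  \<open>test_function T \<phi> \<phi>t \<phi>x\<close>: \<open>\<phi> \<in> C\<^sup>1\<^sub>c([0,T) \<times> \<T>)\<close>, extended by zero to \<open>t \<ge> T\<close>, with partial
  derivatives \<open>\<phi>t\<close> and \<open>\<phi>x\<close>. The support may touch \<open>t = 0\<close>, where \<open>\<phi>t\<close> is one-sided.
\<close>

definition test_function ::
    "real \<Rightarrow> (real \<Rightarrow> real \<Rightarrow> real) \<Rightarrow> (real \<Rightarrow> real \<Rightarrow> real) \<Rightarrow> (real \<Rightarrow> real \<Rightarrow> real) \<Rightarrow> bool" where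
  "test_function T \<phi> \<phi>t \<phi>x \<longleftrightarrow>
     (\<forall>t\<ge>0. periodic (\<phi> t)) \<and>
     (\<forall>t\<ge>0. \<forall>x. ((\<lambda>s. \<phi> s x) has_real_derivative \<phi>t t x) (at t within {0..}) \<and>
                (\<phi> t has_real_derivative \<phi>x t x) (at x)) \<and>
     continuous_on ({0..} \<times> UNIV) (\<lambda>(t, x). \<phi>t t x) \<and>
     continuous_on ({0..} \<times> UNIV) (\<lambda>(t, x). \<phi>x t x) \<and>
     (\<exists>T'<T. \<forall>t\<ge>0. t \<ge> T' \<longrightarrow> (\<forall>x. \<phi> t x = 0))"

text \<open>
  \<open>weak_solution b b\<^sub>\<rho> b\<^sub>\<mu> F G T u\<^sub>0 v\<^sub>0 f g\<close>: weak solution of the system on \<open>[0,T]\<close> with initial datum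
  \<open>(u\<^sub>0, v\<^sub>0)\<close>, where \<open>F\<close> and \<open>G\<close> stand for the means of the two thicknesses.
  Since \<open>L\<^sup>1(0,T;W\<^sup>1\<^sup>,\<^sup>1)\<close> does not make the quadratic fluxes integrable, the existence of the
  integrals on the right-hand sides is required explicitly; a non-integrable function would
  otherwise have integral \<open>0\<close>.
\<close>

definition weak_solution ::
    "real \<Rightarrow> real \<Rightarrow> real \<Rightarrow> real \<Rightarrow> real \<Rightarrow> real \<Rightarrow> (real \<Rightarrow> real) \<Rightarrow> (real \<Rightarrow> real) \<Rightarrow>
     (real \<Rightarrow> real \<Rightarrow> real) \<Rightarrow> (real \<Rightarrow> real \<Rightarrow> real) \<Rightarrow> bool" where
  "weak_solution b b\<^sub>\<rho> b\<^sub>\<mu> F G T u\<^sub>0 v\<^sub>0 f g \<longleftrightarrow>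
     f \<in> bochner 1 T (sobolev 1 L1) \<and> g \<in> bochner 1 T (sobolev 1 L1) \<and>
     (AE t in lebesgue_on {0..T}. mean (f t) = 0 \<and> mean (g t) = 0) \<and>
     (\<exists>fx gx.
        (\<lambda>(t, x). fx t x) \<in> borel_measurable (cylinder T) \<and>
        (\<lambda>(t, x). gx t x) \<in> borel_measurable (cylinder T) \<and>
        (AE t in lebesgue_on {0..T}. has_weak_deriv (f t) (fx t) \<and> has_weak_deriv (g t) (gx t)) \<and>
        (\<forall>\<phi> \<phi>t \<phi>x. test_function T \<phi> \<phi>t \<phi>x \<longrightarrow>
           integrable (cylinder T)
             (\<lambda>(t, x). (f t x + F) * (b\<^sub>\<rho> * fx t x + b * gx t x) * \<phi>x t x) \<and>
           - (\<integral>x. u\<^sub>0 x * \<phi> 0 x \<partial>torus) - (\<integral>(t, x). f t x * \<phi>t t x \<partial>cylinder T)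
             = - (\<integral>(t, x). (f t x + F) * (b\<^sub>\<rho> * fx t x + b * gx t x) * \<phi>x t x \<partial>cylinder T)) \<and>
        (\<forall>\<psi> \<psi>t \<psi>x. test_function T \<psi> \<psi>t \<psi>x \<longrightarrow>
           integrable (cylinder T)
             (\<lambda>(t, x). (g t x + G) * (b\<^sub>\<mu> * (fx t x + gx t x)) * \<psi>x t x) \<and>
           - (\<integral>x. v\<^sub>0 x * \<psi> 0 x \<partial>torus) - (\<integral>(t, x). g t x * \<psi>t t x \<partial>cylinder T)
             = - (\<integral>(t, x). (g t x + G) * (b\<^sub>\<mu> * (fx t x + gx t x)) * \<psi>x t x \<partial>cylinder T)))"

definition global_weak_solution ::
    "real \<Rightarrow> real \<Rightarrow> real \<Rightarrow> real \<Rightarrow> real \<Rightarrow> (real \<Rightarrow> real) \<Rightarrow> (real \<Rightarrow> real) \<Rightarrow>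
     (real \<Rightarrow> real \<Rightarrow> real) \<Rightarrow> (real \<Rightarrow> real \<Rightarrow> real) \<Rightarrow> bool" where
  "global_weak_solution b b\<^sub>\<rho> b\<^sub>\<mu> F G u\<^sub>0 v\<^sub>0 f g \<longleftrightarrow>
     (\<forall>T>0. weak_solution b b\<^sub>\<rho> b\<^sub>\<mu> F G T u\<^sub>0 v\<^sub>0 f g)"

definition energy :: "real \<Rightarrow> (real \<Rightarrow> real) \<Rightarrow> (real \<Rightarrow> real) \<Rightarrow> real" where
  "energy s u v = fnorm (Adot s) u + fnorm (Adot s) v"

definition regularity_class :: "real \<Rightarrow> real \<Rightarrow> (real \<Rightarrow> real \<Rightarrow> real) set" where
  "regularity_class T \<alpha> =
     Linf_cylinder T \<inter> bochner 2 T (sobolev 1 Linf) \<inter> bochner 1 T (holder_C1 \<alpha>) \<inter>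
     measures_valued T (sobolev 2 Linf) \<inter> bochner 2 T (Hdot 1)"

end

theory Submission
 imports Defs "HOL-Analysis.Analysis" "HOL-Complex_Analysis.Great_Picard"
begin

text \<open>
 The whole argument takes place on the Fourier coefficients. In the Wiener norm \<open>en 0\<close> the linear
 part of the system dissipates at least \<open>(2 c E0 + \<delta>) en 2\<close>, where \<open>en 2\<close> is the norm of the second
 derivatives, while the quadratic flux costs at most \<open>2 c en 0 en 2\<close>. Hence \<open>en 0\<close> stays below its
 initial value \<open>E0\<close>, \<open>en 2\<close> is integrable in time, and \<open>en 0 \<le> en 2\<close> for zero means gives exponential
 decay. Explicit Euler steps for the truncated system obey the same estimate, and Helly-type compactness of
 the modes yields a solution. For uniqueness, a solution in \<open>L\<^sup>1(0,T;A\<^sup>2)\<close> is first shown to be bounded in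
 the Wiener norm, by comparing each mode with its supremum over short time intervals; the difference of
 two solutions then satisfies the dissipation estimate with an error that a Gronwall argument absorbs.
\<close>

text \<open>The conditions on the two sigmas say that the linear part is diagonally dominant column
  by column: a mode of f is damped in its own equation with weight <f0> b_rho and feeds the other
  one with weight <g0> b_mu, and similarly for g. Adding the moduli of both modes turns this
  dominance into dissipation. The modulus is not differentiable at 0; in an Euler step with a small
  step size the diagonal factor is nonnegative, so the triangle inequality is enough. The obstacle
  is uniqueness: a weak solution in the class carries no bound in time on its Wiener norm, and its
  definition only makes the flux integrable. This yields no more than linear growth of the modes in
  |k|. The gain comes from letting the derivative in the product fall on the factor of higher
  frequency q: there |k| <= 2 |q|, and the time integral of q^2 |w_q|, summed over q, is small on
  short intervals by absolute continuity. On such intervals the quadratic term contracts, and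
  summability of the modes follows without knowing continuity of the norm in time.\<close>

lemmas B_int_add = Bochner_Integration.integrable_add
 and B_int_bound = Bochner_Integration.integrable_bound
 and B_int_cong = Bochner_Integration.integrable_cong
 and B_int_diff = Bochner_Integration.integrable_diff
 and B_itg_add = Bochner_Integration.integral_add
 and B_itg_cnj = Bochner_Integration.integral_cnj
 and B_itg_cong = Bochner_Integration.integral_cong
 and B_itg_diff = Bochner_Integration.integral_diff
 and B_itg_mult_right_zero = Bochner_Integration.integral_mult_right_zero

abbreviation mag :: "int => real" where "mag k \<equiv> \<bar>real_of_int k\<bar>"

abbreviation leb :: "real => real => real measure" where "leb a b \<equiv> lebesgue_on {a..b}"

lemma borel_measurable_lebesgue_on_borel:
 "f \<in> borel_measurable borel ==> f \<in> borel_measurable (lebesgue_on S)"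
 by (intro measurable_restrict_space1 measurable_completion) simp

lemma borel_measurable_torus_borel:
 "f \<in> borel_measurable borel ==> f \<in> borel_measurable torus"
 unfolding torus_def by (rule borel_measurable_lebesgue_on_borel)

lemma AE_leb: "AE t in leb a b. t \<in> {a..b}"
 by (rule AE_I2) simp

lemma space_torus [simp]: "space torus = {-pi..pi}"
 by (simp add: torus_def)

lemma finite_measure_torus: "finite_measure torus"
 unfolding torus_def by (intro finite_measure_lebesgue_on) simp

lemma sigma_finite_torus: "sigma_finite_measure torus"
 using finite_measure_torus by (rule finite_measure.axioms(1))

lemma measure_torus: "measure torus (space torus) = 2 * pi"
 by (simp add: torus_def measure_restrict_space)

lemma integrable_mult_bounded:
 fixes f g :: "'a => 'b::{real_normed_algebra, second_countable_topology, banach}"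
 assumes "integrable M f" "g \<in> borel_measurable M" "\<And>x. x \<in> space M ==> norm (g x) \<le> C"
 shows "integrable M (\<lambda>x. f x * g x)"
proof (rule B_int_bound[where f = "\<lambda>x. C * norm (f x)"])
 show "integrable M (\<lambda>x. C * norm (f x))" using assms(1) by auto
 show "(\<lambda>x. f x * g x) \<in> borel_measurable M" using assms by auto
 show "AE x in M. norm (f x * g x) \<le> norm (C * norm (f x))"
 proof (rule AE_I2)
  fix x assume "x \<in> space M"
  then have "norm (f x) * norm (g x) \<le> norm (f x) * C" "0 \<le> C"
   using assms(3)[of x] by (auto intro: mult_left_mono order_trans[OF norm_ge_zero])
  then show "norm (f x * g x) \<le> norm (C * norm (f x))"
   using norm_mult_ineq[of "f x" "g x"] by (simp add: abs_mult mult.commute)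
 qed
qed

section \<open>Uniqueness of Fourier coefficients\<close>

lemma integral_compact_zero:
 fixes h :: "real => real"
 assumes h: "integrable (leb a b) h"
  and z: "\<And>\<phi> c d. continuous_on UNIV \<phi> ==> a < c ==> d < b ==> (\<And>x. x \<notin> {c..d} ==> \<phi> x = 0) ==>
   (LINT x|leb a b. h x * \<phi> x) = 0"
  and C: "compact C" "C \<subseteq> {a<..<b}"
 shows "(LINT x|leb a b. h x * indicator C x) = 0"
proof (cases "C = {}")
 case False
 obtain c' where c': "c' \<in> C" "\<And>x. x \<in> C ==> c' \<le> x" using compact_attains_inf[OF C(1) False] by auto
 obtain d' where d': "d' \<in> C" "\<And>x. x \<in> C ==> x \<le> d'" using compact_attains_sup[OF C(1) False] by auto
 have ab: "a < c'" "d' < b" using c' d' C(2) by auto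
 obtain N :: nat where N: "1 / real (Suc N) < (c' - a) / 1" "1 / real (Suc N) < (b - d') / 1"
 proof -
  obtain N1 where "1 / real (Suc N1) < min (c' - a) (b - d')"
   using nat_approx_posE[of "min (c' - a) (b - d')"] ab by (auto simp: inverse_eq_divide)
  then show ?thesis using that[of N1] by simp
 qed
 \<comment> \<open>Continuous cutoffs decreasing to the indicator of \<open>C\<close>. The shift by
   \<open>N\<close> keeps their supports within distance 1 / (N + 1) of \<open>C\<close>, hence
   inside the open interval.\<close>
 define \<phi> where "\<phi> n x = max 0 (1 - real (Suc (n + N)) * infdist x C)" for n x
 have z0: "(LINT x|leb a b. h x * \<phi> n x) = 0" for n
 proof (rule z[where c = "c' - 1 / real (Suc N)" and d = "d' + 1 / real (Suc N)"])
  show "continuous_on UNIV (\<phi> n)" unfolding \<phi>_def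
   by (intro continuous_intros)
  fix x assume x: "x \<notin> {c' - 1 / real (Suc N)..d' + 1 / real (Suc N)}"
  have "1 / real (Suc N) \<le> infdist x C"
   unfolding infdist_notempty[OF False]
  proof (rule cINF_greatest[OF False])
   fix y assume "y \<in> C"
   then show "1 / real (Suc N) \<le> dist x y" using c'(2)[of y] d'(2)[of y] x
    by (auto simp: dist_real_def)
  qed
  then have "1 \<le> real (Suc N) * infdist x C" by (simp add: field_simps)
  also have "... \<le> real (Suc (n + N)) * infdist x C" by (intro mult_right_mono) (auto simp: infdist_nonneg)
  finally show "\<phi> n x = 0" by (simp add: \<phi>_def)
 qed (use N in auto)
 have "(\<lambda>n. LINT x|leb a b. h x * \<phi> n x) \<longlonglongrightarrow> (LINT x|leb a b. h x * indicator C x)"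
 proof (rule integral_dominated_convergence[where w = "\<lambda>x. norm (h x)"])
  show "(\<lambda>x. h x * indicator C x) \<in> borel_measurable (leb a b)"
   using h borel_measurable_lebesgue_on_borel[OF borel_measurable_indicator[OF borel_compact[OF C(1)]]]
   by (intro borel_measurable_times) auto
  show "(\<lambda>x. h x * \<phi> n x) \<in> borel_measurable (leb a b)" for n
  proof -
   have "\<phi> n \<in> borel_measurable (leb a b)" unfolding \<phi>_def
    by (intro borel_measurable_lebesgue_on_borel borel_measurable_continuous_onI continuous_intros)
   then show ?thesis using h by (intro borel_measurable_times) auto
  qed
  show "integrable (leb a b) (\<lambda>x. norm (h x))" using h by auto
  show "AE x in leb a b. norm (h x * \<phi> n x) \<le> norm (h x)" for n
   by (rule AE_I2) (auto simp: \<phi>_def abs_mult infdist_nonneg intro!: mult_left_le)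
  show "AE x in leb a b. (\<lambda>n. h x * \<phi> n x) \<longlonglongrightarrow> h x * indicator C x"
  proof (rule AE_I2)
   fix x
   have "(\<lambda>n. \<phi> n x) \<longlonglongrightarrow> indicator C x"
   proof (cases "x \<in> C")
    case True then show ?thesis by (simp add: \<phi>_def)
   next
    case F: False
    have "infdist x C > 0" using F False C(1) infdist_pos_not_in_closed[of C x] by (auto simp: compact_imp_closed)
    then obtain K where K: "1 / real (Suc K) < infdist x C"
     using nat_approx_posE by (auto simp: inverse_eq_divide)
    have "\<phi> n x = 0" if "n \<ge> K" for n
    proof -
     have "1 \<le> real (Suc K) * infdist x C" using K by (simp add: field_simps)
     also have "... \<le> real (Suc (n + N)) * infdist x C" by (intro mult_right_mono) (use that in \<open>auto simp: infdist_nonneg\<close>)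
     finally show ?thesis by (simp add: \<phi>_def)
    qed
    then have "eventually (\<lambda>n. \<phi> n x = 0) sequentially" using eventually_sequentially by blast
    then show ?thesis using F by (simp add: tendsto_eventually)
   qed
   then show "(\<lambda>n. h x * \<phi> n x) \<longlonglongrightarrow> h x * indicator C x" by (intro tendsto_intros)
  qed
 qed
 then show ?thesis using z0 LIMSEQ_unique by (auto simp: LIMSEQ_const_iff)
qed simp

text \<open>If \<open>h\<close> were positive on a set of positive measure, inner regularity would
  give a compact subset of positive measure inside the open interval. The integral of
  \<open>h\<close> over it is 0 by approximation of its indicator, although \<open>h\<close> is
  positive there.\<close>

lemma AE_nonpos_if_test_zero:
 fixes h :: "real => real"
 assumes h: "integrable (leb a b) h"
  and z: "\<And>\<phi> c d. continuous_on UNIV \<phi> ==> a < c ==> d < b ==> (\<And>x. x \<notin> {c..d} ==> \<phi> x = 0) ==>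
   (LINT x|leb a b. h x * \<phi> x) = 0"
 shows "AE x in leb a b. h x \<le> 0"
proof (rule ccontr)
 assume na: "\<not> ?thesis"
 define A where "A = {x \<in> {a<..<b}. h x > 0}"
 have "{x \<in> space (leb a b). h x > 0} \<in> sets (leb a b)"
  using h by measurable
 then have "{x \<in> {a..b}. h x > 0} \<in> sets lebesgue" by (simp add: sets_restrict_space_iff)
 then have "{x \<in> {a..b}. h x > 0} \<inter> {a<..<b} \<in> sets lebesgue" by (intro sets.Int) auto
 moreover have "{x \<in> {a..b}. h x > 0} \<inter> {a<..<b} = A" by (auto simp: A_def)
 ultimately have A: "A \<in> sets lebesgue" by simp
 have pos: "emeasure lebesgue A > 0"
 proof (rule ccontr)
  assume "\<not> ?thesis"
  then have "A \<in> null_sets lebesgue" using A by auto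
  moreover have "{a, b} \<in> null_sets lebesgue" by (auto intro!: negligible_finite simp flip: negligible_iff_null_sets)
  ultimately have "A \<union> {a, b} \<in> null_sets lebesgue" by blast
  then have "AE x in lebesgue. x \<notin> A \<union> {a,b}" by (rule AE_not_in)
  then have "AE x in lebesgue. x \<in> {a..b} \<longrightarrow> h x \<le> 0" by eventually_elim (auto simp: A_def)
  then show False using na by (simp add: AE_restrict_space_iff)
 qed
 have fin: "emeasure lebesgue A < top"
 proof -
  have "emeasure lebesgue A \<le> emeasure lebesgue {a..b}" by (intro emeasure_mono) (auto simp: A_def)
  then show ?thesis using emeasure_lborel_cbox_finite[of a b] by (auto simp: top_unique)
 qed
 define m where "m = enn2real (emeasure lebesgue A)"
 have m: "emeasure lebesgue A = ennreal m" "m > 0"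
  using pos fin by (simp_all add: m_def ennreal_enn2real enn2real_positive_iff)
 \<comment> \<open>The leftover \<open>A - C\<close> has measure strictly below that of
   \<open>A\<close>, so \<open>C\<close> has positive measure; the proof ends by showing that
   \<open>C\<close> would be a null set.\<close>
 obtain C where C: "closed C" "C \<subseteq> A" "A - C \<in> lmeasurable" "emeasure lebesgue (A - C) < ennreal m"
  using sets_lebesgue_inner_closed[OF A m(2)] by metis
 have Cc: "compact C" using C(1,2) by (auto simp: compact_eq_bounded_closed A_def intro!: bounded_subset[OF bounded_closed_interval[of a b]])
 have int: "(LINT x|leb a b. h x * indicator C x) = 0"
  using C(2) by (intro integral_compact_zero[OF h z Cc]) (auto simp: A_def)
 have i2: "integrable (leb a b) (\<lambda>x. h x * indicator C x)"
  using Cc by (intro integrable_mult_bounded[where C = 1, OF h] borel_measurable_lebesgue_on_borel)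
    (auto intro: borel_measurable_indicator borel_compact simp del: indicator_def split: split_indicator)
 have "AE x in leb a b. h x * indicator C x = 0"
 proof -
  have "AE x in leb a b. 0 \<le> h x * indicator C x"
   by (rule AE_I2) (use C(2) in \<open>auto simp: A_def indicator_def\<close>)
  then show ?thesis using int integral_nonneg_eq_0_iff_AE[OF i2] by simp
 qed
 then have "AE x in lebesgue. x \<in> {a..b} \<longrightarrow> h x * indicator C x = 0" by (simp add: AE_restrict_space_iff)
 then have "AE x in lebesgue. x \<notin> C" by eventually_elim (use C(2) in \<open>auto simp: A_def\<close>)
 then have C0: "C \<in> null_sets lebesgue" using Cc by (simp add: AE_iff_null_sets lmeasurable_compact fmeasurableD)
 have "emeasure lebesgue A \<le> emeasure lebesgue (A - C) + emeasure lebesgue C"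
  using emeasure_subadditive[of "A - C" lebesgue C] C by (simp add: Un_absorb2 fmeasurableD null_setsD2[OF C0])
 then show False using C0 C(4) m(1) by (auto simp: null_sets_def)
qed

lemma AE_zero_if_test_zero:
 fixes h :: "real => real"
 assumes h: "integrable (leb a b) h"
  and z: "\<And>\<phi> c d. continuous_on UNIV \<phi> ==> a < c ==> d < b ==> (\<And>x. x \<notin> {c..d} ==> \<phi> x = 0) ==>
   (LINT x|leb a b. h x * \<phi> x) = 0"
 shows "AE x in leb a b. h x = 0"
proof -
 have "AE x in leb a b. h x \<le> 0" by (rule AE_nonpos_if_test_zero[OF h z])
 moreover have "AE x in leb a b. - h x \<le> 0"
  by (rule AE_nonpos_if_test_zero) (use h z in auto)
 ultimately show ?thesis by eventually_elim auto
qed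

section \<open>Trigonometric polynomials and their density\<close>

inductive trig_poly :: "(real => complex) => bool" where
 mono: "trig_poly (\<lambda>x. c * cis (of_int k * x))"
| add: "trig_poly p ==> trig_poly q ==> trig_poly (\<lambda>x. p x + q x)"

lemma trig_poly_mult:
 assumes "trig_poly p" "trig_poly q"
 shows "trig_poly (\<lambda>x. p x * q x)"
 using assms(1)
proof induction
 case (mono c k)
 show ?case using assms(2)
 proof induction
  case (mono d l)
  have "(\<lambda>x. (c * cis (of_int k * x)) * (d * cis (of_int l * x))) = (\<lambda>x. (c * d) * cis (of_int (k + l) * x))"
   by (auto simp: distrib_right algebra_simps simp flip: cis_mult)
  then show ?case using trig_poly.mono[of "c * d" "k + l"] by simp
 next
  case (add p q)
  then show ?case using trig_poly.add by (simp add: distrib_left)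
 qed
next
 case (add p q)
 then show ?case using trig_poly.add by (simp add: distrib_right)
qed

text \<open>On the circle a real linear functional is a combination of cos x and sin x, hence of cis
  x and cis (-x), and products stay trigonometric. This turns the polynomials supplied by
  Stone-Weierstrass into functions that Fourier coefficients can see.\<close>

lemma trig_poly_real_polynomial:
 "real_polynomial_function g ==> trig_poly (\<lambda>x. of_real (g (cis x)))"
proof (induction rule: real_polynomial_function.induct)
 case (linear f)
 interpret bounded_linear f by fact
 have "complex_of_real (f (cis x)) = of_real (f 1) * of_real (cos x) + of_real (f \<i>) * of_real (sin x)" for x
 proof -
  have "cis x = cos x *\<^sub>R 1 + sin x *\<^sub>R \<i>" by (simp add: complex_eq_iff)
  then have "f (cis x) = cos x * f 1 + sin x * f \<i>" by (simp only: add scaleR) simp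
  then show ?thesis by simp
 qed
 moreover have "complex_of_real (cos x) = (cis (of_int 1 * x) + cis (of_int (-1) * x)) / 2" for x
  by (simp add: complex_eq_iff)
 moreover have "complex_of_real (sin x) = (cis (of_int 1 * x) - cis (of_int (-1) * x)) / (2 * \<i>)" for x
  by (simp add: complex_eq_iff Re_divide Im_divide power2_eq_square)
 ultimately have eq: "(\<lambda>x. complex_of_real (f (cis x))) = (\<lambda>x. ((of_real (f 1) / 2 + of_real (f \<i>) / (2 * \<i>)) * cis (of_int 1 * x)
   + (of_real (f 1) / 2 - of_real (f \<i>) / (2 * \<i>)) * cis (of_int (-1) * x)))"
  by (intro ext) (simp only: times_divide_eq_right divide_divide_eq_left add_divide_distrib diff_divide_distrib
   distrib_left distrib_right left_diff_distrib right_diff_distrib times_divide_eq_left, simp add: algebra_simps)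
 show ?case unfolding eq by (intro trig_poly.add trig_poly.mono)
next
 case (const c)
 show ?case using trig_poly.mono[of "of_real c" 0] by simp
next
 case (add f g)
 then show ?case using trig_poly.add by simp
next
 case (mult f g)
 then show ?case using trig_poly_mult by simp
qed

lemma fourier_cis: "fourier u k = (1 / (2 * pi)) * (LINT x|torus. of_real (u x) * cis (- (of_int k * x)))"
 unfolding fourier_def by (simp add: cis_conv_exp mult.assoc mult.commute mult.left_commute)

lemma measurable_cis [measurable]: "(\<lambda>x. cis (c * x)) \<in> borel_measurable borel"
 by (intro borel_measurable_continuous_onI continuous_intros)

lemma integrable_mult_cis:
 assumes "integrable torus h"
 shows "integrable torus (\<lambda>x. h x * cis (c * x))"
 using assms by (intro integrable_mult_bounded[where C = 1] borel_measurable_torus_borel) auto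

lemma trig_poly_continuous: "trig_poly p ==> continuous_on UNIV p"
 by (induction rule: trig_poly.induct) (auto intro!: continuous_intros)

lemma trig_poly_orthogonal:
 assumes h: "integrable torus h" and z: "\<And>k. fourier h k = 0" and p: "trig_poly p"
 shows "integrable torus (\<lambda>x. of_real (h x) * p x) \<and> (LINT x|torus. of_real (h x) * p x) = 0"
 using p
proof induction
 case (mono c k)
 have i: "integrable torus (\<lambda>x. complex_of_real (h x) * cis (of_int k * x))"
  using h by (intro integrable_mult_cis) auto
 have "(LINT x|torus. complex_of_real (h x) * cis (of_int k * x)) = 0"
  using z[of "-k"] by (simp add: fourier_cis)
 moreover have "(\<lambda>x. complex_of_real (h x) * (c * cis (of_int k * x))) = (\<lambda>x. c * (complex_of_real (h x) * cis (of_int k * x)))"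
  by (simp add: algebra_simps)
 ultimately show ?case using i by simp
next
 case (add p q)
 then show ?case by (simp add: distrib_left)
qed

text \<open>It suffices to test with continuous functions supported inside the open interval. Such a
  function descends to the circle, where polynomials approximate it uniformly; \<open>h\<close> is
  orthogonal to the approximants, so its integral against the test function is at most e times its
  L^1 norm for every e.\<close>

lemma fourier_unique:
 assumes h: "integrable torus h" and z: "\<And>k. fourier h k = 0"
 shows "AE x in torus. h x = 0"
 unfolding torus_def
proof (rule AE_zero_if_test_zero)
 show hi: "integrable (lebesgue_on {- pi..pi}) h" using h by (simp add: torus_def)
 fix \<phi> :: "real => real" and c d
 assume \<phi>: "continuous_on UNIV \<phi>" "- pi < c" "d < pi" "\<And>x. x \<notin> {c..d} ==> \<phi> x = 0"
 \<comment> \<open>\<open>Arg\<close> jumps at -1, but \<open>\<phi>\<close> vanishes near both ends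
   of the interval, so \<open>f\<close> is continuous there as well.\<close>
 define f where "f z = \<phi> (Arg z)" for z
 have per: "\<phi> pi = 0" "\<phi> (-pi) = 0" using \<phi> by auto
 have fc: "f (cis x) = \<phi> x" if "x \<in> {-pi..pi}" for x
 proof (cases "x = -pi")
  case True
  then have "cis x = -1" by (simp add: complex_eq_iff)
  moreover have "Arg (-1) = pi" using Arg_eq_pi[of "-1"] by simp
  ultimately show ?thesis using per True by (simp add: f_def)
 next
  case False
  then show ?thesis using that by (simp add: f_def cis_Arg_unique Arg_cis)
 qed
 \<comment> \<open>Each preimage of a closed set is the image under \<open>cis\<close> of a compact
   set of angles; this avoids treating the branch cut of \<open>Arg\<close> separately.\<close>
 have "continuous_on (sphere 0 1) f"
 proof -
  have "closed (f -` t \<inter> sphere 0 1)" if t: "closed t" for t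
  proof -
   have "f -` t \<inter> sphere 0 1 = cis ` ({-pi..pi} \<inter> \<phi> -` t)"
   proof (intro equalityI subsetI)
    fix z assume z: "z \<in> f -` t \<inter> sphere 0 1"
    then have "z \<noteq> 0" by auto
    then have zc: "z = cis (Arg z)" using z cis_Arg[of z] by (auto simp: sgn_div_norm)
    show "z \<in> cis ` ({-pi..pi} \<inter> \<phi> -` t)"
     using z zc Arg_bounded[of z] by (intro image_eqI[where x = "Arg z"]) (auto simp: f_def)
   next
    fix z assume "z \<in> cis ` ({-pi..pi} \<inter> \<phi> -` t)"
    then show "z \<in> f -` t \<inter> sphere 0 1" using fc by auto
   qed
   moreover have "compact ({-pi..pi} \<inter> \<phi> -` t)"
    by (intro compact_Int_closed closed_vimage t \<phi>) auto
   ultimately show ?thesis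
    by (auto intro!: compact_imp_closed compact_continuous_image continuous_intros)
  qed
  then show ?thesis by (subst continuous_on_closed_vimage) auto
 qed
 note fcont = this
 have "\<bar>LINT x|torus. h x * \<phi> x\<bar> \<le> e * (LINT x|torus. \<bar>h x\<bar>)" if e: "e > 0" for e
 proof -
  obtain g where g: "real_polynomial_function g" "\<And>z. z \<in> sphere 0 1 ==> \<bar>f z - g z\<bar> < e"
   using Stone_Weierstrass_real_polynomial_function[OF _ fcont e] by (metis compact_sphere)
  define p where "p x = g (cis x)" for x
  have tp: "trig_poly (\<lambda>x. of_real (p x))" unfolding p_def by (rule trig_poly_real_polynomial[OF g(1)])
  have *: "integrable torus (\<lambda>x. complex_of_real (h x * p x))" "(LINT x|torus. complex_of_real (h x * p x)) = 0"
   using trig_poly_orthogonal[OF h z tp] by auto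
  have ip: "integrable torus (\<lambda>x. h x * p x)" using *(1) by (simp only: complex_of_real_integrable_eq)
  have zp: "(LINT x|torus. h x * p x) = 0" using *(2) by (simp only: integral_complex_of_real of_real_eq_0_iff)
  have pc: "continuous_on UNIV p"
  proof -
   have "continuous_on UNIV (\<lambda>x. Re (of_real (p x)))" by (intro continuous_intros trig_poly_continuous tp)
   then show ?thesis by simp
  qed
  have close: "\<bar>\<phi> x - p x\<bar> \<le> e" if "x \<in> {-pi..pi}" for x
   using g(2)[of "cis x"] fc[OF that] by (auto simp: p_def)
  have i1: "integrable torus (\<lambda>x. h x * (\<phi> x - p x))"
   using close \<phi>(1) pc by (intro integrable_mult_bounded[OF h] borel_measurable_torus_borel borel_measurable_continuous_onI)
    (auto intro!: continuous_intros)
  have "(LINT x|torus. h x * \<phi> x) = (LINT x|torus. h x * (\<phi> x - p x) + h x * p x)" by (simp add: algebra_simps)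
  also have "... = (LINT x|torus. h x * (\<phi> x - p x))"
   using zp by (subst B_itg_add[OF i1 ip]) auto
  finally have "\<bar>LINT x|torus. h x * \<phi> x\<bar> \<le> (LINT x|torus. \<bar>h x * (\<phi> x - p x)\<bar>)" by (simp add: integral_abs_bound)
  also have "... \<le> (LINT x|torus. e * \<bar>h x\<bar>)"
  proof (intro integral_mono integrable_abs i1)
   show "integrable torus (\<lambda>x. e * \<bar>h x\<bar>)" using h by auto
   fix x assume "x \<in> space torus"
   then show "\<bar>h x * (\<phi> x - p x)\<bar> \<le> e * \<bar>h x\<bar>"
    using mult_left_mono[OF close[of x], of "\<bar>h x\<bar>"] by (simp add: abs_mult mult.commute)
  qed
  finally show ?thesis by simp
 qed
 note bnd = this
 show "(LINT x|lebesgue_on {- pi..pi}. h x * \<phi> x) = 0"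
 proof (rule ccontr)
  assume "\<not> ?thesis"
  then have pos: "\<bar>LINT x|torus. h x * \<phi> x\<bar> > 0" by (simp add: torus_def)
  define H where "H = (LINT x|torus. \<bar>h x\<bar>)"
  have H: "H \<ge> 0" by (simp add: H_def)
  \<comment> \<open>Chosen so that \<open>?e * H\<close> is strictly below the value assumed to be
    nonzero; the summand 1 covers H = 0.\<close>
  let ?e = "\<bar>LINT x|torus. h x * \<phi> x\<bar> / (2 * (H + 1))"
  have "?e > 0" using pos H by (intro divide_pos_pos) auto
  from bnd[OF this] have "\<bar>LINT x|torus. h x * \<phi> x\<bar> \<le> ?e * H" by (simp add: H_def)
  also have "... < \<bar>LINT x|torus. h x * \<phi> x\<bar>"
  proof -
   have "H / (2 * (H + 1)) < 1" using H by (simp add: field_simps)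
   then show ?thesis using mult_strict_left_mono[OF _ pos] by fastforce
  qed
  finally show False by simp
 qed
qed

lemma fourier_unique2:
 assumes "integrable torus u" "integrable torus v" "\<And>k. fourier u k = fourier v k"
 shows "AE x in torus. u x = v x"
proof -
 have "AE x in torus. u x - v x = 0"
 proof (rule fourier_unique)
  fix k
  have "fourier (\<lambda>x. u x - v x) k = fourier u k - fourier v k"
   unfolding fourier_cis of_real_diff left_diff_distrib
   using assms(1,2) integrable_mult_cis[of "\<lambda>x. of_real (u x)" "- of_int k"] integrable_mult_cis[of "\<lambda>x. of_real (v x)" "- of_int k"]
   by (subst B_itg_diff) (auto simp: right_diff_distrib)
  then show "fourier (\<lambda>x. u x - v x) k = 0" using assms(3) by simp
 qed (use assms in auto)
 then show ?thesis by eventually_elim auto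
qed

section \<open>Absolutely convergent Fourier series\<close>

text \<open>Series over the integers are Bochner integrals for the counting measure, so that
  dominated convergence and Fubini also serve for sums over modes. Integrability here means absolute
  summability.\<close>

abbreviation ZM :: "int measure" where "ZM \<equiv> count_space UNIV"

lemma sigma_finite_ZM: "sigma_finite_measure ZM"
 by (intro sigma_finite_measure_count_space)

lemma measurable_pair_ZM:
 assumes "\<And>k::int. f k \<in> borel_measurable M"
 shows "(\<lambda>(t, k). f k t) \<in> borel_measurable (M \<Otimes>\<^sub>M ZM)"
proof -
 have "(\<lambda>(k, t). f k t) \<in> borel_measurable (ZM \<Otimes>\<^sub>M M)"
  using assms by (intro measurable_pair_measure_countable1) auto
 then have "(\<lambda>z. (\<lambda>(k, t). f k t) (snd z, fst z)) \<in> borel_measurable (M \<Otimes>\<^sub>M ZM)"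
  by measurable
 then show ?thesis by (simp add: case_prod_unfold)
qed

lemma integral_ZM_swap:
 fixes f :: "int => 'a => 'b::{banach, second_countable_topology}"
 assumes M: "sigma_finite_measure M" and f: "\<And>k. f k \<in> borel_measurable M"
  and fin: "(\<integral>\<^sup>+t. \<integral>\<^sup>+k. ennreal (norm (f k t)) \<partial>ZM \<partial>M) < \<infinity>"
 shows "AE t in M. integrable ZM (\<lambda>k. f k t)"
  and "integrable M (\<lambda>t. LINT k|ZM. f k t)"
  and "\<And>k. integrable M (f k)"
  and "integrable ZM (\<lambda>k. LINT t|M. f k t)"
  and "(LINT t|M. LINT k|ZM. f k t) = (LINT k|ZM. LINT t|M. f k t)"
proof -
 interpret Z: sigma_finite_measure ZM by (rule sigma_finite_ZM)
 interpret M: sigma_finite_measure M by (rule M)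
 interpret P: pair_sigma_finite M ZM ..
 have meas: "(\<lambda>(t, k). f k t) \<in> borel_measurable (M \<Otimes>\<^sub>M ZM)" by (rule measurable_pair_ZM[OF f])
 have int: "integrable (M \<Otimes>\<^sub>M ZM) (\<lambda>(t, k). f k t)"
  unfolding integrable_iff_bounded
 proof
  have "(\<integral>\<^sup>+z. ennreal (norm (case z of (t, k) => f k t)) \<partial>(M \<Otimes>\<^sub>M ZM)) = (\<integral>\<^sup>+t. \<integral>\<^sup>+k. ennreal (norm (f k t)) \<partial>ZM \<partial>M)"
   using meas by (subst Z.nn_integral_fst[symmetric]) auto
  then show "(\<integral>\<^sup>+z. ennreal (norm (case z of (t, k) => f k t)) \<partial>(M \<Otimes>\<^sub>M ZM)) < \<infinity>" using fin by simp
 qed (rule meas)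
 note int' = int
 show "AE t in M. integrable ZM (\<lambda>k. f k t)" using P.AE_integrable_fst'[OF int] by simp
 show "integrable M (\<lambda>t. LINT k|ZM. f k t)" using P.integrable_fst'[OF int] by simp
 have "AE k in ZM. integrable M (\<lambda>t. f k t)" using P.AE_integrable_snd[OF int] by simp
 then show "\<And>k. integrable M (f k)" by (simp add: AE_count_space)
 show "integrable ZM (\<lambda>k. LINT t|M. f k t)" using P.integrable_snd[OF int] by simp
 show "(LINT t|M. LINT k|ZM. f k t) = (LINT k|ZM. LINT t|M. f k t)"
  using P.Fubini_integral[of "\<lambda>t k. f k t"] int by simp
qed

lemma integral_ZM_uminus:
 fixes c :: "int => 'b::{banach, second_countable_topology}"
 shows "(LINT k|ZM. c (- k)) = (LINT k|ZM. c k)"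
 using integral_bij_count_space[of uminus UNIV UNIV c] by (simp add: bij_betw_def)

section \<open>Fourier series with summable coefficients\<close>

definition synth :: "(int => complex) => real => complex" where
 "synth c x = (LINT k|ZM. c k * cis (of_int k * x))"

text \<open>The functions of the problem are real, so the real part is taken once here; for
  \<open>hermitian\<close> coefficients nothing is lost, see \<open>synth_real\<close>.\<close>

definition wiener :: "(int => complex) => real => real" where
 "wiener c x = Re (synth c x)"

definition hermitian :: "(int => complex) => bool" where
 "hermitian c \<longleftrightarrow> (\<forall>k. c (- k) = cnj (c k))"

definition dcoef :: "(int => complex) => int => complex" where
 "dcoef c k = \<i> * of_int k * c k"

definition conv :: "(int => complex) => (int => complex) => int => complex" where
 "conv c d k = (LINT q|ZM. c (k - q) * d q)"

lemma hermitian_dcoef: "hermitian c ==> hermitian (dcoef c)"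
 by (simp add: hermitian_def dcoef_def)

lemma integrable_ZM_cis: "integrable ZM c ==> integrable ZM (\<lambda>k. c k * cis (of_int k * x))"
 by (rule integrable_mult_bounded[where C = 1]) auto

lemma norm_synth_le: 
 assumes "integrable ZM c"
 shows "norm (synth c x) \<le> (LINT k|ZM. norm (c k))"
proof -
 have "norm (synth c x) \<le> (LINT k|ZM. norm (c k * cis (of_int k * x)))"
  unfolding synth_def by (rule integral_norm_bound)
 then show ?thesis by (simp add: norm_mult)
qed

lemma abs_wiener_le: "integrable ZM c ==> \<bar>wiener c x\<bar> \<le> (LINT k|ZM. norm (c k))"
 unfolding wiener_def using abs_Re_le_cmod norm_synth_le order_trans by blast

lemma synth_add: "integrable ZM c ==> integrable ZM d ==> synth (\<lambda>k. c k + d k) x = synth c x + synth d x"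
 unfolding synth_def by (simp add: distrib_right integrable_ZM_cis)

lemma synth_diff: "integrable ZM c ==> integrable ZM d ==> synth (\<lambda>k. c k - d k) x = synth c x - synth d x"
 unfolding synth_def by (simp add: left_diff_distrib integrable_ZM_cis)

lemma wiener_add: "integrable ZM c ==> integrable ZM d ==> wiener (\<lambda>k. c k + d k) x = wiener c x + wiener d x"
 unfolding wiener_def by (simp add: synth_add)

lemma wiener_diff: "integrable ZM c ==> integrable ZM d ==> wiener (\<lambda>k. c k - d k) x = wiener c x - wiener d x"
 unfolding wiener_def by (simp add: synth_diff)

lemma wiener_scale: "wiener (\<lambda>k. of_real r * c k) x = r * wiener c x"
 unfolding wiener_def synth_def by (simp add: mult.assoc)

lemma synth_real:
 assumes "hermitian c"
 shows "synth c x = of_real (wiener c x)"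
proof -
 have "cnj (synth c x) = (LINT k|ZM. cnj (c k * cis (of_int k * x)))" unfolding synth_def by (simp only: B_itg_cnj)
 also have "... = (LINT k|ZM. c (- k) * cis (of_int (- k) * x))" using assms by (simp add: hermitian_def cis_cnj)
 also have "... = synth c x" unfolding synth_def by (rule integral_ZM_uminus[of "\<lambda>k. c k * cis (of_int k * x)"])
 finally have "cnj (synth c x) = synth c x" .
 then have "synth c x \<in> \<real>" by (simp add: Reals_cnj_iff)
 then show ?thesis by (simp add: wiener_def)
qed

lemma cis_periodic: "cis (of_int k * (x + 2 * pi)) = cis (of_int k * x)"
proof -
 have "cis (of_int k * (x + 2 * pi)) = cis (of_int k * x) * cis (2 * pi * of_int k)" by (simp add: cis_mult algebra_simps)
 then show ?thesis by (simp add: cis_multiple_2pi)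
qed

lemma periodic_wiener: "periodic (wiener c)"
 by (simp add: periodic_def wiener_def synth_def cis_periodic)

lemma isCont_synth:
 assumes c: "integrable ZM c"
 shows "isCont (synth c) x"
 unfolding continuous_at_sequentially comp_def
proof (intro allI impI)
 fix X :: "nat => real" assume "X \<longlonglongrightarrow> x"
 then show "(\<lambda>n. synth c (X n)) \<longlonglongrightarrow> synth c x"
  unfolding synth_def using c
  by (intro integral_dominated_convergence[where w = "\<lambda>k. norm (c k)"] AE_I2)
    (auto simp: norm_mult intro!: tendsto_intros)
qed

lemma continuous_on_wiener: "integrable ZM c ==> continuous_on S (wiener c)"
 unfolding wiener_def using isCont_synth by (intro continuous_intros continuous_at_imp_continuous_on) auto

lemma measurable_wiener: "integrable ZM c ==> wiener c \<in> borel_measurable borel"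
 by (intro borel_measurable_continuous_onI continuous_on_wiener)

lemma cis_has_vector_derivative:
 "((\<lambda>y. cis (a * y)) has_vector_derivative (\<i> * of_real a * cis (a * x))) (at x within S)"
proof -
 have "((\<lambda>y. exp (y *\<^sub>R (\<i> * of_real a))) has_vector_derivative exp (x *\<^sub>R (\<i> * of_real a)) * (\<i> * of_real a)) (at x within S)"
  by (rule exp_scaleR_has_vector_derivative_right)
 then show ?thesis by (simp add: cis_conv_exp scaleR_conv_of_real mult_ac)
qed

lemma norm_cis_diff: "norm (cis a - cis b) \<le> \<bar>a - b\<bar>"
proof -
 have "norm (cis a - cis b) = norm (cis b * (cis (a - b) - 1))" by (simp add: right_diff_distrib cis_mult)
 also have "... = norm (exp (\<i> * of_real (a - b)) - 1)" by (simp add: norm_mult cis_conv_exp)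
 also have "... = 2 * \<bar>sin ((a - b) / 2)\<bar>"
  using dist_exp_i_1[of "a - b"] by (simp add: dist_norm)
 also have "... \<le> \<bar>a - b\<bar>" using abs_sin_x_le_abs_x[of "(a - b) / 2"] by simp
 finally show ?thesis .
qed

lemma integrable_ZM_finite:
 fixes f :: "int => 'b::{banach, second_countable_topology}"
 assumes "finite A" "\<And>k. k \<notin> A ==> f k = 0"
 shows "integrable ZM f"
proof -
 have "integrable (restrict_space ZM A) f" using assms(1) by (simp add: restrict_count_space integrable_count_space)
 then have "integrable ZM (\<lambda>k. indicator A k *\<^sub>R f k)" by (subst (asm) integrable_restrict_space) auto
 moreover have "(\<lambda>k. indicator A k *\<^sub>R f k) = f" using assms(2) by (auto simp: indicator_def)
 ultimately show ?thesis by simp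
qed

lemma integral_ZM_finite:
 fixes f :: "int => 'b::{banach, second_countable_topology}"
 assumes "finite A" "\<And>k. k \<notin> A ==> f k = 0"
 shows "(LINT k|ZM. f k) = (\<Sum>k\<in>A. f k)"
proof -
 have fin: "finite {k. f k \<noteq> 0}" "{k. f k \<noteq> 0} \<subseteq> A" using assms by (auto intro: finite_subset[OF _ assms(1)])
 then have "(LINT k|ZM. f k) = (\<Sum>k | f k \<noteq> 0. f k)"
  using lebesgue_integral_count_space_finite_support[of UNIV f] by simp
 also have "... = (\<Sum>k\<in>A. f k)" using fin assms(1) by (intro sum.mono_neutral_left) auto
 finally show ?thesis .
qed

lemma sum_le_integral_ZM:
 fixes f :: "int => real"
 assumes "integrable ZM f" "\<And>k. f k \<ge> 0" "finite A"
 shows "(\<Sum>k\<in>A. f k) \<le> (LINT k|ZM. f k)"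
proof -
 have "(\<Sum>k\<in>A. f k) = (LINT k|ZM. (if k \<in> A then f k else 0))"
  using assms(3) by (subst integral_ZM_finite[of A]) auto
 also have "... \<le> (LINT k|ZM. f k)"
 proof (rule integral_mono[OF _ assms(1)])
  show "integrable ZM (\<lambda>k. if k \<in> A then f k else 0)" by (rule integrable_ZM_finite[OF assms(3)]) auto
 qed (use assms(2) in auto)
 finally show ?thesis .
qed

lemma le_integral_ZM:
 fixes f :: "int => real"
 assumes "integrable ZM f" "\<And>k. f k \<ge> 0"
 shows "f k \<le> (LINT k|ZM. f k)"
 using sum_le_integral_ZM[OF assms, of "{k}"] by simp

lemma integrable_ZM_of_dcoef:
 assumes "integrable ZM (dcoef c)"
 shows "integrable ZM c"
proof (rule B_int_bound[where f = "\<lambda>k. norm (dcoef c k) + (if k = 0 then norm (c 0) else 0)"])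
 show "integrable ZM (\<lambda>k. norm (dcoef c k) + (if k = 0 then norm (c 0) else 0))"
  by (intro B_int_add integrable_norm[OF assms] integrable_ZM_finite[of "{0}"]) auto
 have "norm (c k) \<le> mag k * norm (c k)" if "k \<noteq> 0" for k
 proof -
  have "1 \<le> \<bar>k\<bar>" using that by linarith
  then have "1 \<le> mag k" by linarith
  then show ?thesis using mult_right_mono[of 1 _ "norm (c k)"] by fastforce
 qed
 then show "AE k in ZM. norm (c k) \<le> norm (norm (dcoef c k) + (if k = 0 then norm (c 0) else 0))"
  by (intro AE_I2) (auto simp: dcoef_def norm_mult)
qed auto

text \<open>A chord is no longer than its arc, so the difference quotient of the k-th term is
  bounded by |k| |c k|. Summability of \<open>dcoef c\<close> therefore dominates the series of
  quotients, uniformly in the increment.\<close>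

lemma DERIV_wiener:
 assumes d: "integrable ZM (dcoef c)"
 shows "(wiener c has_real_derivative wiener (dcoef c) x) (at x)"
proof -
 have c: "integrable ZM c" by (rule integrable_ZM_of_dcoef[OF d])
 have "(\<lambda>h. (wiener c (x + h) - wiener c x) / h) \<midarrow>0\<rightarrow> wiener (dcoef c) x"
  unfolding tendsto_at_iff_sequentially comp_def
 proof (intro allI impI)
  fix X :: "nat => real" assume X: "\<forall>i. X i \<in> UNIV - {0}" "X \<longlonglongrightarrow> 0"
  define Q where "Q n k = (cis (of_int k * (x + X n)) - cis (of_int k * x)) / of_real (X n)" for n k
  have Qb: "norm (Q n k) \<le> \<bar>of_int k\<bar>" for n k
  proof -
   have "norm (cis (of_int k * (x + X n)) - cis (of_int k * x)) \<le> \<bar>of_int k\<bar> * \<bar>X n\<bar>"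
    using norm_cis_diff[of "of_int k * (x + X n)" "of_int k * x"] by (simp add: algebra_simps abs_mult)
   then show ?thesis using X(1) by (simp add: Q_def norm_divide divide_le_eq)
  qed
  have Ql: "(\<lambda>n. Q n k) \<longlonglongrightarrow> \<i> * of_int k * cis (of_int k * x)" for k
  proof -
   have "(\<lambda>n. complex_of_real (X n)) \<longlonglongrightarrow> 0" using tendsto_of_real[OF X(2)] by simp
   then have "filterlim (\<lambda>n. complex_of_real (X n)) (at 0) sequentially" using X(1) by (intro filterlim_atI) auto
   moreover have "((\<lambda>z. exp (\<i> * of_int k * z)) has_field_derivative \<i> * of_int k * exp (\<i> * of_int k * of_real x)) (at (of_real x))"
    by (auto intro!: derivative_eq_intros)
   then have "(\<lambda>h. (exp (\<i> * of_int k * (of_real x + h)) - exp (\<i> * of_int k * of_real x)) / h) \<midarrow>0\<rightarrow> \<i> * of_int k * exp (\<i> * of_int k * of_real x)"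
    by (simp add: DERIV_def)
   ultimately have "(\<lambda>n. (exp (\<i> * of_int k * (of_real x + of_real (X n))) - exp (\<i> * of_int k * of_real x)) / of_real (X n)) \<longlonglongrightarrow> \<i> * of_int k * exp (\<i> * of_int k * of_real x)"
    by (rule filterlim_compose[rotated])
   then show ?thesis by (simp add: Q_def cis_conv_exp mult.assoc)
  qed
  have "(\<lambda>n. LINT k|ZM. c k * Q n k) \<longlonglongrightarrow> synth (dcoef c) x"
   unfolding synth_def
  proof (rule integral_dominated_convergence[where w = "\<lambda>k. norm (dcoef c k)"])
   show "integrable ZM (\<lambda>k. norm (dcoef c k))" using d by auto
   show "AE k in ZM. (\<lambda>n. c k * Q n k) \<longlonglongrightarrow> dcoef c k * cis (of_int k * x)"
    using Ql by (intro AE_I2) (auto simp: dcoef_def mult.assoc mult.left_commute intro!: tendsto_eq_intros)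
   show "AE k in ZM. norm (c k * Q n k) \<le> norm (dcoef c k)" for n
    using mult_left_mono[OF Qb norm_ge_zero[of "c _"]] by (intro AE_I2) (simp add: dcoef_def norm_mult mult.commute mult.left_commute)
  qed auto
  moreover have "(LINT k|ZM. c k * Q n k) = (synth c (x + X n) - synth c x) / of_real (X n)" for n
  proof -
   have "(LINT k|ZM. c k * Q n k) = (LINT k|ZM. (c k * cis (of_int k * (x + X n)) - c k * cis (of_int k * x)) / of_real (X n))"
    by (simp add: Q_def right_diff_distrib diff_divide_distrib)
   also have "... = (synth c (x + X n) - synth c x) / of_real (X n)"
    unfolding synth_def using c by (simp add: integrable_ZM_cis)
   finally show ?thesis .
  qed
  ultimately have "(\<lambda>n. (synth c (x + X n) - synth c x) / of_real (X n)) \<longlonglongrightarrow> synth (dcoef c) x" by simp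
  then have "(\<lambda>n. Re ((synth c (x + X n) - synth c x) / of_real (X n))) \<longlonglongrightarrow> Re (synth (dcoef c) x)" by (intro tendsto_intros)
  then show "(\<lambda>n. (wiener c (x + X n) - wiener c x) / X n) \<longlonglongrightarrow> wiener (dcoef c) x" by (simp add: wiener_def)
 qed
 then show ?thesis by (simp add: DERIV_def)
qed

section \<open>Fourier coefficients of series and products\<close>

lemma integral_torus_cis: "(LINT x|torus. cis (of_int m * x)) = (if m = 0 then 2 * of_real pi else 0)"
proof (cases "m = 0")
 case True
 then show ?thesis using measure_torus by (simp add: scaleR_conv_of_real)
next
 case False
 have i: "integrable torus (\<lambda>x. cis (of_int m * x))"
  using integrable_mult_cis[OF finite_measure.integrable_const[OF finite_measure_torus, of "1::complex"], of "of_int m"] by simp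
 have "((\<lambda>x. cis (of_int m * x)) has_integral (cis (of_int m * pi) / (\<i> * of_int m) - cis (of_int m * (-pi)) / (\<i> * of_int m))) {-pi..pi}"
 proof (rule fundamental_theorem_of_calculus)
  show "((\<lambda>x. cis (of_int m * x) / (\<i> * of_int m)) has_vector_derivative cis (of_int m * x)) (at x within {-pi..pi})" for x
   using has_vector_derivative_divide[OF cis_has_vector_derivative[of "of_int m" x "{-pi..pi}"], of "\<i> * of_int m"] False by simp
 qed simp
 moreover have "cis (of_int m * pi) = cis (of_int m * (-pi))" using cis_periodic[of m "-pi"] by simp
 ultimately have "((\<lambda>x. cis (of_int m * x)) has_integral 0) {-pi..pi}" by simp
 then show ?thesis using False i lebesgue_integral_eq_integral[of "{-pi..pi}" "\<lambda>x. cis (of_int m * x)"]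
  by (auto simp: torus_def integral_unique)
qed

text \<open>The series of the second factor is inserted and summed out by Fubini; multiplication by
  cis (q x) shifts the coefficients of \<open>u\<close> by q. With \<open>u\<close> = 1 this yields
  the coefficients of a Fourier series, with \<open>u\<close> = w + M those of the flux.\<close>

lemma fourier_mult_wiener:
 assumes u: "integrable torus u" and d: "integrable ZM d" "hermitian d"
 shows "fourier (\<lambda>x. u x * wiener d x) k = conv (fourier u) d k"
proof -
 have M: "(\<integral>\<^sup>+x. \<integral>\<^sup>+q. ennreal (norm (of_real (u x) * (d q * cis (of_int q * x)) * cis (- (of_int k * x)))) \<partial>ZM \<partial>torus)
  = (\<integral>\<^sup>+x. ennreal (norm (u x)) * (\<integral>\<^sup>+q. ennreal (norm (d q)) \<partial>ZM) \<partial>torus)"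
  by (auto simp: norm_mult ennreal_mult nn_integral_cmult intro!: nn_integral_cong)
 also have "... = (\<integral>\<^sup>+x. ennreal (norm (u x)) \<partial>torus) * (\<integral>\<^sup>+q. ennreal (norm (d q)) \<partial>ZM)"
  using u by (intro nn_integral_multc) auto
 also have "... < \<infinity>" using u d(1) by (auto simp: integrable_iff_bounded ennreal_mult_less_top)
 finally have fin: "(\<integral>\<^sup>+x. \<integral>\<^sup>+q. ennreal (norm (of_real (u x) * (d q * cis (of_int q * x)) * cis (- (of_int k * x)))) \<partial>ZM \<partial>torus) < \<infinity>" .
 have ms: "(\<lambda>x. of_real (u x) * (d q * cis (of_int q * x)) * cis (- (of_int k * x))) \<in> borel_measurable torus" for q
  using u borel_measurable_torus_borel[OF measurable_cis[of "of_int q"]] borel_measurable_torus_borel[OF measurable_cis[of "- of_int k"]]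
  by (intro borel_measurable_times) auto
 have "2 * pi * fourier (\<lambda>x. u x * wiener d x) k = (LINT x|torus. of_real (u x * wiener d x) * cis (- (of_int k * x)))"
  by (simp add: fourier_cis)
 also have "... = (LINT x|torus. LINT q|ZM. of_real (u x) * (d q * cis (of_int q * x)) * cis (- (of_int k * x)))"
  using integrable_ZM_cis[OF d(1)] by (simp add: synth_real[OF d(2), symmetric] synth_def)
 also have "... = (LINT q|ZM. LINT x|torus. of_real (u x) * (d q * cis (of_int q * x)) * cis (- (of_int k * x)))"
  by (rule integral_ZM_swap(5)[OF sigma_finite_torus ms fin])
 also have "... = (LINT q|ZM. (2 * pi * fourier u (k - q)) * d q)"
 proof (rule B_itg_cong[OF refl])
  fix q
  have "of_real (u x) * (d q * cis (of_int q * x)) * cis (- (of_int k * x)) = of_real (u x) * cis (- (of_int (k - q) * x)) * d q" for x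
  proof -
   have "cis (of_int q * x) * cis (- (of_int k * x)) = cis (- (of_int (k - q) * x))" by (simp add: cis_mult algebra_simps)
   then show ?thesis by (metis mult.assoc mult.commute)
  qed
  then have "(LINT x|torus. of_real (u x) * (d q * cis (of_int q * x)) * cis (- (of_int k * x)))
   = (LINT x|torus. of_real (u x) * cis (- (of_int (k - q) * x)) * d q)" by presburger
  then show "(LINT x|torus. of_real (u x) * (d q * cis (of_int q * x)) * cis (- (of_int k * x))) = 2 * pi * fourier u (k - q) * d q"
   by (simp add: fourier_cis)
 qed
 also have "... = 2 * pi * conv (fourier u) d k" by (simp add: conv_def mult.assoc)
 finally show ?thesis by simp
qed

lemma fourier_one: "fourier (\<lambda>x. 1) k = (if k = 0 then 1 else 0)"
 using integral_torus_cis[of "-k"] by (simp add: fourier_cis)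

lemma integrable_torus_const: "integrable torus (\<lambda>x. c :: 'b::{banach, second_countable_topology})"
 by (rule finite_measure.integrable_const[OF finite_measure_torus])

lemma fourier_wiener:
 assumes "integrable ZM c" "hermitian c"
 shows "fourier (wiener c) k = c k"
proof -
 have "fourier (\<lambda>x. 1 * wiener c x) k = conv (fourier (\<lambda>x. 1)) c k"
  by (rule fourier_mult_wiener[OF integrable_torus_const assms])
 also have "... = (\<Sum>q\<in>{k}. fourier (\<lambda>x. 1) (k - q) * c q)"
  unfolding conv_def by (rule integral_ZM_finite) (auto simp: fourier_one)
 finally show ?thesis by (simp add: fourier_one)
qed

lemma hermitian_fourier: "hermitian (fourier u)"
proof -
 have "cnj (fourier u k) = fourier u (- k)" for k
 proof -
  have "cnj (fourier u k) = (1 / (2 * pi)) * (LINT x|torus. cnj (of_real (u x) * cis (- (of_int k * x))))"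
   unfolding fourier_cis complex_cnj_mult[of "complex_of_real _" "lebesgue_integral _ _"] by (simp only: B_itg_cnj complex_cnj_complex_of_real)
  then show ?thesis by (simp add: fourier_cis cis_cnj)
 qed
 then show ?thesis by (simp add: hermitian_def)
qed

lemma integrable_torus_bounded:
 fixes u :: "real => 'b::{banach, second_countable_topology}"
 assumes "u \<in> borel_measurable torus" "\<And>x. norm (u x) \<le> C"
 shows "integrable torus u"
 using finite_measure.integrable_const_bound[OF finite_measure_torus, of u C] assms by auto

lemma integrable_torus_wiener: "integrable ZM c ==> integrable torus (wiener c)"
 using abs_wiener_le by (intro integrable_torus_bounded[where C = "LINT k|ZM. norm (c k)"] borel_measurable_torus_borel measurable_wiener) auto

lemma wiener_fourier_AE:
 assumes "integrable torus u" "integrable ZM (fourier u)"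
 shows "AE x in torus. u x = wiener (fourier u) x"
 using assms by (intro fourier_unique2 integrable_torus_wiener) (auto simp: fourier_wiener hermitian_fourier)

lemma fourier_AE_cong:
 assumes "AE x in torus. u x = v x" "u \<in> borel_measurable torus" "v \<in> borel_measurable torus"
 shows "fourier u k = fourier v k"
 unfolding fourier_cis
proof (intro arg_cong[where f = "\<lambda>z. _ * z"] integral_cong_AE)
 show "AE x in torus. complex_of_real (u x) * cis (- (of_int k * x)) = of_real (v x) * cis (- (of_int k * x))"
  using assms(1) by eventually_elim simp
qed (use assms borel_measurable_torus_borel[OF measurable_cis[of "- of_int k"]] in \<open>auto intro!: borel_measurable_times\<close>)

section \<open>Weak derivatives in terms of Fourier coefficients\<close>

definition trig :: "int => real => real => real => real" where
 "trig k a b x = a * cos (of_int k * x) + b * sin (of_int k * x)"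

lemma periodic_trig: "periodic (trig k a b)"
 using cis_periodic[of k] by (auto simp: periodic_def trig_def complex_eq_iff)

lemma DERIV_trig: "(trig k a b has_real_derivative trig k (b * of_int k) (- a * of_int k) x) (at x)"
 unfolding trig_def[abs_def] by (auto intro!: derivative_eq_intros)

lemma deriv_trig: "deriv (trig k a b) = trig k (b * of_int k) (- a * of_int k)"
 using DERIV_imp_deriv[OF DERIV_trig] by blast

lemma continuous_on_trig: "continuous_on S (trig k a b)"
 unfolding trig_def[abs_def] by (intro continuous_intros)

text \<open>The two-parameter family is closed under \<open>deriv\<close>, so all iterated
  derivatives stay in it. It replaces the complex exponentials because the test functions of
  \<open>has_weak_deriv\<close> are real.\<close>

lemma smooth_periodic_trig: "smooth_periodic (trig k a b)"
proof -
 have "\<exists>a' b'. (deriv ^^ n) (trig k a b) = trig k a' b'" for n by (induction n) (auto simp: deriv_trig, blast)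
 then have "(deriv ^^ n) (trig k a b) field_differentiable (at x)" for n x
  unfolding field_differentiable_def using DERIV_trig by metis
 then show ?thesis using periodic_trig by (simp add: smooth_periodic_def)
qed

lemma fourier_cos_sin:
 assumes "integrable torus u"
 shows "fourier u k = (1 / (2 * pi)) * (of_real (LINT x|torus. u x * cos (of_int k * x)) - \<i> * of_real (LINT x|torus. u x * sin (of_int k * x)))"
proof -
 have iw: "integrable torus (\<lambda>x. of_real (u x) * cis (- (of_int k * x)))"
  using integrable_mult_cis[of "\<lambda>x. of_real (u x)" "- of_int k"] assms by auto
 have "(LINT x|torus. of_real (u x) * cis (- (of_int k * x))) = of_real (LINT x|torus. u x * cos (of_int k * x)) - \<i> * of_real (LINT x|torus. u x * sin (of_int k * x))"
  using integral_Re[OF iw] integral_Im[OF iw] by (simp add: complex_eq_iff)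
 then show ?thesis by (simp add: fourier_cis)
qed

lemma fourier_weak_deriv:
 assumes "has_weak_deriv u v"
 shows "fourier v k = \<i> * of_int k * fourier u k"
proof -
 have u: "integrable torus u" and v: "integrable torus v" using assms by (auto simp: has_weak_deriv_def)
 have 1: "(LINT x|torus. u x * trig k (b * of_int k) (- a * of_int k) x) = - (LINT x|torus. v x * trig k a b x)" for a b
  using assms smooth_periodic_trig[of k a b] unfolding has_weak_deriv_def deriv_trig[symmetric] by blast
 have "- of_int k * (LINT x|torus. u x * sin (of_int k * x)) = - (LINT x|torus. v x * cos (of_int k * x))"
  using 1[of 0 1] by (simp add: trig_def mult.left_commute)
 moreover have "of_int k * (LINT x|torus. u x * cos (of_int k * x)) = - (LINT x|torus. v x * sin (of_int k * x))"
  using 1[of 1 0] by (simp add: trig_def mult.left_commute)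
 ultimately have *: "(LINT x|torus. v x * cos (of_int k * x)) = of_int k * (LINT x|torus. u x * sin (of_int k * x))"
   "(LINT x|torus. v x * sin (of_int k * x)) = - of_int k * (LINT x|torus. u x * cos (of_int k * x))" by auto
 show ?thesis unfolding fourier_cos_sin[OF u] fourier_cos_sin[OF v] * by (simp add: algebra_simps)
qed

text \<open>The coefficients of a weak derivative are i k times those of the function, and an
  integrable function is determined almost everywhere by its coefficients. This identifies whatever
  derivative \<open>weak_deriv\<close> has chosen.\<close>

lemma has_weak_deriv_unique:
 assumes "has_weak_deriv u v" "has_weak_deriv u' v'" "AE x in torus. u x = u' x"
 shows "AE x in torus. v x = v' x"
proof (rule fourier_unique2)
 fix k
 have "fourier u k = fourier u' k" using assms by (intro fourier_AE_cong) (auto simp: has_weak_deriv_def)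
 then show "fourier v k = fourier v' k" using fourier_weak_deriv[OF assms(1)] fourier_weak_deriv[OF assms(2)] by simp
qed (use assms in \<open>auto simp: has_weak_deriv_def\<close>)

text \<open>The boundary terms cancel by periodicity. Only C^1 is asked of \<open>\<eta>\<close>,
  since the formula serves both the smooth test functions of \<open>has_weak_deriv\<close> and the
  time slices of the test functions of the evolution problem.\<close>

lemma wiener_by_parts:
 assumes d: "integrable ZM (dcoef c)" and per: "periodic \<eta>"
  and D: "\<And>x. (\<eta> has_real_derivative \<eta>' x) (at x)" and c2: "continuous_on UNIV \<eta>'"
 shows "(LINT x|torus. wiener c x * \<eta>' x) = - (LINT x|torus. wiener (dcoef c) x * \<eta> x)"
proof -
 have c: "integrable ZM c" by (rule integrable_ZM_of_dcoef[OF d])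
 have iu: "integrable torus (wiener c)" and iv: "integrable torus (wiener (dcoef c))"
  using c d by (auto intro: integrable_torus_wiener)
 have c1: "continuous_on UNIV \<eta>" using D by (meson DERIV_isCont continuous_at_imp_continuous_on)
 have "((\<lambda>x. wiener c x * \<eta>' x + wiener (dcoef c) x * \<eta> x) has_integral (wiener c pi * \<eta> pi - wiener c (-pi) * \<eta> (-pi))) {-pi..pi}"
 proof (rule fundamental_theorem_of_calculus)
  fix x assume "x \<in> {- pi..pi}"
  have "((\<lambda>x. wiener c x * \<eta> x) has_real_derivative (wiener c x * \<eta>' x + wiener (dcoef c) x * \<eta> x)) (at x)"
   using DERIV_mult[OF DERIV_wiener[OF d] D] by (simp add: add.commute mult.commute)
  then show "((\<lambda>x. wiener c x * \<eta> x) has_vector_derivative (wiener c x * \<eta>' x + wiener (dcoef c) x * \<eta> x)) (at x within {- pi..pi})"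
   by (simp add: has_real_derivative_iff_has_vector_derivative has_vector_derivative_at_within)
 qed simp
 moreover have "wiener c pi = wiener c (-pi)" "\<eta> pi = \<eta> (-pi)"
  using periodic_wiener[of c] per unfolding periodic_def
  by (auto dest!: spec[of _ "-pi"])
 ultimately have 0: "((\<lambda>x. wiener c x * \<eta>' x + wiener (dcoef c) x * \<eta> x) has_integral 0) {-pi..pi}" by simp
 have bd: "integrable torus (\<lambda>x. f x * g x)" if "continuous_on UNIV g" "integrable torus f" for f g :: "real => real"
 proof -
  have "compact (g ` {-pi..pi})" using that(1) by (intro compact_continuous_image) (auto intro: continuous_on_subset)
  then obtain B where B: "\<And>x. x \<in> {-pi..pi} ==> norm (g x) \<le> B" by (metis bounded_iff compact_imp_bounded imageI)
  show ?thesis using B that by (intro integrable_mult_bounded[where C = B] borel_measurable_torus_borel borel_measurable_continuous_onI) auto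
 qed
 have i1: "integrable torus (\<lambda>x. wiener c x * \<eta>' x)" and i2: "integrable torus (\<lambda>x. wiener (dcoef c) x * \<eta> x)"
  using bd c1 c2 iu iv by auto
 have "(LINT x|torus. wiener c x * \<eta>' x + wiener (dcoef c) x * \<eta> x) = 0"
  using lebesgue_integral_eq_integral[of "{-pi..pi}" "\<lambda>x. wiener c x * \<eta>' x + wiener (dcoef c) x * \<eta> x"] i1 i2 integral_unique[OF 0]
  by (simp add: torus_def)
 then show ?thesis using i1 i2 by simp
qed

lemma has_weak_deriv_wiener:
 assumes d: "integrable ZM (dcoef c)"
 shows "has_weak_deriv (wiener c) (wiener (dcoef c))"
 unfolding has_weak_deriv_def
proof (intro conjI allI impI)
 show "integrable torus (wiener c)" "integrable torus (wiener (dcoef c))"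
  using d integrable_ZM_of_dcoef[OF d] by (auto intro: integrable_torus_wiener)
 fix \<eta> assume \<eta>: "smooth_periodic \<eta>"
 show "(LINT x|torus. wiener c x * deriv \<eta> x) = - (LINT x|torus. wiener (dcoef c) x * \<eta> x)"
 proof (rule wiener_by_parts[OF d])
  show "periodic \<eta>" using \<eta> by (simp add: smooth_periodic_def)
  show "(\<eta> has_real_derivative deriv \<eta> x) (at x)" for x
   using \<eta> unfolding smooth_periodic_def by (metis DERIV_deriv_iff_field_differentiable funpow_0)
  have "deriv \<eta> field_differentiable (at x)" for x
  proof -
   have "(deriv ^^ 1) \<eta> field_differentiable (at x)" using \<eta> unfolding smooth_periodic_def by blast
   then show ?thesis by simp
  qed
  then show "continuous_on UNIV (deriv \<eta>)"
   by (intro continuous_at_imp_continuous_on ballI field_differentiable_imp_continuous_at)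
 qed
qed

section \<open>The energy estimate\<close>

text \<open>With natural powers 0 ^ 0 = 1: the weight s = 0 counts the mode k = 0, every s > 0
  ignores it. Finiteness is a separate predicate because the integral in \<open>l1\<close> is 0 for
  a family that is not summable.\<close>

definition ell :: "nat => (int => complex) => bool" where
 "ell s x \<longleftrightarrow> integrable ZM (\<lambda>k. mag k ^ s * norm (x k))"

definition l1 :: "nat => (int => complex) => real" where
 "l1 s x = (LINT k|ZM. mag k ^ s * norm (x k))"

definition cmult :: "(int => complex) => int => complex" where
 "cmult x k = of_int k * x k"

text \<open>Coefficients of the product of x with the derivative of y, up to the factor i, which is
  restored in \<open>jcoef\<close>.\<close>

definition flux :: "(int => complex) => (int => complex) => int => complex" where
 "flux x y = conv x (cmult y)"

lemma abs_int_power_mono: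
 assumes "s \<le> t" "k \<noteq> 0 \<or> s = t"
 shows "mag k ^ s \<le> mag k ^ t"
proof (cases "k = 0")
 case False
 then have "1 \<le> \<bar>k\<bar>" by linarith
 then have "1 \<le> mag k" by linarith
 then show ?thesis using assms by (intro power_increasing) auto
qed (use assms in auto)

lemma ell_0_iff: "ell 0 x \<longleftrightarrow> integrable ZM x"
 by (simp add: ell_def integrable_norm_iff)

lemma ell_mono:
 assumes "ell t x" "s \<le> t"
 shows "ell s x"
 unfolding ell_def
proof (rule B_int_bound[where f = "\<lambda>k. mag k ^ t * norm (x k) + (if k = 0 then norm (x 0) else 0)"])
 show "integrable ZM (\<lambda>k. mag k ^ t * norm (x k) + (if k = 0 then norm (x 0) else 0))"
 proof (rule B_int_add)
  show "integrable ZM (\<lambda>k. if k = 0 then norm (x 0) else 0)" by (rule integrable_ZM_finite[of "{0}"]) auto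
 qed (use assms(1) in \<open>simp add: ell_def\<close>)
 show "AE k in ZM. norm (mag k ^ s * norm (x k)) \<le> norm (mag k ^ t * norm (x k) + (if k = 0 then norm (x 0) else 0))"
 proof (rule AE_I2)
  fix k
  show "norm (mag k ^ s * norm (x k)) \<le> norm (mag k ^ t * norm (x k) + (if k = 0 then norm (x 0) else 0))"
   using mult_right_mono[OF abs_int_power_mono[OF assms(2)], of k "norm (x k)"]
   by (cases "k = 0"; cases "s = 0"; cases "t = 0") (auto simp: abs_mult power_0_left)
 qed
qed auto

lemma l1_nonneg [simp]: "0 \<le> l1 s x"
 by (simp add: l1_def)

lemma l1_mono:
 assumes "ell t x" "s \<le> t" "x 0 = 0"
 shows "l1 s x \<le> l1 t x"
 unfolding l1_def
proof (rule integral_mono)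
 show "mag k ^ s * norm (x k) \<le> mag k ^ t * norm (x k)" for k
  using mult_right_mono[OF abs_int_power_mono[OF assms(2)], of k "norm (x k)"] assms(3) by (cases "k = 0") auto
qed (use ell_mono assms in \<open>auto simp: ell_def\<close>)

lemma ell_add_scale:
 assumes "ell s x" "ell s y"
 shows "ell s (\<lambda>k. of_real a * x k + of_real b * y k)"
  and "l1 s (\<lambda>k. of_real a * x k + of_real b * y k) \<le> \<bar>a\<bar> * l1 s x + \<bar>b\<bar> * l1 s y"
proof -
 have i: "integrable ZM (\<lambda>k. \<bar>a\<bar> * (mag k ^ s * norm (x k)) + \<bar>b\<bar> * (mag k ^ s * norm (y k)))"
  using assms by (auto simp: ell_def)
 have le: "mag k ^ s * norm (of_real a * x k + of_real b * y k) \<le> \<bar>a\<bar> * (mag k ^ s * norm (x k)) + \<bar>b\<bar> * (mag k ^ s * norm (y k))" for k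
 proof -
  have "norm (of_real a * x k + of_real b * y k) \<le> \<bar>a\<bar> * norm (x k) + \<bar>b\<bar> * norm (y k)"
   by (rule order_trans[OF norm_triangle_ineq]) (simp add: norm_mult)
  from mult_left_mono[OF this, of "mag k ^ s"] show ?thesis by (simp add: algebra_simps)
 qed
 show e: "ell s (\<lambda>k. of_real a * x k + of_real b * y k)" unfolding ell_def
  by (rule B_int_bound[OF i]) (use le in \<open>auto intro!: AE_I2 order_trans[OF le] simp: abs_mult\<close>)
 have "l1 s (\<lambda>k. of_real a * x k + of_real b * y k) \<le> (LINT k|ZM. \<bar>a\<bar> * (mag k ^ s * norm (x k)) + \<bar>b\<bar> * (mag k ^ s * norm (y k)))"
  unfolding l1_def using e i le by (intro integral_mono) (auto simp: ell_def)
 then show "l1 s (\<lambda>k. of_real a * x k + of_real b * y k) \<le> \<bar>a\<bar> * l1 s x + \<bar>b\<bar> * l1 s y"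
  using assms by (simp add: l1_def ell_def)
qed

lemma ell_diff:
 assumes "ell s x" "ell s y"
 shows "ell s (\<lambda>k. x k - y k)"
 using ell_add_scale(1)[OF assms, of 1 "-1"] by simp

lemma norm_le_l1_0: "ell 0 x ==> norm (x k) \<le> l1 0 x"
 using le_integral_ZM[of "\<lambda>k. norm (x k)" k] by (simp add: ell_def l1_def)

lemma integrable_flux_summand:
 assumes "ell 0 x" "ell 1 y"
 shows "integrable ZM (\<lambda>q. x (k - q) * cmult y q)"
proof (rule B_int_bound[where f = "\<lambda>q. l1 0 x * (mag q ^ 1 * norm (y q))"])
 show "AE q in ZM. norm (x (k - q) * cmult y q) \<le> norm (l1 0 x * (mag q ^ 1 * norm (y q)))"
  using norm_le_l1_0[OF assms(1)] by (intro AE_I2) (auto simp: norm_mult cmult_def intro!: mult_right_mono)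
qed (use assms in \<open>auto simp: ell_def\<close>)

lemma norm_flux_le:
 assumes "ell 0 x" "ell 1 y"
 shows "norm (flux x y k) \<le> l1 0 x * l1 1 y"
proof -
 have "norm (flux x y k) \<le> (LINT q|ZM. norm (x (k - q) * cmult y q))" unfolding flux_def conv_def by (rule integral_norm_bound)
 also have "... \<le> (LINT q|ZM. l1 0 x * (mag q ^ 1 * norm (y q)))"
 proof (rule integral_mono)
  show "integrable ZM (\<lambda>q. norm (x (k - q) * cmult y q))" by (intro integrable_norm integrable_flux_summand assms)
  show "integrable ZM (\<lambda>q. l1 0 x * (mag q ^ 1 * norm (y q)))" using assms(2) by (simp add: ell_def)
  show "norm (x (k - q) * cmult y q) \<le> l1 0 x * (mag q ^ 1 * norm (y q))" for q
   using norm_le_l1_0[OF assms(1)] by (auto simp: norm_mult cmult_def intro!: mult_right_mono)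
 qed
 finally show ?thesis by (simp add: l1_def)
qed

text \<open>The loss of derivatives in the product is distributed by $|k| \le |k-q| + |q|$ and Young's inequality.\<close>

lemma flux_bound:
 assumes x: "ell 2 x" and y: "ell 2 y" and \<theta>: "\<theta> > 0"
 shows "ell 1 (flux x y)"
  and "l1 1 (flux x y) \<le> (1 + 1 / (4 * \<theta>)) * l1 0 x * l1 2 y + \<theta> * l1 2 x * l1 0 y"
proof -
 define C where "C = (1 + 1 / (4 * \<theta>)) * l1 0 x * l1 2 y + \<theta> * l1 2 x * l1 0 y"
 have C0: "C \<ge> 0" using \<theta> by (auto simp: C_def)
 have x0: "ell 0 x" and y1: "ell 1 y" and y0: "ell 0 y" using x y ell_mono by auto
 define T where "T k q = mag k * (norm (x (k - q)) * (mag q * norm (y q)))" for k q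
 \<comment> \<open>\<open>\<theta>\<close> is left free: the value 1/2 minimises the total weight 1
   + 1/(4 \<theta>) + \<theta>, which is then 2, and the estimate of differences also uses the value
   1.\<close>
 have young: "T k q \<le> (1 + 1 / (4 * \<theta>)) * (real_of_int q)^2 * norm (y q) * norm (x (k - q)) + \<theta> * norm (y q) * ((real_of_int (k - q))^2 * norm (x (k - q)))" for k q
 proof -
  let ?a = "mag (k - q)" and ?b = "mag q"
  have "mag k * ?b \<le> (?a + ?b) * ?b" by (intro mult_right_mono) auto
  also have "... = ?b^2 + ?a * ?b" by (simp add: algebra_simps power2_eq_square)
  also have "?a * ?b \<le> \<theta> * ?a^2 + 1 / (4 * \<theta>) * ?b^2"
  proof -
   have "0 \<le> \<theta> * (?a - ?b / (2 * \<theta>))^2" using \<theta> by simp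
   also have "... = \<theta> * ?a^2 + 1 / (4 * \<theta>) * ?b^2 - ?a * ?b" using \<theta>
    by (simp add: power2_eq_square field_simps)
   finally show ?thesis by simp
  qed
  finally have "mag k * ?b \<le> (1 + 1 / (4 * \<theta>)) * ?b^2 + \<theta> * ?a^2" by (simp add: algebra_simps)
  from mult_right_mono[OF this, of "norm (x (k - q)) * norm (y q)"] show ?thesis
   by (simp add: T_def algebra_simps)
 qed
 have "(\<integral>\<^sup>+k. ennreal (mag k ^ 1 * norm (flux x y k)) \<partial>ZM) \<le> (\<integral>\<^sup>+k. \<integral>\<^sup>+q. ennreal (T k q) \<partial>ZM \<partial>ZM)"
 proof (rule nn_integral_mono)
  fix k
  have "ennreal (norm (flux x y k)) \<le> (\<integral>\<^sup>+q. norm (x (k - q) * cmult y q) \<partial>ZM)"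
   unfolding flux_def conv_def by (intro integral_norm_bound_ennreal integrable_flux_summand x0 y1)
  then have "ennreal (mag k) * ennreal (norm (flux x y k)) \<le> ennreal (mag k) * (\<integral>\<^sup>+q. norm (x (k - q) * cmult y q) \<partial>ZM)"
   by (rule mult_left_mono) simp
  also have "... = (\<integral>\<^sup>+q. ennreal (T k q) \<partial>ZM)"
   by (simp add: nn_integral_cmult[symmetric] ennreal_mult[symmetric] T_def norm_mult cmult_def)
  finally show "ennreal (mag k ^ 1 * norm (flux x y k)) \<le> (\<integral>\<^sup>+q. ennreal (T k q) \<partial>ZM)" by (simp add: ennreal_mult)
 qed
 also have "... = (\<integral>\<^sup>+q. \<integral>\<^sup>+k. ennreal (T k q) \<partial>ZM \<partial>ZM)"
  by (rule nn_integral_count_space_nn_integral[symmetric]) auto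
 also have "... \<le> (\<integral>\<^sup>+q. ennreal ((1 + 1 / (4 * \<theta>)) * l1 0 x * ((real_of_int q)^2 * norm (y q)) + \<theta> * l1 2 x * norm (y q)) \<partial>ZM)"
 proof (rule nn_integral_mono)
  fix q
  have sx: "bij (\<lambda>k::int. k - q)" by (rule o_bij[where g = "\<lambda>k. k + q"]) auto
  have i0: "integrable ZM (\<lambda>k. norm (x (k - q)))" and e0: "(LINT k|ZM. norm (x (k - q))) = l1 0 x"
   using integrable_bij_count_space[OF sx, of "\<lambda>k. norm (x k)"] integral_bij_count_space[OF sx, of "\<lambda>k. norm (x k)"] x0 
   by (auto simp: ell_def l1_def)
  have i2: "integrable ZM (\<lambda>k. (real_of_int (k - q))^2 * norm (x (k - q)))" and e2: "(LINT k|ZM. (real_of_int (k - q))^2 * norm (x (k - q))) = l1 2 x"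
   using integrable_bij_count_space[OF sx, of "\<lambda>k. (real_of_int k)^2 * norm (x k)"] integral_bij_count_space[OF sx, of "\<lambda>k. (real_of_int k)^2 * norm (x k)"] x
   by (auto simp: ell_def l1_def)
  let ?U = "\<lambda>k. (1 + 1 / (4 * \<theta>)) * (real_of_int q)^2 * norm (y q) * norm (x (k - q)) + \<theta> * norm (y q) * ((real_of_int (k - q))^2 * norm (x (k - q)))"
  have "(\<integral>\<^sup>+k. ennreal (T k q) \<partial>ZM) \<le> (\<integral>\<^sup>+k. ennreal (?U k) \<partial>ZM)"
   using young by (intro nn_integral_mono ennreal_leI) auto
  also have "... = ennreal (LINT k|ZM. ?U k)"
   using i0 i2 \<theta> by (intro nn_integral_eq_integral) auto
  also have "(LINT k|ZM. ?U k) = (1 + 1 / (4 * \<theta>)) * (real_of_int q)^2 * norm (y q) * l1 0 x + \<theta> * norm (y q) * l1 2 x"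
   using i0 i2 e0 e2 by (subst B_itg_add) auto
  finally show "(\<integral>\<^sup>+k. ennreal (T k q) \<partial>ZM) \<le> ennreal ((1 + 1 / (4 * \<theta>)) * l1 0 x * ((real_of_int q)^2 * norm (y q)) + \<theta> * l1 2 x * norm (y q))"
   by (simp add: mult_ac)
 qed
 also have "... = ennreal (LINT q|ZM. (1 + 1 / (4 * \<theta>)) * l1 0 x * ((real_of_int q)^2 * norm (y q)) + \<theta> * l1 2 x * norm (y q))"
  using y y0 \<theta> by (intro nn_integral_eq_integral) (auto simp: ell_def)
 also have "(LINT q|ZM. (1 + 1 / (4 * \<theta>)) * l1 0 x * ((real_of_int q)^2 * norm (y q)) + \<theta> * l1 2 x * norm (y q)) = C"
  using y y0 by (subst B_itg_add) (auto simp: ell_def C_def l1_def)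
 finally have nn: "(\<integral>\<^sup>+k. ennreal (mag k ^ 1 * norm (flux x y k)) \<partial>ZM) \<le> ennreal C" .
 show "ell 1 (flux x y)" unfolding ell_def integrable_iff_bounded
  using order.strict_trans1[OF nn, of top] by (auto simp: abs_mult)
 show "l1 1 (flux x y) \<le> C" unfolding l1_def using nn C0 by (intro integral_real_bounded) auto
qed

lemma flux_diff:
 assumes "ell 0 x" "ell 0 x'" "ell 1 y" "ell 1 y'"
 shows "flux x y k - flux x' y' k = flux (\<lambda>k. x k - x' k) y k + flux x' (\<lambda>k. y k - y' k) k"
proof -
 note i = integrable_flux_summand
 have "flux (\<lambda>k. x k - x' k) y k = (LINT q|ZM. x (k - q) * cmult y q - x' (k - q) * cmult y q)"
  by (simp add: flux_def conv_def left_diff_distrib)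
 also have "... = flux x y k - flux x' y k" using i assms by (simp add: flux_def conv_def)
 finally have 1: "flux (\<lambda>k. x k - x' k) y k = flux x y k - flux x' y k" .
 have "flux x' (\<lambda>k. y k - y' k) k = (LINT q|ZM. x' (k - q) * cmult y q - x' (k - q) * cmult y' q)"
  by (simp add: flux_def conv_def cmult_def right_diff_distrib)
 also have "... = flux x' y k - flux x' y' k" using i assms by (simp add: flux_def conv_def)
 finally show ?thesis using 1 by simp
qed

section \<open>The two-component system in Fourier modes and a single Euler step\<close>

text \<open>The component \<open>True\<close> of a state is \<open>f\<close>, the component \<open>False\<close> is \<open>g\<close>.\<close>

locale film =
 fixes M \<alpha> \<beta> :: "bool => real" and c E0 \<delta> :: real
 assumes pos: "\<And>i. M i > 0" "\<And>i. \<alpha> i > 0" "\<And>i. \<beta> i > 0" "\<delta> > 0" "E0 \<ge> 0"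
  and c: "\<alpha> True \<le> c" "\<beta> True + \<alpha> False \<le> c" "\<beta> False \<le> c"
  and gap: "2 * c * E0 + \<delta> \<le> M True * \<alpha> True - M False * \<alpha> False"
   "2 * c * E0 + \<delta> \<le> M False * \<beta> False - M True * \<beta> True"
begin

text \<open>The i-th equation says that the time derivative of w_i is the x-derivative of (w_i +
  M_i) times the x-derivative of this combination.\<close>

definition pot :: "bool => (bool => int => complex) => int => complex" where
 "pot i w k = of_real (\<alpha> i) * w True k + of_real (\<beta> i) * w False k"

text \<open>The outer derivative i k and the factor i omitted from \<open>flux\<close> combine to
  the minus sign.\<close>

definition rhs :: "(bool => int => complex) => bool => int => complex" where
 "rhs w i k = - of_int k * (of_int k * of_real (M i) * pot i w k + flux (w i) (pot i w) k)"

definition en :: "nat => (bool => int => complex) => real" where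
 "en s w = l1 s (w True) + l1 s (w False)"

lemma en_nonneg [simp]: "0 \<le> en s w"
 by (simp add: en_def)

lemma l1_le_en: "l1 s (w i) \<le> en s w"
 by (cases i) (auto simp: en_def)

lemma en_mono: "(\<And>i. ell t (w i)) ==> s \<le> t ==> (\<And>i. w i 0 = 0) ==> en s w \<le> en t w"
 unfolding en_def by (intro add_mono l1_mono) auto

lemma c_pos: "c > 0" using c(1) pos(2)[of True] by linarith

lemma coeff_le: "\<alpha> i \<le> c" "\<beta> i \<le> c"
 using c pos(2)[of False] pos(3)[of True] by (cases i; simp)+

lemma ell_pot:
 assumes "\<And>i. ell s (w i)"
 shows "ell s (pot i w)" "l1 s (pot i w) \<le> \<alpha> i * l1 s (w True) + \<beta> i * l1 s (w False)"
 using ell_add_scale[OF assms assms, of "\<alpha> i" True "\<beta> i" False] pos(2,3)[of i]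
 unfolding pot_def[abs_def] by auto

lemma l1_pot_le: "(\<And>i. ell s (w i)) ==> l1 s (pot i w) \<le> c * en s w"
 using ell_pot(2)[of s w i] mult_right_mono[OF coeff_le(1)[of i], of "l1 s (w True)"] mult_right_mono[OF coeff_le(2)[of i], of "l1 s (w False)"]
 by (simp add: en_def distrib_left)

lemma pot_diff: "pot i (\<lambda>i k. w i k - w' i k) k = pot i w k - pot i w' k"
 by (simp add: pot_def algebra_simps)

text \<open>The choice \<theta> = 1/2 in \<open>flux_bound\<close> gives the weights 3/2 and 1/2.
  After summation the four products of an \<open>l1 0\<close> with an \<open>l1 2\<close> have
  coefficients 2 \<alpha> True, (3 \<beta> True + \<alpha> False) / 2, (\<beta> True + 3 \<alpha>
  False) / 2 and 2 \<beta> False; the conditions on \<open>c\<close> in the locale are shaped to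
  bound all four by 2 c.\<close>

lemma flux_energy:
 assumes w: "\<And>i. ell 2 (w i)"
 shows "(\<Sum>i\<in>UNIV. l1 1 (flux (w i) (pot i w))) \<le> 2 * c * en 0 w * en 2 w"
proof -
 have w0: "\<And>i. ell 0 (w i)" using w ell_mono by blast
 have b: "l1 1 (flux (w i) (pot i w)) \<le> 3/2 * l1 0 (w i) * (\<alpha> i * l1 2 (w True) + \<beta> i * l1 2 (w False))
   + 1/2 * l1 2 (w i) * (\<alpha> i * l1 0 (w True) + \<beta> i * l1 0 (w False))" for i
 proof -
  have "l1 1 (flux (w i) (pot i w)) \<le> 3/2 * l1 0 (w i) * l1 2 (pot i w) + 1/2 * l1 2 (w i) * l1 0 (pot i w)"
   using flux_bound(2)[OF w ell_pot(1)[OF w], of "1/2" i i] by simp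
  also have "... \<le> 3/2 * l1 0 (w i) * (\<alpha> i * l1 2 (w True) + \<beta> i * l1 2 (w False))
   + 1/2 * l1 2 (w i) * (\<alpha> i * l1 0 (w True) + \<beta> i * l1 0 (w False))"
   by (intro add_mono mult_left_mono ell_pot w w0) auto
  finally show ?thesis .
 qed
 define x0 x2 z0 z2 where "x0 = l1 0 (w True)" "x2 = l1 2 (w True)" "z0 = l1 0 (w False)" "z2 = l1 2 (w False)"
 have nn: "x0 \<ge> 0" "x2 \<ge> 0" "z0 \<ge> 0" "z2 \<ge> 0" by (auto simp: x0_x2_z0_z2_def)
 have "(\<Sum>i\<in>UNIV. l1 1 (flux (w i) (pot i w))) = l1 1 (flux (w True) (pot True w)) + l1 1 (flux (w False) (pot False w))"
  by (simp add: UNIV_bool)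
 also have "... \<le> (2 * \<alpha> True) * (x0 * x2) + (3/2 * \<beta> True + 1/2 * \<alpha> False) * (x0 * z2)
   + (1/2 * \<beta> True + 3/2 * \<alpha> False) * (z0 * x2) + (2 * \<beta> False) * (z0 * z2)"
  using b[of True] b[of False] by (simp add: x0_x2_z0_z2_def algebra_simps)
 also have "... \<le> (2 * c) * (x0 * x2) + (2 * c) * (x0 * z2) + (2 * c) * (z0 * x2) + (2 * c) * (z0 * z2)"
  using nn c pos(2)[of False] pos(3)[of True] by (intro add_mono mult_right_mono) auto
 also have "... = 2 * c * en 0 w * en 2 w" by (simp add: en_def x0_x2_z0_z2_def algebra_simps)
 finally show ?thesis .
qed

text \<open>The quadratic term of a state with frequencies up to n reaches up to 2 n. Projecting
  back to |k| \<le> n keeps the state finitely supported, so that one step size is stable for all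
  iterates.\<close>

definition euler :: "nat => real => (bool => int => complex) => bool => int => complex" where
 "euler n \<tau> w i k = (if \<bar>k\<bar> \<le> int n then w i k + of_real \<tau> * rhs w i k else 0)"

definition supported :: "nat => (bool => int => complex) => bool" where
 "supported n w \<longleftrightarrow> (\<forall>i k. (\<bar>k\<bar> > int n \<or> k = 0) \<longrightarrow> w i k = 0) \<and> (\<forall>i. hermitian (w i))"

lemma supported_ell: 
 assumes "supported n w" shows "ell s (w i)"
 unfolding ell_def
proof (rule integrable_ZM_finite[of "{- int n..int n}"])
 fix k assume "k \<notin> {- int n..int n}"
 then have "\<bar>k\<bar> > int n" by auto
 then show "mag k ^ s * cmod (w i k) = 0" using assms by (auto simp: supported_def)
qed auto

lemma hermitian_pot: "(\<And>i. hermitian (w i)) ==> hermitian (pot i w)"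
 by (simp add: hermitian_def pot_def)

text \<open>The sign is negative because the factor i of the derivative is missing from
  \<open>flux\<close>.\<close>

lemma hermitian_flux:
 assumes "hermitian x" "hermitian y" 
 shows "flux x y (- k) = - cnj (flux x y k)"
proof -
 have "cnj (flux x y k) = (LINT q|ZM. cnj (x (k - q) * cmult y q))" unfolding flux_def conv_def by (rule B_itg_cnj[symmetric])
 also have "... = (LINT q|ZM. - (x (- k - (- q)) * cmult y (- q)))"
 proof (rule B_itg_cong[OF refl])
  fix q
  have "x (- k - (- q)) = cnj (x (k - q))" using assms(1) unfolding hermitian_def by (metis minus_diff_eq minus_diff_minus)
  then show "cnj (x (k - q) * cmult y q) = - (x (- k - (- q)) * cmult y (- q))" 
   using assms(2) by (simp add: hermitian_def cmult_def)
 qed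
 also have "... = (LINT q|ZM. - (x (- k - q) * cmult y q))" by (rule integral_ZM_uminus[of "\<lambda>q. - (x (- k - q) * cmult y q)"])
 also have "... = - flux x y (- k)" by (simp add: flux_def conv_def)
 finally show ?thesis by simp
qed

lemma supported_euler:
 assumes "supported n w" shows "supported n (euler n \<tau> w)"
proof -
 have h: "\<And>i. hermitian (w i)" using assms by (simp add: supported_def)
 have "hermitian (euler n \<tau> w i)" for i
  unfolding hermitian_def
 proof
  fix k
  have "rhs w i (- k) = cnj (rhs w i k)"
   using hermitian_flux[OF h hermitian_pot[OF h]] hermitian_pot[OF h, of i] by (simp add: rhs_def hermitian_def algebra_simps)
  then show "euler n \<tau> w i (- k) = cnj (euler n \<tau> w i k)" using h by (simp add: euler_def hermitian_def)
 qed
 then show ?thesis using assms by (auto simp: supported_def euler_def rhs_def)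
qed

text \<open>Contribution of the linear part to the growth of the modulus of component
  \<open>i\<close>, with a and b the moduli of the two modes: the own mode damps, the other one
  enters with its worst sign.\<close>

definition exch :: "bool => real => real => real" where
 "exch i a b = (if i then \<beta> i * b - \<alpha> i * a else \<alpha> i * a - \<beta> i * b)"

text \<open>Under the step size condition the diagonal factor of the step is nonnegative, so the
  damping survives when moduli are taken; coupling and flux are estimated by the triangle
  inequality.\<close>

lemma norm_euler_le:
 assumes "supported n w" and \<tau>: "\<tau> > 0" "\<tau> * (real n)^2 * (M i * (\<alpha> i + \<beta> i)) \<le> 1"
 shows "norm (euler n \<tau> w i k) \<le> norm (w i k)
   + \<tau> * M i * (mag k^2 * exch i (norm (w True k)) (norm (w False k)))
   + \<tau> * (mag k^1 * norm (flux (w i) (pot i w) k))" (is "_ \<le> ?R")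
proof (cases "\<bar>k\<bar> \<le> int n")
 case True
 have k2: "mag k^2 \<le> (real n)^2" using True by (intro power_mono) auto
 have le1: "\<tau> * mag k^2 * (M i * a) \<le> 1" if "0 < a" "a \<le> \<alpha> i + \<beta> i" for a
 proof -
  have "\<tau> * mag k^2 * (M i * a) \<le> \<tau> * (real n)^2 * (M i * (\<alpha> i + \<beta> i))"
   using k2 \<tau> that pos(1)[of i] by (intro mult_mono mult_left_mono) auto
  then show ?thesis using \<tau> by linarith
 qed
 \<comment> \<open>\<open>?d\<close> multiplies the own component and damps it, \<open>?e\<close>
   multiplies the other component.\<close>
 let ?d = "if i then \<alpha> i else \<beta> i" and ?e = "if i then \<beta> i else \<alpha> i"
 let ?K = "\<tau> * mag k^2 * M i"
 have kk: "(of_int k * of_int k :: complex) = of_real (mag k^2)" by (simp add: power2_eq_square)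
 have e1: "euler n \<tau> w i k = of_real (1 - ?K * ?d) * w i k - of_real (?K * ?e) * w (\<not> i) k - of_real \<tau> * of_int k * flux (w i) (pot i w) k"
  using True kk unfolding euler_def rhs_def pot_def
  by (cases i) (simp_all add: algebra_simps power2_eq_square)
 have "norm (euler n \<tau> w i k) \<le> norm (of_real (1 - ?K * ?d) * w i k) + norm (of_real (?K * ?e) * w (\<not> i) k) + norm (of_real \<tau> * of_int k * flux (w i) (pot i w) k)"
  unfolding e1 by (intro order_trans[OF norm_triangle_ineq4] add_right_mono norm_triangle_ineq4)
 also have "... = \<bar>1 - ?K * ?d\<bar> * norm (w i k) + (?K * ?e) * norm (w (\<not> i) k) + \<tau> * mag k * norm (flux (w i) (pot i w) k)"
  using \<tau>(1) pos(1)[of i] pos(2)[of i] pos(3)[of i] unfolding norm_mult norm_of_real by (cases i) (simp_all add: abs_mult)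
 also have "\<bar>1 - ?K * ?d\<bar> = 1 - ?K * ?d" using le1[of ?d] pos(2,3)[of i] by (auto simp: mult_ac split: if_splits)
 also have "(1 - ?K * ?d) * norm (w i k) + (?K * ?e) * norm (w (\<not> i) k) + \<tau> * mag k * norm (flux (w i) (pot i w) k) = ?R"
  by (cases i) (simp_all add: exch_def algebra_simps)
 finally show ?thesis .
next
 case False
 then show ?thesis using assms by (auto simp: exch_def euler_def supported_def)
qed

text \<open>Summing both components, the second-order norm of f receives the weight M False \<alpha>
  False - M True \<alpha> True and that of g the weight M True \<beta> True - M False \<beta> False.
  By \<open>gap\<close> both are at most -(2 c E0 + \<delta>). The flux takes back at most 2 c E0
  while \<open>en 0 w\<close> is below E0, and \<open>\<delta>\<close> remains.\<close>

lemma euler_energy: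
 assumes s: "supported n w" and \<tau>: "\<tau> > 0" "\<And>i. \<tau> * (real n)^2 * (M i * (\<alpha> i + \<beta> i)) \<le> 1"
  and E: "en 0 w \<le> E0"
 shows "en 0 (euler n \<tau> w) + \<tau> * \<delta> * en 2 w \<le> en 0 w"
proof -
 note e = supported_ell[OF s]
 have e2: "integrable ZM (\<lambda>k. mag k^2 * norm (w i k))" for i using e[of 2 i] by (simp add: ell_def)
 have e0: "integrable ZM (\<lambda>k. norm (w i k))" for i using e[of 0 i] by (simp add: ell_def)
 have ef: "integrable ZM (\<lambda>k. mag k^1 * norm (flux (w i) (pot i w) k))" for i
  using flux_bound(1)[OF e ell_pot(1)[OF e], of 1 i i] by (simp add: ell_def)
 have 1: "l1 0 (euler n \<tau> w i) \<le> l1 0 (w i) + \<tau> * M i * exch i (l1 2 (w True)) (l1 2 (w False))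
   + \<tau> * l1 1 (flux (w i) (pot i w))" for i
 proof -
  have id: "integrable ZM (\<lambda>k. mag k^2 * exch i (norm (w True k)) (norm (w False k)))"
   "(LINT k|ZM. mag k^2 * exch i (norm (w True k)) (norm (w False k)))
    = exch i (l1 2 (w True)) (l1 2 (w False))"
  proof -
   have eq: "(\<lambda>k. mag k^2 * exch i (norm (w True k)) (norm (w False k)))
     = (\<lambda>k. (if i then 1 else -1) * (\<beta> i * (mag k^2 * norm (w False k)) - \<alpha> i * (mag k^2 * norm (w True k))))"
    by (auto simp: exch_def algebra_simps)
   have ib: "integrable ZM (\<lambda>k. \<beta> i * (mag k^2 * norm (w False k)))" "integrable ZM (\<lambda>k. \<alpha> i * (mag k^2 * norm (w True k)))"
    by (rule integrable_mult_right[OF e2])+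
   show "integrable ZM (\<lambda>k. mag k^2 * exch i (norm (w True k)) (norm (w False k)))"
    unfolding eq by (intro integrable_mult_right B_int_diff ib)
   have "(LINT k|ZM. (\<beta> i * (mag k^2 * norm (w False k)) - \<alpha> i * (mag k^2 * norm (w True k)))) = \<beta> i * l1 2 (w False) - \<alpha> i * l1 2 (w True)"
    unfolding B_itg_diff[OF ib] l1_def by (simp only: B_itg_mult_right_zero)
   then show "(LINT k|ZM. mag k^2 * exch i (norm (w True k)) (norm (w False k)))
    = exch i (l1 2 (w True)) (l1 2 (w False))"
    unfolding eq B_itg_mult_right_zero by (auto simp: exch_def)
  qed
  have "l1 0 (euler n \<tau> w i) \<le> (LINT k|ZM. (norm (w i k)
   + \<tau> * M i * (mag k^2 * exch i (norm (w True k)) (norm (w False k))))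
   + \<tau> * (mag k^1 * norm (flux (w i) (pot i w) k)))"
   unfolding l1_def
  proof (rule integral_mono)
   show "integrable ZM (\<lambda>k. mag k ^ 0 * norm (euler n \<tau> w i k))"
    using supported_ell[OF supported_euler[OF s], of 0] by (simp add: ell_def)
   show "integrable ZM (\<lambda>k. (norm (w i k)
   + \<tau> * M i * (mag k^2 * exch i (norm (w True k)) (norm (w False k))))
   + \<tau> * (mag k^1 * norm (flux (w i) (pot i w) k)))"
    by (intro B_int_add integrable_mult_right e0 ef id)
  qed (use norm_euler_le[OF s \<tau>(1) \<tau>(2)] in auto)
  also have "... = l1 0 (w i) + \<tau> * M i * exch i (l1 2 (w True)) (l1 2 (w False))
   + \<tau> * l1 1 (flux (w i) (pot i w))"
   by (subst B_itg_add, (intro B_int_add integrable_mult_right e0 ef id)+,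
     subst B_itg_add, (intro B_int_add integrable_mult_right e0 ef id)+)
     (simp only: B_itg_mult_right_zero id(2), simp add: l1_def)
  finally show ?thesis .
 qed
 define A B N where "A = l1 2 (w True)" "B = l1 2 (w False)" "N = (\<Sum>i\<in>UNIV. l1 1 (flux (w i) (pot i w)))"
 have AB: "A \<ge> 0" "B \<ge> 0" by (auto simp: A_B_N_def)
 have "en 0 (euler n \<tau> w) \<le> en 0 w + \<tau> * (M True * (\<beta> True * B - \<alpha> True * A) + M False * (\<alpha> False * A - \<beta> False * B) + N)"
  using 1[of True] 1[of False] by (simp add: exch_def en_def A_B_N_def UNIV_bool algebra_simps)
 also have "M True * (\<beta> True * B - \<alpha> True * A) + M False * (\<alpha> False * A - \<beta> False * B) + N \<le> - \<delta> * en 2 w"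
 proof -
  have "N \<le> 2 * c * en 0 w * en 2 w" unfolding A_B_N_def by (rule flux_energy[OF e])
  also have "... \<le> 2 * c * E0 * en 2 w" using E c_pos by (intro mult_right_mono mult_left_mono) auto
  also have "... = 2 * c * E0 * A + 2 * c * E0 * B" by (simp add: en_def A_B_N_def algebra_simps)
  finally have "N \<le> 2 * c * E0 * A + 2 * c * E0 * B" .
  moreover have "(2 * c * E0 + \<delta>) * A \<le> (M True * \<alpha> True - M False * \<alpha> False) * A" "(2 * c * E0 + \<delta>) * B \<le> (M False * \<beta> False - M True * \<beta> True) * B"
   using gap AB by (auto intro: mult_right_mono)
  ultimately show ?thesis by (simp add: en_def A_B_N_def algebra_simps)
 qed
 finally show ?thesis using \<tau>(1) by (simp add: algebra_simps)
qed

end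

section \<open>Approximation and compactness\<close>

text \<open>Fatou with a bound that varies with n: the decay estimate for the approximations
  involves the step size and attains its final form only in the limit.\<close>

lemma integrable_Fatou:
 fixes f :: "'a => real"
 assumes i: "\<And>n. integrable M (g n)" and nn: "\<And>n x. g n x \<ge> 0" and C: "\<And>n. (LINT x|M. g n x) \<le> C n" "C \<longlonglongrightarrow> L"
  and lim: "AE x in M. (\<lambda>n. g n x) \<longlonglongrightarrow> f x" and f: "f \<in> borel_measurable M"
 shows "integrable M f" "(LINT x|M. f x) \<le> L"
proof -
 have "0 \<le> (LINT x|M. g n x)" for n using nn by (intro integral_nonneg_AE AE_I2)
 then have C0: "C n \<ge> 0" for n using C(1)[of n] by (meson order_trans)
 then have L0: "L \<ge> 0" using C(2) by (intro LIMSEQ_le_const) auto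
 have fn: "AE x in M. f x \<ge> 0" using lim by eventually_elim (use nn in \<open>auto intro: LIMSEQ_le_const\<close>)
 have "(\<integral>\<^sup>+x. ennreal (f x) \<partial>M) = (\<integral>\<^sup>+x. liminf (\<lambda>n. ennreal (g n x)) \<partial>M)"
 proof (rule nn_integral_cong_AE)
  show "AE x in M. ennreal (f x) = liminf (\<lambda>n. ennreal (g n x))"
   using lim by eventually_elim (auto intro!: lim_imp_Liminf[symmetric] tendsto_ennrealI)
 qed
 also have "... \<le> liminf (\<lambda>n. \<integral>\<^sup>+x. ennreal (g n x) \<partial>M)"
  using i by (intro nn_integral_liminf) auto
 also have "... \<le> liminf (\<lambda>n. ennreal (C n))"
 proof (intro Liminf_mono always_eventually allI)
  fix n
  show "(\<integral>\<^sup>+x. ennreal (g n x) \<partial>M) \<le> ennreal (C n)"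
   using i nn C by (subst nn_integral_eq_integral) (auto intro: ennreal_leI)
 qed
 also have "... = ennreal L" using C(2) by (intro lim_imp_Liminf tendsto_ennrealI) auto
 finally have le: "(\<integral>\<^sup>+x. ennreal (f x) \<partial>M) \<le> ennreal L" .
 show "integrable M f"
  using le f fn by (intro integrableI_nn_integral_finite[of _ _ "enn2real (\<integral>\<^sup>+x. ennreal (f x) \<partial>M)"])
    (auto simp: ennreal_enn2real_if top_unique)
 show "(LINT x|M. f x) \<le> L" using le L0 by (intro integral_real_bounded) auto
qed

text \<open>Convergence of single modes passes through finite sums. Cutting the convolution in q
  produces one, with an error of order 1/Q controlled by \<open>l1 2\<close>.\<close>

definition flux_trunc :: "nat => (int => complex) => (int => complex) => int => complex" where
 "flux_trunc Q x y k = (\<Sum>q\<in>{- int Q..int Q}. x (k - q) * cmult y q)"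

lemma flux_trunc_error:
 assumes x: "ell 0 x" and y: "ell 2 y" and Q: "Q > 0"
 shows "norm (flux x y k - flux_trunc Q x y k) \<le> l1 0 x * l1 2 y / real Q"
proof -
 have y1: "ell 1 y" using y ell_mono by auto
 have fin: "flux_trunc Q x y k = (LINT q|ZM. (if q \<in> {- int Q..int Q} then x (k - q) * cmult y q else 0))"
  unfolding flux_trunc_def by (subst integral_ZM_finite[of "{- int Q..int Q}"]) (auto intro!: sum.cong)
 have fi: "integrable ZM (\<lambda>q. if q \<in> {- int Q..int Q} then x (k - q) * cmult y q else 0)"
  by (rule integrable_ZM_finite[of "{- int Q..int Q}"]) auto
 note i = integrable_flux_summand[OF x y1, of k]
 have "norm (flux x y k - flux_trunc Q x y k) = norm (LINT q|ZM. x (k - q) * cmult y q - (if q \<in> {- int Q..int Q} then x (k - q) * cmult y q else 0))"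
  unfolding fin flux_def conv_def using i fi by simp
 also have "... \<le> (LINT q|ZM. norm (x (k - q) * cmult y q - (if q \<in> {- int Q..int Q} then x (k - q) * cmult y q else 0)))"
  by (rule integral_norm_bound)
 also have "... \<le> (LINT q|ZM. l1 0 x / real Q * (mag q^2 * norm (y q)))"
 proof (rule integral_mono)
  show "integrable ZM (\<lambda>q. norm (x (k - q) * cmult y q - (if q \<in> {- int Q..int Q} then x (k - q) * cmult y q else 0)))"
   using i fi by (intro integrable_norm B_int_diff)
  show "integrable ZM (\<lambda>q. l1 0 x / real Q * (mag q^2 * norm (y q)))"
   using y by (intro integrable_mult_right) (simp add: ell_def)
  fix q
  show "norm (x (k - q) * cmult y q - (if q \<in> {- int Q..int Q} then x (k - q) * cmult y q else 0)) \<le> l1 0 x / real Q * (mag q^2 * norm (y q))"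
  proof (cases "q \<in> {- int Q..int Q}")
   case False
   then have "int Q \<le> \<bar>q\<bar>" by auto
   then have "real Q \<le> mag q" by linarith
   then have "real Q * mag q \<le> mag q ^ 2" unfolding power2_eq_square by (intro mult_right_mono) auto
   then have "mag q \<le> mag q ^ 2 / real Q" using Q by (simp add: field_simps)
   then have "norm (x (k - q)) * (mag q * norm (y q)) \<le> l1 0 x * (mag q ^ 2 / real Q * norm (y q))"
    using norm_le_l1_0[OF x, of "k - q"] by (intro mult_mono mult_right_mono) auto
   then show ?thesis using False by (simp add: norm_mult cmult_def)
  qed simp
 qed
 also have "... = l1 0 x * l1 2 y / real Q" by (simp add: l1_def)
 finally show ?thesis .
qed

lemma l1_1_interpol:
 assumes y: "ell 2 y" and \<eta>: "\<eta> > 0"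
 shows "l1 1 y \<le> l1 0 y / \<eta> + \<eta> * l1 2 y"
proof -
 have i: "ell 0 y" "ell 1 y" using y ell_mono by auto
 have "l1 1 y \<le> (LINT k|ZM. 1 / \<eta> * (mag k^0 * norm (y k)) + \<eta> * (mag k^2 * norm (y k)))"
  unfolding l1_def
 proof (rule integral_mono)
  fix k
  have "0 \<le> (mag k * \<eta> - 1)^2" by simp
  then have "2 * mag k * \<eta> \<le> 1 + (mag k * \<eta>)^2" by (simp add: power2_diff)
  moreover have "mag k * \<eta> \<ge> 0" using \<eta> by simp
  ultimately have "mag k * \<eta> \<le> 1 + (mag k * \<eta>)^2" by linarith
  then have "mag k \<le> 1 / \<eta> + \<eta> * mag k^2" using \<eta> by (simp add: field_simps power2_eq_square)
  from mult_right_mono[OF this, of "norm (y k)"]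
  show "mag k ^ 1 * norm (y k) \<le> 1 / \<eta> * (mag k^0 * norm (y k)) + \<eta> * (mag k^2 * norm (y k))"
   by (simp add: algebra_simps)
 qed (use i y in \<open>auto simp: ell_def\<close>)
 also have "... = l1 0 y / \<eta> + \<eta> * l1 2 y"
  using i y by (subst B_itg_add) (auto simp: ell_def l1_def)
 finally show ?thesis .
qed

context film
begin

definition rate :: "bool => int => real" where
 "rate i k = (mag k)^2 * M i * c * E0 + mag k * c * E0 * (E0 + 1)"

lemma rate_nonneg: "rate i k \<ge> 0"
 using pos(1)[of i] pos(5) c_pos by (simp add: rate_def)

lemma norm_pot_le: "(\<And>i. ell 0 (w i)) ==> norm (pot i w k) \<le> c * en 0 w"
 by (rule order_trans[OF norm_le_l1_0[OF ell_pot(1)] l1_pot_le])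

text \<open>The time integral of \<open>en 2\<close> is bounded but not known to be uniformly small
  on short intervals. Interpolation of \<open>en 1\<close> puts a small factor \<open>\<eta>\<close>
  in front of it, at the price of 1/\<eta> in front of a constant, which a short interval
  compensates. This is the source of equicontinuity of each mode.\<close>

lemma rhs_bound:
 assumes w: "\<And>i. ell 2 (w i)" and E: "en 0 w \<le> E0" and \<eta>: "\<eta> > 0"
 shows "norm (rhs w i k) \<le> rate i k * (1 + 1 / \<eta> + \<eta> * en 2 w)"
proof -
 have w0: "\<And>i. ell 0 (w i)" and w1: "\<And>i. ell 1 (w i)" using w ell_mono[of 2] by auto
 have p: "norm (pot i w k) \<le> c * E0" using norm_pot_le[of w, OF w0, of i k] mult_left_mono[OF E, of c] c_pos by linarith
 have "en 1 w \<le> en 0 w / \<eta> + \<eta> * en 2 w"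
  using l1_1_interpol[OF w \<eta>, of True] l1_1_interpol[OF w \<eta>, of False] by (simp add: en_def add_divide_distrib distrib_left)
 also have "... \<le> E0 / \<eta> + \<eta> * en 2 w" using E \<eta> by (simp add: divide_right_mono)
 finally have e1: "en 1 w \<le> E0 / \<eta> + \<eta> * en 2 w" .
 have "norm (flux (w i) (pot i w) k) \<le> l1 0 (w i) * l1 1 (pot i w)" by (rule norm_flux_le[OF w0 ell_pot(1)[OF w1]])
 also have "... \<le> E0 * (c * (E0 / \<eta> + \<eta> * en 2 w))"
 proof (rule mult_mono)
  show "l1 0 (w i) \<le> E0" using l1_le_en[of 0 w i] E by linarith
  show "l1 1 (pot i w) \<le> c * (E0 / \<eta> + \<eta> * en 2 w)"
   using l1_pot_le[of 1 w i, OF w1] mult_left_mono[OF e1, of c] c_pos by linarith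
 qed (use pos(5) in auto)
 also have "... \<le> E0 * (c * ((E0 + 1) * (1 / \<eta> + \<eta> * en 2 w)))"
 proof -
  have "0 \<le> E0 * (\<eta> * en 2 w)" "0 \<le> 1 / \<eta>" using pos(5) \<eta> by auto
  moreover have "(E0 + 1) * (1 / \<eta> + \<eta> * en 2 w) = E0 / \<eta> + \<eta> * en 2 w + (E0 * (\<eta> * en 2 w) + 1 / \<eta>)"
   by (simp add: distrib_left distrib_right add_divide_distrib)
  ultimately have "E0 / \<eta> + \<eta> * en 2 w \<le> (E0 + 1) * (1 / \<eta> + \<eta> * en 2 w)" by linarith
  then show ?thesis using pos(5) c_pos by (intro mult_left_mono) auto
 qed
 finally have f: "norm (flux (w i) (pot i w) k) \<le> c * E0 * (E0 + 1) * (1 / \<eta> + \<eta> * en 2 w)" by (simp add: mult_ac)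
 have "norm (rhs w i k) \<le> mag k * (mag k * M i * norm (pot i w k) + norm (flux (w i) (pot i w) k))"
  unfolding rhs_def norm_mult norm_minus_cancel
  using pos(1)[of i] by (auto intro!: mult_left_mono order_trans[OF norm_triangle_ineq] simp: norm_mult)
 also have "... \<le> mag k * (mag k * M i * (c * E0) + c * E0 * (E0 + 1) * (1 / \<eta> + \<eta> * en 2 w))"
  using p f pos(1)[of i] by (intro mult_left_mono add_mono) auto
 also have "... \<le> rate i k * (1 + 1 / \<eta> + \<eta> * en 2 w)"
 proof -
  let ?Y = "1 / \<eta> + \<eta> * en 2 w" 
  have Y: "?Y \<ge> 0" using \<eta> by auto
  have "rate i k * (1 + ?Y) = ((mag k)^2 * M i * c * E0) + mag k * c * E0 * (E0 + 1) * ?Y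
   + ((mag k)^2 * M i * c * E0 * ?Y + mag k * c * E0 * (E0 + 1))"
   by (simp add: rate_def algebra_simps)
  moreover have "0 \<le> (mag k)^2 * M i * c * E0 * ?Y + mag k * c * E0 * (E0 + 1)"
   using mult_nonneg_nonneg[OF _ Y, of "(mag k)^2 * M i * c * E0"] pos(1)[of i] pos(5) c_pos by simp
  moreover have "mag k * (mag k * M i * (c * E0) + c * E0 * (E0 + 1) * ?Y)
    = ((mag k)^2 * M i * c * E0) + mag k * c * E0 * (E0 + 1) * ?Y"
   by (simp add: algebra_simps power2_eq_square)
  ultimately show ?thesis by (simp add: add.assoc)
 qed
 finally show ?thesis .
qed

end

section \<open>Euler iterates: uniform bounds and a convergent subsequence\<close>

locale film_data = film +
 fixes u :: "bool => int => complex"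
 assumes u: "\<And>i. integrable ZM (u i)" "\<And>i. hermitian (u i)" "\<And>i. u i 0 = 0" "en 0 u \<le> E0"
begin

text \<open>The sum dominates both stability constants, and the cube dominates n^2, so the step is
  stable on |k| \<le> n; the cube also sends the step to 0.\<close>

definition \<tau> :: "nat => real" where
 "\<tau> n = 1 / ((1 + (\<Sum>i\<in>UNIV. M i * (\<alpha> i + \<beta> i))) * real (Suc n) ^ 3)"

definition init :: "nat => bool => int => complex" where
 "init n i k = (if \<bar>k\<bar> \<le> int n then u i k else 0)"

definition iter :: "nat => nat => bool => int => complex" where
 "iter n j = (euler n (\<tau> n) ^^ j) (init n)"

definition W :: "nat => real => bool => int => complex" where
 "W n t = iter n (nat \<lfloor>t / \<tau> n\<rfloor>)"

lemma stab_pos: "(\<Sum>i\<in>UNIV. M i * (\<alpha> i + \<beta> i)) > 0" 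
proof (rule sum_pos)
 fix i :: bool
 show "0 < M i * (\<alpha> i + \<beta> i)" using pos(1)[of i] pos(2)[of i] pos(3)[of i] by simp
qed auto

lemma tau_pos: "\<tau> n > 0"
 using stab_pos by (simp add: \<tau>_def)

lemma tau_stable: "\<tau> n * (real n)^2 * (M i * (\<alpha> i + \<beta> i)) \<le> 1"
proof -
 let ?L = "\<Sum>i\<in>UNIV. M i * (\<alpha> i + \<beta> i)"
 have "M i * (\<alpha> i + \<beta> i) \<le> ?L" 
 proof (rule member_le_sum)
  fix j :: bool
  show "0 \<le> M j * (\<alpha> j + \<beta> j)" using pos(1)[of j] pos(2)[of j] pos(3)[of j] by simp
 qed auto
 then have "(real n)^2 * (M i * (\<alpha> i + \<beta> i)) \<le> real (Suc n)^3 * (1 + ?L)"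
 proof (intro mult_mono)
  have "(real n)^2 \<le> real (Suc n) ^ 2" by (intro power_mono) auto
  also have "... \<le> real (Suc n) ^ 3" by (intro power_increasing) auto
  finally show "(real n)^2 \<le> real (Suc n) ^ 3" .
 qed (use pos(1-3)[of i] in \<open>auto intro!: mult_nonneg_nonneg add_nonneg_nonneg\<close>)
 moreover have "0 < real (Suc n)^3 * (1 + ?L)" using stab_pos by (intro mult_pos_pos) auto
 ultimately have "(real n)^2 * (M i * (\<alpha> i + \<beta> i)) / (real (Suc n)^3 * (1 + ?L)) \<le> 1" by (simp only: divide_le_eq_1_pos)
 then show ?thesis by (simp only: \<tau>_def mult.commute[of "1 + ?L"] times_divide_eq_left mult_1 mult.assoc)
qed

lemma tau_tendsto: "\<tau> \<longlonglongrightarrow> 0"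
proof (rule tendsto_sandwich[where f = "\<lambda>_. 0" and h = "\<lambda>n. 1 / real (Suc n)"])
 have "\<tau> n \<le> 1 / real (Suc n)" for n
 proof -
  have "real (Suc n) ^ 1 \<le> real (Suc n) ^ 3" by (intro power_increasing) auto
  then have "1 * real (Suc n) \<le> (1 + (\<Sum>i\<in>UNIV. M i * (\<alpha> i + \<beta> i))) * real (Suc n) ^ 3"
   using stab_pos by (intro mult_mono) auto
  then show ?thesis unfolding \<tau>_def by (intro divide_left_mono) (use stab_pos in auto)
 qed
 then show "\<forall>\<^sub>F n in sequentially. \<tau> n \<le> 1 / real (Suc n)" by auto
 show "(\<lambda>n. 1 / real (Suc n)) \<longlonglongrightarrow> 0" using LIMSEQ_inverse_real_of_nat by (simp add: inverse_eq_divide)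
qed (use tau_pos in \<open>auto intro!: always_eventually less_imp_le\<close>)

lemma supported_init: "supported n (init n)"
 using u by (auto simp: supported_def init_def hermitian_def)

lemma supported_iter: "supported n (iter n j)"
 by (induction j) (auto simp: iter_def supported_init supported_euler)

lemma ell_u: "ell 0 (u i)" using u(1) by (simp add: ell_0_iff)

lemma en_init: "en 0 (init n) \<le> E0"
proof -
 have "l1 0 (init n i) \<le> l1 0 (u i)" for i
  unfolding l1_def using supported_ell[OF supported_init, of 0] ell_u
  by (intro integral_mono) (auto simp: ell_def init_def)
 from add_mono[OF this[of True] this[of False]] show ?thesis using u(4) by (simp add: en_def)
qed

lemma iter_Suc: "iter n (Suc j) = euler n (\<tau> n) (iter n j)"
 by (simp add: iter_def)

text \<open>The discrete energy estimate telescopes. The induction hypothesis also provides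
  \<open>en 0\<close> below E0, under which the next step dissipates.\<close>

lemma iter_energy: "en 0 (iter n j) + \<tau> n * \<delta> * (\<Sum>l<j. en 2 (iter n l)) \<le> E0"
proof (induction j)
 case 0
 then show ?case using en_init by (simp add: iter_def)
next
 case (Suc j)
 have "0 \<le> \<tau> n * \<delta> * (\<Sum>l<j. en 2 (iter n l))" using tau_pos[of n] pos(4) by (auto intro!: sum_nonneg mult_nonneg_nonneg)
 then have "en 0 (iter n j) \<le> E0" using Suc by linarith
 from euler_energy[OF supported_iter tau_pos tau_stable this] Suc show ?case
  by (simp add: iter_Suc algebra_simps)
qed

lemma iter_le: "en 0 (iter n j) \<le> E0"
proof -
 have "0 \<le> \<tau> n * \<delta> * (\<Sum>l<j. en 2 (iter n l))" using tau_pos[of n] pos(4) by (auto intro!: sum_nonneg mult_nonneg_nonneg)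
 then show ?thesis using iter_energy[of n j] by linarith
qed

lemma iter_sum_le: "(\<Sum>l\<in>{a..<b}. \<tau> n * en 2 (iter n l)) \<le> E0 / \<delta>"
proof -
 have "(\<Sum>l\<in>{a..<b}. \<tau> n * en 2 (iter n l)) \<le> (\<Sum>l<b. \<tau> n * en 2 (iter n l))"
  using tau_pos[of n] by (intro sum_mono2) auto
 also have "... = (\<tau> n * \<delta> * (\<Sum>l<b. en 2 (iter n l))) / \<delta>" using pos(4) by (simp flip: sum_distrib_left)
 also have "... \<le> E0 / \<delta>"
 proof (rule divide_right_mono)
  show "\<tau> n * \<delta> * (\<Sum>l<b. en 2 (iter n l)) \<le> E0" using iter_energy[of n b] en_nonneg[of 0 "iter n b"] by linarith
 qed (use pos(4) in auto)
 finally show ?thesis .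
qed

text \<open>Each step contracts by 1 - \<delta> \<tau>, which is at most exp (-\<delta> \<tau>); the
  product over j steps is the exponential in the elapsed time.\<close>

lemma iter_decay: "en 0 (iter n j) \<le> E0 * exp (- \<delta> * (\<tau> n * real j))"
proof (induction j)
 case 0
 then show ?case using iter_le[of n 0] by simp
next
 case (Suc j)
 have "en 0 (iter n j) \<le> en 2 (iter n j)"
  using supported_iter[of n j] by (intro en_mono supported_ell) (auto simp: supported_def)
 then have "\<tau> n * \<delta> * en 0 (iter n j) \<le> \<tau> n * \<delta> * en 2 (iter n j)" using tau_pos[of n] pos(4) by (intro mult_left_mono) auto
 then have "en 0 (iter n (Suc j)) \<le> (1 + - \<delta> * \<tau> n) * en 0 (iter n j)"
  using euler_energy[OF supported_iter tau_pos tau_stable iter_le, of n j] by (simp add: iter_Suc algebra_simps)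
 also have "... \<le> exp (- \<delta> * \<tau> n) * en 0 (iter n j)"
  using exp_ge_add_one_self[of "- \<delta> * \<tau> n"] by (intro mult_right_mono) auto
 also have "... \<le> exp (- \<delta> * \<tau> n) * (E0 * exp (- \<delta> * (\<tau> n * real j)))" using Suc by (intro mult_left_mono) auto
 also have "... = E0 * exp (- \<delta> * (\<tau> n * real (Suc j)))" by (simp add: exp_add[symmetric] algebra_simps)
 finally show ?case .
qed

lemma iter_diff: 
 assumes "a \<le> b"
 shows "iter n b i k - iter n a i k = (if \<bar>k\<bar> \<le> int n then \<Sum>l\<in>{a..<b}. of_real (\<tau> n) * rhs (iter n l) i k else 0)"
 using assms
proof (induction b rule: dec_induct)
 case (step b)
 have "iter n (Suc b) i k - iter n a i k = (iter n (Suc b) i k - iter n b i k) + (iter n b i k - iter n a i k)" by simp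
 also have "iter n (Suc b) i k - iter n b i k = (if \<bar>k\<bar> \<le> int n then of_real (\<tau> n) * rhs (iter n b) i k else 0)"
  using supported_iter[of n b] by (auto simp: iter_Suc euler_def supported_def)
 finally show ?case using step by simp
qed simp

lemma iter_increment:
 assumes "a \<le> b" "\<eta> > 0"
 shows "norm (iter n b i k - iter n a i k) \<le> rate i k * (real (b - a) * \<tau> n * (1 + 1 / \<eta>) + \<eta> * (E0 / \<delta>))"
proof -
 have "norm (iter n b i k - iter n a i k) \<le> (\<Sum>l\<in>{a..<b}. \<tau> n * norm (rhs (iter n l) i k))"
  unfolding iter_diff[OF assms(1)] using tau_pos[of n]
  by (auto intro!: sum_nonneg order_trans[OF norm_sum] simp: norm_mult)
 also have "... \<le> (\<Sum>l\<in>{a..<b}. \<tau> n * (rate i k * (1 + 1 / \<eta> + \<eta> * en 2 (iter n l))))"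
  using tau_pos[of n] rhs_bound[OF supported_ell[OF supported_iter] iter_le assms(2)] by (intro sum_mono mult_left_mono) auto
 also have "... = rate i k * (real (b - a) * \<tau> n * (1 + 1 / \<eta>) + \<eta> * (\<Sum>l\<in>{a..<b}. \<tau> n * en 2 (iter n l)))"
  by (simp add: sum_distrib_left sum.distrib algebra_simps)
 also have "... \<le> rate i k * (real (b - a) * \<tau> n * (1 + 1 / \<eta>) + \<eta> * (E0 / \<delta>))"
  using iter_sum_le[of n a b] assms(2) rate_nonneg by (intro mult_left_mono add_left_mono) auto
 finally show ?thesis .
qed

text \<open>Rounding to whole steps costs at most one step, hence the extra \<open>\<tau> n\<close>:
  the piecewise constant interpolants are equicontinuous only asymptotically.\<close>

lemma W_increment:
 assumes "0 \<le> s" "s \<le> t" "\<eta> > 0"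
 shows "norm (W n t i k - W n s i k) \<le> rate i k * ((t - s + \<tau> n) * (1 + 1 / \<eta>) + \<eta> * (E0 / \<delta>))"
proof -
 let ?a = "nat \<lfloor>s / \<tau> n\<rfloor>" and ?b = "nat \<lfloor>t / \<tau> n\<rfloor>"
 have sn: "0 \<le> s / \<tau> n" "s / \<tau> n \<le> t / \<tau> n" using assms tau_pos[of n] by (auto intro: divide_right_mono)
 have ab: "?a \<le> ?b" using sn by (intro nat_mono floor_mono)
 have "real (?b - ?a) = real_of_int \<lfloor>t / \<tau> n\<rfloor> - real_of_int \<lfloor>s / \<tau> n\<rfloor>" using ab sn by (simp add: of_nat_diff)
 also have "... \<le> t / \<tau> n - s / \<tau> n + 1" by linarith
 finally have "real (?b - ?a) * \<tau> n \<le> (t / \<tau> n - s / \<tau> n + 1) * \<tau> n" using tau_pos[of n] by (intro mult_right_mono) auto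
 also have "... = t - s + \<tau> n" using tau_pos[of n] by (simp add: field_simps)
 finally have le: "real (?b - ?a) * \<tau> n \<le> t - s + \<tau> n" .
 have "norm (W n t i k - W n s i k) \<le> rate i k * (real (?b - ?a) * \<tau> n * (1 + 1 / \<eta>) + \<eta> * (E0 / \<delta>))"
  unfolding W_def by (rule iter_increment[OF ab assms(3)])
 also have "... \<le> rate i k * ((t - s + \<tau> n) * (1 + 1 / \<eta>) + \<eta> * (E0 / \<delta>))"
  using le rate_nonneg assms(3) by (intro mult_left_mono add_right_mono mult_right_mono) auto
 finally show ?thesis .
qed

lemma W_bound: "norm (W n t i k) \<le> E0"
proof -
 have "norm (W n t i k) \<le> l1 0 (W n t i)" unfolding W_def by (intro norm_le_l1_0 supported_ell[OF supported_iter])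
 also have "... \<le> en 0 (W n t)" by (rule l1_le_en)
 also have "... \<le> E0" unfolding W_def by (rule iter_le)
 finally show ?thesis .
qed

text \<open>The order of choice matters: \<open>\<eta>\<close> is taken small against E0 / \<delta>,
  and \<open>\<rho>\<close> afterwards small against 1 + 1/\<eta>.\<close>

lemma small_modulus:
 assumes "\<epsilon> > 0"
 obtains \<rho> where "\<rho> > 0" "\<And>h. 0 \<le> h ==> h \<le> \<rho> ==> \<exists>\<eta>>0. rate i k * (h * (1 + 1 / \<eta>) + \<eta> * (E0 / \<delta>)) < \<epsilon>"
proof -
 \<comment> \<open>The rate vanishes at k = 0; adding 1 allows division by it.\<close>
 define R where "R = rate i k + 1"
 have R: "R > 0" "rate i k \<le> R" using rate_nonneg[of i k] by (auto simp: R_def)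
 define \<eta> where "\<eta> = \<epsilon> / (4 * R * (E0 / \<delta> + 1))"
 have ED: "E0 / \<delta> \<ge> 0" using pos by auto
 have \<eta>: "\<eta> > 0" using assms R ED by (auto simp: \<eta>_def intro!: divide_pos_pos mult_pos_pos)
 define \<rho> where "\<rho> = \<epsilon> / (4 * R * (1 + 1 / \<eta>))"
 have e1: "1 + 1 / \<eta> > 0" using \<eta> by (simp add: add_pos_pos)
 show thesis
 proof (rule that[of \<rho>])
  show "\<rho> > 0" using assms R e1 by (auto simp: \<rho>_def)
  fix h assume h: "0 \<le> h" "h \<le> \<rho>"
  have "rate i k * (h * (1 + 1 / \<eta>) + \<eta> * (E0 / \<delta>)) \<le> R * (\<rho> * (1 + 1 / \<eta>) + \<eta> * (E0 / \<delta> + 1))"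
   using R h \<eta> e1 ED rate_nonneg[of i k] by (intro mult_mono add_mono mult_right_mono mult_left_mono add_nonneg_nonneg mult_nonneg_nonneg) auto
  also have "... = R * (\<rho> * (1 + 1 / \<eta>)) + R * (\<eta> * (E0 / \<delta> + 1))" by (simp add: distrib_left)
  also have "R * (\<rho> * (1 + 1 / \<eta>)) = \<epsilon> / 4" using R e1 by (simp add: \<rho>_def)
  also have "R * (\<eta> * (E0 / \<delta> + 1)) = \<epsilon> / 4" 
  proof -
   have "E0 / \<delta> + 1 \<noteq> 0" using ED by linarith
   then show ?thesis using R unfolding \<eta>_def by (simp del: add_divide_eq_iff divide_add_eq_iff)
  qed
  also have "\<epsilon> / 4 + \<epsilon> / 4 < \<epsilon>" using assms by simp
  finally have "rate i k * (h * (1 + 1 / \<eta>) + \<eta> * (E0 / \<delta>)) < \<epsilon>" .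
  then show "\<exists>\<eta>>0. rate i k * (h * (1 + 1 / \<eta>) + \<eta> * (E0 / \<delta>)) < \<epsilon>" using \<eta> by blast
 qed
qed

text \<open>A diagonal argument handles the countably many triples with rational time, and
  asymptotic equicontinuity carries the Cauchy property over to every nonnegative time.\<close>

lemma subsequence:
 obtains \<phi> where "strict_mono \<phi>" "\<And>t i k. t \<ge> 0 ==> convergent (\<lambda>n. W (\<phi> n) t i k)"
proof -
 define S where "S = {(q, i, k) | (q::real) (i::bool) (k::int). q \<in> \<rat>}"
 have "countable S"
 proof -
  have "S = \<rat> \<times> UNIV" by (auto simp: S_def)
  then show ?thesis by (simp add: countable_rat)
 qed
 then obtain \<phi> where \<phi>: "strict_mono \<phi>" "\<And>x. x \<in> S ==> \<exists>l. (\<lambda>n. (\<lambda>(t, i, k). W (\<phi> n) t i k) x) \<longlonglongrightarrow> l"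
  by (rule function_convergent_subsequence[where f = "\<lambda>n (t, i, k). W n t i k" and M = E0]) (auto simp: W_bound)
 have rat: "Cauchy (\<lambda>n. W (\<phi> n) q i k)" if "q \<in> \<rat>" for q i k
  using \<phi>(2)[of "(q, i, k)"] that by (intro convergent_Cauchy) (auto simp: S_def convergent_def)
 have "Cauchy (\<lambda>n. W (\<phi> n) t i k)" if t: "t \<ge> 0" for t i k
  unfolding Cauchy_iff
 proof (intro allI impI)
  fix e :: real assume e: "e > 0"
  obtain \<rho> where \<rho>: "\<rho> > 0" "\<And>h. 0 \<le> h ==> h \<le> \<rho> ==> \<exists>\<eta>>0. rate i k * (h * (1 + 1 / \<eta>) + \<eta> * (E0 / \<delta>)) < e / 3"
   using small_modulus[of "e / 3" i k] e by auto
  \<comment> \<open>Taken to the right of t, so that it is nonnegative and the increment estimate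
    applies from t to q.\<close>
  obtain q where q: "q \<in> \<rat>" "t < q" "q < t + \<rho> / 2" using Rats_dense_in_real[of t "t + \<rho> / 2"] \<rho>(1) by auto
  have "eventually (\<lambda>n. \<tau> n < \<rho> / 2) sequentially" using tau_tendsto \<rho>(1) by (intro order_tendstoD(2)) auto
  then obtain N1 where N1: "\<And>n. n \<ge> N1 ==> \<tau> n < \<rho> / 2" by (auto simp: eventually_sequentially)
  obtain N2 where N2: "\<And>m n. m \<ge> N2 ==> n \<ge> N2 ==> norm (W (\<phi> m) q i k - W (\<phi> n) q i k) < e / 3"
   using rat[OF q(1), of i k] e unfolding Cauchy_iff by (meson divide_pos_pos zero_less_numeral)
  have close: "norm (W (\<phi> n) q i k - W (\<phi> n) t i k) < e / 3" if "n \<ge> N1" for n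
  proof -
   have "\<phi> n \<ge> N1" using seq_suble[OF \<phi>(1), of n] that by linarith
   then have "q - t + \<tau> (\<phi> n) \<le> \<rho>" using N1[of "\<phi> n"] q by auto
   then obtain \<eta> where "\<eta> > 0" "rate i k * ((q - t + \<tau> (\<phi> n)) * (1 + 1 / \<eta>) + \<eta> * (E0 / \<delta>)) < e / 3"
    using \<rho>(2)[of "q - t + \<tau> (\<phi> n)"] q tau_pos[of "\<phi> n"] by auto
   then show ?thesis using W_increment[OF t, of q \<eta> "\<phi> n" i k] q by (meson less_imp_le order.strict_trans1)
  qed
  show "\<exists>N. \<forall>m\<ge>N. \<forall>n\<ge>N. norm (W (\<phi> m) t i k - W (\<phi> n) t i k) < e"
  proof (intro exI[of _ "max N1 N2"] allI impI)
   fix m n assume mn: "max N1 N2 \<le> m" "max N1 N2 \<le> n"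
   have eq: "W (\<phi> m) t i k - W (\<phi> n) t i k = - (W (\<phi> m) q i k - W (\<phi> m) t i k) + (W (\<phi> m) q i k - W (\<phi> n) q i k) + (W (\<phi> n) q i k - W (\<phi> n) t i k)" by simp
   have "norm (W (\<phi> m) t i k - W (\<phi> n) t i k) \<le> norm (W (\<phi> m) q i k - W (\<phi> m) t i k) + norm (W (\<phi> m) q i k - W (\<phi> n) q i k) + norm (W (\<phi> n) q i k - W (\<phi> n) t i k)"
    unfolding eq using norm_triangle_ineq[of "- (W (\<phi> m) q i k - W (\<phi> m) t i k) + (W (\<phi> m) q i k - W (\<phi> n) q i k)" "W (\<phi> n) q i k - W (\<phi> n) t i k"] norm_triangle_ineq[of "- (W (\<phi> m) q i k - W (\<phi> m) t i k)" "W (\<phi> m) q i k - W (\<phi> n) q i k"] unfolding norm_minus_cancel by linarith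
   also have "... < e" using close[of m] close[of n] N2[of m n] mn by auto
   finally show "norm (W (\<phi> m) t i k - W (\<phi> n) t i k) < e" .
  qed
 qed
 then have "convergent (\<lambda>n. W (\<phi> n) t i k)" if "t \<ge> 0" for t i k using that Cauchy_convergent by blast
 then show thesis using that \<phi>(1) by blast
qed

definition \<phi> :: "nat => nat" where
 "\<phi> = (SOME \<phi>. strict_mono \<phi> \<and> (\<forall>t i k. t \<ge> 0 \<longrightarrow> convergent (\<lambda>n. W (\<phi> n) t i k)))"

lemma phi: "strict_mono \<phi>" "t \<ge> 0 ==> convergent (\<lambda>n. W (\<phi> n) t i k)"
proof -
 have "\<exists>\<phi>. strict_mono \<phi> \<and> (\<forall>t i k. t \<ge> 0 \<longrightarrow> convergent (\<lambda>n. W (\<phi> n) t i k))" using subsequence by metis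
 from someI_ex[OF this] show "strict_mono \<phi>" "t \<ge> 0 ==> convergent (\<lambda>n. W (\<phi> n) t i k)"
  unfolding \<phi>_def by blast+
qed

text \<open>The clamp at 0 continues the limit constantly to negative times, so that continuity and
  measurability hold on the whole line.\<close>

definition w :: "real => bool => int => complex" where
 "w t i k = lim (\<lambda>n. W (\<phi> n) (max 0 t) i k)"

lemma W_tendsto: "t \<ge> 0 ==> (\<lambda>n. W (\<phi> n) t i k) \<longlonglongrightarrow> w t i k"
 using phi(2)[of t i k] by (simp add: w_def convergent_LIMSEQ_iff)

lemma tau_phi_tendsto: "(\<lambda>n. \<tau> (\<phi> n)) \<longlonglongrightarrow> 0"
 using LIMSEQ_subseq_LIMSEQ[OF tau_tendsto phi(1)] by (simp add: comp_def)

end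

section \<open>The limit equation\<close>

lemma measurable_integral_ZM:
 fixes f :: "int => 'a => 'b::{banach, second_countable_topology}"
 assumes "\<And>k. f k \<in> borel_measurable N"
 shows "(\<lambda>t. LINT k|ZM. f k t) \<in> borel_measurable N"
 using sigma_finite_measure.borel_measurable_lebesgue_integral[OF sigma_finite_ZM, of "\<lambda>t k. f k t" N] measurable_pair_ZM[OF assms]
 by simp

lemma measurable_l1:
 assumes "\<And>k. (\<lambda>t. x t k) \<in> borel_measurable N"
 shows "(\<lambda>t. l1 s (x t)) \<in> borel_measurable N"
 unfolding l1_def using assms by (intro measurable_integral_ZM) auto

lemma measurable_flux:
 assumes "\<And>k. (\<lambda>t. x t k) \<in> borel_measurable N" "\<And>k. (\<lambda>t. y t k) \<in> borel_measurable N"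
 shows "(\<lambda>t. flux (x t) (y t) k) \<in> borel_measurable N"
 unfolding flux_def conv_def cmult_def using assms by (intro measurable_integral_ZM) auto

text \<open>Rewrites an Euler sum as a time integral of a piecewise constant function; the indicator
  removes the last, incomplete step.\<close>

lemma step_function_integral:
 fixes r :: "nat => 'b::{banach, second_countable_topology}"
 assumes \<tau>: "\<tau> > 0" and J: "real J * \<tau> \<le> t"
 shows "integrable (leb 0 t) (\<lambda>s. indicator {..<real J * \<tau>} s *\<^sub>R r (nat \<lfloor>s / \<tau>\<rfloor>))"
  and "(LINT s|leb 0 t. indicator {..<real J * \<tau>} s *\<^sub>R r (nat \<lfloor>s / \<tau>\<rfloor>)) = (\<Sum>l<J. \<tau> *\<^sub>R r l)"
proof -
 let ?A = "\<lambda>l. {real l * \<tau>..<real (Suc l) * \<tau>}"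
 have eq: "indicator {..<real J * \<tau>} s *\<^sub>R r (nat \<lfloor>s / \<tau>\<rfloor>) = (\<Sum>l<J. indicator (?A l) s *\<^sub>R r l)" if s: "s \<ge> 0" for s
 proof -
  define m where "m = nat \<lfloor>s / \<tau>\<rfloor>"
  have sm: "s \<in> ?A l \<longleftrightarrow> l = m" for l
  proof -
   have "s \<in> ?A l \<longleftrightarrow> real l \<le> s / \<tau> \<and> s / \<tau> < real l + 1" using \<tau> by (auto simp: field_simps)
   also have "... \<longleftrightarrow> \<lfloor>s / \<tau>\<rfloor> = int l" by (auto simp: floor_eq_iff)
   also have "... \<longleftrightarrow> l = m" using s \<tau> by (auto simp: m_def)
   finally show ?thesis .
  qed
  have sJ: "s < real J * \<tau> \<longleftrightarrow> m < J"
  proof -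
   have m: "real m * \<tau> \<le> s" "s < real (Suc m) * \<tau>" using sm[of m] by auto
   show ?thesis
   proof
    assume "s < real J * \<tau>"
    then have "real m * \<tau> < real J * \<tau>" using m by linarith
    then show "m < J" using \<tau> by simp
   next
    assume "m < J"
    then have "real (Suc m) * \<tau> \<le> real J * \<tau>" using \<tau> by (intro mult_right_mono) auto
    then show "s < real J * \<tau>" using m by linarith
   qed
  qed
  have "(\<Sum>l<J. indicator (?A l) s *\<^sub>R r l) = (\<Sum>l<J. if l = m then r l else 0)"
   using sm by (intro sum.cong) (auto simp: indicator_def)
  also have "... = (if m < J then r m else 0)" by simp
  finally show ?thesis using sJ by (simp add: m_def indicator_def)
 qed
 have meas: "?A l \<in> sets (leb 0 t)" "measure (leb 0 t) (?A l) = \<tau>" "emeasure (leb 0 t) (?A l) < \<infinity>" if "l < J" for l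
 proof -
  have "real (Suc l) * \<tau> \<le> real J * \<tau>" using that \<tau> by (intro mult_right_mono) auto
  moreover have "0 \<le> real l * \<tau>" using \<tau> by simp
  ultimately have sub: "?A l \<subseteq> {0..t}" using J by (intro subsetI) (simp only: atLeastLessThan_iff atLeastAtMost_iff, linarith)
  then have "?A l = {0..t} \<inter> ?A l" by auto
  then show A: "?A l \<in> sets (leb 0 t)" by (auto simp: sets_restrict_space)
  have "measure (leb 0 t) (?A l) = measure lebesgue (?A l)" using sub by (intro measure_restrict_space) auto
  then show "measure (leb 0 t) (?A l) = \<tau>" using \<tau> by (simp add: algebra_simps)
  show "emeasure (leb 0 t) (?A l) < \<infinity>" using sub \<tau> by (simp add: emeasure_restrict_space algebra_simps)
 qed
 have i: "integrable (leb 0 t) (\<lambda>s. indicator (?A l) s *\<^sub>R r l)" if "l < J" for l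
  using meas[OF that] by (intro integrable_scaleR_left integrable_real_indicator) auto
 have isum: "integrable (leb 0 t) (\<lambda>s. \<Sum>l<J. indicator (?A l) s *\<^sub>R r l)"
  using i by (intro Bochner_Integration.integrable_sum) auto
 show "integrable (leb 0 t) (\<lambda>s. indicator {..<real J * \<tau>} s *\<^sub>R r (nat \<lfloor>s / \<tau>\<rfloor>))"
  by (subst B_int_cong[OF refl eq]) (use isum in auto)
 have "(LINT s|leb 0 t. indicator {..<real J * \<tau>} s *\<^sub>R r (nat \<lfloor>s / \<tau>\<rfloor>)) = (LINT s|leb 0 t. (\<Sum>l<J. indicator (?A l) s *\<^sub>R r l))"
  by (rule B_itg_cong[OF refl eq]) auto
 also have "... = (\<Sum>l<J. LINT s|leb 0 t. indicator (?A l) s *\<^sub>R r l)"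
  using i by (intro Bochner_Integration.integral_sum) auto
 also have "... = (\<Sum>l<J. \<tau> *\<^sub>R r l)"
 proof (rule sum.cong[OF refl])
  fix l assume "l \<in> {..<J}"
  then have l: "l < J" by simp
  have "(LINT s|leb 0 t. indicator (?A l) s *\<^sub>R r l) = (LINT s|leb 0 t. indicator (?A l) s) *\<^sub>R r l"
   using meas[OF l] by (intro integral_scaleR_left integrable_real_indicator) auto
  also have "(LINT s|leb 0 t. indicator (?A l) s) = \<tau>" using meas[OF l] sets.sets_into_space[OF meas(1)[OF l]]
   by (simp add: Int_absorb2)
  finally show "(LINT s|leb 0 t. indicator (?A l) s *\<^sub>R r l) = \<tau> *\<^sub>R r l" .
 qed
 finally show "(LINT s|leb 0 t. indicator {..<real J * \<tau>} s *\<^sub>R r (nat \<lfloor>s / \<tau>\<rfloor>)) = (\<Sum>l<J. \<tau> *\<^sub>R r l)" .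
qed

context film
begin

lemma en_eq_integral:
 assumes "\<And>i. ell s (w i)"
 shows "integrable ZM (\<lambda>k. mag k^s * (norm (w True k) + norm (w False k)))"
  and "en s w = (LINT k|ZM. mag k^s * (norm (w True k) + norm (w False k)))"
 using assms[of True] assms[of False] by (auto simp: ell_def en_def l1_def distrib_left)

lemma ell_from_sum:
 assumes "integrable ZM (\<lambda>k. mag k^s * (norm (w True k) + norm (w False k)))"
 shows "ell s (w i)"
 unfolding ell_def
 by (rule B_int_bound[OF assms]) (auto intro!: AE_I2 mult_left_mono simp: abs_mult, (cases i; simp)+)

lemma measurable_rhs:
 assumes "\<And>i k. (\<lambda>t. w t i k) \<in> borel_measurable N"
 shows "(\<lambda>t. rhs (w t) i k) \<in> borel_measurable N"
proof -
 have p: "(\<lambda>t. pot i (w t) k) \<in> borel_measurable N" for k using assms unfolding pot_def by measurable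
 show ?thesis unfolding rhs_def using p measurable_flux[OF assms p] by measurable
qed

lemma measurable_en:
 assumes "\<And>i k. (\<lambda>t. w t i k) \<in> borel_measurable N"
 shows "(\<lambda>t. en s (w t)) \<in> borel_measurable N"
 unfolding en_def using assms by (intro borel_measurable_add measurable_l1)

definition rhs_trunc :: "nat => (bool => int => complex) => bool => int => complex" where
 "rhs_trunc Q w i k = - of_int k * (of_int k * of_real (M i) * pot i w k + flux_trunc Q (w i) (pot i w) k)"

lemma rhs_trunc_error:
 assumes w: "\<And>i. ell 2 (w i)" and E: "en 0 w \<le> E0" and Q: "Q > 0"
 shows "norm (rhs w i k - rhs_trunc Q w i k) \<le> mag k * E0 * c / real Q * en 2 w"
proof -
 have w0: "\<And>i. ell 0 (w i)" using w ell_mono by blast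
 have "rhs w i k - rhs_trunc Q w i k = - of_int k * (flux (w i) (pot i w) k - flux_trunc Q (w i) (pot i w) k)"
  by (simp add: rhs_def rhs_trunc_def algebra_simps)
 then have "norm (rhs w i k - rhs_trunc Q w i k) = mag k * norm (flux (w i) (pot i w) k - flux_trunc Q (w i) (pot i w) k)"
  by (simp add: norm_mult)
 also have "... \<le> mag k * (l1 0 (w i) * l1 2 (pot i w) / real Q)"
  by (intro mult_left_mono flux_trunc_error w0 ell_pot w Q) auto
 also have "... \<le> mag k * (E0 * (c * en 2 w) / real Q)"
  using l1_le_en[of 0 w i] E l1_pot_le[of 2 w i, OF w] pos(5) Q by (intro mult_left_mono divide_right_mono mult_mono) auto
 finally show ?thesis by (simp add: mult_ac)
qed

lemma rhs_trunc_bound: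
 assumes w0: "\<And>i. ell 0 (w i)" and E: "en 0 w \<le> E0"
 shows "norm (rhs_trunc Q w i k) \<le> mag k * (mag k * M i * (c * E0) + (\<Sum>q\<in>{- int Q..int Q}. E0 * (mag q * (c * E0))))"
proof -
 have p: "norm (pot i w q) \<le> c * E0" for q using norm_pot_le[of w, OF w0, of i q] mult_left_mono[OF E, of c] c_pos by linarith
 have x: "norm (w i q) \<le> E0" for q using norm_le_l1_0[OF w0, of i q] l1_le_en[of 0 w i] E by linarith
 have f: "norm (flux_trunc Q (w i) (pot i w) k) \<le> (\<Sum>q\<in>{- int Q..int Q}. E0 * (mag q * (c * E0)))"
  unfolding flux_trunc_def cmult_def
 proof (rule sum_norm_le)
  fix q
  show "norm (w i (k - q) * (of_int q * pot i w q)) \<le> E0 * (mag q * (c * E0))"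
   unfolding norm_mult norm_of_int using x p pos(5) by (intro mult_mono mult_left_mono mult_nonneg_nonneg) auto
 qed
 have "norm (rhs_trunc Q w i k) \<le> mag k * (mag k * M i * norm (pot i w k) + norm (flux_trunc Q (w i) (pot i w) k))"
  unfolding rhs_trunc_def norm_mult norm_minus_cancel
  using pos(1)[of i] by (auto intro!: mult_left_mono order_trans[OF norm_triangle_ineq] simp: norm_mult)
 also have "... \<le> mag k * (mag k * M i * (c * E0) + (\<Sum>q\<in>{- int Q..int Q}. E0 * (mag q * (c * E0))))"
  using p f pos(1)[of i] by (intro mult_left_mono add_mono) auto
 finally show ?thesis .
qed

lemma tendsto_rhs_trunc:
 assumes "\<And>i k. (\<lambda>n. x n i k) \<longlonglongrightarrow> w i k"
 shows "(\<lambda>n. rhs_trunc Q (x n) i k) \<longlonglongrightarrow> rhs_trunc Q w i k"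
 unfolding rhs_trunc_def flux_trunc_def cmult_def pot_def
 by (intro tendsto_intros assms)

end

context film_data
begin

lemma en_W_le: "en 0 (W n t) \<le> E0" unfolding W_def by (rule iter_le)

lemma ell_W: "ell s (W n t i)" unfolding W_def by (rule supported_ell[OF supported_iter])

lemma w_increment:
 assumes "0 \<le> s" "s \<le> t" "\<eta> > 0"
 shows "norm (w t i k - w s i k) \<le> rate i k * ((t - s) * (1 + 1 / \<eta>) + \<eta> * (E0 / \<delta>))"
proof (rule LIMSEQ_le)
 show "(\<lambda>n. norm (W (\<phi> n) t i k - W (\<phi> n) s i k)) \<longlonglongrightarrow> norm (w t i k - w s i k)"
  using assms by (intro tendsto_intros W_tendsto) auto
 have "(\<lambda>n. rate i k * ((t - s + \<tau> (\<phi> n)) * (1 + 1 / \<eta>) + \<eta> * (E0 / \<delta>))) \<longlonglongrightarrow> rate i k * ((t - s + 0) * (1 + 1 / \<eta>) + \<eta> * (E0 / \<delta>))"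
  by (intro tendsto_intros tau_phi_tendsto)
 then show "(\<lambda>n. rate i k * ((t - s + \<tau> (\<phi> n)) * (1 + 1 / \<eta>) + \<eta> * (E0 / \<delta>))) \<longlonglongrightarrow> rate i k * ((t - s) * (1 + 1 / \<eta>) + \<eta> * (E0 / \<delta>))" by simp
qed (use W_increment[OF assms] in auto)

lemma w_max: "w (max 0 t) = w t"
 by (intro ext) (simp add: w_def)

lemma continuous_w: "continuous_on UNIV (\<lambda>t. w t i k)"
 unfolding continuous_on_iff
proof (intro ballI allI impI)
 fix t e :: real assume e: "e > 0"
 obtain \<rho> where \<rho>: "\<rho> > 0" "\<And>h. 0 \<le> h ==> h \<le> \<rho> ==> \<exists>\<eta>>0. rate i k * (h * (1 + 1 / \<eta>) + \<eta> * (E0 / \<delta>)) < e"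
  using small_modulus[OF e] by metis
 have *: "norm (w b i k - w a i k) < e" if "0 \<le> a" "a \<le> b" "b - a \<le> \<rho>" for a b
  using \<rho>(2)[of "b - a"] w_increment[OF that(1,2), of _ i k] that by (meson diff_ge_0_iff_ge order.strict_trans1)
 show "\<exists>d>0. \<forall>s\<in>UNIV. dist s t < d \<longrightarrow> dist (w s i k) (w t i k) < e"
 proof (intro exI[of _ \<rho>] conjI ballI impI)
  fix s assume "dist s t < \<rho>"
  then have "norm (w (max 0 (max s t)) i k - w (max 0 (min s t)) i k) < e" by (intro *) (auto simp: dist_real_def)
  then show "dist (w s i k) (w t i k) < e" unfolding w_max
   by (cases "s \<le> t") (simp_all add: max_absorb1 max_absorb2 min_absorb1 min_absorb2 dist_norm norm_minus_commute)
 qed (rule \<rho>(1))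
qed

lemma measurable_w: "(\<lambda>t. w t i k) \<in> borel_measurable (lebesgue_on S)"
 by (intro borel_measurable_lebesgue_on_borel borel_measurable_continuous_onI continuous_w)

lemma w_zero_mode: "t \<ge> 0 ==> w t i 0 = 0"
proof -
 assume "t \<ge> 0"
 have "W (\<phi> n) t i 0 = 0" for n using supported_iter[of "\<phi> n"] by (auto simp: W_def supported_def)
 then show ?thesis using W_tendsto[OF \<open>t \<ge> 0\<close>, of i 0] by (simp add: LIMSEQ_const_iff)
qed

lemma hermitian_w: "t \<ge> 0 ==> hermitian (w t i)"
 unfolding hermitian_def
proof
 fix k assume t: "t \<ge> 0"
 have "(\<lambda>n. W (\<phi> n) t i (- k)) = (\<lambda>n. cnj (W (\<phi> n) t i k))" using supported_iter by (auto simp: W_def supported_def hermitian_def)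
 then have "(\<lambda>n. W (\<phi> n) t i (- k)) \<longlonglongrightarrow> cnj (w t i k)" using W_tendsto[OF t, of i k] by (simp add: tendsto_cnj)
 then show "w t i (- k) = cnj (w t i k)" using W_tendsto[OF t, of i "-k"] LIMSEQ_unique by blast
qed

lemma W_decay: "t \<ge> 0 ==> en 0 (W n t) \<le> E0 * exp (- \<delta> * (t - \<tau> n))"
proof -
 assume t: "t \<ge> 0"
 have "t - \<tau> n \<le> \<tau> n * real (nat \<lfloor>t / \<tau> n\<rfloor>)"
 proof -
  have "t / \<tau> n - 1 \<le> real (nat \<lfloor>t / \<tau> n\<rfloor>)" by linarith
  from mult_left_mono[OF this, of "\<tau> n"] have "\<tau> n * (t / \<tau> n) - \<tau> n \<le> \<tau> n * real (nat \<lfloor>t / \<tau> n\<rfloor>)"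
   using tau_pos[of n] by (simp add: right_diff_distrib)
  then show ?thesis using tau_pos[of n] by simp
 qed
 then have "E0 * exp (- \<delta> * (\<tau> n * real (nat \<lfloor>t / \<tau> n\<rfloor>))) \<le> E0 * exp (- \<delta> * (t - \<tau> n))"
  using pos(4,5) by (intro mult_left_mono) auto
 then show ?thesis using iter_decay[of n "nat \<lfloor>t / \<tau> n\<rfloor>"] unfolding W_def by linarith
qed

lemma w_energy:
 assumes t: "t \<ge> 0"
 shows "ell 0 (w t i)" and "en 0 (w t) \<le> E0 * exp (- \<delta> * t)"
proof -
 have F: "integrable ZM (\<lambda>k. mag k^0 * (norm (w t True k) + norm (w t False k)))"
  "(LINT k|ZM. mag k^0 * (norm (w t True k) + norm (w t False k))) \<le> E0 * exp (- \<delta> * (t - 0))"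
 \<comment> \<open>The bound is written with \<open>t - 0\<close> so that it is literally the limit
   of the bounds with \<open>t - \<tau> (\<phi> n)\<close>.\<close>
 proof (rule_tac [1-2] integrable_Fatou[where g = "\<lambda>n k. mag k^0 * (norm (W (\<phi> n) t True k) + norm (W (\<phi> n) t False k))" and C = "\<lambda>n. E0 * exp (- \<delta> * (t - \<tau> (\<phi> n)))" and L = "E0 * exp (- \<delta> * (t - 0))"])
  show "integrable ZM (\<lambda>k. mag k^0 * (norm (W (\<phi> n) t True k) + norm (W (\<phi> n) t False k)))" for n
   by (rule en_eq_integral(1)[OF ell_W])
  then show "integrable ZM (\<lambda>k. mag k^0 * (norm (W (\<phi> n) t True k) + norm (W (\<phi> n) t False k)))" for n .
  show "(LINT k|ZM. mag k^0 * (norm (W (\<phi> n) t True k) + norm (W (\<phi> n) t False k))) \<le> E0 * exp (- \<delta> * (t - \<tau> (\<phi> n)))" for n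
   using W_decay[OF t, of "\<phi> n"] en_eq_integral(2)[of 0 "W (\<phi> n) t", OF ell_W] by simp
  then show "(LINT k|ZM. mag k^0 * (norm (W (\<phi> n) t True k) + norm (W (\<phi> n) t False k))) \<le> E0 * exp (- \<delta> * (t - \<tau> (\<phi> n)))" for n .
  show "(\<lambda>n. E0 * exp (- \<delta> * (t - \<tau> (\<phi> n)))) \<longlonglongrightarrow> E0 * exp (- \<delta> * (t - 0))" by (intro tendsto_intros tau_phi_tendsto)
  then show "(\<lambda>n. E0 * exp (- \<delta> * (t - \<tau> (\<phi> n)))) \<longlonglongrightarrow> E0 * exp (- \<delta> * (t - 0))" .
  show "AE k in ZM. (\<lambda>n. mag k ^ 0 * (cmod (W (\<phi> n) t True k) + cmod (W (\<phi> n) t False k))) \<longlonglongrightarrow> mag k ^ 0 * (cmod (w t True k) + cmod (w t False k))"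
   by (intro AE_I2 tendsto_intros W_tendsto t)
  then show "AE k in ZM. (\<lambda>n. mag k ^ 0 * (cmod (W (\<phi> n) t True k) + cmod (W (\<phi> n) t False k))) \<longlonglongrightarrow> mag k ^ 0 * (cmod (w t True k) + cmod (w t False k))" .
 qed auto
 show e: "ell 0 (w t i)" for i using ell_from_sum[OF F(1)] .
 show "en 0 (w t) \<le> E0 * exp (- \<delta> * t)" using F(2) en_eq_integral(2)[of 0 "w t", OF e] by simp
qed

lemma en_w_le: "t \<ge> 0 ==> en 0 (w t) \<le> E0"
proof -
 assume t: "t \<ge> 0"
 have "exp (- \<delta> * t) \<le> 1" using t pos(4) by simp
 from mult_left_mono[OF this pos(5)] w_energy(2)[OF t] show ?thesis by simp
qed

lemma W_dissipation: "(\<integral>\<^sup>+s. ennreal (en 2 (W n s)) \<partial>leb 0 t) \<le> ennreal (E0 / \<delta>)"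
proof -
 \<comment> \<open>One step more than fits, so that [0,t] is covered; the bound on the sum of
   \<open>en 2\<close> holds for any number of steps.\<close>
 define J where "J = Suc (nat \<lfloor>t / \<tau> n\<rfloor>)"
 have tJ: "t < real J * \<tau> n"
 proof -
  have "t / \<tau> n < real J" unfolding J_def by linarith
  then show ?thesis using tau_pos[of n] by (simp add: field_simps)
 qed
 let ?T = "real J * \<tau> n"
 note st = step_function_integral[OF tau_pos[of n], of J ?T "\<lambda>l. en 2 (iter n l)"]
 have "(\<integral>\<^sup>+s. ennreal (en 2 (W n s)) \<partial>leb 0 t) = (\<integral>\<^sup>+s. ennreal (en 2 (W n s)) * indicator {0..t} s \<partial>lebesgue)"
  by (rule nn_integral_restrict_space) auto
 also have "... \<le> (\<integral>\<^sup>+s. ennreal (indicator {..<?T} s *\<^sub>R en 2 (iter n (nat \<lfloor>s / \<tau> n\<rfloor>))) * indicator {0..?T} s \<partial>lebesgue)"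
  using tJ by (intro nn_integral_mono) (auto simp: indicator_def W_def)
 also have "... = (\<integral>\<^sup>+s. ennreal (indicator {..<?T} s *\<^sub>R en 2 (iter n (nat \<lfloor>s / \<tau> n\<rfloor>))) \<partial>lebesgue_on {0..?T})"
  by (rule nn_integral_restrict_space[symmetric]) auto
 also have "... = ennreal (\<Sum>l<J. \<tau> n * en 2 (iter n l))"
  using st by (subst nn_integral_eq_integral) auto
 also have "... \<le> ennreal (E0 / \<delta>)" using iter_sum_le[of n 0 J] by (intro ennreal_leI) (simp add: atLeast0LessThan)
 finally show ?thesis .
qed

lemma measurable_W: "(\<lambda>s. W n s i k) \<in> borel_measurable (lebesgue_on S)"
proof -
 have "(\<lambda>s. (\<lambda>j. iter n j i k) (nat \<lfloor>s / \<tau> n\<rfloor>)) \<in> borel_measurable borel"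
  by (rule measurable_compose[of "\<lambda>s. nat \<lfloor>s / \<tau> n\<rfloor>" _ "count_space UNIV"]) auto
 then show ?thesis unfolding W_def by (rule borel_measurable_lebesgue_on_borel)
qed

text \<open>Fatou is applied over the modes and again over time. The extended real \<open>e2\<close>
  makes sense before summability is known, and finiteness of its time integral yields
  \<open>ell 2\<close> for almost every time.\<close>

lemma w_dissipation:
 shows "AE s in leb 0 t. \<forall>i. ell 2 (w s i)"
  and "integrable (leb 0 t) (\<lambda>s. en 2 (w s))"
  and "(LINT s|leb 0 t. en 2 (w s)) \<le> E0 / \<delta>"
proof -
 define e2 where "e2 x = (\<integral>\<^sup>+k. ennreal (mag k^2 * (norm (x True k) + norm (x False k))) \<partial>ZM)" for x :: "bool => int => complex"
 have e2W: "e2 (W n s) = ennreal (en 2 (W n s))" for n s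
  unfolding e2_def using en_eq_integral[of 2 "W n s", OF ell_W] by (subst nn_integral_eq_integral) auto
 have le: "e2 (w s) \<le> liminf (\<lambda>n. ennreal (en 2 (W (\<phi> n) s)))" if s: "s \<ge> 0" for s
 proof -
  have "e2 (w s) = (\<integral>\<^sup>+k. liminf (\<lambda>n. ennreal (mag k^2 * (norm (W (\<phi> n) s True k) + norm (W (\<phi> n) s False k)))) \<partial>ZM)"
   unfolding e2_def
   by (intro nn_integral_cong lim_imp_Liminf[symmetric] tendsto_ennrealI tendsto_intros W_tendsto s) auto
  also have "... \<le> liminf (\<lambda>n. e2 (W (\<phi> n) s))" unfolding e2_def by (intro nn_integral_liminf) auto
  finally show ?thesis by (simp add: e2W)
 qed
 have "(\<integral>\<^sup>+s. e2 (w s) \<partial>leb 0 t) \<le> (\<integral>\<^sup>+s. liminf (\<lambda>n. ennreal (en 2 (W (\<phi> n) s))) \<partial>leb 0 t)"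
  using le by (intro nn_integral_mono) auto
 also have "... \<le> liminf (\<lambda>n. (\<integral>\<^sup>+s. ennreal (en 2 (W (\<phi> n) s)) \<partial>leb 0 t))"
  by (intro nn_integral_liminf measurable_compose[OF measurable_en measurable_ennreal] measurable_W)
 also have "... \<le> liminf (\<lambda>n::nat. ennreal (E0 / \<delta>))"
  by (intro Liminf_mono always_eventually allI W_dissipation)
 also have "... = ennreal (E0 / \<delta>)" by (simp add: Liminf_const)
 finally have fin: "(\<integral>\<^sup>+s. e2 (w s) \<partial>leb 0 t) \<le> ennreal (E0 / \<delta>)" .
 have me: "(\<lambda>s. e2 (w s)) \<in> borel_measurable (leb 0 t)"
 proof -
  have "(\<lambda>(s, k). ennreal (mag k^2 * (norm (w s True k) + norm (w s False k)))) \<in> borel_measurable (leb 0 t \<Otimes>\<^sub>M ZM)"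
   by (rule measurable_pair_ZM) (use measurable_w in measurable)
  then show ?thesis unfolding e2_def by (intro sigma_finite_measure.borel_measurable_nn_integral[OF sigma_finite_ZM])
 qed
 have "AE s in leb 0 t. e2 (w s) \<noteq> \<infinity>"
  using fin by (intro nn_integral_noteq_infinite[OF me]) (auto simp: top_unique)
 then have ae: "AE s in leb 0 t. integrable ZM (\<lambda>k. mag k^2 * (norm (w s True k) + norm (w s False k)))"
  by eventually_elim (auto simp: e2_def integrable_iff_bounded less_top)
 then show ae2: "AE s in leb 0 t. \<forall>i. ell 2 (w s i)"
  by eventually_elim (use ell_from_sum in blast)
 have me2: "(\<lambda>s. en 2 (w s)) \<in> borel_measurable (leb 0 t)" by (intro measurable_en measurable_w)
 have "(\<integral>\<^sup>+s. ennreal (en 2 (w s)) \<partial>leb 0 t) = (\<integral>\<^sup>+s. e2 (w s) \<partial>leb 0 t)"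
 proof (rule nn_integral_cong_AE)
  show "AE s in leb 0 t. ennreal (en 2 (w s)) = e2 (w s)"
   using ae2
  proof eventually_elim
   case (elim s)
   then show ?case unfolding e2_def using en_eq_integral[of 2 "w s"] by (subst nn_integral_eq_integral) auto
  qed
 qed
 then have nn: "(\<integral>\<^sup>+s. ennreal (en 2 (w s)) \<partial>leb 0 t) \<le> ennreal (E0 / \<delta>)" using fin by simp
 then show "integrable (leb 0 t) (\<lambda>s. en 2 (w s))"
  using me2 by (intro integrableI_bounded) (auto simp: top_unique less_top[symmetric])
 show "(LINT s|leb 0 t. en 2 (w s)) \<le> E0 / \<delta>" using nn pos(4,5) by (intro integral_real_bounded) auto
qed

lemma w_rhs_integrable: "integrable (leb 0 t) (\<lambda>s. rhs (w s) i k)"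
proof (rule B_int_bound[where f = "\<lambda>s. rate i k * (2 + en 2 (w s))"])
 have "integrable (leb 0 t) (\<lambda>s. 2::real)"
  by (intro finite_measure.integrable_const finite_measure_lebesgue_on) simp
 then show "integrable (leb 0 t) (\<lambda>s. rate i k * (2 + en 2 (w s)))"
  using w_dissipation(2) by (intro integrable_mult_right B_int_add)
 show "(\<lambda>s. rhs (w s) i k) \<in> borel_measurable (leb 0 t)" by (intro measurable_rhs measurable_w)
 note AE_leb[of 0 t]
 then show "AE s in leb 0 t. norm (rhs (w s) i k) \<le> norm (rate i k * (2 + en 2 (w s)))"
  using w_dissipation(1)
 proof eventually_elim
  case (elim s)
  then have "norm (rhs (w s) i k) \<le> rate i k * (1 + 1 / 1 + 1 * en 2 (w s))" by (intro rhs_bound en_w_le) auto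
  then show ?case using rate_nonneg[of i k] by simp
 qed
qed

lemma w_0: "w 0 i k = u i k"
proof -
 have "(\<lambda>n. W (\<phi> n) 0 i k) \<longlonglongrightarrow> u i k"
 proof (rule tendsto_eventually)
  have "eventually (\<lambda>n. n \<ge> nat \<bar>k\<bar>) sequentially" by (rule eventually_ge_at_top)
  then show "eventually (\<lambda>n. W (\<phi> n) 0 i k = u i k) sequentially"
  proof eventually_elim
   case (elim n)
   then have "\<phi> n \<ge> nat \<bar>k\<bar>" using seq_suble[OF phi(1), of n] by linarith
   then show ?case by (auto simp: W_def iter_def init_def)
  qed
 qed
 then show ?thesis using W_tendsto[of 0 i k] LIMSEQ_unique by blast
qed

text \<open>Convergence of single modes passes to the limit in the truncated right-hand side, but
  not directly in \<open>rhs\<close>. The truncation errors are at most C / Q uniformly in n,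
  because the time integral of \<open>en 2\<close> is bounded by E0 / \<delta> for the iterates and
  for the limit; so Q is fixed before n tends to infinity.\<close>

lemma w_equation:
 assumes t: "t \<ge> 0"
 shows "w t i k = u i k + (LINT s|leb 0 t. rhs (w s) i k)"
proof -
 let ?L = "leb 0 t"
 define J where "J n = nat \<lfloor>t / \<tau> (\<phi> n)\<rfloor>" for n
 \<comment> \<open>Stops the time integral at the last completed Euler step, where it equals the
   increment of the iterates exactly once |k| is within the cutoff.\<close>
 define I where "I n s = (indicator {..<real (J n) * \<tau> (\<phi> n)} s :: real)" for n s
 have JT: "real (J n) * \<tau> (\<phi> n) \<le> t" "t - \<tau> (\<phi> n) \<le> real (J n) * \<tau> (\<phi> n)" for n
 proof -
  have tp: "\<tau> (\<phi> n) > 0" by (rule tau_pos)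
  have "real (J n) \<le> t / \<tau> (\<phi> n)" "t / \<tau> (\<phi> n) - 1 \<le> real (J n)" unfolding J_def using t tp by (auto simp: less_imp_le)
  then show "real (J n) * \<tau> (\<phi> n) \<le> t" "t - \<tau> (\<phi> n) \<le> real (J n) * \<tau> (\<phi> n)" using tp by (auto simp: field_simps)
 qed
 note st = step_function_integral[OF tau_pos JT(1)]
 define C where "C = mag k * E0 * c * (E0 / \<delta>)"
 have iR: "integrable ?L (\<lambda>s. I n s *\<^sub>R rhs (W (\<phi> n) s) i k)" for n
  using st(1)[of n "\<lambda>l. rhs (iter (\<phi> n) l) i k"] by (simp add: W_def I_def)
 have iRQ: "integrable ?L (\<lambda>s. I n s *\<^sub>R rhs_trunc Q (W (\<phi> n) s) i k)" for n Q
  using st(1)[of n "\<lambda>l. rhs_trunc Q (iter (\<phi> n) l) i k"] by (simp add: W_def I_def)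
 have iE: "integrable ?L (\<lambda>s. I n s * en 2 (W (\<phi> n) s))" "(LINT s|?L. I n s * en 2 (W (\<phi> n) s)) \<le> E0 / \<delta>" for n
  using st[of n "\<lambda>l. en 2 (iter (\<phi> n) l)"] iter_sum_le[of "\<phi> n" 0 "J n"] by (simp_all add: W_def I_def atLeast0LessThan)
 have err1: "norm ((LINT s|?L. I n s *\<^sub>R rhs (W (\<phi> n) s) i k) - (LINT s|?L. I n s *\<^sub>R rhs_trunc Q (W (\<phi> n) s) i k)) \<le> C / real Q" if Q: "Q > 0" for n Q
 proof -
  have "norm ((LINT s|?L. I n s *\<^sub>R rhs (W (\<phi> n) s) i k) - (LINT s|?L. I n s *\<^sub>R rhs_trunc Q (W (\<phi> n) s) i k))
   = norm (LINT s|?L. I n s *\<^sub>R (rhs (W (\<phi> n) s) i k - rhs_trunc Q (W (\<phi> n) s) i k))"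
   using iR iRQ by (simp add: scaleR_diff_right)
  also have "... \<le> (LINT s|?L. norm (I n s *\<^sub>R (rhs (W (\<phi> n) s) i k - rhs_trunc Q (W (\<phi> n) s) i k)))" by (rule integral_norm_bound)
  also have "... \<le> (LINT s|?L. mag k * E0 * c / real Q * (I n s * en 2 (W (\<phi> n) s)))"
  proof (rule integral_mono)
   show "integrable ?L (\<lambda>s. norm (I n s *\<^sub>R (rhs (W (\<phi> n) s) i k - rhs_trunc Q (W (\<phi> n) s) i k)))"
    unfolding scaleR_diff_right by (intro integrable_norm B_int_diff iR iRQ)
   fix s
   show "norm (I n s *\<^sub>R (rhs (W (\<phi> n) s) i k - rhs_trunc Q (W (\<phi> n) s) i k)) \<le> mag k * E0 * c / real Q * (I n s * en 2 (W (\<phi> n) s))"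
    using rhs_trunc_error[of "W (\<phi> n) s" Q i k, OF ell_W en_W_le Q] by (auto simp: I_def indicator_def)
  qed (intro integrable_mult_right iE)
  also have "... \<le> mag k * E0 * c / real Q * (E0 / \<delta>)"
   unfolding B_itg_mult_right_zero using iE(2) pos(5) c_pos by (intro mult_left_mono) auto
  finally show ?thesis by (simp add: C_def mult.commute)
 qed
 have mT: "(\<lambda>s. rhs_trunc Q (w s) i k) \<in> borel_measurable ?L" for Q
  unfolding rhs_trunc_def flux_trunc_def cmult_def pot_def using measurable_w by measurable
 define B where "B Q = mag k * (mag k * M i * (c * E0) + (\<Sum>q\<in>{- int Q..int Q}. E0 * (mag q * (c * E0))))" for Q
 have fin: "finite_measure ?L" by (intro finite_measure_lebesgue_on) simp
 have s0: "AE s in ?L. s \<in> {0..t}" by (rule AE_I2) simp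
 have iT: "integrable ?L (\<lambda>s. rhs_trunc Q (w s) i k)" for Q
  by (rule finite_measure.integrable_const_bound[OF fin _ mT, where B = "B Q"])
    (use s0 rhs_trunc_bound[OF w_energy(1) en_w_le] in \<open>auto simp: B_def elim!: eventually_mono\<close>)
 have err2: "norm ((LINT s|?L. rhs (w s) i k) - (LINT s|?L. rhs_trunc Q (w s) i k)) \<le> C / real Q" if Q: "Q > 0" for Q
 proof -
  have "norm ((LINT s|?L. rhs (w s) i k) - (LINT s|?L. rhs_trunc Q (w s) i k)) = norm (LINT s|?L. rhs (w s) i k - rhs_trunc Q (w s) i k)"
   using w_rhs_integrable iT by simp
  also have "... \<le> (LINT s|?L. norm (rhs (w s) i k - rhs_trunc Q (w s) i k))" by (rule integral_norm_bound)
  also have "... \<le> (LINT s|?L. mag k * E0 * c / real Q * en 2 (w s))"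
  proof (rule integral_mono_AE)
   show "AE s in ?L. norm (rhs (w s) i k - rhs_trunc Q (w s) i k) \<le> mag k * E0 * c / real Q * en 2 (w s)"
    using s0 w_dissipation(1) by eventually_elim (use rhs_trunc_error[OF _ en_w_le Q] in auto)
  qed (use w_rhs_integrable iT w_dissipation(2) in auto)
  also have "... \<le> mag k * E0 * c / real Q * (E0 / \<delta>)"
   unfolding B_itg_mult_right_zero using w_dissipation(3) pos(5) c_pos by (intro mult_left_mono) auto
  finally show ?thesis by (simp add: C_def mult.commute)
 qed
 have lim: "(\<lambda>n. LINT s|?L. I n s *\<^sub>R rhs_trunc Q (W (\<phi> n) s) i k) \<longlonglongrightarrow> (LINT s|?L. rhs_trunc Q (w s) i k)" for Q
 proof (rule integral_dominated_convergence[where w = "\<lambda>s. B Q"])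
  show "integrable ?L (\<lambda>s. B Q)" by (rule finite_measure.integrable_const[OF fin])
  show "AE s in ?L. norm (I n s *\<^sub>R rhs_trunc Q (W (\<phi> n) s) i k) \<le> B Q" for n
  proof (rule AE_I2)
   fix s
   have "norm (rhs_trunc Q (W (\<phi> n) s) i k) \<le> B Q" unfolding B_def by (rule rhs_trunc_bound[OF ell_W en_W_le])
   moreover have "0 \<le> B Q" using calculation norm_ge_zero order_trans by blast
   ultimately show "norm (I n s *\<^sub>R rhs_trunc Q (W (\<phi> n) s) i k) \<le> B Q" by (auto simp: I_def indicator_def)
  qed
  \<comment> \<open>The cutoff \<open>I n\<close> is 0 at s = t for every n, whereas for s < t it is
    eventually 1.\<close>
  have "{t} \<in> null_sets lebesgue" by (auto intro!: negligible_finite simp flip: negligible_iff_null_sets)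
  then have "AE s in lebesgue. s \<notin> {t}" by (rule AE_not_in)
  then have "AE s in ?L. s \<noteq> t" by (auto simp: AE_restrict_space_iff elim: eventually_mono)
  with s0 show "AE s in ?L. (\<lambda>n. I n s *\<^sub>R rhs_trunc Q (W (\<phi> n) s) i k) \<longlonglongrightarrow> rhs_trunc Q (w s) i k"
  proof eventually_elim
   case (elim s)
   have "eventually (\<lambda>n. \<tau> (\<phi> n) < t - s) sequentially" using elim by (intro order_tendstoD(2)[OF tau_phi_tendsto]) auto
   then have "eventually (\<lambda>n. I n s = 1) sequentially"
   proof eventually_elim
    case (elim n)
    then have "s < real (J n) * \<tau> (\<phi> n)" using JT(2)[of n] by linarith
    then show ?case by (simp add: I_def)
   qed
   then have "(\<lambda>n. I n s) \<longlonglongrightarrow> 1" by (rule tendsto_eventually)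
   then have "(\<lambda>n. I n s *\<^sub>R rhs_trunc Q (W (\<phi> n) s) i k) \<longlonglongrightarrow> 1 *\<^sub>R rhs_trunc Q (w s) i k"
    using elim by (intro tendsto_scaleR tendsto_rhs_trunc W_tendsto) auto
   then show ?case by simp
  qed
  show "(\<lambda>s. I n s *\<^sub>R rhs_trunc Q (W (\<phi> n) s) i k) \<in> borel_measurable ?L" for n by (rule borel_measurable_integrable[OF iRQ])
 qed (rule mT)
 have main: "(\<lambda>n. LINT s|?L. I n s *\<^sub>R rhs (W (\<phi> n) s) i k) \<longlonglongrightarrow> (LINT s|?L. rhs (w s) i k)"
 proof (rule LIMSEQ_I)
  fix e :: real assume e: "e > 0"
  obtain Q0 :: nat where "real Q0 > max 0 (3 * C / e)" using reals_Archimedean2 by blast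
  then obtain Q :: nat where Q: "real Q > 3 * C / e" "Q > 0" by (intro that[of Q0]) auto
  have CQ: "C / real Q < e / 3" using Q e by (simp add: field_simps)
  obtain N where N: "\<And>n. n \<ge> N ==> norm ((LINT s|?L. I n s *\<^sub>R rhs_trunc Q (W (\<phi> n) s) i k) - (LINT s|?L. rhs_trunc Q (w s) i k)) < e / 3"
   using LIMSEQ_D[OF lim, of "e / 3" Q] e by auto
  show "\<exists>no. \<forall>n\<ge>no. norm ((LINT s|?L. I n s *\<^sub>R rhs (W (\<phi> n) s) i k) - (LINT s|?L. rhs (w s) i k)) < e"
  proof (intro exI[of _ N] allI impI)
   fix n assume "N \<le> n"
   let ?a = "LINT s|?L. I n s *\<^sub>R rhs (W (\<phi> n) s) i k" and ?b = "LINT s|?L. I n s *\<^sub>R rhs_trunc Q (W (\<phi> n) s) i k"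
    and ?c = "LINT s|?L. rhs_trunc Q (w s) i k" and ?d = "LINT s|?L. rhs (w s) i k"
   have "norm (?a - ?d) \<le> norm (?a - ?b) + norm (?b - ?c) + norm (?d - ?c)"
    using norm_triangle_ineq[of "?a - ?b" "?b - ?c"] norm_triangle_ineq[of "?a - ?c" "?c - ?d"] norm_minus_commute[of ?d ?c] by simp
   also have "... < e" using err1[OF Q(2), of n] err2[OF Q(2)] N[OF \<open>N \<le> n\<close>] CQ by linarith
   finally show "norm (?a - ?d) < e" .
  qed
 qed
 have "(\<lambda>n. W (\<phi> n) t i k - init (\<phi> n) i k) \<longlonglongrightarrow> w t i k - u i k"
 proof (intro tendsto_diff W_tendsto t)
  have "(\<lambda>n. W (\<phi> n) 0 i k) \<longlonglongrightarrow> w 0 i k" by (rule W_tendsto) simp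
  then show "(\<lambda>n. init (\<phi> n) i k) \<longlonglongrightarrow> u i k" by (simp add: W_def iter_def w_0)
 qed
 moreover have "eventually (\<lambda>n. W (\<phi> n) t i k - init (\<phi> n) i k = (LINT s|?L. I n s *\<^sub>R rhs (W (\<phi> n) s) i k)) sequentially"
 proof -
  have "eventually (\<lambda>n. n \<ge> nat \<bar>k\<bar>) sequentially" by (rule eventually_ge_at_top)
  then show ?thesis
  proof eventually_elim
   case (elim n)
   then have nk: "\<bar>k\<bar> \<le> int (\<phi> n)" using seq_suble[OF phi(1), of n] by linarith
   have "W (\<phi> n) t i k - init (\<phi> n) i k = iter (\<phi> n) (J n) i k - iter (\<phi> n) 0 i k" by (simp add: W_def J_def iter_def)
   also have "... = (\<Sum>l<J n. \<tau> (\<phi> n) *\<^sub>R rhs (iter (\<phi> n) l) i k)"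
    using nk by (subst iter_diff) (auto simp: atLeast0LessThan scaleR_conv_of_real)
   also have "... = (LINT s|?L. I n s *\<^sub>R rhs (W (\<phi> n) s) i k)"
    using st(2)[of n "\<lambda>l. rhs (iter (\<phi> n) l) i k"] by (simp add: W_def I_def)
   finally show ?case .
  qed
 qed
 ultimately have "(\<lambda>n. LINT s|?L. I n s *\<^sub>R rhs (W (\<phi> n) s) i k) \<longlonglongrightarrow> w t i k - u i k"
  by (rule Lim_transform_eventually)
 then have "w t i k - u i k = (LINT s|?L. rhs (w s) i k)" using main by (rule LIMSEQ_unique)
 then show ?thesis by (simp add: algebra_simps)
qed

end

section \<open>Norms of Fourier series\<close>

lemma has_weak_deriv_AE_cong:
 assumes "AE x in torus. u x = u' x" "integrable torus u" "integrable torus u'"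
 shows "has_weak_deriv u v \<longleftrightarrow> has_weak_deriv u' v"
proof -
 have "(LINT x|torus. u x * deriv \<eta> x) = (LINT x|torus. u' x * deriv \<eta> x)" if \<eta>: "smooth_periodic \<eta>" for \<eta>
 proof (rule integral_cong_AE)
  have "deriv \<eta> field_differentiable (at x)" for x
  proof -
   have "(deriv ^^ 1) \<eta> field_differentiable (at x)" using \<eta> unfolding smooth_periodic_def by blast
   then show ?thesis by simp
  qed
  then have "continuous_on UNIV (deriv \<eta>)"
   by (intro continuous_at_imp_continuous_on ballI field_differentiable_imp_continuous_at)
  then have "deriv \<eta> \<in> borel_measurable torus" by (intro borel_measurable_torus_borel borel_measurable_continuous_onI)
  then show "(\<lambda>x. u x * deriv \<eta> x) \<in> borel_measurable torus" "(\<lambda>x. u' x * deriv \<eta> x) \<in> borel_measurable torus"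
   using assms(2,3) by auto
  show "AE x in torus. u x * deriv \<eta> x = u' x * deriv \<eta> x" using assms(1) by eventually_elim simp
 qed
 then show ?thesis using assms(2,3) by (auto simp: has_weak_deriv_def)
qed

text \<open>The weak derivative is chosen from the set of all weak derivatives. Changing
  \<open>u\<close> on a null set leaves this set unchanged, so the two choices agree as functions
  and not merely almost everywhere.\<close>

lemma weak_deriv_AE_cong:
 assumes "AE x in torus. u x = u' x" "integrable torus u" "integrable torus u'"
 shows "weak_deriv u = weak_deriv u'"
 unfolding weak_deriv_def using has_weak_deriv_AE_cong[OF assms] by presburger

lemma weak_deriv_wiener:
 assumes "integrable ZM (dcoef c)"
 shows "integrable torus (weak_deriv (wiener c))" "AE x in torus. weak_deriv (wiener c) x = wiener (dcoef c) x"
proof -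
 have h: "has_weak_deriv (wiener c) (wiener (dcoef c))" by (rule has_weak_deriv_wiener[OF assms])
 have h2: "has_weak_deriv (wiener c) (weak_deriv (wiener c))" unfolding weak_deriv_def
  using h by (rule someI[of "\<lambda>v. has_weak_deriv (wiener c) v"])
 show "integrable torus (weak_deriv (wiener c))" using h2 by (simp add: has_weak_deriv_def)
 show "AE x in torus. weak_deriv (wiener c) x = wiener (dcoef c) x" by (rule has_weak_deriv_unique[OF h2 h]) simp
qed

lemma norm_dcoef: "norm (dcoef c k) = mag k * norm (c k)"
 by (simp add: dcoef_def norm_mult)

lemma ell_dcoef: "ell s (dcoef c) \<longleftrightarrow> ell (Suc s) c"
 by (simp add: ell_def norm_dcoef mult_ac)

lemma l1_dcoef: "l1 s (dcoef c) = l1 (Suc s) c"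
 by (simp add: l1_def norm_dcoef mult_ac)

text \<open>Symmetry makes the series real, the vanishing mode makes its mean zero, and
  \<open>ell 2\<close> gives two continuous derivatives.\<close>

definition good :: "(int => complex) => bool" where
 "good c \<longleftrightarrow> hermitian c \<and> c 0 = 0 \<and> ell 2 c"

lemma goodD:
 assumes "good c"
 shows "ell 2 c" "ell 1 c" "ell 0 c" "integrable ZM c" "integrable ZM (dcoef c)" "integrable ZM (dcoef (dcoef c))"
  "hermitian c" "c 0 = 0" "l1 0 c \<le> l1 1 c" "l1 1 c \<le> l1 2 c"
proof -
 show e: "ell 2 c" "ell 1 c" "ell 0 c" "c 0 = 0" "hermitian c" using assms ell_mono by (auto simp: good_def)
 show "integrable ZM c" using e by (simp add: ell_0_iff)
 show "integrable ZM (dcoef c)" using e by (simp add: ell_0_iff[symmetric] ell_dcoef)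
 show "integrable ZM (dcoef (dcoef c))" using e by (simp add: ell_0_iff[symmetric] ell_dcoef numeral_2_eq_2[symmetric])
 show "l1 0 c \<le> l1 1 c" "l1 1 c \<le> l1 2 c" using e by (auto intro: l1_mono)
qed

lemma good_add: "good c ==> good d ==> good (\<lambda>k. c k + d k)"
 using ell_add_scale(1)[of 2 c d 1 1] by (simp add: good_def hermitian_def)

lemma good_diff: "good c ==> good d ==> good (\<lambda>k. c k - d k)"
 using ell_diff[of 2 c d] by (simp add: good_def hermitian_def)

text \<open>A \<open>fun_space\<close> carries no norm axioms. \<open>tame\<close> and
  \<open>subadd\<close> isolate the properties used of the target spaces, and only for series with
  \<open>good\<close> coefficients: membership, a nonnegative norm dominated by \<open>l1 s\<close>,
  and the triangle inequality.\<close>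

definition tame :: "fun_space => nat => real => bool" where
 "tame X s C \<longleftrightarrow> C \<ge> 0 \<and> (\<forall>c. good c \<longrightarrow> wiener c \<in> elems X \<and> 0 \<le> fnorm X (wiener c) \<and> fnorm X (wiener c) \<le> C * l1 s c)"

definition subadd :: "fun_space => bool" where
 "subadd X \<longleftrightarrow> (\<forall>c d. good c \<longrightarrow> good d \<longrightarrow>
   fnorm X (wiener (\<lambda>k. c k + d k)) \<le> fnorm X (wiener c) + fnorm X (wiener d))"

lemma tame_mono:
 assumes "tame X s C" "s \<le> t" "t \<le> 2"
 shows "tame X t C"
 unfolding tame_def
proof (intro conjI allI impI)
 fix c assume g: "good c"
 have "l1 s c \<le> l1 t c" using goodD[OF g] assms(2,3) by (intro l1_mono ell_mono[of 2 c t]) auto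
 then have "C * l1 s c \<le> C * l1 t c" using assms(1) by (intro mult_left_mono) (auto simp: tame_def)
 then show "fnorm X (wiener c) \<le> C * l1 t c" using assms(1) g unfolding tame_def by fastforce
qed (use assms in \<open>auto simp: tame_def\<close>)

lemma linf_enorm_AE_cong:
 assumes "AE x in torus. u x = v x" "u \<in> borel_measurable torus" "v \<in> borel_measurable torus"
 shows "linf_enorm u = linf_enorm v"
 unfolding linf_enorm_def using assms by (intro esssup_AE_cong) (auto elim: eventually_mono)

lemma linf_enorm_bound:
 assumes "u \<in> borel_measurable torus" "AE x in torus. \<bar>u x\<bar> \<le> B"
 shows "linf_enorm u \<le> ennreal B"
 unfolding linf_enorm_def using assms by (intro esssup_I) (auto elim: eventually_mono intro: ennreal_leI)

lemma linf_enorm_add: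
 assumes "u \<in> borel_measurable torus" "v \<in> borel_measurable torus"
 shows "linf_enorm (\<lambda>x. u x + v x) \<le> linf_enorm u + linf_enorm v"
 unfolding linf_enorm_def
proof (rule esssup_I)
 show "AE x in torus. ennreal \<bar>u x + v x\<bar> \<le> esssup torus (\<lambda>x. ennreal \<bar>u x\<bar>) + esssup torus (\<lambda>x. ennreal \<bar>v x\<bar>)"
  using esssup_AE[of "\<lambda>x. ennreal \<bar>u x\<bar>" torus] esssup_AE[of "\<lambda>x. ennreal \<bar>v x\<bar>" torus]
 proof eventually_elim
  case (elim x)
  have "ennreal \<bar>u x + v x\<bar> \<le> ennreal \<bar>u x\<bar> + ennreal \<bar>v x\<bar>"
   unfolding ennreal_plus[OF abs_ge_zero abs_ge_zero, symmetric] by (intro ennreal_leI abs_triangle_ineq)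
  then show ?case using add_mono[OF elim] by (rule order_trans)
 qed
qed (use assms in auto)

definition linf :: "(int => complex) => real" where
 "linf c = enn2real (linf_enorm (wiener c))"

lemma measurable_wiener_torus: "integrable ZM c ==> wiener c \<in> borel_measurable torus"
 by (intro borel_measurable_torus_borel measurable_wiener)

lemma linf_enorm_wiener:
 assumes "integrable ZM c"
 shows "linf_enorm (wiener c) \<le> ennreal (l1 0 c)"
 using abs_wiener_le[OF assms] by (intro linf_enorm_bound measurable_wiener_torus assms) (auto simp: l1_def)

lemma linf_le:
 assumes "integrable ZM c" shows "0 \<le> linf c" "linf c \<le> l1 0 c" "linf_enorm (wiener c) < \<infinity>"
 using linf_enorm_wiener[OF assms] by (auto simp: linf_def intro: enn2real_leI order.strict_trans1)

lemma linf_add: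
 assumes "integrable ZM c" "integrable ZM d"
 shows "linf (\<lambda>k. c k + d k) \<le> linf c + linf d"
proof -
 have "(\<lambda>x. wiener c x + wiener d x) = wiener (\<lambda>k. c k + d k)" by (intro ext) (simp add: wiener_add assms)
 then have "linf_enorm (wiener (\<lambda>k. c k + d k)) \<le> linf_enorm (wiener c) + linf_enorm (wiener d)"
  using linf_enorm_add[OF measurable_wiener_torus measurable_wiener_torus, of c d] assms by simp
 moreover have "linf_enorm (wiener c) + linf_enorm (wiener d) < \<infinity>" using linf_le(3) assms by simp
 ultimately show ?thesis using enn2real_mono linf_le(3)[OF assms(1)] linf_le(3)[OF assms(2)]
  unfolding linf_def by (metis enn2real_plus infinity_ennreal_def)
qed

lemma dcoef_add: "dcoef (\<lambda>k. c k + d k) = (\<lambda>k. dcoef c k + dcoef d k)"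
 by (auto simp: dcoef_def algebra_simps)

lemma Linf_fnorm: "fnorm Linf u = enn2real (linf_enorm u)"
 and Linf_elems: "u \<in> elems Linf \<longleftrightarrow> u \<in> borel_measurable torus \<and> linf_enorm u < \<infinity>"
 by (auto simp: Linf_def)

lemma fnorm_weak_deriv_Linf:
 assumes "integrable ZM (dcoef c)"
 shows "fnorm Linf (weak_deriv (wiener c)) = linf (dcoef c)"
 unfolding Linf_fnorm linf_def using weak_deriv_wiener[OF assms] measurable_wiener_torus[OF assms]
 by (subst linf_enorm_AE_cong) auto

lemma fnorm_sobolev_1_Linf:
 assumes "integrable ZM (dcoef c)"
 shows "fnorm (sobolev 1 Linf) (wiener c) = linf c + linf (dcoef c)"
 by (simp add: fnorm_weak_deriv_Linf[OF assms]) (simp add: Linf_fnorm linf_def)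

lemma fnorm_sobolev_2_Linf:
 assumes "integrable ZM (dcoef c)" "integrable ZM (dcoef (dcoef c))"
 shows "fnorm (sobolev 2 Linf) (wiener c) = linf c + (linf (dcoef c) + linf (dcoef (dcoef c)))"
proof -
 have "weak_deriv (weak_deriv (wiener c)) = weak_deriv (wiener (dcoef c))"
  using weak_deriv_wiener[OF assms(1)] integrable_torus_wiener[OF assms(1)] by (intro weak_deriv_AE_cong) auto
 then have "fnorm (sobolev 1 Linf) (weak_deriv (wiener c)) = linf (dcoef c) + linf (dcoef (dcoef c))"
  using fnorm_weak_deriv_Linf assms by simp
 then show ?thesis by (simp add: numeral_2_eq_2 Linf_fnorm linf_def)
qed

lemma wiener_in_Linf: "integrable ZM c ==> wiener c \<in> elems Linf"
 using linf_le(3) measurable_wiener_torus by (simp add: Linf_elems)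

lemma wiener_in_sobolev_1_Linf: 
 assumes "integrable ZM (dcoef c)" 
 shows "wiener c \<in> elems (sobolev 1 Linf)"
 using wiener_in_Linf[OF integrable_ZM_of_dcoef[OF assms]] wiener_in_Linf[OF assms] has_weak_deriv_wiener[OF assms] by auto

lemma tame_sobolev_1_Linf: "tame (sobolev 1 Linf) 1 2"
 unfolding tame_def
proof (intro conjI allI impI)
 fix c assume g: "good c"
 note gd = goodD[OF g]
 show "wiener c \<in> elems (sobolev 1 Linf)" by (rule wiener_in_sobolev_1_Linf[OF gd(5)])
 show "0 \<le> fnorm (sobolev 1 Linf) (wiener c)" "fnorm (sobolev 1 Linf) (wiener c) \<le> 2 * l1 1 c"
  unfolding fnorm_sobolev_1_Linf[OF gd(5)] using linf_le[OF gd(4)] linf_le[OF gd(5)] gd by (auto simp: l1_dcoef)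
qed simp

lemma subadd_sobolev_1_Linf: "subadd (sobolev 1 Linf)"
 unfolding subadd_def
proof (intro allI impI)
 fix c d assume g: "good c" "good d"
 show "fnorm (sobolev 1 Linf) (wiener (\<lambda>k. c k + d k)) \<le> fnorm (sobolev 1 Linf) (wiener c) + fnorm (sobolev 1 Linf) (wiener d)"
  unfolding fnorm_sobolev_1_Linf[OF goodD(5)[OF g(1)]] fnorm_sobolev_1_Linf[OF goodD(5)[OF g(2)]] fnorm_sobolev_1_Linf[OF goodD(5)[OF good_add[OF g]]]
  using linf_add[OF goodD(4)[OF g(1)] goodD(4)[OF g(2)]] linf_add[OF goodD(5)[OF g(1)] goodD(5)[OF g(2)]]
  by (simp add: dcoef_add)
qed

lemma tame_sobolev_2_Linf: "tame (sobolev 2 Linf) 2 3"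
 unfolding tame_def
proof (intro conjI allI impI)
 fix c assume g: "good c"
 note gd = goodD[OF g]
 show "wiener c \<in> elems (sobolev 2 Linf)"
  using wiener_in_Linf[OF gd(4)] wiener_in_sobolev_1_Linf[OF gd(6)] has_weak_deriv_wiener[OF gd(5)]
  by (auto simp: numeral_2_eq_2)
 show "0 \<le> fnorm (sobolev 2 Linf) (wiener c)" "fnorm (sobolev 2 Linf) (wiener c) \<le> 3 * l1 2 c"
  unfolding fnorm_sobolev_2_Linf[OF gd(5,6)] using linf_le[OF gd(4)] linf_le[OF gd(5)] linf_le[OF gd(6)] gd 
  by (auto simp: l1_dcoef numeral_2_eq_2)
qed simp

definition int_abs :: "(int => complex) => real" where
 "int_abs c = (LINT x|torus. \<bar>wiener c x\<bar>)"

lemma int_abs_le: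
 assumes "integrable ZM c"
 shows "0 \<le> int_abs c" "int_abs c \<le> 2 * pi * l1 0 c"
proof -
 show "0 \<le> int_abs c" by (simp add: int_abs_def)
 have "int_abs c \<le> (LINT x|torus. l1 0 c)" unfolding int_abs_def using abs_wiener_le[OF assms]
  by (intro integral_mono integrable_abs integrable_torus_wiener assms integrable_torus_const) (auto simp: l1_def)
 then show "int_abs c \<le> 2 * pi * l1 0 c" using measure_torus by simp
qed

lemma int_abs_add:
 assumes "integrable ZM c" "integrable ZM d"
 shows "int_abs (\<lambda>k. c k + d k) \<le> int_abs c + int_abs d"
proof -
 note i = integrable_torus_wiener[OF assms(1)] integrable_torus_wiener[OF assms(2)]
 have "int_abs (\<lambda>k. c k + d k) \<le> (LINT x|torus. \<bar>wiener c x\<bar> + \<bar>wiener d x\<bar>)"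
  unfolding int_abs_def wiener_add[OF assms] using i by (intro integral_mono) auto
 then show ?thesis using i by (simp add: int_abs_def)
qed

lemma fnorm_sobolev_1_L1:
 assumes "integrable ZM (dcoef c)"
 shows "fnorm (sobolev 1 L1) (wiener c) = int_abs c + int_abs (dcoef c)"
proof -
 have "(LINT x|torus. \<bar>weak_deriv (wiener c) x\<bar>) = int_abs (dcoef c)"
  unfolding int_abs_def using weak_deriv_wiener[OF assms] measurable_wiener_torus[OF assms]
  by (intro integral_cong_AE) (auto elim: eventually_mono)
 then show ?thesis by (simp add: L1_def int_abs_def)
qed

lemma tame_sobolev_1_L1: "tame (sobolev 1 L1) 2 (4 * pi)"
 unfolding tame_def
proof (intro conjI allI impI)
 fix c assume g: "good c"
 note gd = goodD[OF g]
 show "wiener c \<in> elems (sobolev 1 L1)"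
  using integrable_torus_wiener[OF gd(4)] integrable_torus_wiener[OF gd(5)] has_weak_deriv_wiener[OF gd(5)]
  by (auto simp: L1_def)
 have "2 * pi * l1 0 c + 2 * pi * l1 1 c \<le> 2 * pi * l1 2 c + 2 * pi * l1 2 c" using gd by (intro add_mono mult_left_mono) auto
 then show "0 \<le> fnorm (sobolev 1 L1) (wiener c)" "fnorm (sobolev 1 L1) (wiener c) \<le> 4 * pi * l1 2 c"
  unfolding fnorm_sobolev_1_L1[OF gd(5)] using int_abs_le[OF gd(4)] int_abs_le[OF gd(5)] by (auto simp: l1_dcoef)
qed simp

lemma subadd_sobolev_1_L1: "subadd (sobolev 1 L1)"
 unfolding subadd_def
proof (intro allI impI)
 fix c d assume g: "good c" "good d"
 show "fnorm (sobolev 1 L1) (wiener (\<lambda>k. c k + d k)) \<le> fnorm (sobolev 1 L1) (wiener c) + fnorm (sobolev 1 L1) (wiener d)"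
  unfolding fnorm_sobolev_1_L1[OF goodD(5)[OF g(1)]] fnorm_sobolev_1_L1[OF goodD(5)[OF g(2)]] fnorm_sobolev_1_L1[OF goodD(5)[OF good_add[OF g]]]
  using int_abs_add[OF goodD(4)[OF g(1)] goodD(4)[OF g(2)]] int_abs_add[OF goodD(5)[OF g(1)] goodD(5)[OF g(2)]]
  by (simp add: dcoef_add)
qed

section \<open>The Hoelder space and the periodic representative\<close>

lemma periodic_int: 
 assumes "periodic v"
 shows "v (x + 2 * pi * of_int n) = v x"
proof -
 have nat: "v (x + 2 * pi * real m) = v x" for m x
 proof (induction m)
  case (Suc m)
  have "v (x + 2 * pi * real (Suc m)) = v ((x + 2 * pi * real m) + 2 * pi)" by (simp add: algebra_simps)
  then show ?case using assms Suc unfolding periodic_def by simp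
 qed simp
 show ?thesis
 proof (cases "n \<ge> 0")
  case True
  then show ?thesis using nat[of x "nat n"] by simp
 next
  case False
  then show ?thesis using nat[of "x + 2 * pi * of_int n" "nat (- n)"] by simp
 qed
qed

text \<open>The norm of \<open>holder_C1\<close> refers to the representative through a definite
  description, so it must be unique. Points of difference inside the period form an open null set,
  the left endpoint follows by closure, all other points by periodicity.\<close>

lemma periodic_continuous_AE_eq:
 assumes "periodic v" "periodic w" "continuous_on UNIV v" "continuous_on UNIV w" "AE x in torus. v x = w x"
 shows "v = w"
proof -
 have "AE x in lebesgue_on {-pi..pi}. v x = w x" using assms(5) unfolding torus_def .
 then have ae: "AE x in lebesgue. x \<in> {-pi..pi} \<longrightarrow> v x = w x" by (subst (asm) AE_restrict_space_iff) auto
 have on: "v x = w x" if x: "x \<in> {-pi<..<pi}" for x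
 proof (rule ccontr)
  assume ne: "v x \<noteq> w x"
  define U where "U = {-pi<..<pi} \<inter> {x. v x \<noteq> w x}"
  have "open {x. v x \<noteq> w x}" using assms(3,4) by (rule open_Collect_neq)
  then have U: "open U" "x \<in> U" using x ne by (auto simp: U_def)
  have "AE x in lebesgue. x \<notin> U" using ae by eventually_elim (auto simp: U_def)
  then have "U \<in> null_sets lebesgue" using U(1) by (subst (asm) AE_iff_null_sets[symmetric]) (auto simp: borel_open)
  then have "negligible U" by (simp add: negligible_iff_null_sets)
  then show False using open_not_negligible[OF U(1)] U(2) by blast
 qed
 have end': "v (-pi) = w (-pi)"
 proof -
  have cl: "closure {-pi<..<pi} = {-pi..pi}" by (rule closure_greaterThanLessThan) simp
  have "continuous_on UNIV (\<lambda>x. v x - w x)" by (rule continuous_on_diff[OF assms(3,4)])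
  then have "continuous_on (closure {-pi<..<pi}) (\<lambda>x. v x - w x)" by (rule continuous_on_subset) simp
  moreover have "v x - w x = 0" if "x \<in> {-pi<..<pi}" for x using on[OF that] by simp
  moreover have "-pi \<in> closure {-pi<..<pi}" unfolding cl by simp
  ultimately have "v (-pi) - w (-pi) = 0" by (rule continuous_constant_on_closure)
  then show ?thesis by simp
 qed
 have "v x = w x" for x
 proof -
  define n where "n = \<lfloor>(x + pi) / (2 * pi)\<rfloor>"
  define y where "y = x - 2 * pi * of_int n"
  have "of_int n \<le> (x + pi) / (2 * pi)" "(x + pi) / (2 * pi) < of_int n + 1" unfolding n_def by linarith+
  then have "of_int n * (2 * pi) \<le> x + pi" "x + pi < (of_int n + 1) * (2 * pi)" by (simp_all add: field_simps)
  then have "y \<in> {-pi..<pi}" by (simp add: y_def algebra_simps)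
  then have "v y = w y" using on end' by (cases "y = -pi") auto
  moreover have "v x = v y" "w x = w y"
   using periodic_int[OF assms(1), of y n] periodic_int[OF assms(2), of y n] by (simp_all add: y_def)
  ultimately show ?thesis by simp
 qed
 then show ?thesis by auto
qed

lemma deriv_wiener: "integrable ZM (dcoef c) ==> deriv (wiener c) = wiener (dcoef c)"
 using DERIV_imp_deriv[OF DERIV_wiener] by blast

text \<open>For |x - y| \<le> 1 the bound on the second derivative gives a Lipschitz estimate, and
  |x - y| is below its power \<open>\<alpha>\<close>; for larger distances twice the sup-norm of the
  derivative suffices.\<close>

lemma holder_quotient_bound:
 assumes g: "good c" and \<alpha>: "\<alpha> \<in> {0..<1/2}"
 shows "\<bar>deriv (wiener c) x - deriv (wiener c) y\<bar> \<le> 2 * l1 2 c * \<bar>x - y\<bar> powr \<alpha>"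
proof -
 note gd = goodD[OF g]
 have lip: "\<bar>wiener (dcoef c) x - wiener (dcoef c) y\<bar> \<le> l1 2 c * \<bar>x - y\<bar>"
 proof -
  have "norm (wiener (dcoef c) x - wiener (dcoef c) y) \<le> l1 2 c * norm (x - y)"
  proof (rule field_differentiable_bound[of UNIV])
   show "(wiener (dcoef c) has_field_derivative wiener (dcoef (dcoef c)) z) (at z within UNIV)" for z using DERIV_wiener[OF gd(6)] by simp
   show "norm (wiener (dcoef (dcoef c)) z) \<le> l1 2 c" for z
    using abs_wiener_le[OF gd(6), of z] l1_dcoef[of 0 "dcoef c"] l1_dcoef[of 1 c] by (simp add: l1_def numeral_2_eq_2)
  qed auto
  then show ?thesis by simp
 qed
 have bd: "\<bar>wiener (dcoef c) x - wiener (dcoef c) y\<bar> \<le> 2 * l1 2 c"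
 proof -
  have "\<bar>wiener (dcoef c) z\<bar> \<le> l1 2 c" for z
   using abs_wiener_le[OF gd(5), of z] l1_dcoef[of 0 c] gd(10) by (simp add: l1_def)
  from this[of x] this[of y] show ?thesis by linarith
 qed
 show ?thesis
 proof (cases "x = y")
  case False
  show ?thesis
  proof (cases "\<bar>x - y\<bar> \<le> 1")
   case True
   have "\<bar>x - y\<bar> powr 1 \<le> \<bar>x - y\<bar> powr \<alpha>" using True \<alpha> by (intro powr_mono') auto
   then have "l1 2 c * \<bar>x - y\<bar> \<le> 2 * l1 2 c * \<bar>x - y\<bar> powr \<alpha>"
    using mult_left_mono[of "\<bar>x - y\<bar>" "\<bar>x - y\<bar> powr \<alpha>" "l1 2 c"] by (simp add: mult.assoc) (smt (verit) l1_nonneg mult_nonneg_nonneg powr_ge_zero)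
   then show ?thesis using lip deriv_wiener[OF gd(5)] by simp
  next
   case F: False
   have "1 \<le> \<bar>x - y\<bar> powr \<alpha>" using F \<alpha> by (intro ge_one_powr_ge_zero) auto
   then have "2 * l1 2 c * 1 \<le> 2 * l1 2 c * \<bar>x - y\<bar> powr \<alpha>" by (intro mult_left_mono) auto
   then show ?thesis using bd deriv_wiener[OF gd(5)] by simp
  qed
 qed simp
qed

lemma C1_rep_wiener:
 assumes g: "good c" and \<alpha>: "\<alpha> \<in> {0..<1/2}"
 shows "C1_rep \<alpha> (wiener c) (wiener c)"
 unfolding C1_rep_def
proof (intro conjI allI)
 note gd = goodD[OF g]
 show "wiener c field_differentiable at x" for x using DERIV_wiener[OF gd(5)] unfolding field_differentiable_def by blast
 show "continuous_on UNIV (deriv (wiener c))" unfolding deriv_wiener[OF gd(5)] by (rule continuous_on_wiener[OF gd(5)])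
 show "\<exists>C. \<forall>x y. \<bar>deriv (wiener c) x - deriv (wiener c) y\<bar> \<le> C * \<bar>x - y\<bar> powr \<alpha>"
  using holder_quotient_bound[OF assms] by blast
qed (auto simp: periodic_wiener)

lemma holder_rep:
 assumes g: "good c" and \<alpha>: "\<alpha> \<in> {0..<1/2}"
 shows "(THE v. C1_rep \<alpha> (wiener c) v) = wiener c"
proof (rule the_equality)
 fix v assume v: "C1_rep \<alpha> (wiener c) v"
 have "continuous_on UNIV v" using v unfolding C1_rep_def
  by (intro continuous_at_imp_continuous_on ballI field_differentiable_imp_continuous_at) auto
 then show "v = wiener c" using v goodD(4)[OF g] unfolding C1_rep_def
  by (intro periodic_continuous_AE_eq periodic_wiener continuous_on_wiener) (auto elim: eventually_mono)
qed (rule C1_rep_wiener[OF assms])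

definition sups :: "real => (int => complex) => real" where
 "sups \<alpha> c = (SUP x. \<bar>wiener c x\<bar>) + (SUP x. \<bar>wiener (dcoef c) x\<bar>) +
   (SUP (x, y) \<in> {(x, y). x \<noteq> y}. \<bar>wiener (dcoef c) x - wiener (dcoef c) y\<bar> / \<bar>x - y\<bar> powr \<alpha>)"

lemma fnorm_holder:
 assumes g: "good c" and \<alpha>: "\<alpha> \<in> {0..<1/2}"
 shows "fnorm (holder_C1 \<alpha>) (wiener c) = sups \<alpha> c"
 using holder_rep[OF assms] deriv_wiener[OF goodD(5)[OF g]] by (simp add: holder_C1_def C1_norm_def sups_def)

lemma sup_bounds:
 assumes g: "good c" and \<alpha>: "\<alpha> \<in> {0..<1/2}"
 shows "\<bar>wiener c x\<bar> \<le> l1 2 c" "\<bar>wiener (dcoef c) x\<bar> \<le> l1 2 c"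
  "x \<noteq> y ==> \<bar>wiener (dcoef c) x - wiener (dcoef c) y\<bar> / \<bar>x - y\<bar> powr \<alpha> \<le> 2 * l1 2 c"
proof -
 note gd = goodD[OF g]
 show "\<bar>wiener c x\<bar> \<le> l1 2 c" using abs_wiener_le[OF gd(4), of x] gd(9,10) by (simp add: l1_def)
 show "\<bar>wiener (dcoef c) x\<bar> \<le> l1 2 c" using abs_wiener_le[OF gd(5), of x] l1_dcoef[of 0 c] gd(10) by (simp add: l1_def)
 show "\<bar>wiener (dcoef c) x - wiener (dcoef c) y\<bar> / \<bar>x - y\<bar> powr \<alpha> \<le> 2 * l1 2 c" if "x \<noteq> y"
  using holder_quotient_bound[OF assms, of x y] that unfolding deriv_wiener[OF gd(5)] by (simp add: divide_le_eq)
qed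

lemma tame_holder:
 assumes \<alpha>: "\<alpha> \<in> {0..<1/2}"
 shows "tame (holder_C1 \<alpha>) 2 4"
 unfolding tame_def
proof (intro conjI allI impI)
 fix c assume g: "good c"
 note b = sup_bounds[OF g \<alpha>]
 show "wiener c \<in> elems (holder_C1 \<alpha>)" using C1_rep_wiener[OF g \<alpha>] by (auto simp: holder_C1_def)
 have 1: "0 \<le> (SUP x. \<bar>wiener c x\<bar>)" "(SUP x. \<bar>wiener c x\<bar>) \<le> l1 2 c"
  using b(1) by (auto intro!: cSUP_least cSUP_upper2[of _ _ 0] bdd_aboveI2)
 have 2: "0 \<le> (SUP x. \<bar>wiener (dcoef c) x\<bar>)" "(SUP x. \<bar>wiener (dcoef c) x\<bar>) \<le> l1 2 c"
  using b(2) by (auto intro!: cSUP_least cSUP_upper2[of _ _ 0] bdd_aboveI2)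
 have ne: "{(x, y). x \<noteq> (y::real)} \<noteq> {}" using zero_neq_one[where 'a = real] by blast
 have 3: "0 \<le> (SUP (x, y) \<in> {(x, y). x \<noteq> y}. \<bar>wiener (dcoef c) x - wiener (dcoef c) y\<bar> / \<bar>x - y\<bar> powr \<alpha>)"
  "(SUP (x, y) \<in> {(x, y). x \<noteq> y}. \<bar>wiener (dcoef c) x - wiener (dcoef c) y\<bar> / \<bar>x - y\<bar> powr \<alpha>) \<le> 2 * l1 2 c"
  using b(3) ne by (auto intro!: cSUP_least cSUP_upper2[of _ _ "(0, 1)"] bdd_aboveI2)
 show "0 \<le> fnorm (holder_C1 \<alpha>) (wiener c)" "fnorm (holder_C1 \<alpha>) (wiener c) \<le> 4 * l1 2 c"
  unfolding fnorm_holder[OF g \<alpha>] sups_def using 1 2 3 by linarith+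
qed simp

lemma SUP_add_le:
 fixes f g h :: "'a => real"
 assumes "A \<noteq> {}" "\<And>x. x \<in> A ==> h x \<le> f x + g x" "\<And>x. x \<in> A ==> f x \<le> B" "\<And>x. x \<in> A ==> g x \<le> C"
 shows "(SUP x\<in>A. h x) \<le> (SUP x\<in>A. f x) + (SUP x\<in>A. g x)"
proof (rule cSUP_least[OF assms(1)])
 fix x assume x: "x \<in> A"
 have "f x \<le> (SUP x\<in>A. f x)" "g x \<le> (SUP x\<in>A. g x)" using x assms(3,4) by (auto intro!: cSUP_upper bdd_aboveI2)
 then show "h x \<le> (SUP x\<in>A. f x) + (SUP x\<in>A. g x)" using assms(2)[OF x] by linarith
qed

lemma subadd_holder:
 assumes \<alpha>: "\<alpha> \<in> {0..<1/2}"
 shows "subadd (holder_C1 \<alpha>)"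
 unfolding subadd_def
proof (intro allI impI)
 fix c d assume g: "good c" "good d"
 note bc = sup_bounds[OF g(1) \<alpha>] and bd = sup_bounds[OF g(2) \<alpha>]
 note w = wiener_add[OF goodD(4)[OF g(1)] goodD(4)[OF g(2)]] wiener_add[OF goodD(5)[OF g(1)] goodD(5)[OF g(2)]]
 have ne: "{(x, y). x \<noteq> (y::real)} \<noteq> {}" using zero_neq_one[where 'a = real] by blast
 have 3: "(SUP (x, y) \<in> {(x, y). x \<noteq> y}. \<bar>(wiener (dcoef c) x + wiener (dcoef d) x) - (wiener (dcoef c) y + wiener (dcoef d) y)\<bar> / \<bar>x - y\<bar> powr \<alpha>)
  \<le> (SUP (x, y) \<in> {(x, y). x \<noteq> y}. \<bar>wiener (dcoef c) x - wiener (dcoef c) y\<bar> / \<bar>x - y\<bar> powr \<alpha>)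
   + (SUP (x, y) \<in> {(x, y). x \<noteq> y}. \<bar>wiener (dcoef d) x - wiener (dcoef d) y\<bar> / \<bar>x - y\<bar> powr \<alpha>)"
 proof (rule SUP_add_le[OF ne, where B = "2 * l1 2 c" and C = "2 * l1 2 d"])
  fix z :: "real \<times> real" assume "z \<in> {(x, y). x \<noteq> y}"
  then obtain x y where z: "z = (x, y)" "x \<noteq> y" by auto
  have "\<bar>(wiener (dcoef c) x + wiener (dcoef d) x) - (wiener (dcoef c) y + wiener (dcoef d) y)\<bar> / \<bar>x - y\<bar> powr \<alpha>
   \<le> (\<bar>wiener (dcoef c) x - wiener (dcoef c) y\<bar> + \<bar>wiener (dcoef d) x - wiener (dcoef d) y\<bar>) / \<bar>x - y\<bar> powr \<alpha>"
   by (intro divide_right_mono) auto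
  then show "(case z of (x, y) => \<bar>(wiener (dcoef c) x + wiener (dcoef d) x) - (wiener (dcoef c) y + wiener (dcoef d) y)\<bar> / \<bar>x - y\<bar> powr \<alpha>)
   \<le> (case z of (x, y) => \<bar>wiener (dcoef c) x - wiener (dcoef c) y\<bar> / \<bar>x - y\<bar> powr \<alpha>) + (case z of (x, y) => \<bar>wiener (dcoef d) x - wiener (dcoef d) y\<bar> / \<bar>x - y\<bar> powr \<alpha>)"
   by (simp only: z(1) prod.case add_divide_distrib)
  show "(case z of (x, y) => \<bar>wiener (dcoef c) x - wiener (dcoef c) y\<bar> / \<bar>x - y\<bar> powr \<alpha>) \<le> 2 * l1 2 c"
   using bc(3)[OF z(2)] by (simp only: z(1) prod.case)
  show "(case z of (x, y) => \<bar>wiener (dcoef d) x - wiener (dcoef d) y\<bar> / \<bar>x - y\<bar> powr \<alpha>) \<le> 2 * l1 2 d"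
   using bd(3)[OF z(2)] by (simp only: z(1) prod.case)
 qed
 have 1: "(SUP x. \<bar>wiener c x + wiener d x\<bar>) \<le> (SUP x. \<bar>wiener c x\<bar>) + (SUP x. \<bar>wiener d x\<bar>)"
  using bc(1) bd(1) by (intro SUP_add_le) auto
 have 2: "(SUP x. \<bar>wiener (dcoef c) x + wiener (dcoef d) x\<bar>) \<le> (SUP x. \<bar>wiener (dcoef c) x\<bar>) + (SUP x. \<bar>wiener (dcoef d) x\<bar>)"
  using bc(2) bd(2) by (intro SUP_add_le) auto
 show "fnorm (holder_C1 \<alpha>) (wiener (\<lambda>k. c k + d k)) \<le> fnorm (holder_C1 \<alpha>) (wiener c) + fnorm (holder_C1 \<alpha>) (wiener d)"
  unfolding fnorm_holder[OF g(1) \<alpha>] fnorm_holder[OF g(2) \<alpha>] fnorm_holder[OF good_add[OF g] \<alpha>] sups_def dcoef_add w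
  using 1 2 3 by linarith
qed

text \<open>Translates the \<open>infsum\<close> in the norms of the statement into integrals for
  the counting measure.\<close>

lemma infsum_ZM:
 fixes f :: "int => real"
 assumes "\<And>k. f k \<ge> 0"
 shows "f summable_on UNIV \<longleftrightarrow> integrable ZM f" "integrable ZM f ==> infsum f UNIV = (LINT k|ZM. f k)"
proof -
 show "f summable_on UNIV \<longleftrightarrow> integrable ZM f"
  using summable_on_iff_abs_summable_on_real[of f UNIV] abs_summable_equivalent[of f UNIV] unfolding abs_summable_on_def by blast
 show "integrable ZM f ==> infsum f UNIV = (LINT k|ZM. f k)"
  using infsetsum_infsum[of f UNIV] by (simp add: abs_summable_on_def infsetsum_def)
qed

lemma mean_eq_fourier: "integrable torus u ==> of_real (mean u) = fourier u 0"
 by (simp add: mean_def fourier_cis)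

lemma mean_wiener: "good c ==> mean (wiener c) = 0"
 using mean_eq_fourier[OF integrable_torus_wiener, of c] fourier_wiener[of c 0] goodD[of c] by simp

lemma abs_powr_nat: "mag k powr real s = (if s = 0 \<and> k = 0 then 0 else (mag k) ^ s)"
 by (cases "k = 0") (auto simp: powr_realpow)

text \<open>Each weighted mode is bounded by the whole sum, so one factor of the square can be
  replaced by \<open>l1 1 c\<close>.\<close>

lemma ell_sq:
 assumes g: "good c"
 shows "integrable ZM (\<lambda>k. mag k^2 * (norm (c k))^2)" "(LINT k|ZM. mag k^2 * (norm (c k))^2) \<le> (l1 1 c)^2"
proof -
 note gd = goodD[OF g]
 have i1: "integrable ZM (\<lambda>k. mag k^1 * norm (c k))" using gd(2) by (simp add: ell_def)
 have le: "mag k^2 * (norm (c k))^2 \<le> l1 1 c * (mag k^1 * norm (c k))" for k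
 proof -
  have "mag k^1 * norm (c k) \<le> l1 1 c" unfolding l1_def by (rule le_integral_ZM[OF i1]) simp
  from mult_right_mono[OF this, of "mag k^1 * norm (c k)"] show ?thesis by (simp add: power2_eq_square mult_ac)
 qed
 show i: "integrable ZM (\<lambda>k. mag k^2 * (norm (c k))^2)"
  by (rule B_int_bound[OF integrable_mult_right[OF i1, of "l1 1 c"]]) (use le in \<open>auto intro!: AE_I2 simp: abs_mult\<close>)
 have "(LINT k|ZM. mag k^2 * (norm (c k))^2) \<le> (LINT k|ZM. l1 1 c * (mag k^1 * norm (c k)))"
  using le by (intro integral_mono i integrable_mult_right i1) auto
 then show "(LINT k|ZM. mag k^2 * (norm (c k))^2) \<le> (l1 1 c)^2" by (simp add: l1_def power2_eq_square)
qed

lemma fnorm_Hdot: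
 assumes g: "good c"
 shows "wiener c \<in> elems (Hdot 1)" "fnorm (Hdot 1) (wiener c) = sqrt (LINT k|ZM. mag k^2 * (norm (c k))^2)"
proof -
 note gd = goodD[OF g]
 have f: "fourier (wiener c) = c" using fourier_wiener[OF gd(4,7)] by auto
 have p: "mag k powr 2 = mag k^2" for k using abs_powr_nat[of k 2] by simp
 show "fnorm (Hdot 1) (wiener c) = sqrt (LINT k|ZM. mag k^2 * (norm (c k))^2)"
  using infsum_ZM(2)[OF _ ell_sq(1)[OF g]] by (simp add: Hdot_def f p)
 have sq: "integrable torus (\<lambda>x. (wiener c x)^2)"
 proof (rule integrable_torus_bounded[where C = "(l1 0 c)^2"])
  show "(\<lambda>x. (wiener c x)^2) \<in> borel_measurable torus" using measurable_wiener_torus[OF gd(4)] by measurable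
  show "norm ((wiener c x)^2) \<le> (l1 0 c)^2" for x
   using power_mono[OF abs_wiener_le[OF gd(4), of x], of 2] by (simp add: l1_def)
 qed
 have "integrable ZM (\<lambda>k. (norm (c k))^2)"
 proof (rule B_int_bound[OF ell_sq(1)[OF g]])
  show "AE k in ZM. norm ((norm (c k))^2) \<le> norm (mag k^2 * (norm (c k))^2)"
  proof (rule AE_I2)
   fix k
   show "norm ((norm (c k))^2) \<le> norm (mag k^2 * (norm (c k))^2)"
    using mult_right_mono[OF abs_int_power_mono[of 0 2 k], of "(norm (c k))^2"] gd(8) by (cases "k = 0") (auto simp: abs_mult)
  qed
 qed auto
 then have "integrable ZM (\<lambda>k. (1 + mag k^2) * (norm (c k))^2)" using ell_sq(1)[OF g] by (simp add: distrib_right)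
 then show "wiener c \<in> elems (Hdot 1)"
  using integrable_torus_wiener[OF gd(4)] sq mean_wiener[OF g] infsum_ZM(1)[of "\<lambda>k. (1 + mag k^2) * (norm (c k))^2"]
  by (simp add: Hdot_def f p)
qed

lemma tame_Hdot: "tame (Hdot 1) 1 1"
 unfolding tame_def
proof (intro conjI allI impI)
 fix c assume g: "good c"
 show "wiener c \<in> elems (Hdot 1)" by (rule fnorm_Hdot(1)[OF g])
 show "0 \<le> fnorm (Hdot 1) (wiener c)" unfolding fnorm_Hdot(2)[OF g] by (auto intro!: integral_nonneg_AE)
 have "sqrt (LINT k|ZM. mag k^2 * (norm (c k))^2) \<le> sqrt ((l1 1 c)^2)" by (rule real_sqrt_le_mono[OF ell_sq(2)[OF g]])
 then show "fnorm (Hdot 1) (wiener c) \<le> 1 * l1 1 c" unfolding fnorm_Hdot(2)[OF g] by simp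
qed simp

section \<open>Regularity of paths\<close>

text \<open>Interpolation with the best \<open>\<eta>\<close>. It makes the squares of first-order
  norms integrable in time when the Wiener norm is bounded and \<open>l1 2\<close> is
  integrable.\<close>

lemma l1_1_sq:
 assumes c: "ell 2 c"
 shows "(l1 1 c)^2 \<le> 4 * l1 0 c * l1 2 c"
proof -
 define A B x where "A = l1 0 c" "B = l1 2 c" "x = l1 1 c"
 have nn: "A \<ge> 0" "B \<ge> 0" "x \<ge> 0" by (auto simp: A_B_x_def)
 have le: "x \<le> A / \<eta> + \<eta> * B" if "\<eta> > 0" for \<eta> using l1_1_interpol[OF c that] by (simp add: A_B_x_def)
 have "x^2 \<le> 4 * A * B"
 proof (cases "x = 0")
  case False
  then have x: "x > 0" using nn by simp
  show ?thesis
  proof (cases "B = 0")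
   case True
   \<comment> \<open>If B = 0, interpolation with a large \<open>\<eta>\<close> contradicts x >
     0.\<close>
   have "x \<le> A / ((A + 1) / x)" using le[of "(A + 1) / x"] True x nn by (simp add: add_pos_nonneg)
   also have "... < x" using x nn by (simp add: field_simps)
   finally show ?thesis by simp
  next
   case False
   then have B: "B > 0" using nn by simp
   \<comment> \<open>The choice \<eta> = x / (2 B) leaves half of x on the right, where it is
     absorbed.\<close>
   have "x \<le> 2 * A * B / x + x / 2" using le[of "x / (2 * B)"] x B by (simp add: mult_ac)
   then have "x / 2 \<le> 2 * A * B / x" by simp
   then have "x / 2 * x \<le> 2 * A * B" using x by (simp add: pos_le_divide_eq)
   then show ?thesis by (simp add: power2_eq_square)
  qed
 qed (use nn in simp)
 then show ?thesis by (simp add: A_B_x_def)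
qed

lemma borel_measurable_wiener_path:
 fixes c :: "real => int => complex"
 assumes "\<And>k. (\<lambda>t. c t k) \<in> borel_measurable borel"
 shows "(\<lambda>(t, x). wiener (c t) x) \<in> borel_measurable borel"
proof -
 have "(\<lambda>z::real \<times> real. c (fst z) k * cis (of_int k * snd z)) \<in> borel_measurable (borel :: (real \<times> real) measure)" for k
 proof -
  have "fst \<in> borel_measurable (borel :: (real \<times> real) measure)" "snd \<in> borel_measurable (borel :: (real \<times> real) measure)"
   by (intro borel_measurable_continuous_onI continuous_intros)+
  note fs = this
  have "(\<lambda>z::real \<times> real. c (fst z) k) \<in> borel_measurable borel" by (rule measurable_compose[OF fs(1) assms])
  moreover have "(\<lambda>z::real \<times> real. cis (of_int k * snd z)) \<in> borel_measurable borel" by (rule measurable_compose[OF fs(2) measurable_cis])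
  ultimately show ?thesis by (rule borel_measurable_times)
 qed
 from measurable_integral_ZM[of "\<lambda>k (z::real \<times> real). c (fst z) k * cis (of_int k * snd z)", OF this]
 show ?thesis unfolding wiener_def synth_def case_prod_unfold by measurable
qed

lemma measurable_cylinder_borel: "f \<in> borel_measurable borel ==> f \<in> borel_measurable (cylinder T)"
 unfolding cylinder_def by (rule borel_measurable_lebesgue_on_borel)

lemma finite_measure_cylinder: "finite_measure (cylinder T)"
proof -
 have "{0..T} \<times> {-pi..pi} = cbox (0::real, -pi) (T, pi)" by (simp add: cbox_Pair_eq del: cbox_interval)
 then have "{0..T} \<times> {-pi..pi} \<in> lmeasurable" by (metis lmeasurable_cbox)
 then show ?thesis unfolding cylinder_def by (rule finite_measure_lebesgue_on)
qed

lemma lebesgue_on_subset: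
 fixes h :: "real => 'b::{banach, second_countable_topology}"
 assumes "B \<in> sets borel" "B \<subseteq> {0..T}" "integrable (leb 0 T) h"
 shows "integrable (lebesgue_on B) h" "(LINT t|lebesgue_on B. h t) = (LINT t|leb 0 T. indicator B t *\<^sub>R h t)"
  "integrable (leb 0 T) (\<lambda>t. indicator B t *\<^sub>R h t)"
proof -
 have s: "B \<inter> space lebesgue \<in> sets lebesgue" "{0..T} \<inter> space lebesgue \<in> sets lebesgue" using assms(1) by auto
 have eq: "indicator {0..T} t *\<^sub>R (indicator B t *\<^sub>R h t) = indicator B t *\<^sub>R h t" for t using assms(2) by (auto simp: indicator_def)
 have i: "integrable lebesgue (\<lambda>t. indicator {0..T} t *\<^sub>R h t)" using assms(3) integrable_restrict_space[OF s(2)] by blast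
 have "integrable lebesgue (\<lambda>t. indicator B t *\<^sub>R (indicator {0..T} t *\<^sub>R h t))" using assms(1) by (intro integrable_mult_indicator i) auto
 also have "(\<lambda>t. indicator B t *\<^sub>R (indicator {0..T} t *\<^sub>R h t)) = (\<lambda>t. indicator B t *\<^sub>R h t)" using assms(2) by (intro ext) (auto split: split_indicator)
 finally have ib: "integrable lebesgue (\<lambda>t. indicator B t *\<^sub>R h t)" .
 from ib show "integrable (lebesgue_on B) h" using integrable_restrict_space[OF s(1)] by blast
 show "(LINT t|lebesgue_on B. h t) = (LINT t|leb 0 T. indicator B t *\<^sub>R h t)"
  unfolding integral_restrict_space[OF s(1)] integral_restrict_space[OF s(2)] eq ..
 show "integrable (leb 0 T) (\<lambda>t. indicator B t *\<^sub>R h t)"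
  unfolding integrable_restrict_space[OF s(2)] eq by (rule ib)
qed

lemma finite_measure_on:
 fixes T :: real
 assumes "B \<in> sets borel" "B \<subseteq> {0..T}"
 shows "finite_measure (lebesgue_on B)"
proof (rule finite_measure_lebesgue_on)
 have "bounded B" by (rule bounded_subset[OF bounded_closed_interval[of 0 T] assms(2)])
 then show "B \<in> lmeasurable" using assms(1) by (intro bounded_set_imp_lmeasurable) auto
qed

text \<open>\<open>good\<close> is required at every time, so that no exceptional null set has to be
  carried through the verification of the function spaces; the solution is redefined on a null set
  of times before it enters.\<close>

locale wiener_path =
 fixes c :: "real => int => complex" and E :: real
 assumes meas: "\<And>k. (\<lambda>t. c t k) \<in> borel_measurable borel"
  and good: "\<And>t. good (c t)"
  and bdd: "\<And>t. l1 0 (c t) \<le> E"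
  and int2: "\<And>T. integrable (leb 0 T) (\<lambda>t. l1 2 (c t))"
begin

lemma E_nonneg: "E \<ge> 0" using bdd[of 0] l1_nonneg[of 0 "c 0"] by linarith

lemmas gd = goodD[OF good]

lemma joint: "(\<lambda>(t, x). wiener (c t) x) \<in> borel_measurable (cylinder T)"
 by (intro measurable_cylinder_borel borel_measurable_wiener_path meas)

lemma abs_le: "\<bar>wiener (c t) x\<bar> \<le> E"
 using abs_wiener_le[OF gd(4), of t x] bdd[of t] by (simp add: l1_def)

lemma Linf_cylinder: "(\<lambda>t. wiener (c t)) \<in> Linf_cylinder T"
proof -
 have "esssup (cylinder T) (\<lambda>(t, x). ennreal \<bar>wiener (c t) x\<bar>) \<le> ennreal E"
 proof (rule esssup_I)
  show "(\<lambda>(t, x). ennreal \<bar>wiener (c t) x\<bar>) \<in> borel_measurable (cylinder T)"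
   using joint[of T] unfolding case_prod_unfold by measurable
 qed (use abs_le in \<open>auto intro!: AE_I2 ennreal_leI\<close>)
 then show ?thesis using joint by (auto simp: Linf_cylinder_def intro: order.strict_trans1)
qed

text \<open>Strong measurability asks for approximants that are simple in time and belong to the
  space. Each mode is approximated by simple functions bounded by twice its modulus, and finitely
  many modes are kept; dominated convergence over k gives convergence in \<open>l1 2\<close> at
  every time.\<close>

lemma approx:
 obtains a where "\<And>n. simple_function (leb 0 T) (a n)"
  "\<And>n t. good (a n t)"
  "\<And>t. t \<in> {0..T} ==> (\<lambda>n. l1 2 (\<lambda>k. c t k - a n t k)) \<longlonglongrightarrow> 0"
proof -
 let ?L = "leb 0 T"
 have "\<forall>k. \<exists>F. (\<forall>i. simple_function ?L (F i)) \<and> (\<forall>t\<in>space ?L. (\<lambda>i. F i t) \<longlonglongrightarrow> c t k) \<and>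
  (\<forall>i. \<forall>t\<in>space ?L. dist (F i t) 0 \<le> 2 * dist (c t k) 0)"
  by (rule allI, rule borel_measurable_implies_sequence_metric) (intro borel_measurable_lebesgue_on_borel meas)
 from choice[OF this] obtain F where F0: "\<forall>k. (\<forall>i. simple_function ?L (F k i)) \<and> (\<forall>t\<in>space ?L. (\<lambda>i. F k i t) \<longlonglongrightarrow> c t k) \<and>
  (\<forall>i. \<forall>t\<in>space ?L. dist (F k i t) 0 \<le> 2 * dist (c t k) 0)" by blast
 have F: "\<And>k i. simple_function ?L (F k i)" "\<And>k t. t \<in> {0..T} ==> (\<lambda>i. F k i t) \<longlonglongrightarrow> c t k"
  "\<And>k i t. t \<in> {0..T} ==> norm (F k i t) \<le> 2 * norm (c t k)"
  using F0 by auto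
 \<comment> \<open>Negative modes are conjugates of positive ones, which keeps the approximants
   \<open>hermitian\<close>. The frequency cutoff m is separated from the accuracy n so that
   simplicity can be proved by induction on m.\<close>
 define b where "b m n t k = (if 1 \<le> k \<and> k \<le> int m then F k n t else if - int m \<le> k \<and> k \<le> -1 then cnj (F (- k) n t) else 0)" for m n :: nat and t and k :: int
 have bs: "simple_function ?L (b m n)" for m n
 proof (induction m)
  case 0
  have "b 0 n = (\<lambda>t k. 0)" by (intro ext) (auto simp: b_def)
  then show ?case by simp
 next
  case (Suc m)
  have "b (Suc m) n = (\<lambda>t. (\<lambda>z g. g(int m + 1 := z, - int m - 1 := cnj z)) (F (int m + 1) n t) (b m n t))"
   by (intro ext) (auto simp: b_def add.commute)
  then show ?case using simple_function_compose2[OF F(1) Suc, of "\<lambda>z g. g(int m + 1 := z, - int m - 1 := cnj z)" "int m + 1" n] by (simp only:)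
 qed
 define a where "a n = b n n" for n
 have ag: "good (a n t)" for n t
 proof -
  have "ell 2 (a n t)" unfolding ell_def by (rule integrable_ZM_finite[of "{- int n..int n}"]) (auto simp: a_def b_def)
  then show ?thesis by (auto simp: good_def a_def b_def hermitian_def)
 qed
 have ab: "norm (a n t k) \<le> 2 * norm (c t k)" if t: "t \<in> {0..T}" for n t k
  using F(3)[OF t, of k n] F(3)[OF t, of "- k" n] gd(7)[of t] by (auto simp: a_def b_def hermitian_def)
 have al: "(\<lambda>n. a n t k) \<longlonglongrightarrow> c t k" if t: "t \<in> {0..T}" for t k
 proof -
  have ev: "eventually (\<lambda>n. int n \<ge> \<bar>k\<bar>) sequentially" using eventually_ge_at_top[of "nat \<bar>k\<bar>"] by eventually_elim auto
  consider "k = 0" | "k > 0" | "k < 0" by linarith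
  then show ?thesis
  proof cases
   case 1
   then show ?thesis using gd(8)[of t] by (simp add: a_def b_def)
  next
   case 2
   have "eventually (\<lambda>n. F k n t = a n t k) sequentially" using ev by eventually_elim (use 2 in \<open>auto simp: a_def b_def\<close>)
   then show ?thesis by (rule Lim_transform_eventually[OF F(2)[OF t, of k]])
  next
   case 3
   have "eventually (\<lambda>n. cnj (F (- k) n t) = a n t k) sequentially" using ev by eventually_elim (use 3 in \<open>auto simp: a_def b_def\<close>)
   moreover have "(\<lambda>n. cnj (F (- k) n t)) \<longlonglongrightarrow> cnj (c t (- k))" using F(2)[OF t, of "- k"] by (intro tendsto_intros)
   moreover have "cnj (c t (- k)) = c t k" using gd(7)[of t] by (simp add: hermitian_def)
   ultimately show ?thesis using Lim_transform_eventually[of "\<lambda>n. cnj (F (- k) n t)" "c t k" sequentially "\<lambda>n. a n t k"] by simp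
  qed
 qed
 show thesis
 proof (rule that[of a])
  fix t assume t: "t \<in> {0..T}"
  have "(\<lambda>n. l1 2 (\<lambda>k. c t k - a n t k)) \<longlonglongrightarrow> (LINT k|ZM. mag k^2 * norm (c t k - c t k))"
   unfolding l1_def
  proof (rule integral_dominated_convergence[where w = "\<lambda>k. 3 * (mag k^2 * norm (c t k))"])
   show "integrable ZM (\<lambda>k. 3 * (mag k^2 * norm (c t k)))" using gd(1)[of t] by (simp add: ell_def)
   show "AE k in ZM. (\<lambda>n. mag k ^ 2 * cmod (c t k - a n t k)) \<longlonglongrightarrow> mag k ^ 2 * cmod (c t k - c t k)"
    by (intro AE_I2 tendsto_intros al t)
   show "AE k in ZM. norm (mag k ^ 2 * cmod (c t k - a n t k)) \<le> 3 * (mag k ^ 2 * cmod (c t k))" for n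
   proof (rule AE_I2)
    fix k
    have "norm (c t k - a n t k) \<le> 3 * norm (c t k)" using ab[OF t, of n k] norm_triangle_ineq4[of "c t k" "a n t k"] by linarith
    from mult_left_mono[OF this, of "mag k^2"]
    show "norm (mag k ^ 2 * cmod (c t k - a n t k)) \<le> 3 * (mag k ^ 2 * cmod (c t k))" by (simp add: abs_mult)
   qed
  qed auto
  then show "(\<lambda>n. l1 2 (\<lambda>k. c t k - a n t k)) \<longlonglongrightarrow> 0" by simp
 qed (use bs ag in \<open>auto simp: a_def\<close>)
qed

lemma tame_tendsto:
 assumes X: "tame X s C" "s \<le> 2" and a: "\<And>n. good (a n)" "(\<lambda>n. l1 2 (\<lambda>k. c t k - a n k)) \<longlonglongrightarrow> 0"
 shows "(\<lambda>n. fnorm X (wiener (\<lambda>k. c t k - a n k))) \<longlonglongrightarrow> 0"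
proof (rule tendsto_sandwich[where f = "\<lambda>_. 0" and h = "\<lambda>n. C * l1 2 (\<lambda>k. c t k - a n k)"])
 have X2: "tame X 2 C" using X by (intro tame_mono[OF X(1)]) auto
 show "\<forall>\<^sub>F n in sequentially. 0 \<le> fnorm X (wiener (\<lambda>k. c t k - a n k))"
  "\<forall>\<^sub>F n in sequentially. fnorm X (wiener (\<lambda>k. c t k - a n k)) \<le> C * l1 2 (\<lambda>k. c t k - a n k)"
  using X2 good_diff[OF good a(1)] unfolding tame_def by auto
 show "(\<lambda>n. C * l1 2 (\<lambda>k. c t k - a n k)) \<longlonglongrightarrow> 0" using tendsto_mult_right_zero[OF a(2)] by simp
qed auto

lemma strongly_measurable:
 assumes X: "tame X s C" "s \<le> 2"
 shows "strongly_measurable T X (\<lambda>t. wiener (c t))"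
proof -
 obtain a where a: "\<And>n. simple_function (leb 0 T) (a n)" "\<And>n t. good (a n t)"
  "\<And>t. t \<in> {0..T} ==> (\<lambda>n. l1 2 (\<lambda>k. c t k - a n t k)) \<longlonglongrightarrow> 0"
  by (rule approx[of T]) blast
 show ?thesis unfolding strongly_measurable_def
 proof (intro exI[of _ "\<lambda>n t. wiener (a n t)"] conjI allI)
  show "simple_function (leb 0 T) (\<lambda>t. wiener (a n t))" for n by (rule simple_function_compose1[OF a(1)])
  show "(\<lambda>t. wiener (a n t)) ` {0..T} \<subseteq> elems X" for n using X(1) a(2) by (auto simp: tame_def)
  show "AE t in leb 0 T. wiener (c t) \<in> elems X \<and> (\<lambda>n. fnorm X (\<lambda>x. wiener (c t) x - wiener (a n t) x)) \<longlonglongrightarrow> 0"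
  proof (intro AE_I2 conjI)
   fix t assume "t \<in> space (leb 0 T)"
   then have t: "t \<in> {0..T}" by simp
   show "wiener (c t) \<in> elems X" using X(1) good by (simp add: tame_def)
   have "(\<lambda>x. wiener (c t) x - wiener (a n t) x) = wiener (\<lambda>k. c t k - a n t k)" for n
    using wiener_diff[OF gd(4) goodD(4)[OF a(2)]] by (intro ext) simp
   then show "(\<lambda>n. fnorm X (\<lambda>x. wiener (c t) x - wiener (a n t) x)) \<longlonglongrightarrow> 0"
    using tame_tendsto[OF X a(2) a(3)[OF t]] by simp
  qed
 qed
qed

text \<open>Subadditivity, used in both directions, makes the norm continuous along the
  approximants, so the norm of the path is a pointwise limit of simple functions.\<close>

lemma measurable_fnorm:
 assumes X: "tame X s C" "s \<le> 2" "subadd X"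
 shows "(\<lambda>t. fnorm X (wiener (c t))) \<in> borel_measurable (leb 0 T)"
proof -
 obtain a where a: "\<And>n. simple_function (leb 0 T) (a n)" "\<And>n t. good (a n t)"
  "\<And>t. t \<in> {0..T} ==> (\<lambda>n. l1 2 (\<lambda>k. c t k - a n t k)) \<longlonglongrightarrow> 0"
  by (rule approx[of T]) blast
 show ?thesis
 proof (rule borel_measurable_LIMSEQ_metric)
  show "(\<lambda>t. fnorm X (wiener (a n t))) \<in> borel_measurable (leb 0 T)" for n
   by (intro borel_measurable_simple_function simple_function_compose1[OF a(1)])
  fix t assume "t \<in> space (leb 0 T)"
  then have t: "t \<in> {0..T}" by simp
  have sym: "fnorm X (wiener (\<lambda>k. a n t k - c t k)) \<le> C * l1 2 (\<lambda>k. c t k - a n t k)" for n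
  proof -
   have "tame X 2 C" using X by (intro tame_mono[OF X(1)]) auto
   then have "fnorm X (wiener (\<lambda>k. a n t k - c t k)) \<le> C * l1 2 (\<lambda>k. a n t k - c t k)"
    using good_diff[OF a(2) good] by (simp add: tame_def)
   then show ?thesis by (simp add: l1_def norm_minus_commute)
  qed
  have sym2: "fnorm X (wiener (\<lambda>k. c t k - a n t k)) \<le> C * l1 2 (\<lambda>k. c t k - a n t k)" for n
  proof -
   have "tame X 2 C" using X by (intro tame_mono[OF X(1)]) auto
   then show ?thesis using good_diff[OF good a(2)] by (simp add: tame_def)
  qed
  have up: "fnorm X (wiener (c t)) \<le> fnorm X (wiener (a n t)) + fnorm X (wiener (\<lambda>k. c t k - a n t k))" for n
   using X(3) a(2)[of n t] good_diff[OF good[of t] a(2)[of n t]] unfolding subadd_def by fastforce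
  have lo: "fnorm X (wiener (a n t)) \<le> fnorm X (wiener (c t)) + fnorm X (wiener (\<lambda>k. a n t k - c t k))" for n
   using X(3) good[of t] good_diff[OF a(2)[of n t] good[of t]] unfolding subadd_def by fastforce
  have "(\<lambda>n. fnorm X (wiener (a n t)) - fnorm X (wiener (c t))) \<longlonglongrightarrow> 0"
  proof (rule Lim_null_comparison)
   show "\<forall>\<^sub>F n in sequentially. norm (fnorm X (wiener (a n t)) - fnorm X (wiener (c t))) \<le> C * l1 2 (\<lambda>k. c t k - a n t k)"
    using up lo sym sym2 by (intro always_eventually allI) (smt (verit) real_norm_def)
   show "(\<lambda>n. C * l1 2 (\<lambda>k. c t k - a n t k)) \<longlonglongrightarrow> 0" using tendsto_mult_right_zero[OF a(3)[OF t]] by simp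
  qed
  then show "(\<lambda>n. fnorm X (wiener (a n t))) \<longlonglongrightarrow> fnorm X (wiener (c t))" by (simp add: LIM_zero_iff)
 qed
qed

text \<open>For p = 1 the norm is controlled by \<open>l1 2\<close>, which is integrable. For p = 2
  it is controlled by \<open>l1 1\<close>, whose square interpolates between the bound
  \<open>E\<close> and \<open>l1 2\<close>.\<close>

lemma bochner:
 assumes X: "tame X s C" and ps: "p = 1 \<and> s = 2 \<or> p = 2 \<and> s = 1"
  and m: "(\<lambda>t. fnorm X (wiener (c t))) \<in> borel_measurable (leb 0 T)"
 shows "(\<lambda>t. wiener (c t)) \<in> bochner p T X"
proof -
 have "integrable (leb 0 T) (\<lambda>t. fnorm X (wiener (c t)) ^ p)"
 proof (rule B_int_bound[where f = "\<lambda>t. (C + 4 * C^2 * E) * l1 2 (c t)"])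
  show "integrable (leb 0 T) (\<lambda>t. (C + 4 * C^2 * E) * l1 2 (c t))" using int2 by simp
  show "(\<lambda>t. fnorm X (wiener (c t)) ^ p) \<in> borel_measurable (leb 0 T)" using m by measurable
  show "AE t in leb 0 T. norm (fnorm X (wiener (c t)) ^ p) \<le> norm ((C + 4 * C^2 * E) * l1 2 (c t))"
  proof (rule AE_I2)
   fix t
   have b: "0 \<le> fnorm X (wiener (c t))" "fnorm X (wiener (c t)) \<le> C * l1 s (c t)" "C \<ge> 0" using X good by (auto simp: tame_def)
   have "fnorm X (wiener (c t)) ^ p \<le> (C + 4 * C^2 * E) * l1 2 (c t)"
   proof (cases "p = 1")
    case True
    then have "fnorm X (wiener (c t)) ^ p \<le> C * l1 2 (c t)" using b ps by auto
    moreover have "0 \<le> 4 * C^2 * E * l1 2 (c t)" using E_nonneg by simp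
    ultimately show ?thesis unfolding distrib_right by linarith
   next
    case False
    then have ps': "p = 2" "s = 1" using ps by auto
    have "fnorm X (wiener (c t)) ^ 2 \<le> (C * l1 1 (c t))^2" using b ps' by (intro power_mono) auto
    also have "... \<le> C^2 * (4 * l1 0 (c t) * l1 2 (c t))" unfolding power_mult_distrib by (intro mult_left_mono l1_1_sq gd) auto
    also have "... \<le> C^2 * (4 * E * l1 2 (c t))" using bdd[of t] by (intro mult_left_mono mult_right_mono) auto
    finally have "fnorm X (wiener (c t)) ^ p \<le> 4 * C^2 * E * l1 2 (c t)" by (simp add: ps' mult_ac)
    moreover have "0 \<le> C * l1 2 (c t)" using b by simp
    ultimately show ?thesis unfolding distrib_right by linarith
   qed
   moreover have "0 \<le> fnorm X (wiener (c t)) ^ p" using b by simp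
   ultimately show "norm (fnorm X (wiener (c t)) ^ p) \<le> norm ((C + 4 * C^2 * E) * l1 2 (c t))" by simp
  qed
 qed
 moreover have "s \<le> 2" using ps by auto
 ultimately show ?thesis using joint strongly_measurable[OF X] by (simp add: bochner_def)
qed

lemma measurable_fnorm_Hdot: "(\<lambda>t. fnorm (Hdot 1) (wiener (c t))) \<in> borel_measurable (leb 0 T)"
proof -
 have "(\<lambda>t. sqrt (LINT k|ZM. mag k^2 * (norm (c t k))^2)) \<in> borel_measurable (leb 0 T)"
 proof (rule measurable_compose[OF _ borel_measurable_sqrt], rule measurable_integral_ZM)
  fix k
  have "(\<lambda>t. c t k) \<in> borel_measurable (leb 0 T)" by (intro borel_measurable_lebesgue_on_borel meas)
  then show "(\<lambda>t. mag k^2 * (norm (c t k))^2) \<in> borel_measurable (leb 0 T)" by measurable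
 qed
 then show ?thesis by (simp only: fnorm_Hdot(2)[OF good])
qed

section \<open>The path as a vector-valued measure\<close>

definition tint :: "real set => int => complex" where
 "tint B k = (LINT t|lebesgue_on B. c t k)"

definition mass :: "real set => real" where
 "mass B = (LINT t|lebesgue_on B. l1 2 (c t))"

lemma coeff_integrable:
 assumes "B \<in> sets borel" "B \<subseteq> {0..T}"
 shows "integrable (lebesgue_on B) (\<lambda>t. c t k)"
proof (rule finite_measure.integrable_const_bound[OF finite_measure_on[OF assms]])
 show "AE t in lebesgue_on B. norm (c t k) \<le> E" using norm_le_l1_0[OF gd(3)] bdd by (intro AE_I2) (meson order_trans)
qed (intro borel_measurable_lebesgue_on_borel meas)

text \<open>Sum and time integral can be exchanged because \<open>l1 2\<close> is integrable in
  time. The value of the measure on \<open>B\<close> is therefore again a series with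
  \<open>good\<close> coefficients, bounded by the scalar measure \<open>mass\<close>.\<close>

lemma tint_good:
 assumes B: "B \<in> sets borel" "B \<subseteq> {0..T}"
 shows "good (tint B)" "l1 2 (tint B) \<le> mass B"
  "wiener (tint B) x = (LINT t|lebesgue_on B. wiener (c t) x)"
proof -
 let ?L = "lebesgue_on B"
 have sf: "sigma_finite_measure ?L" using finite_measure_on[OF B] by (rule finite_measure.axioms(1))
 have mc: "(\<lambda>t. c t k) \<in> borel_measurable ?L" for k by (intro borel_measurable_lebesgue_on_borel meas)
 have i2: "integrable ?L (\<lambda>t. l1 2 (c t))" by (rule lebesgue_on_subset(1)[OF B int2])
 have m2: "(\<lambda>t. mag k^2 * norm (c t k)) \<in> borel_measurable ?L" for k using mc by measurable
 have fin: "(\<integral>\<^sup>+t. \<integral>\<^sup>+k. ennreal (norm (mag k^2 * norm (c t k))) \<partial>ZM \<partial>?L) < \<infinity>"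
 proof -
  have "(\<integral>\<^sup>+t. \<integral>\<^sup>+k. ennreal (norm (mag k^2 * norm (c t k))) \<partial>ZM \<partial>?L) = (\<integral>\<^sup>+t. ennreal (l1 2 (c t)) \<partial>?L)"
  proof (rule nn_integral_cong)
   fix t
   show "(\<integral>\<^sup>+k. ennreal (norm (mag k^2 * norm (c t k))) \<partial>ZM) = ennreal (l1 2 (c t))"
    using gd(1)[of t] unfolding l1_def by (subst nn_integral_eq_integral[symmetric]) (auto simp: ell_def)
  qed
  also have "... < \<infinity>" using i2 by (simp add: integrable_iff_bounded)
  finally show ?thesis .
 qed
 note sw = integral_ZM_swap[OF sf m2 fin]
 have le: "mag k^2 * norm (tint B k) \<le> (LINT t|?L. mag k^2 * norm (c t k))" for k
 proof -
  have "norm (tint B k) \<le> (LINT t|?L. norm (c t k))" unfolding tint_def by (rule integral_norm_bound)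
  from mult_left_mono[OF this, of "mag k^2"] show ?thesis by simp
 qed
 have e: "ell 2 (tint B)" unfolding ell_def
  by (rule B_int_bound[OF sw(4)]) (use le in \<open>auto intro!: AE_I2 order_trans[OF le] simp: abs_mult\<close>)
 have "l1 2 (tint B) \<le> (LINT k|ZM. (LINT t|?L. mag k^2 * norm (c t k)))"
  unfolding l1_def using e sw(4) le by (intro integral_mono) (auto simp: ell_def)
 also have "... = mass B" unfolding mass_def l1_def using sw(5) by simp
 finally show "l1 2 (tint B) \<le> mass B" .
 have "tint B (- k) = cnj (tint B k)" for k
  using gd(7) unfolding tint_def hermitian_def by (subst B_itg_cnj[symmetric]) simp
 moreover have "tint B 0 = 0" using gd(8) by (simp add: tint_def)
 ultimately show g: "good (tint B)" using e by (simp add: good_def hermitian_def)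
 have mcx: "(\<lambda>t. c t k * cis (of_int k * x)) \<in> borel_measurable ?L" for k using mc by measurable
 have fin0: "(\<integral>\<^sup>+t. \<integral>\<^sup>+k. ennreal (norm (c t k * cis (of_int k * x))) \<partial>ZM \<partial>?L) < \<infinity>"
 proof -
  have "(\<integral>\<^sup>+t. \<integral>\<^sup>+k. ennreal (norm (c t k * cis (of_int k * x))) \<partial>ZM \<partial>?L) \<le> (\<integral>\<^sup>+t. ennreal (l1 2 (c t)) \<partial>?L)"
  proof (rule nn_integral_mono)
   fix t
   have "(\<integral>\<^sup>+k. ennreal (norm (c t k * cis (of_int k * x))) \<partial>ZM) = ennreal (l1 0 (c t))"
    using gd(3)[of t] unfolding l1_def by (subst nn_integral_eq_integral[symmetric]) (auto simp: ell_def norm_mult)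
   also have "... \<le> ennreal (l1 2 (c t))" using gd(9,10)[of t] by (intro ennreal_leI) auto
   finally show "(\<integral>\<^sup>+k. ennreal (norm (c t k * cis (of_int k * x))) \<partial>ZM) \<le> ennreal (l1 2 (c t))" .
  qed
  also have "... < \<infinity>" using i2 by (simp add: integrable_iff_bounded)
  finally show ?thesis .
 qed
 note sx = integral_ZM_swap[OF sf mcx fin0]
 have "synth (tint B) x = (LINT t|?L. synth (c t) x)"
  unfolding synth_def tint_def using sx(5) by simp
 moreover have "integrable ?L (\<lambda>t. synth (c t) x)" using sx(2) by (simp add: synth_def)
 ultimately show "wiener (tint B) x = (LINT t|?L. wiener (c t) x)"
  unfolding wiener_def by simp
qed

lemma tint_Un:
 assumes "A \<in> sets borel" "A \<subseteq> {0..T}" "B \<in> sets borel" "B \<subseteq> {0..T}" "A \<inter> B = {}"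
 shows "tint (A \<union> B) k = tint A k + tint B k"
proof -
 have AB: "A \<union> B \<in> sets borel" "A \<union> B \<subseteq> {0..T}" using assms by auto
 have i: "integrable (leb 0 T) (\<lambda>t. c t k)" by (rule coeff_integrable[of _ T]) auto
 have ind: "indicator (A \<union> B) t *\<^sub>R c t k = indicator A t *\<^sub>R c t k + indicator B t *\<^sub>R c t k" for t
  using assms(5) by (auto simp: indicator_def)
 show ?thesis unfolding tint_def lebesgue_on_subset(2)[OF AB i] lebesgue_on_subset(2)[OF assms(1,2) i] lebesgue_on_subset(2)[OF assms(3,4) i] ind
  by (rule B_itg_add[OF lebesgue_on_subset(3)[OF assms(1,2) i] lebesgue_on_subset(3)[OF assms(3,4) i]])
qed

lemma sets_Icc: "B \<in> sets (restrict_space borel {0..T}) \<longleftrightarrow> B \<in> sets borel \<and> B \<subseteq> {0..T::real}"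
 by (subst sets_restrict_space_iff) auto

text \<open>Countable additivity and bounded variation are inherited from the finite scalar measure
  with density \<open>l1 2\<close>, which dominates the norm of the vector measure.\<close>

lemma measures_valued:
 assumes X: "tame X s C" "s \<le> 2"
 shows "(\<lambda>t. wiener (c t)) \<in> measures_valued T X"
proof -
 have X2: "tame X 2 C" using X by (intro tame_mono[OF X(1)]) auto
 then have C: "C \<ge> 0" by (simp add: tame_def)
 have bound: "0 \<le> fnorm X (wiener (tint B))" "fnorm X (wiener (tint B)) \<le> C * mass B" "wiener (tint B) \<in> elems X" 
  if "B \<in> sets borel" "B \<subseteq> {0..T}" for B
  using X2 tint_good(1,2)[OF that] mult_left_mono[OF tint_good(2)[OF that] C] unfolding tame_def by (auto intro: order_trans)
 have int: "integrable (cylinder T) (\<lambda>(t, x). wiener (c t) x)"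
  by (rule finite_measure.integrable_const_bound[OF finite_measure_cylinder, where B = E]) (use abs_le joint in auto)
 have "radon_measure T X (\<lambda>B. wiener (tint B))"
  unfolding radon_measure_def
 proof (intro conjI ballI allI impI)
  show "wiener (tint B) \<in> elems X" if "B \<in> sets (restrict_space borel {0..T})" for B using that bound(3) sets_Icc by blast
 next
  fix B :: "nat => real set"
  assume B: "range B \<subseteq> sets (restrict_space borel {0..T})" "disjoint_family B"
  \<comment> \<open>Tail unions: after n summands the remainder is the measure of
    \<open>V n\<close>, and these sets decrease to the empty set.\<close>
  define V where "V n = (\<Union>i\<in>{n..}. B i)" for n
  have Bs: "B i \<in> sets borel" "B i \<subseteq> {0..T}" for i using B(1) sets_Icc by blast+
  have Vs: "V n \<in> sets borel" "V n \<subseteq> {0..T}" for n using Bs unfolding V_def by auto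
  have dis: "B n \<inter> V (Suc n) = {}" for n
  proof -
   have "B n \<inter> B i = {}" if "i \<ge> Suc n" for i using B(2) that unfolding disjoint_family_on_def by (metis Suc_n_not_le_n UNIV_I)
   then show ?thesis unfolding V_def by blast
  qed
  have Veq: "V n = B n \<union> V (Suc n)" for n 
  proof -
   have "{n..} = insert n {Suc n..}" by auto
   then show ?thesis unfolding V_def by simp
  qed
  have step: "wiener (tint (V 0)) x - (\<Sum>i<n. wiener (tint (B i)) x) = wiener (tint (V n)) x" for n x
  proof (induction n)
   case (Suc n)
   have "tint (V n) = (\<lambda>k. tint (B n) k + tint (V (Suc n)) k)"
    using tint_Un[OF Bs Vs dis] Veq[of n] by auto
   then have "wiener (tint (V n)) x = wiener (tint (B n)) x + wiener (tint (V (Suc n))) x"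
    using wiener_add[OF goodD(4)[OF tint_good(1)[OF Bs]] goodD(4)[OF tint_good(1)[OF Vs]]] by simp
   then show ?case using Suc by simp
  qed simp
  have V0: "(\<Union>i. B i) = V 0" by (auto simp: V_def)
  have "(\<lambda>n. mass (V n)) \<longlonglongrightarrow> (LINT t|leb 0 T. 0)"
   unfolding mass_def lebesgue_on_subset(2)[OF Vs int2]
  proof (rule integral_dominated_convergence[where w = "\<lambda>t. l1 2 (c t)"])
   show "AE t in leb 0 T. (\<lambda>n. indicator (V n) t *\<^sub>R l1 2 (c t)) \<longlonglongrightarrow> 0"
   proof (rule AE_I2)
    fix t
    have "\<exists>N. \<forall>n\<ge>N. t \<notin> V n"
    proof (cases "\<exists>i. t \<in> B i")
     case True
     then obtain i where "t \<in> B i" by auto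
     then have "t \<notin> B j" if "j \<noteq> i" for j using B(2) that unfolding disjoint_family_on_def by blast
     then have "t \<notin> V n" if "n \<ge> Suc i" for n using that unfolding V_def by fastforce
     then show ?thesis by blast
    qed (auto simp: V_def)
    then have "eventually (\<lambda>n. indicator (V n) t *\<^sub>R l1 2 (c t) = 0) sequentially"
     unfolding eventually_sequentially by (auto simp: indicator_def)
    then show "(\<lambda>n. indicator (V n) t *\<^sub>R l1 2 (c t)) \<longlonglongrightarrow> 0" by (rule tendsto_eventually)
   qed
   show "(\<lambda>t. indicator (V n) t *\<^sub>R l1 2 (c t)) \<in> borel_measurable (leb 0 T)" for n
    by (rule borel_measurable_integrable[OF lebesgue_on_subset(3)[OF Vs int2]])
   show "AE t in leb 0 T. norm (indicator (V n) t *\<^sub>R l1 2 (c t)) \<le> l1 2 (c t)" for n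
    by (intro AE_I2) (auto simp: indicator_def)
  qed (use int2 in auto)
  then have ml: "(\<lambda>n. C * mass (V n)) \<longlonglongrightarrow> 0" using tendsto_mult_right_zero[of "\<lambda>n. mass (V n)" sequentially C] by simp
  show "(\<lambda>n. fnorm X (\<lambda>x. wiener (tint (\<Union>i. B i)) x - (\<Sum>i<n. wiener (tint (B i)) x))) \<longlonglongrightarrow> 0"
   unfolding V0 step
   by (rule tendsto_sandwich[where f = "\<lambda>_. 0", OF _ _ _ ml]) (use bound[OF Vs] in auto)
 next
  show "\<exists>K. \<forall>\<B>. finite \<B> \<longrightarrow> \<B> \<subseteq> sets (restrict_space borel {0..T}) \<longrightarrow> disjoint \<B> \<longrightarrow> (\<Sum>B\<in>\<B>. fnorm X (wiener (tint B))) \<le> K"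
  proof (intro exI[of _ "C * mass {0..T}"] allI impI)
   fix \<B> assume F: "finite \<B>" "\<B> \<subseteq> sets (restrict_space borel {0..T})" "disjoint \<B>"
   have Bs: "B \<in> sets borel" "B \<subseteq> {0..T}" if "B \<in> \<B>" for B using that F(2) sets_Icc by blast+
   have "(\<Sum>B\<in>\<B>. fnorm X (wiener (tint B))) \<le> (\<Sum>B\<in>\<B>. C * mass B)" using bound(2)[OF Bs] by (intro sum_mono) auto
   also have "... = C * (\<Sum>B\<in>\<B>. LINT t|leb 0 T. indicator B t *\<^sub>R l1 2 (c t))"
    unfolding sum_distrib_left mass_def by (intro sum.cong refl) (simp add: lebesgue_on_subset(2)[OF Bs int2])
   also have "(\<Sum>B\<in>\<B>. LINT t|leb 0 T. indicator B t *\<^sub>R l1 2 (c t)) = (LINT t|leb 0 T. (\<Sum>B\<in>\<B>. indicator B t *\<^sub>R l1 2 (c t)))"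
    by (rule Bochner_Integration.integral_sum[symmetric]) (rule lebesgue_on_subset(3)[OF Bs int2])
   also have "... \<le> (LINT t|leb 0 T. l1 2 (c t))"
   proof (rule integral_mono)
    show "integrable (leb 0 T) (\<lambda>t. \<Sum>B\<in>\<B>. indicator B t *\<^sub>R l1 2 (c t))"
     by (intro Bochner_Integration.integrable_sum lebesgue_on_subset(3)[OF Bs int2])
    fix t
    have "(\<Sum>B\<in>\<B>. indicator B t) \<le> (1::real)"
    proof (cases "\<exists>B\<in>\<B>. t \<in> B")
     case True
     then obtain B0 where B0: "B0 \<in> \<B>" "t \<in> B0" by auto
     have "(\<Sum>B\<in>\<B>. indicator B t :: real) = (\<Sum>B\<in>\<B>. if B = B0 then 1 else 0)"
      using F(3) B0 by (intro sum.cong) (auto simp: indicator_def disjoint_def)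
     then show ?thesis using F(1) B0 by simp
    qed (auto simp: indicator_def sum.neutral)
    then show "(\<Sum>B\<in>\<B>. indicator B t *\<^sub>R l1 2 (c t)) \<le> l1 2 (c t)"
     unfolding real_scaleR_def sum_distrib_right[symmetric] using mult_right_mono[of _ 1 "l1 2 (c t)"] by fastforce
   qed (rule int2)
   finally show "(\<Sum>B\<in>\<B>. fnorm X (wiener (tint B))) \<le> C * mass {0..T}" using C by (simp add: mass_def mult_left_mono)
  qed
 qed
 moreover have "\<forall>B\<in>sets (restrict_space borel {0..T}). AE x in torus. wiener (tint B) x = (LINT t|lebesgue_on B. wiener (c t) x)"
  using tint_good(3) sets_Icc by (intro ballI AE_I2) blast
 ultimately show ?thesis using int unfolding measures_valued_def by blast
qed

lemma regularity:
 assumes "\<alpha> \<in> {0..<1/2}"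
 shows "(\<lambda>t. wiener (c t)) \<in> regularity_class T \<alpha>"
 unfolding regularity_class_def
 using Linf_cylinder measures_valued[OF tame_sobolev_2_Linf]
  bochner[OF tame_sobolev_1_Linf _ measurable_fnorm[OF tame_sobolev_1_Linf _ subadd_sobolev_1_Linf]]
  bochner[OF tame_holder[OF assms] _ measurable_fnorm[OF tame_holder[OF assms] _ subadd_holder[OF assms]]]
  bochner[OF tame_Hdot _ measurable_fnorm_Hdot]
 by simp

lemma bochner_W11: "(\<lambda>t. wiener (c t)) \<in> bochner 1 T (sobolev 1 L1)"
 using bochner[OF tame_sobolev_1_L1 _ measurable_fnorm[OF tame_sobolev_1_L1 _ subadd_sobolev_1_L1]] by simp

end

section \<open>Fubini on the cylinder\<close>

lemma nn_integral_lebesgue_on: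
 fixes f :: "'a::euclidean_space => ennreal"
 assumes "S \<in> sets borel"
 shows "(\<integral>\<^sup>+x. f x \<partial>lebesgue_on S) = (\<integral>\<^sup>+x. f x * indicator S x \<partial>lborel)"
 using assms by (subst nn_integral_restrict_space) (auto simp: nn_integral_completion)

lemma sets_rect: "{0..T} \<times> {-pi..pi} \<in> sets (borel :: (real \<times> real) measure)"
 by (intro borel_closed closed_Times) auto

lemma space_cylinder: "space (cylinder T) = {0..T} \<times> {-pi..pi}"
 by (simp add: cylinder_def)

lemma borel_pair_section:
 assumes "f \<in> borel_measurable (borel :: (real \<times> real) measure)"
 shows "(\<lambda>x. f (t, x)) \<in> borel_measurable borel" "(\<lambda>t. f (t, x)) \<in> borel_measurable borel"
proof -
 have "(\<lambda>x. (t, x)) \<in> borel_measurable (borel :: real measure)" "(\<lambda>t. (t, x)) \<in> borel_measurable (borel :: real measure)"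
  by (intro borel_measurable_continuous_onI continuous_intros)+
 then show "(\<lambda>x. f (t, x)) \<in> borel_measurable borel" "(\<lambda>t. f (t, x)) \<in> borel_measurable borel"
  using assms by (auto intro: measurable_compose)
qed

text \<open>The cylinder carries the restriction of completed Lebesgue measure on the plane, not a
  product measure; slices are reached through the product of Borel-Lebesgue measures.\<close>

lemma AE_cylinder_slices:
 assumes "AE z in cylinder T. P z"
 shows "AE t in leb 0 T. AE x in torus. P (t, x)" "AE x in torus. AE t in leb 0 T. P (t, x)"
proof -
 have "{0..T} \<times> {-pi..pi} \<inter> space lebesgue \<in> sets (lebesgue :: (real \<times> real) measure)" using sets_rect by auto
 then have "AE z in lebesgue. z \<in> {0..T} \<times> {-pi..pi} \<longrightarrow> P z" using assms unfolding cylinder_def by (subst (asm) AE_restrict_space_iff) auto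
 then have ae: "AE z in lborel \<Otimes>\<^sub>M lborel. z \<in> {0..T} \<times> {-pi..pi} \<longrightarrow> P z" unfolding lborel_prod AE_completion_iff .
 from lborel_pair.AE_pair[OF ae]
 have "AE t in lebesgue. AE x in lebesgue. (t, x) \<in> {0..T} \<times> {-pi..pi} \<longrightarrow> P (t, x)" by (simp add: AE_completion_iff)
 then show "AE t in leb 0 T. AE x in torus. P (t, x)"
  unfolding torus_def by (subst AE_restrict_space_iff, simp, subst AE_restrict_space_iff, simp) (auto elim: eventually_mono)
 \<comment> \<open>Exchanging the two almost-everywhere quantifiers needs a measurable exceptional
   set, hence the passage to a null set \<open>N\<close> of the product.\<close>
 obtain N where N: "{z. \<not> (z \<in> {0..T} \<times> {-pi..pi} \<longrightarrow> P z)} \<subseteq> N" "N \<in> null_sets (lborel \<Otimes>\<^sub>M lborel)"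
  using ae by (auto elim!: AE_E simp: space_pair_measure null_sets_def)
 have "AE z in lborel \<Otimes>\<^sub>M lborel. z \<notin> N" by (rule AE_not_in[OF N(2)])
 moreover have "{x. x \<notin> N} \<in> sets (borel \<Otimes>\<^sub>M borel)"
 proof -
  have "space (lborel \<Otimes>\<^sub>M lborel) - N \<in> sets (lborel \<Otimes>\<^sub>M lborel)" by (rule sets.compl_sets[OF null_setsD2[OF N(2)]])
  moreover have "space (lborel \<Otimes>\<^sub>M lborel) - N = {x :: real \<times> real. x \<notin> N}" by (auto simp: space_pair_measure)
  ultimately show ?thesis by simp
 qed
 ultimately have "AE x in lborel. AE t in lborel. (t, x) \<notin> N"
  using lborel_pair.AE_commute[of "\<lambda>t x. (t, x) \<notin> N"] lborel_pair.AE_pair_iff[of "\<lambda>t x. (t, x) \<notin> N"] N(2)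
  by (auto simp: space_pair_measure null_sets_def)
 then have "AE x in lborel. AE t in lborel. (t, x) \<in> {0..T} \<times> {-pi..pi} \<longrightarrow> P (t, x)"
 proof eventually_elim
  case (elim x)
  then show ?case
  proof eventually_elim
   case (elim t)
   then show ?case using N(1) by blast
  qed
 qed
 then have "AE x in lebesgue. AE t in lebesgue. (t, x) \<in> {0..T} \<times> {-pi..pi} \<longrightarrow> P (t, x)" by (simp add: AE_completion_iff)
 then show "AE x in torus. AE t in leb 0 T. P (t, x)"
  unfolding torus_def by (subst AE_restrict_space_iff, simp, subst AE_restrict_space_iff, simp) (auto elim: eventually_mono)
qed

text \<open>Every slice of a Borel function is measurable, while a Lebesgue measurable function on
  the cylinder guarantees this only for almost every slice. Fubini is therefore proved for Borel
  versions and transferred.\<close>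

lemma cylinder_version:
 fixes h :: "real \<times> real => real"
 assumes "h \<in> borel_measurable (cylinder T)"
 obtains g where "g \<in> borel_measurable borel" "AE z in cylinder T. h z = g z"
proof -
 let ?C = "{0..T} \<times> {-pi..pi}"
 have C: "?C \<inter> space lebesgue \<in> sets lebesgue" using sets_rect by auto
 have "(\<lambda>z. indicator ?C z *\<^sub>R h z) \<in> borel_measurable lebesgue"
  using assms unfolding cylinder_def by (subst (asm) borel_measurable_restrict_space_iff[OF C]) (simp add: mult.commute)
 then obtain g where g: "g \<in> borel_measurable lborel" "AE z in lborel. indicator ?C z *\<^sub>R h z = g z"
  using completion_ex_borel_measurable_real by blast
 have "AE z in lebesgue. indicator ?C z *\<^sub>R h z = g z" using g(2) by (rule AE_completion)
 then have "AE z in lebesgue. z \<in> ?C \<longrightarrow> h z = g z" by eventually_elim auto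
 then have "AE z in cylinder T. h z = g z" unfolding cylinder_def by (subst AE_restrict_space_iff[OF C]) 
 then show thesis using that g(1) by simp
qed

lemma lebesgue_on_AE_measurable:
 fixes u v :: "real => 'b::euclidean_space"
 assumes "AE x in leb a b. u x = v x" "v \<in> borel_measurable (leb a b)"
 shows "u \<in> borel_measurable (leb a b)"
proof -
 have C: "{a..b} \<inter> space lebesgue \<in> sets (lebesgue :: real measure)" by auto
 have "AE x in lebesgue. x \<in> {a..b} \<longrightarrow> u x = v x" using assms(1) by (subst (asm) AE_restrict_space_iff[OF C])
 then have ae: "AE x in lebesgue. indicator {a..b} x *\<^sub>R v x = indicator {a..b} x *\<^sub>R u x" by eventually_elim (auto split: split_indicator)
 have "(\<lambda>x. indicator {a..b} x *\<^sub>R v x) \<in> borel_measurable lebesgue" using assms(2) by (subst (asm) borel_measurable_restrict_space_iff[OF C])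
 then have "(\<lambda>x. indicator {a..b} x *\<^sub>R u x) \<in> borel_measurable lebesgue" using ae by (rule borel_measurable_AE)
 then show ?thesis by (subst borel_measurable_restrict_space_iff[OF C])
qed

lemma cylinder_slice_measurable:
 fixes h :: "real \<times> real => real"
 assumes "h \<in> borel_measurable (cylinder T)"
 shows "AE t in leb 0 T. (\<lambda>x. h (t, x)) \<in> borel_measurable torus"
proof -
 obtain g where g: "g \<in> borel_measurable borel" "AE z in cylinder T. h z = g z" by (rule cylinder_version[OF assms])
 from AE_cylinder_slices(1)[OF g(2)] show ?thesis
  unfolding torus_def by eventually_elim (rule lebesgue_on_AE_measurable[OF _ borel_measurable_lebesgue_on_borel[OF borel_pair_section(1)[OF g(1)]]])
qed

lemma cylinder_Fubini_borel:
 fixes g :: "real \<times> real => real"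
 assumes g: "g \<in> borel_measurable borel"
 shows "(\<integral>\<^sup>+z. ennreal \<bar>g z\<bar> \<partial>cylinder T) = (\<integral>\<^sup>+t. \<integral>\<^sup>+x. ennreal \<bar>g (t, x)\<bar> \<partial>torus \<partial>leb 0 T)"
  and "integrable (cylinder T) g ==> AE t in leb 0 T. integrable torus (\<lambda>x. g (t, x))"
  and "integrable (cylinder T) g ==> integrable (leb 0 T) (\<lambda>t. LINT x|torus. g (t, x))"
  and "integrable (cylinder T) g ==> (LINT z|cylinder T. g z) = (LINT t|leb 0 T. LINT x|torus. g (t, x))"
  and "integrable (cylinder T) g ==> (LINT z|cylinder T. g z) = (LINT x|torus. LINT t|leb 0 T. g (t, x))"
  and "integrable (cylinder T) g ==> integrable torus (\<lambda>x. LINT t|leb 0 T. g (t, x))"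
proof -
 let ?C = "{0..T} \<times> {-pi..pi}"
 define G where "G z = indicator ?C z *\<^sub>R g z" for z
 have ind: "indicator ?C (t, x) = (indicator {0..T} t * indicator {-pi..pi} x :: 'c::{comm_semiring_1})" for t x by (auto simp: indicator_def)
 have C: "?C \<inter> space lebesgue \<in> sets (lebesgue :: (real \<times> real) measure)" using sets_rect by auto
 have C1: "{a..b} \<inter> space lebesgue \<in> sets (lebesgue :: real measure)" for a b by auto
 have Gb: "G \<in> borel_measurable borel" unfolding G_def using g sets_rect by (intro borel_measurable_scaleR) auto
 then have GP: "G \<in> borel_measurable (lborel \<Otimes>\<^sub>M lborel)" by (simp add: lborel_prod)
 have "(\<integral>\<^sup>+z. ennreal \<bar>g z\<bar> \<partial>cylinder T) = (\<integral>\<^sup>+z. ennreal \<bar>g z\<bar> * indicator ?C z \<partial>lborel)"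
  unfolding cylinder_def by (rule nn_integral_lebesgue_on[OF sets_rect])
 also have "... = (\<integral>\<^sup>+z. ennreal \<bar>g z\<bar> * indicator ?C z \<partial>(lborel \<Otimes>\<^sub>M lborel))" by (simp add: lborel_prod)
 also have "... = (\<integral>\<^sup>+t. \<integral>\<^sup>+x. ennreal \<bar>g (t, x)\<bar> * indicator ?C (t, x) \<partial>lborel \<partial>lborel)"
  using g sets_rect by (intro lborel.nn_integral_fst[symmetric]) (auto simp: lborel_prod)
 also have "... = (\<integral>\<^sup>+t. (\<integral>\<^sup>+x. ennreal \<bar>g (t, x)\<bar> * indicator {-pi..pi} x \<partial>lborel) * indicator {0..T} t \<partial>lborel)"
 proof (rule nn_integral_cong)
  fix t
  show "(\<integral>\<^sup>+x. ennreal \<bar>g (t, x)\<bar> * indicator ?C (t, x) \<partial>lborel) = (\<integral>\<^sup>+x. ennreal \<bar>g (t, x)\<bar> * indicator {-pi..pi} x \<partial>lborel) * indicator {0..T} t"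
   using borel_pair_section(1)[OF g, of t] by (cases "t \<in> {0..T}") (auto simp: indicator_def)
 qed
 also have "... = (\<integral>\<^sup>+t. \<integral>\<^sup>+x. ennreal \<bar>g (t, x)\<bar> \<partial>torus \<partial>leb 0 T)"
  unfolding torus_def by (simp add: nn_integral_lebesgue_on)
 finally show "(\<integral>\<^sup>+z. ennreal \<bar>g z\<bar> \<partial>cylinder T) = (\<integral>\<^sup>+t. \<integral>\<^sup>+x. ennreal \<bar>g (t, x)\<bar> \<partial>torus \<partial>leb 0 T)" .
 assume gi: "integrable (cylinder T) g"
 have "integrable lebesgue G" using gi unfolding cylinder_def G_def by (subst (asm) integrable_restrict_space[OF C])
 then have Gi: "integrable (lborel \<Otimes>\<^sub>M lborel) G" using Gb by (simp add: integrable_completion lborel_prod)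
 have e0: "(LINT z|cylinder T. g z) = (LINT z|(lborel \<Otimes>\<^sub>M lborel). G z)"
  unfolding cylinder_def integral_restrict_space[OF C] G_def[symmetric] lborel_prod using Gb by (subst integral_completion) auto
 have sec: "integrable (leb a b) f \<longleftrightarrow> integrable lborel (\<lambda>x. indicator {a..b} x *\<^sub>R f x)"
  "(LINT x|leb a b. f x) = (LINT x|lborel. indicator {a..b} x *\<^sub>R f x)"
  if "f \<in> borel_measurable borel" for f :: "real => real" and a b
  unfolding integral_restrict_space[OF C1] integrable_restrict_space[OF C1] using that
  by (simp_all add: integral_completion integrable_completion)
 have s1: "(LINT x|lborel. G (t, x)) = indicator {0..T} t *\<^sub>R (LINT x|torus. g (t, x))" for t
  unfolding torus_def sec(2)[OF borel_pair_section(1)[OF g]] G_def by (auto simp: indicator_def)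
 have s2: "(LINT t|lborel. G (t, x)) = indicator {-pi..pi} x *\<^sub>R (LINT t|leb 0 T. g (t, x))" for x
  unfolding sec(2)[OF borel_pair_section(2)[OF g]] G_def by (auto simp: indicator_def)
 have "AE t in lborel. integrable lborel (\<lambda>x. G (t, x))" by (rule lborel_pair.AE_integrable_fst'[OF Gi])
 then have "AE t in lebesgue. t \<in> {0..T} \<longrightarrow> integrable torus (\<lambda>x. g (t, x))"
  unfolding AE_completion_iff torus_def sec(1)[OF borel_pair_section(1)[OF g]] by eventually_elim (auto simp: G_def ind)
 then show "AE t in leb 0 T. integrable torus (\<lambda>x. g (t, x))" by (subst AE_restrict_space_iff[OF C1])
 have "integrable lborel (\<lambda>t. LINT x|lborel. G (t, x))" by (rule lborel_pair.integrable_fst'[OF Gi])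
 then have i1: "integrable lborel (\<lambda>t. indicator {0..T} t *\<^sub>R (LINT x|torus. g (t, x)))" unfolding s1 .
 then show "integrable (leb 0 T) (\<lambda>t. LINT x|torus. g (t, x))"
  unfolding integrable_restrict_space[OF C1] by (subst integrable_completion) auto
 show "(LINT z|cylinder T. g z) = (LINT t|leb 0 T. LINT x|torus. g (t, x))"
  unfolding e0 lborel_pair.integral_fst'[OF Gi, symmetric] s1 integral_restrict_space[OF C1]
  using i1 by (subst integral_completion) auto
 have "integrable lborel (\<lambda>x. LINT t|lborel. G (t, x))" using lborel_pair.integrable_snd[of "\<lambda>t x. G (t, x)"] Gi by simp
 then have i2: "integrable lborel (\<lambda>x. indicator {-pi..pi} x *\<^sub>R (LINT t|leb 0 T. g (t, x)))" unfolding s2 .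
 then show "integrable torus (\<lambda>x. LINT t|leb 0 T. g (t, x))"
  unfolding torus_def integrable_restrict_space[OF C1] by (simp only: integrable_completion[OF borel_measurable_integrable[OF i2]])
 have "(LINT z|(lborel \<Otimes>\<^sub>M lborel). G z) = (LINT x|lborel. LINT t|lborel. G (t, x))"
  using lborel_pair.integral_snd[of "\<lambda>t x. G (t, x)"] Gi by simp
 then show "(LINT z|cylinder T. g z) = (LINT x|torus. LINT t|leb 0 T. g (t, x))"
  unfolding e0 s2 using i2 integral_restrict_space[OF C1, of "-pi" pi "\<lambda>x. LINT t|leb 0 T. g (t, x)"]
  by (simp only: torus_def integral_completion[OF borel_measurable_integrable[OF i2]])
qed

lemma cylinder_Fubini:
 fixes h :: "real \<times> real => real"
 assumes h: "integrable (cylinder T) h"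
 shows "AE t in leb 0 T. integrable torus (\<lambda>x. h (t, x))"
  and "integrable (leb 0 T) (\<lambda>t. LINT x|torus. h (t, x))"
  and "(LINT z|cylinder T. h z) = (LINT t|leb 0 T. LINT x|torus. h (t, x))"
proof -
 have hm: "h \<in> borel_measurable (cylinder T)" using h by auto
 obtain g where g: "g \<in> borel_measurable borel" "AE z in cylinder T. h z = g z" by (rule cylinder_version[OF hm])
 have gm: "g \<in> borel_measurable (cylinder T)" by (rule measurable_cylinder_borel[OF g(1)])
 have gi: "integrable (cylinder T) g" using h integrable_cong_AE[OF hm gm g(2)] by blast
 note F = cylinder_Fubini_borel(2-4)[OF g(1) gi]
 note sl = AE_cylinder_slices(1)[OF g(2)]
 have eq: "AE t in leb 0 T. (LINT x|torus. h (t, x)) = (LINT x|torus. g (t, x))"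
  using sl cylinder_slice_measurable[OF hm]
 proof eventually_elim
  case (elim t)
  then show ?case using borel_measurable_torus_borel[OF borel_pair_section(1)[OF g(1)]] by (intro integral_cong_AE)
 qed
 show "AE t in leb 0 T. integrable torus (\<lambda>x. h (t, x))"
  using sl cylinder_slice_measurable[OF hm] F(1)
 proof eventually_elim
  case (elim t)
  then show ?case using borel_measurable_torus_borel[OF borel_pair_section(1)[OF g(1)]] integrable_cong_AE by blast
 qed
 have m: "(\<lambda>t. LINT x|torus. h (t, x)) \<in> borel_measurable (leb 0 T)"
  by (rule lebesgue_on_AE_measurable[OF eq borel_measurable_integrable[OF F(2)]])
 show "integrable (leb 0 T) (\<lambda>t. LINT x|torus. h (t, x))"
  using integrable_cong_AE[OF m borel_measurable_integrable[OF F(2)] eq] F(2) by blast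
 show "(LINT z|cylinder T. h z) = (LINT t|leb 0 T. LINT x|torus. h (t, x))"
  using integral_cong_AE[OF hm gm g(2)] F(3) integral_cong_AE[OF m borel_measurable_integrable[OF F(2)] eq] by simp
qed

lemma cylinder_Tonelli:
 fixes h :: "real \<times> real => real"
 assumes hm: "h \<in> borel_measurable (cylinder T)"
  and b: "AE t in leb 0 T. AE x in torus. \<bar>h (t, x)\<bar> \<le> b t" "integrable (leb 0 T) b"
 shows "integrable (cylinder T) h"
proof -
 obtain g where g: "g \<in> borel_measurable borel" "AE z in cylinder T. h z = g z" by (rule cylinder_version[OF hm])
 have gm: "g \<in> borel_measurable (cylinder T)" by (rule measurable_cylinder_borel[OF g(1)])
 have "(\<integral>\<^sup>+z. ennreal \<bar>g z\<bar> \<partial>cylinder T) = (\<integral>\<^sup>+t. \<integral>\<^sup>+x. ennreal \<bar>g (t, x)\<bar> \<partial>torus \<partial>leb 0 T)"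
  by (rule cylinder_Fubini_borel(1)[OF g(1)])
 also have "... \<le> (\<integral>\<^sup>+t. ennreal (2 * pi) * ennreal \<bar>b t\<bar> \<partial>leb 0 T)"
 proof (rule nn_integral_mono_AE)
  show "AE t in leb 0 T. (\<integral>\<^sup>+x. ennreal \<bar>g (t, x)\<bar> \<partial>torus) \<le> ennreal (2 * pi) * ennreal \<bar>b t\<bar>"
   using b(1) AE_cylinder_slices(1)[OF g(2)]
  proof eventually_elim
   case (elim t)
   have "(\<integral>\<^sup>+x. ennreal \<bar>g (t, x)\<bar> \<partial>torus) \<le> (\<integral>\<^sup>+x. ennreal \<bar>b t\<bar> \<partial>torus)"
   proof (rule nn_integral_mono_AE)
    show "AE x in torus. ennreal \<bar>g (t, x)\<bar> \<le> ennreal \<bar>b t\<bar>" using elim by eventually_elim (auto intro!: ennreal_leI)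
   qed
   also have "... = ennreal \<bar>b t\<bar> * emeasure torus (space torus)" by simp
   also have "emeasure torus (space torus) = ennreal (2 * pi)"
    using measure_torus finite_measure.emeasure_eq_measure[OF finite_measure_torus] by simp
   finally show ?case by (simp add: mult.commute)
  qed
 qed
 also have "... = ennreal (2 * pi) * (\<integral>\<^sup>+t. ennreal \<bar>b t\<bar> \<partial>leb 0 T)" using b(2) by (intro nn_integral_cmult) auto
 also have "... < \<infinity>" using b(2) by (auto simp: integrable_iff_bounded ennreal_mult_less_top)
 finally have "integrable (cylinder T) g" using gm by (intro integrableI_bounded) auto
 then show ?thesis using integrable_cong_AE[OF hm gm g(2)] by blast
qed

lemma integrable_continuous_lebesgue_on:
 fixes f :: "real => real"
 assumes "continuous_on {a..b} f"
 shows "integrable (leb a b) f"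
proof -
 have "compact (f ` {a..b})" by (intro compact_continuous_image assms) auto
 then obtain B where B: "\<And>t. t \<in> {a..b} ==> norm (f t) \<le> B" by (metis bounded_iff compact_imp_bounded imageI)
 show ?thesis
 proof (rule finite_measure.integrable_const_bound[OF finite_measure_lebesgue_on, where B = B])
  show "f \<in> borel_measurable (leb a b)" by (rule continuous_imp_measurable_on_sets_lebesgue[OF assms]) simp
 qed (use B in auto)
qed

lemma integral_derivative_lebesgue_on:
 assumes "a \<le> b" "\<And>t. t \<in> {a..b} ==> (\<phi> has_real_derivative \<phi>' t) (at t within {a..b})" "continuous_on {a..b} \<phi>'"
 shows "(LINT t|leb a b. \<phi>' t) = \<phi> b - \<phi> a"
proof -
 have "(LINT t|leb a b. \<phi>' t) = integral {a..b} \<phi>'"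
  by (intro lebesgue_integral_eq_integral integrable_continuous_lebesgue_on assms) auto
 also have "... = \<phi> b - \<phi> a"
  using assms by (intro integral_unique fundamental_theorem_of_calculus)
   (auto simp: has_real_derivative_iff_has_vector_derivative[symmetric])
 finally show ?thesis .
qed

text \<open>Fubini on the triangle s \<le> t takes the place of differentiating the indefinite
  integral of \<open>R\<close>. The inner integral of \<open>\<phi>'\<close> over [s,T] is -\<phi> s
  because \<open>\<phi>\<close> vanishes at T.\<close>

lemma ac_by_parts:
 fixes R :: "real => 'b::{banach, second_countable_topology}"
 assumes T: "T \<ge> 0" and R: "integrable (leb 0 T) R"
  and D: "\<And>t. t \<in> {0..T} ==> (\<phi> has_real_derivative \<phi>' t) (at t within {0..T})"
  and cont: "continuous_on {0..T} \<phi>'" and end0: "\<phi> T = 0"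
 shows "integrable (leb 0 T) (\<lambda>t. \<phi>' t *\<^sub>R (LINT s|leb 0 t. R s))"
  and "(LINT t|leb 0 T. \<phi>' t *\<^sub>R (LINT s|leb 0 t. R s)) = - (LINT s|leb 0 T. \<phi> s *\<^sub>R R s)"
proof -
 let ?L = "leb 0 T"
 have fin: "finite_measure ?L" by (intro finite_measure_lebesgue_on) simp
 interpret L: finite_measure ?L by (rule fin)
 interpret P: pair_sigma_finite ?L ?L ..
 define K where "K t s = indicator {..t} s *\<^sub>R (\<phi>' t *\<^sub>R R s)" for t s
 have "compact (\<phi>' ` {0..T})" by (intro compact_continuous_image cont) auto
 then obtain B where B: "\<And>t. t \<in> {0..T} ==> norm (\<phi>' t) \<le> B" by (metis bounded_iff compact_imp_bounded imageI)
 have eM: "emeasure ?L (space ?L) < top" using L.emeasure_finite[of "space ?L"] by (metis infinity_ennreal_def top.not_eq_extremum)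
 have B0: "B \<ge> 0" using B[of 0] T norm_ge_zero order_trans by fastforce
 have idm: "(\<lambda>x. x) \<in> borel_measurable ?L" by (intro borel_measurable_lebesgue_on_borel) auto
 have m1: "fst \<in> borel_measurable (?L \<Otimes>\<^sub>M ?L)" by (rule measurable_compose[OF measurable_fst idm])
 have m2: "snd \<in> borel_measurable (?L \<Otimes>\<^sub>M ?L)" by (rule measurable_compose[OF measurable_snd idm])
 have p1: "(\<lambda>z. \<phi>' (fst z)) \<in> borel_measurable (?L \<Otimes>\<^sub>M ?L)"
  by (rule measurable_compose[OF measurable_fst]) (rule continuous_imp_measurable_on_sets_lebesgue[OF cont], simp)
 have p2: "(\<lambda>z. R (snd z)) \<in> borel_measurable (?L \<Otimes>\<^sub>M ?L)"
  by (rule measurable_compose[OF measurable_snd]) (use R in auto)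
 have "Measurable.pred (?L \<Otimes>\<^sub>M ?L) (\<lambda>z. snd z \<le> fst z)" using m1 m2 by measurable
 then have "(\<lambda>z. (if snd z \<le> fst z then 1 else 0 :: real) *\<^sub>R (\<phi>' (fst z) *\<^sub>R R (snd z))) \<in> borel_measurable (?L \<Otimes>\<^sub>M ?L)"
  by (intro borel_measurable_scaleR measurable_If p1 p2) auto
 moreover have "(\<lambda>z. (if snd z \<le> fst z then 1 else 0 :: real) *\<^sub>R (\<phi>' (fst z) *\<^sub>R R (snd z))) = (\<lambda>(t, s). K t s)"
  by (auto simp: K_def indicator_def)
 ultimately have Km: "(\<lambda>(t, s). K t s) \<in> borel_measurable (?L \<Otimes>\<^sub>M ?L)" by simp
 have Ki: "integrable (?L \<Otimes>\<^sub>M ?L) (\<lambda>(t, s). K t s)"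
 proof (rule integrableI_bounded[OF Km])
  have "(\<integral>\<^sup>+z. ennreal (norm (case z of (t, s) => K t s)) \<partial>(?L \<Otimes>\<^sub>M ?L)) = (\<integral>\<^sup>+t. \<integral>\<^sup>+s. ennreal (norm (K t s)) \<partial>?L \<partial>?L)"
   using Km by (subst L.nn_integral_fst[symmetric]) auto
  also have "... \<le> (\<integral>\<^sup>+t. \<integral>\<^sup>+s. ennreal (norm (B *\<^sub>R R s)) \<partial>?L \<partial>?L)"
  proof (intro nn_integral_mono ennreal_leI)
   fix t s assume "t \<in> space ?L"
   then have "\<bar>\<phi>' t\<bar> \<le> B" using B by auto
   then show "norm (K t s) \<le> norm (B *\<^sub>R R s)" using B0 by (auto simp: K_def indicator_def intro: mult_right_mono)
  qed
  also have "... = (\<integral>\<^sup>+s. ennreal (norm (B *\<^sub>R R s)) \<partial>?L) * emeasure ?L (space ?L)" by simp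
  also have "... < \<infinity>" using integrable_scaleR_right[OF R, of B] eM
   unfolding infinity_ennreal_def ennreal_mult_less_top integrable_iff_bounded by auto
  finally show "(\<integral>\<^sup>+z. ennreal (norm (case z of (t, s) => K t s)) \<partial>(?L \<Otimes>\<^sub>M ?L)) < \<infinity>" .
 qed
 have f1: "(LINT s|?L. K t s) = \<phi>' t *\<^sub>R (LINT s|leb 0 t. R s)" if t: "t \<in> {0..T}" for t
 proof -
  have "(LINT s|leb 0 t. R s) = (LINT s|?L. indicator {0..t} s *\<^sub>R R s)"
   using t by (intro lebesgue_on_subset(2) R) auto
  moreover have "(LINT s|?L. K t s) = (LINT s|?L. \<phi>' t *\<^sub>R (indicator {0..t} s *\<^sub>R R s))"
   by (intro B_itg_cong) (auto simp: K_def indicator_def)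
  ultimately show ?thesis by (simp only: integral_scaleR_right)
 qed
 have f2: "(LINT t|?L. K t s) = - (\<phi> s *\<^sub>R R s)" if s: "s \<in> {0..T}" for s
 proof -
  note ci = integrable_continuous_lebesgue_on[OF cont]
  have sub: "{s..T} \<in> sets borel" "{s..T} \<subseteq> {0..T}" using s by auto
  have "(LINT t|?L. K t s) = (LINT t|?L. (indicator {s..T} t *\<^sub>R \<phi>' t) *\<^sub>R R s)"
   by (intro B_itg_cong) (auto simp: K_def indicator_def)
  also have "... = (LINT t|?L. indicator {s..T} t *\<^sub>R \<phi>' t) *\<^sub>R R s"
   using lebesgue_on_subset(3)[OF sub ci] by (intro integral_scaleR_left) auto
  also have "(LINT t|?L. indicator {s..T} t *\<^sub>R \<phi>' t) = (LINT t|leb s T. \<phi>' t)"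
   by (rule lebesgue_on_subset(2)[OF sub ci, symmetric])
  also have "... = \<phi> T - \<phi> s"
  proof (rule integral_derivative_lebesgue_on)
   fix t assume "t \<in> {s..T}"
   then have t: "t \<in> {0..T}" using s by auto
   show "(\<phi> has_real_derivative \<phi>' t) (at t within {s..T})"
    by (rule has_field_derivative_subset[OF D[OF t] sub(2)])
  qed (use s continuous_on_subset[OF cont sub(2)] in auto)
  finally show ?thesis using end0 by simp
 qed
 have "integrable ?L (\<lambda>t. LINT s|?L. K t s)" using P.integrable_fst'[OF Ki] by simp
 then show "integrable ?L (\<lambda>t. \<phi>' t *\<^sub>R (LINT s|leb 0 t. R s))"
  by (subst B_int_cong[OF refl, of _ _ "\<lambda>t. LINT s|?L. K t s"]) (use f1 in auto)
 have "(LINT t|?L. \<phi>' t *\<^sub>R (LINT s|leb 0 t. R s)) = (LINT t|?L. LINT s|?L. K t s)"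
  using f1 by (intro B_itg_cong) auto
 also have "... = (LINT s|?L. LINT t|?L. K t s)" by (rule P.Fubini_integral[OF Ki, symmetric])
 also have "... = (LINT s|?L. - (\<phi> s *\<^sub>R R s))" using f2 by (intro B_itg_cong) auto
 finally show "(LINT t|?L. \<phi>' t *\<^sub>R (LINT s|leb 0 t. R s)) = - (LINT s|?L. \<phi> s *\<^sub>R R s)" by simp
qed

section \<open>The weak formulation\<close>

lemma compact_continuous_bounded:
 fixes f :: "'a::topological_space => 'b::real_normed_vector"
 assumes "compact K" "continuous_on K f"
 shows "\<exists>B. \<forall>z\<in>K. norm (f z) \<le> B"
 using compact_imp_bounded[OF compact_continuous_image[OF assms(2,1)]] unfolding bounded_iff by simp

text \<open>The definition of a test function states continuity of the two derivatives. Their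
  boundedness on the rectangle makes the function Lipschitz in each variable, which yields its joint
  continuity, and vanishing at T yields the bound B T.\<close>

lemma test_function_facts:
 assumes tf: "test_function T \<phi> \<phi>t \<phi>x" and T: "T > 0"
 obtains B where "B \<ge> 0"
  "\<And>t x. t \<in> {0..T} ==> x \<in> {-pi..pi} ==> \<bar>\<phi>t t x\<bar> \<le> B \<and> \<bar>\<phi>x t x\<bar> \<le> B \<and> \<bar>\<phi> t x\<bar> \<le> B * T"
  "continuous_on ({0..T} \<times> {-pi..pi}) (\<lambda>(t, x). \<phi> t x)"
  "continuous_on ({0..T} \<times> {-pi..pi}) (\<lambda>(t, x). \<phi>t t x)"
  "continuous_on ({0..T} \<times> {-pi..pi}) (\<lambda>(t, x). \<phi>x t x)"
  "\<And>x. \<phi> T x = 0"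
  "\<And>t x. t \<in> {0..T} ==> ((\<lambda>s. \<phi> s x) has_real_derivative \<phi>t t x) (at t within {0..T})"
  "\<And>x. continuous_on {0..T} (\<lambda>t. \<phi>t t x)"
  "\<And>t. t \<in> {0..T} ==> continuous_on UNIV (\<phi>x t)"
proof -
 let ?R = "{0..T} \<times> {-pi..pi}"
 have sub: "?R \<subseteq> {0..} \<times> UNIV" by auto
 have c: "continuous_on ({0..} \<times> UNIV) (\<lambda>(t, x). \<phi>t t x)" "continuous_on ({0..} \<times> UNIV) (\<lambda>(t, x). \<phi>x t x)"
  using tf by (auto simp: test_function_def)
 have ct: "continuous_on ?R (\<lambda>(t, x). \<phi>t t x)" "continuous_on ?R (\<lambda>(t, x). \<phi>x t x)"
  using c sub continuous_on_subset by blast+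
 have cmp: "compact ?R" by (intro compact_Times) auto
 from compact_continuous_bounded[OF cmp ct(1)] obtain B1 where B1: "\<forall>z\<in>?R. norm ((\<lambda>(t, x). \<phi>t t x) z) \<le> B1" ..
 from compact_continuous_bounded[OF cmp ct(2)] obtain B2 where B2: "\<forall>z\<in>?R. norm ((\<lambda>(t, x). \<phi>x t x) z) \<le> B2" ..
 define B where "B = max B1 (max B2 0)"
 have B: "\<bar>\<phi>t t x\<bar> \<le> B" "\<bar>\<phi>x t x\<bar> \<le> B" if "t \<in> {0..T}" "x \<in> {-pi..pi}" for t x
  using bspec[OF B1, of "(t, x)"] bspec[OF B2, of "(t, x)"] that by (auto simp: B_def)
 have B0: "B \<ge> 0" by (simp add: B_def)
 have "\<forall>t\<ge>0. \<forall>x. ((\<lambda>s. \<phi> s x) has_real_derivative \<phi>t t x) (at t within {0..}) \<and> (\<phi> t has_real_derivative \<phi>x t x) (at x)"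
  using tf unfolding test_function_def by (elim conjE)
 then have D0: "((\<lambda>s. \<phi> s x) has_real_derivative \<phi>t t x) (at t within {0..})" "(\<phi> t has_real_derivative \<phi>x t x) (at x)"
  if "t \<ge> 0" for t x using that by simp_all
 have Dt: "((\<lambda>s. \<phi> s x) has_real_derivative \<phi>t t x) (at t within {0..T})" if "t \<in> {0..T}" for t x
  by (rule has_field_derivative_subset[OF D0(1)]) (use that in auto)
 have Dx: "(\<phi> t has_real_derivative \<phi>x t x) (at x)" if "t \<in> {0..T}" for t x
  by (rule D0(2)) (use that in simp)
 obtain T' where "T' < T" "\<forall>t\<ge>0. t \<ge> T' \<longrightarrow> (\<forall>x. \<phi> t x = 0)"
  using tf unfolding test_function_def by (elim conjE exE)
 then have z: "\<phi> T x = 0" for x using T by auto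
 have lt: "\<bar>\<phi> t x - \<phi> t' x\<bar> \<le> B * \<bar>t - t'\<bar>" if "t \<in> {0..T}" "t' \<in> {0..T}" "x \<in> {-pi..pi}" for t t' x
  using field_differentiable_bound[of "{0..T}" "\<lambda>s. \<phi> s x" "\<lambda>t. \<phi>t t x" B t t'] Dt B that by auto
 have lx: "\<bar>\<phi> t x - \<phi> t x'\<bar> \<le> B * \<bar>x - x'\<bar>" if "t \<in> {0..T}" "x \<in> {-pi..pi}" "x' \<in> {-pi..pi}" for t x x'
  using field_differentiable_bound[of "{-pi..pi}" "\<phi> t" "\<phi>x t" B x x'] has_field_derivative_at_within[OF Dx[OF that(1)]] B that by auto
 have cphi: "continuous_on ?R (\<lambda>(t, x). \<phi> t x)"
 proof (rule lipschitz_on_continuous_on[where L = "2 * B"], rule lipschitz_onI)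
  fix z z' assume "z \<in> ?R" "z' \<in> ?R"
  then obtain t x t' x' where z: "z = (t, x)" "z' = (t', x')" "t \<in> {0..T}" "t' \<in> {0..T}" "x \<in> {-pi..pi}" "x' \<in> {-pi..pi}" by auto
  have "\<bar>\<phi> t x - \<phi> t' x'\<bar> \<le> \<bar>\<phi> t x - \<phi> t' x\<bar> + \<bar>\<phi> t' x - \<phi> t' x'\<bar>" by simp
  also have "... \<le> B * \<bar>t - t'\<bar> + B * \<bar>x - x'\<bar>" using lt lx z by (intro add_mono) auto
  also have "... \<le> B * dist z z' + B * dist z z'"
   using dist_fst_le[of z z'] dist_snd_le[of z z'] B0 z by (intro add_mono mult_left_mono) (auto simp: dist_real_def)
  finally show "dist ((\<lambda>(t, x). \<phi> t x) z) ((\<lambda>(t, x). \<phi> t x) z') \<le> 2 * B * dist z z'"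
   by (simp add: z dist_real_def)
 qed (use B0 in simp)
 have bphi: "\<bar>\<phi> t x\<bar> \<le> B * T" if "t \<in> {0..T}" "x \<in> {-pi..pi}" for t x
 proof -
  have "\<bar>\<phi> t x - \<phi> T x\<bar> \<le> B * \<bar>t - T\<bar>" using lt[of t T x] that T by auto
  also have "... \<le> B * T" using that B0 by (intro mult_left_mono) auto
  finally show ?thesis by (simp add: z)
 qed
 have cts: "continuous_on {0..T} (\<lambda>t. \<phi>t t x)" for x
 proof -
  have "continuous_on {0..T} (\<lambda>t. (t, x))" by (intro continuous_intros)
  moreover have "(\<lambda>t. (t, x)) ` {0..T} \<subseteq> {0..} \<times> UNIV" by auto
  ultimately have "continuous_on {0..T} (\<lambda>t. case (t, x) of (t, x) => \<phi>t t x)" by (rule continuous_on_compose2[OF c(1)])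
  then show ?thesis by simp
 qed
 have cxs: "continuous_on UNIV (\<phi>x t)" if "t \<in> {0..T}" for t
 proof -
  have "continuous_on UNIV (\<lambda>x. (t, x))" by (intro continuous_intros)
  moreover have "(\<lambda>x. (t, x)) ` UNIV \<subseteq> {0..} \<times> UNIV" using that by auto
  ultimately have "continuous_on UNIV (\<lambda>x. case (t, x) of (t, x) => \<phi>x t x)" by (rule continuous_on_compose2[OF c(2)])
  then show ?thesis by simp
 qed
 show thesis using that[OF B0 _ cphi ct z Dt cts cxs] B bphi by blast
qed

section \<open>The constructed modes form a weak solution\<close>

context film_data
begin

text \<open>The Fourier series of \<open>w t\<close> is differentiable only for almost every \<open>t\<close>; at the other times \<open>w t\<close> is replaced by \<open>0\<close>.\<close>

definition gw :: "real => bool => int => complex" where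
 "gw t = (if \<forall>i. ell 2 (w t i) then w t else (\<lambda>_ _. 0))"

lemma w_energy': "ell 0 (w t i)" "en 0 (w t) \<le> E0" "w t i 0 = 0" "hermitian (w t i)"
 using w_energy(1)[of "max 0 t"] en_w_le[of "max 0 t"] w_zero_mode[of "max 0 t"] hermitian_w[of "max 0 t"]
 by (simp_all add: w_max)

lemma borel_w: "(\<lambda>t. w t i k) \<in> borel_measurable borel"
 by (intro borel_measurable_continuous_onI continuous_w)

lemma borel_gw: "(\<lambda>t. gw t i k) \<in> borel_measurable borel"
proof -
 have "ell 2 (w t i) \<longleftrightarrow> (\<integral>\<^sup>+k. ennreal (mag k^2 * norm (w t i k)) \<partial>ZM) < \<infinity>" for t i
  by (simp add: ell_def integrable_iff_bounded abs_mult)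
 moreover have "(\<lambda>t. \<integral>\<^sup>+k. ennreal (mag k^2 * norm (w t i k)) \<partial>ZM) \<in> borel_measurable borel" for i
 proof -
  have "(\<lambda>(t, k). ennreal (mag k^2 * norm (w t i k))) \<in> borel_measurable (borel \<Otimes>\<^sub>M ZM)"
   by (rule measurable_pair_ZM) (use borel_w in measurable)
  then show ?thesis by (intro sigma_finite_measure.borel_measurable_nn_integral[OF sigma_finite_ZM])
 qed
 ultimately have "Measurable.pred borel (\<lambda>t. ell 2 (w t i))" for i by simp
 then have "Measurable.pred borel (\<lambda>t. \<forall>i. ell 2 (w t i))" by measurable
 then have "(\<lambda>t. if \<forall>i. ell 2 (w t i) then w t i k else 0) \<in> borel_measurable borel" using borel_w by (intro measurable_If) auto
 moreover have "(\<lambda>t. if \<forall>i. ell 2 (w t i) then w t i k else 0) = (\<lambda>t. gw t i k)" by (auto simp: gw_def)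
 ultimately show ?thesis by simp
qed

lemma gw_good: "good (gw t i)"
proof (cases "\<forall>i. ell 2 (w t i)")
 case True
 then show ?thesis using w_energy'[of t] by (simp add: gw_def good_def)
next
 case False
 then have "gw t i = (\<lambda>_. 0)" unfolding gw_def by (simp only: if_False)
 then show ?thesis by (simp add: good_def hermitian_def ell_def)
qed

lemma en_gw_le: "en s (gw t) \<le> en s (w t)"
 by (auto simp: gw_def en_def l1_def intro!: add_nonneg_nonneg integral_nonneg_AE)

lemma AE_gw: "AE t in leb 0 T. gw t = w t"
 using w_dissipation(1)[of T] by eventually_elim (simp add: gw_def)

lemma int_en2_gw: "integrable (leb 0 T) (\<lambda>t. en 2 (gw t))"
proof (rule B_int_bound[OF w_dissipation(2)])
 show "(\<lambda>t. en 2 (gw t)) \<in> borel_measurable (leb 0 T)"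
  by (intro measurable_en borel_measurable_lebesgue_on_borel borel_gw)
qed (use en_gw_le in auto)

lemma path: "wiener_path (\<lambda>t. gw t i) E0"
proof
 show "l1 0 (gw t i) \<le> E0" for t using l1_le_en[of 0 "gw t" i] en_gw_le[of 0 t] w_energy'(2)[of t] by linarith
 show "integrable (leb 0 T) (\<lambda>t. l1 2 (gw t i))" for T
 proof (rule B_int_bound[OF int_en2_gw])
  show "(\<lambda>t. l1 2 (gw t i)) \<in> borel_measurable (leb 0 T)"
   by (intro measurable_l1 borel_measurable_lebesgue_on_borel borel_gw)
 qed (use l1_le_en in auto)
qed (use borel_gw gw_good in auto)

end

context film
begin

text \<open>Fourier coefficients of the full flux, including the mean \<open>M i\<close>, with the
  factor i of the derivative restored.\<close>

definition jcoef :: "(bool => int => complex) => bool => int => complex" where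
 "jcoef w i k = \<i> * (of_int k * of_real (M i) * pot i w k + flux (w i) (pot i w) k)"

lemma rhs_jcoef: "rhs w i = dcoef (jcoef w i)"
proof
 fix k
 have "\<i> * of_int k * (\<i> * X) = - of_int k * X" for X :: complex by (simp add: complex_eq_iff)
 then show "rhs w i k = dcoef (jcoef w i) k" by (simp only: rhs_def dcoef_def jcoef_def)
qed

text \<open>Two summable derivatives of the state make the time derivative of its Fourier series
  absolutely convergent, with a bound that is integrable in time.\<close>

lemma rhs_l1:
 assumes w: "\<And>i. ell 2 (w i)" and E: "en 0 w \<le> E"
 shows "ell 0 (rhs w i)" "l1 0 (rhs w i) \<le> (M i * c + 2 * c * E) * en 2 w"
proof -
 have p: "ell 2 (pot i w)" by (rule ell_pot[OF w])
 have f: "ell 1 (flux (w i) (pot i w))" by (rule flux_bound(1)[OF w p, of 1]) simp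
 have le: "norm (rhs w i k) \<le> M i * (mag k^2 * norm (pot i w k)) + mag k^1 * norm (flux (w i) (pot i w) k)" for k
 proof -
  have "norm (rhs w i k) \<le> mag k * (mag k * M i * norm (pot i w k) + norm (flux (w i) (pot i w) k))"
   unfolding rhs_def norm_mult norm_minus_cancel
   using pos(1)[of i] by (auto intro!: mult_left_mono order_trans[OF norm_triangle_ineq] simp: norm_mult)
  also have "... = M i * (mag k^2 * norm (pot i w k)) + mag k^1 * norm (flux (w i) (pot i w) k)"
   by (simp only: power2_eq_square power_one_right distrib_left ac_simps)
  finally show ?thesis .
 qed
 have i: "integrable ZM (\<lambda>k. M i * (mag k^2 * norm (pot i w k)) + mag k^1 * norm (flux (w i) (pot i w) k))"
  using p f unfolding ell_def by (intro B_int_add integrable_mult_right)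
 show e: "ell 0 (rhs w i)" unfolding ell_def
  by (rule B_int_bound[OF i]) (use le in \<open>auto intro!: AE_I2 order_trans[OF le]\<close>)
 have "l1 0 (rhs w i) \<le> (LINT k|ZM. M i * (mag k^2 * norm (pot i w k)) + mag k^1 * norm (flux (w i) (pot i w) k))"
  unfolding l1_def using e le i by (intro integral_mono) (auto simp: ell_def)
 also have "... = M i * l1 2 (pot i w) + l1 1 (flux (w i) (pot i w))"
  using p f unfolding l1_def ell_def by (subst B_itg_add) auto
 also have "... \<le> M i * (c * en 2 w) + 2 * c * E * en 2 w"
 proof (intro add_mono mult_left_mono)
  show "l1 2 (pot i w) \<le> c * en 2 w" by (rule l1_pot_le[OF w])
  have "l1 1 (flux (w i) (pot i w)) \<le> (\<Sum>i\<in>UNIV. l1 1 (flux (w i) (pot i w)))" by (intro member_le_sum) auto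
  also have "... \<le> 2 * c * en 0 w * en 2 w" by (rule flux_energy[OF w])
  also have "... \<le> 2 * c * E * en 2 w" using E c_pos by (intro mult_right_mono mult_left_mono) auto
  finally show "l1 1 (flux (w i) (pot i w)) \<le> 2 * c * E * en 2 w" .
 qed (use pos(1)[of i] in auto)
 finally show "l1 0 (rhs w i) \<le> (M i * c + 2 * c * E) * en 2 w" by (simp add: algebra_simps)
qed

lemma jcoef_hermitian: "(\<And>i. hermitian (w i)) ==> hermitian (jcoef w i)"
 using hermitian_flux[of "w i" "pot i w"] hermitian_pot[of w i]
 by (simp add: hermitian_def jcoef_def algebra_simps)

text \<open>Both sides have the same coefficients: the constant \<open>M i\<close> contributes to
  the convolution at q = k alone, which is the linear term, and the rest is \<open>flux\<close>.
  Uniqueness of coefficients then gives equality almost everywhere.\<close>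

lemma wiener_jcoef:
 assumes g: "\<And>i. good (w i)"
 shows "AE x in torus. wiener (jcoef w i) x = (wiener (w i) x + M i) * (\<alpha> i * wiener (dcoef (w True)) x + \<beta> i * wiener (dcoef (w False)) x)"
proof (rule fourier_unique2)
 note gd = goodD[OF g]
 have p: "ell 2 (pot i w)" by (rule ell_pot[OF gd(1)])
 have hp: "hermitian (pot i w)" by (rule hermitian_pot[OF gd(7)])
 have ep: "integrable ZM (dcoef (pot i w))" using ell_mono[OF p, of 1] by (simp add: ell_dcoef ell_0_iff[symmetric])
 have ij: "integrable ZM (jcoef w i)"
  using rhs_l1(1)[OF gd(1) order_refl] unfolding rhs_jcoef ell_0_iff by (rule integrable_ZM_of_dcoef)
 show "integrable torus (wiener (jcoef w i))" by (rule integrable_torus_wiener[OF ij])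
 have eq: "\<alpha> i * wiener (dcoef (w True)) x + \<beta> i * wiener (dcoef (w False)) x = wiener (dcoef (pot i w)) x" for x
 proof -
  have "dcoef (pot i w) = (\<lambda>k. of_real (\<alpha> i) * dcoef (w True) k + of_real (\<beta> i) * dcoef (w False) k)"
   by (auto simp: dcoef_def pot_def algebra_simps)
  then show ?thesis using wiener_add[of "\<lambda>k. of_real (\<alpha> i) * dcoef (w True) k" "\<lambda>k. of_real (\<beta> i) * dcoef (w False) k" x] gd(5)
   by (simp add: wiener_scale)
 qed
 let ?u = "\<lambda>x. wiener (w i) x + M i"
 have iu: "integrable torus ?u" by (rule B_int_add[OF integrable_torus_wiener[OF gd(4)] integrable_torus_const])
 have "integrable torus (\<lambda>x. ?u x * wiener (dcoef (pot i w)) x)"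
  using abs_wiener_le[OF ep] by (intro integrable_mult_bounded[OF iu measurable_wiener_torus[OF ep]]) auto
 then show "integrable torus (\<lambda>x. ?u x * (\<alpha> i * wiener (dcoef (w True)) x + \<beta> i * wiener (dcoef (w False)) x))" unfolding eq .
 fix k
 have fu: "fourier ?u k = w i k + (if k = 0 then of_real (M i) else 0)" for k
 proof -
  have "fourier ?u k = (1 / (2 * pi)) * (LINT x|torus. of_real (wiener (w i) x) * cis (- (of_int k * x)) + of_real (M i) * cis (- (of_int k * x)))"
   by (simp add: fourier_cis distrib_right)
  also have "... = fourier (wiener (w i)) k + of_real (M i) * fourier (\<lambda>x. 1) k"
   using integrable_mult_cis[of "\<lambda>x. of_real (wiener (w i) x)" "- of_int k"] integrable_torus_wiener[OF goodD(4)[OF g[of i]]]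
    integrable_mult_cis[OF integrable_torus_const, of "of_real (M i)" "- of_int k"]
   by (subst B_itg_add) (auto simp: fourier_cis distrib_left)
  finally show ?thesis using fourier_wiener[OF gd(4,7)] fourier_one by simp
 qed
 have "fourier (\<lambda>x. ?u x * wiener (dcoef (pot i w)) x) k = conv (fourier ?u) (dcoef (pot i w)) k"
  by (rule fourier_mult_wiener[OF iu ep hermitian_dcoef[OF hp]])
 also have "... = (LINT q|ZM. \<i> * (w i (k - q) * cmult (pot i w) q) + (if q = k then of_real (M i) * dcoef (pot i w) k else 0))"
  unfolding conv_def fu by (intro B_itg_cong) (auto simp: dcoef_def cmult_def algebra_simps)
 also have "... = \<i> * flux (w i) (pot i w) k + of_real (M i) * dcoef (pot i w) k"
 proof (subst B_itg_add)
  show "integrable ZM (\<lambda>q. \<i> * (w i (k - q) * cmult (pot i w) q))"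
   by (intro integrable_mult_right integrable_flux_summand gd ell_mono[OF p]) simp
  show "integrable ZM (\<lambda>q. if q = k then of_real (M i) * dcoef (pot i w) k else 0)"
   by (rule integrable_ZM_finite[of "{k}"]) auto
  have "(LINT q|ZM. (if q = k then of_real (M i) * dcoef (pot i w) k else 0)) = of_real (M i) * dcoef (pot i w) k"
   by (subst integral_ZM_finite[of "{k}"]) auto
  then show "(LINT q|ZM. \<i> * (w i (k - q) * cmult (pot i w) q)) + (LINT q|ZM. (if q = k then of_real (M i) * dcoef (pot i w) k else 0))
   = \<i> * flux (w i) (pot i w) k + of_real (M i) * dcoef (pot i w) k" by (simp add: flux_def conv_def)
 qed
 also have "... = jcoef w i k" by (simp add: jcoef_def dcoef_def algebra_simps)
 finally have "fourier (\<lambda>x. ?u x * wiener (dcoef (pot i w)) x) k = jcoef w i k" .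
 then show "fourier (wiener (jcoef w i)) k = fourier (\<lambda>x. ?u x * (\<alpha> i * wiener (dcoef (w True)) x + \<beta> i * wiener (dcoef (w False)) x)) k"
  unfolding eq using fourier_wiener[OF ij jcoef_hermitian[OF gd(7)]] by simp
qed

end

context film_data
begin

lemma integrable_en2_bound: "integrable (leb 0 T) (\<lambda>s. K * en 2 (w s))"
 using w_dissipation(2) by simp

text \<open>The mode equations are summed at fixed x. Sum and time integral may be exchanged since
  the l^1 norm of \<open>rhs\<close> is at most a multiple of \<open>en 2\<close>. The identity
  holds at every x and t, as needed for integrating by parts in time at fixed x.\<close>

lemma wiener_evolution:
 assumes t: "t \<in> {0..T}"
 shows "wiener (w t i) x = wiener (u i) x + (LINT s|leb 0 t. wiener (rhs (w s) i) x)"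
  and "integrable (leb 0 T) (\<lambda>s. wiener (rhs (w s) i) x)"
proof -
 define K where "K = M i * c + 2 * c * E0"
 have sw: "integrable (leb 0 t) (\<lambda>s. synth (rhs (w s) i) x)"
  "integrable ZM (\<lambda>k. LINT s|leb 0 t. rhs (w s) i k * cis (of_int k * x))"
  "(LINT s|leb 0 t. synth (rhs (w s) i) x) = (LINT k|ZM. LINT s|leb 0 t. rhs (w s) i k * cis (of_int k * x))" for t
 proof -
  let ?L = "leb 0 t"
  have sf: "sigma_finite_measure ?L" by (intro finite_measure.axioms(1) finite_measure_lebesgue_on) simp
  have m: "(\<lambda>s. rhs (w s) i k * cis (of_int k * x)) \<in> borel_measurable ?L" for k
   using measurable_rhs[OF measurable_w] by measurable
  have fin: "(\<integral>\<^sup>+s. \<integral>\<^sup>+k. ennreal (norm (rhs (w s) i k * cis (of_int k * x))) \<partial>ZM \<partial>?L) < \<infinity>"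
  proof -
   have "(\<integral>\<^sup>+s. \<integral>\<^sup>+k. ennreal (norm (rhs (w s) i k * cis (of_int k * x))) \<partial>ZM \<partial>?L) \<le> (\<integral>\<^sup>+s. ennreal (K * en 2 (w s)) \<partial>?L)"
   proof (rule nn_integral_mono_AE)
    show "AE s in ?L. (\<integral>\<^sup>+k. ennreal (norm (rhs (w s) i k * cis (of_int k * x))) \<partial>ZM) \<le> ennreal (K * en 2 (w s))"
     using w_dissipation(1)
    proof eventually_elim
     case (elim s)
     then have r: "ell 0 (rhs (w s) i)" "l1 0 (rhs (w s) i) \<le> K * en 2 (w s)"
      unfolding K_def using rhs_l1[of "w s" "E0" i] w_energy'(2) by auto
     have "(\<integral>\<^sup>+k. ennreal (norm (rhs (w s) i k * cis (of_int k * x))) \<partial>ZM) = ennreal (l1 0 (rhs (w s) i))"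
      using r(1) unfolding l1_def by (subst nn_integral_eq_integral[symmetric]) (auto simp: ell_def norm_mult)
     then show ?case using r(2) by (simp add: ennreal_leI)
    qed
   qed
   also have "... < \<infinity>" using integrable_en2_bound[of t K] by (subst nn_integral_eq_integral) (auto simp: K_def pos(5) less_imp_le[OF c_pos] less_imp_le[OF pos(1)])
   finally show ?thesis .
  qed
  note s = integral_ZM_swap[OF sf m fin]
  show "integrable ?L (\<lambda>s. synth (rhs (w s) i) x)" using s(2) by (simp add: synth_def)
  show "integrable ZM (\<lambda>k. LINT s|?L. rhs (w s) i k * cis (of_int k * x))" by (rule s(4))
  show "(LINT s|?L. synth (rhs (w s) i) x) = (LINT k|ZM. LINT s|?L. rhs (w s) i k * cis (of_int k * x))"
   using s(5) by (simp add: synth_def)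
 qed
 show "integrable (leb 0 T) (\<lambda>s. wiener (rhs (w s) i) x)"
  unfolding wiener_def by (rule integrable_Re[OF sw(1)])
 have "synth (w t i) x = (LINT k|ZM. u i k * cis (of_int k * x) + (LINT s|leb 0 t. rhs (w s) i k * cis (of_int k * x)))"
  unfolding synth_def
 proof (rule B_itg_cong[OF refl])
  fix k
  have "(LINT s|leb 0 t. rhs (w s) i k * cis (of_int k * x)) = (LINT s|leb 0 t. rhs (w s) i k) * cis (of_int k * x)"
   by (rule Bochner_Integration.integral_mult_left) (rule w_rhs_integrable)
  then show "w t i k * cis (of_int k * x) = u i k * cis (of_int k * x) + (LINT s|leb 0 t. rhs (w s) i k * cis (of_int k * x))"
   using w_equation[of t i k] t by (simp add: distrib_right)
 qed
 also have "... = synth (u i) x + (LINT s|leb 0 t. synth (rhs (w s) i) x)"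
  unfolding sw(3) unfolding synth_def by (rule B_itg_add[OF integrable_ZM_cis[OF u(1)] sw(2)])
 finally show "wiener (w t i) x = wiener (u i) x + (LINT s|leb 0 t. wiener (rhs (w s) i) x)"
  unfolding wiener_def using integral_Re[OF sw(1)] by simp
qed

definition J :: "bool => real => real => real" where
 "J i t x = (wiener (gw t i) x + M i) * (\<alpha> i * wiener (dcoef (gw t True)) x + \<beta> i * wiener (dcoef (gw t False)) x)"

lemma borel_dcoef_gw: "(\<lambda>t. dcoef (gw t i) k) \<in> borel_measurable borel"
 unfolding dcoef_def using borel_gw by measurable

lemma borel_J: "(\<lambda>(t, x). J i t x) \<in> borel_measurable borel"
proof -
 note m = borel_measurable_wiener_path[of "\<lambda>t. gw t i", OF borel_gw] borel_measurable_wiener_path[of "\<lambda>t. dcoef (gw t _)", OF borel_dcoef_gw]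
 from m(1) m(2)[of True] m(2)[of False] show ?thesis unfolding J_def case_prod_unfold by measurable
qed

lemma J_bound: "\<bar>J i t x\<bar> \<le> (E0 + M i) * c * en 2 (gw t)"
proof -
 note gd = goodD[OF gw_good]
 have f: "\<bar>wiener (gw t i) x + M i\<bar> \<le> E0 + M i" using wiener_path.abs_le[OF path, of t i x] pos(1)[of i] by linarith
 have d: "\<bar>wiener (dcoef (gw t i)) x\<bar> \<le> l1 2 (gw t i)" for i
  using abs_wiener_le[OF gd(5), of t i x] l1_dcoef[of 0 "gw t i"] gd(10)[of t i] by (simp add: l1_def)
 have "\<bar>\<alpha> i * wiener (dcoef (gw t True)) x + \<beta> i * wiener (dcoef (gw t False)) x\<bar>
   \<le> \<bar>\<alpha> i * wiener (dcoef (gw t True)) x\<bar> + \<bar>\<beta> i * wiener (dcoef (gw t False)) x\<bar>" by (rule abs_triangle_ineq)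
 also have "... \<le> c * l1 2 (gw t True) + c * l1 2 (gw t False)"
  unfolding abs_mult using pos(2,3)[of i] coeff_le[of i] d c_pos by (intro add_mono mult_mono) auto
 finally have "\<bar>\<alpha> i * wiener (dcoef (gw t True)) x + \<beta> i * wiener (dcoef (gw t False)) x\<bar> \<le> c * en 2 (gw t)" by (simp add: en_def distrib_left)
 then have "\<bar>J i t x\<bar> \<le> (E0 + M i) * (c * en 2 (gw t))" unfolding J_def abs_mult using f by (intro mult_mono) auto
 then show ?thesis by (simp add: mult.assoc)
qed

text \<open>Integration by parts in time at fixed x, exchange of the integrals, integration by parts
  in space at fixed t. The function \<open>h2\<close>, which pairs the divergence of the flux with
  \<open>\<psi>\<close>, links \<open>h1\<close>, which contains \<psi>t, to \<open>h3\<close>,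
  which contains \<psi>x.\<close>

lemma weak_equation:
 assumes tf: "test_function T \<psi> \<psi>t \<psi>x" and T: "T > 0"
 shows "integrable (cylinder T) (\<lambda>(t, x). J i t x * \<psi>x t x)"
  and "- (LINT x|torus. wiener (u i) x * \<psi> 0 x) - (LINT (t, x)|cylinder T. wiener (gw t i) x * \<psi>t t x)
   = - (LINT (t, x)|cylinder T. J i t x * \<psi>x t x)"
proof -
 let ?R = "{0..T} \<times> {-pi..pi}" and ?L = "leb 0 T"
 obtain B where B0: "B \<ge> 0"
  and B: "\<And>t x. t \<in> {0..T} ==> x \<in> {-pi..pi} ==> \<bar>\<psi>t t x\<bar> \<le> B \<and> \<bar>\<psi>x t x\<bar> \<le> B \<and> \<bar>\<psi> t x\<bar> \<le> B * T"
  and cc: "continuous_on ?R (\<lambda>(t, x). \<psi> t x)" "continuous_on ?R (\<lambda>(t, x). \<psi>t t x)" "continuous_on ?R (\<lambda>(t, x). \<psi>x t x)"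
  and z: "\<And>x. \<psi> T x = 0"
  and Dt: "\<And>t x. t \<in> {0..T} ==> ((\<lambda>s. \<psi> s x) has_real_derivative \<psi>t t x) (at t within {0..T})"
  and ct: "\<And>x. continuous_on {0..T} (\<lambda>t. \<psi>t t x)" and cx: "\<And>t. t \<in> {0..T} ==> continuous_on UNIV (\<psi>x t)"
  by (rule test_function_facts[OF tf T]) blast
 have per: "periodic (\<psi> t)" and Dx: "(\<psi> t has_real_derivative \<psi>x t y) (at y)" if "t \<in> {0..T}" for t y
  using tf that unfolding test_function_def by auto
 \<comment> \<open>The indicator turns test functions known to be continuous on the closed rectangle
   into Borel functions on the plane.\<close>
 define h1 h2 h3 where "h1 z = indicator ?R z *\<^sub>R (case z of (t, x) => \<psi>t t x) * (case z of (t, x) => wiener (gw t i) x)"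
  and "h2 z = indicator ?R z *\<^sub>R (case z of (t, x) => \<psi> t x) * (case z of (t, x) => wiener (rhs (w t) i) x)"
  and "h3 z = indicator ?R z *\<^sub>R (case z of (t, x) => \<psi>x t x) * (case z of (t, x) => J i t x)" for z :: "real \<times> real"
 have borel_rhs: "(\<lambda>t. rhs (w t) i k) \<in> borel_measurable borel" for k by (rule measurable_rhs[OF borel_w])
 have m1: "h1 \<in> borel_measurable borel" unfolding h1_def
  by (intro borel_measurable_times borel_measurable_continuous_on_indicator sets_rect cc borel_measurable_wiener_path borel_gw)
 have m2: "h2 \<in> borel_measurable borel" unfolding h2_def
  by (intro borel_measurable_times borel_measurable_continuous_on_indicator sets_rect cc borel_measurable_wiener_path borel_rhs)
 have m3: "h3 \<in> borel_measurable borel" unfolding h3_def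
  by (intro borel_measurable_times borel_measurable_continuous_on_indicator sets_rect cc borel_J)
 have inL: "AE t in ?L. t \<in> {0..T}" by (rule AE_I2) simp
 have inT: "AE x in torus. x \<in> {-pi..pi}" by (rule AE_I2) simp
 have i1: "integrable (cylinder T) h1"
 proof (rule finite_measure.integrable_const_bound[OF finite_measure_cylinder, where B = "B * E0"])
  show "AE z in cylinder T. norm (h1 z) \<le> B * E0"
  proof (rule AE_I2)
   fix z assume "z \<in> space (cylinder T)"
   then show "norm (h1 z) \<le> B * E0" using B wiener_path.abs_le[OF path, of "fst z" i "snd z"] B0
    by (auto simp: h1_def space_cylinder abs_mult intro!: mult_mono)
  qed
 qed (rule measurable_cylinder_borel[OF m1])
 define K where "K = M i * c + 2 * c * E0"
 have g_bound: "AE t in ?L. \<forall>x. \<bar>wiener (rhs (w t) i) x\<bar> \<le> K * en 2 (w t)"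
  using w_dissipation(1)
 proof eventually_elim
  case (elim t)
  then have r: "ell 0 (rhs (w t) i)" "l1 0 (rhs (w t) i) \<le> K * en 2 (w t)"
   unfolding K_def using rhs_l1[of "w t" "E0" i] w_energy'(2) by auto
  then show ?case using abs_wiener_le[of "rhs (w t) i"] by (auto simp: ell_0_iff l1_def intro: order_trans)
 qed
 have i2: "integrable (cylinder T) h2"
 proof (rule cylinder_Tonelli[OF measurable_cylinder_borel[OF m2]])
  show "integrable ?L (\<lambda>t. B * T * (K * en 2 (w t)))" using integrable_en2_bound[of T K] by simp
  show "AE t in ?L. AE x in torus. \<bar>h2 (t, x)\<bar> \<le> B * T * (K * en 2 (w t))"
   using g_bound inL
  proof eventually_elim
   case (elim t)
   show ?case using inT
    by eventually_elim (use elim B B0 T in \<open>auto simp: h2_def abs_mult intro!: mult_mono\<close>)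
  qed
 qed
 have i3: "integrable (cylinder T) h3"
 proof (rule cylinder_Tonelli[OF measurable_cylinder_borel[OF m3]])
  show "integrable ?L (\<lambda>t. B * ((E0 + M i) * c * en 2 (gw t)))" using int_en2_gw by simp
  show "AE t in ?L. AE x in torus. \<bar>h3 (t, x)\<bar> \<le> B * ((E0 + M i) * c * en 2 (gw t))"
   using inL
  proof eventually_elim
   case (elim t)
   show ?case using inT
    by eventually_elim (use elim B B0 J_bound in \<open>auto simp: h3_def abs_mult intro!: mult_mono\<close>)
  qed
 qed
 have e1: "(LINT (t, x)|cylinder T. wiener (gw t i) x * \<psi>t t x) = (LINT z|cylinder T. h1 z)"
  by (intro B_itg_cong) (auto simp: h1_def space_cylinder)
 have e3: "(LINT (t, x)|cylinder T. J i t x * \<psi>x t x) = (LINT z|cylinder T. h3 z)"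
  by (intro B_itg_cong) (auto simp: h3_def space_cylinder)
 show "integrable (cylinder T) (\<lambda>(t, x). J i t x * \<psi>x t x)"
  by (subst B_int_cong[OF refl, of _ _ h3]) (use i3 in \<open>auto simp: h3_def space_cylinder\<close>)
 have inner1: "(LINT t|?L. h1 (t, x)) = - (wiener (u i) x * \<psi> 0 x) - (LINT t|?L. h2 (t, x))" if x: "x \<in> {-pi..pi}" for x
 proof -
  let ?g = "\<lambda>s. wiener (rhs (w s) i) x"
  have ig: "integrable ?L ?g" by (rule wiener_evolution(2)[of 0]) (use T in simp)
  have T0: "T \<ge> 0" using T by simp
  note ac = ac_by_parts[where \<phi> = "\<lambda>t. \<psi> t x" and \<phi>' = "\<lambda>t. \<psi>t t x", OF T0 ig Dt ct z]
  have ip: "integrable ?L (\<lambda>t. \<psi>t t x)" by (rule integrable_continuous_lebesgue_on[OF ct])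
  have mh: "(\<lambda>t. h1 (t, x)) \<in> borel_measurable ?L" by (intro borel_measurable_lebesgue_on_borel borel_pair_section m1)
  have "(LINT t|?L. h1 (t, x)) = (LINT t|?L. wiener (u i) x * \<psi>t t x + \<psi>t t x *\<^sub>R (LINT s|leb 0 t. ?g s))"
  proof (rule integral_cong_AE[OF mh])
   show "(\<lambda>t. wiener (u i) x * \<psi>t t x + \<psi>t t x *\<^sub>R (LINT s|leb 0 t. ?g s)) \<in> borel_measurable ?L"
    using borel_measurable_integrable[OF ip] borel_measurable_integrable[OF ac(1)] by measurable
   show "AE t in ?L. h1 (t, x) = wiener (u i) x * \<psi>t t x + \<psi>t t x *\<^sub>R (LINT s|leb 0 t. ?g s)"
    using inL AE_gw
    by eventually_elim (use x wiener_evolution(1)[of _ T i x] in \<open>auto simp: h1_def algebra_simps\<close>)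
  qed
  also have "... = wiener (u i) x * (LINT t|?L. \<psi>t t x) + (LINT t|?L. \<psi>t t x *\<^sub>R (LINT s|leb 0 t. ?g s))"
   using ip ac(1) by (subst B_itg_add) auto
  also have "(LINT t|?L. \<psi>t t x) = \<psi> T x - \<psi> 0 x" by (rule integral_derivative_lebesgue_on[OF T0 Dt ct])
  also have "(LINT t|?L. \<psi>t t x *\<^sub>R (LINT s|leb 0 t. ?g s)) = - (LINT s|?L. \<psi> s x *\<^sub>R ?g s)" by (rule ac(2))
  also have "(LINT s|?L. \<psi> s x *\<^sub>R ?g s) = (LINT t|?L. h2 (t, x))"
   using x by (intro B_itg_cong) (auto simp: h2_def)
  finally show ?thesis by (simp add: z)
 qed
 have iu: "integrable torus (\<lambda>x. wiener (u i) x * \<psi> 0 x)"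
 proof (rule integrable_mult_bounded[where C = "B * T"])
  show "integrable torus (wiener (u i))" by (rule integrable_torus_wiener[OF u(1)])
  have "continuous_on {-pi..pi} (\<psi> 0)"
   using Dx[of 0] T by (intro continuous_at_imp_continuous_on ballI) (auto intro: DERIV_isCont)
  then show "\<psi> 0 \<in> borel_measurable torus" unfolding torus_def by (rule continuous_imp_measurable_on_sets_lebesgue) simp
 qed (use B[of 0] T in auto)
 have "(LINT z|cylinder T. h1 z) = (LINT x|torus. LINT t|?L. h1 (t, x))" by (rule cylinder_Fubini_borel(5)[OF m1 i1])
 also have "... = (LINT x|torus. - (wiener (u i) x * \<psi> 0 x) - (LINT t|?L. h2 (t, x)))"
  using inner1 by (intro B_itg_cong) auto
 also have "... = - (LINT x|torus. wiener (u i) x * \<psi> 0 x) - (LINT x|torus. LINT t|?L. h2 (t, x))"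
  using iu cylinder_Fubini_borel(6)[OF m2 i2] by (subst B_itg_diff) auto
 also have "(LINT x|torus. LINT t|?L. h2 (t, x)) = (LINT z|cylinder T. h2 z)" by (rule cylinder_Fubini_borel(5)[OF m2 i2, symmetric])
 also have "... = (LINT t|?L. LINT x|torus. h2 (t, x))" by (rule cylinder_Fubini_borel(4)[OF m2 i2])
 also have "... = (LINT t|?L. - (LINT x|torus. h3 (t, x)))"
 proof (rule integral_cong_AE)
  show "(\<lambda>t. LINT x|torus. h2 (t, x)) \<in> borel_measurable ?L" by (rule borel_measurable_integrable[OF cylinder_Fubini_borel(3)[OF m2 i2]])
  show "(\<lambda>t. - (LINT x|torus. h3 (t, x))) \<in> borel_measurable ?L"
   using borel_measurable_integrable[OF cylinder_Fubini_borel(3)[OF m3 i3]] by measurable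
  show "AE t in ?L. (LINT x|torus. h2 (t, x)) = - (LINT x|torus. h3 (t, x))"
   using inL AE_gw w_dissipation(1)
  proof eventually_elim
   case (elim t)
   have gt: "gw t = w t" using elim by simp
   have ew: "\<And>i. ell 2 (w t i)" using elim by simp
   have d: "integrable ZM (dcoef (jcoef (w t) i))"
    using rhs_l1(1)[OF ew w_energy'(2)] unfolding rhs_jcoef ell_0_iff .
   have gg: "\<And>i. good (w t i)" using gw_good[of t] gt by simp
   have ae: "AE x in torus. wiener (jcoef (w t) i) x = J i t x"
    unfolding J_def gt by (rule wiener_jcoef[OF gg])
   have "(LINT x|torus. h2 (t, x)) = (LINT x|torus. wiener (dcoef (jcoef (w t) i)) x * \<psi> t x)"
    using elim(1) by (intro B_itg_cong) (auto simp: h2_def rhs_jcoef)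
   also have "... = - (LINT x|torus. wiener (jcoef (w t) i) x * \<psi>x t x)"
    using wiener_by_parts[OF d per[OF elim(1)] Dx[OF elim(1)] cx[OF elim(1)]] by simp
   also have "(LINT x|torus. wiener (jcoef (w t) i) x * \<psi>x t x) = (LINT x|torus. h3 (t, x))"
   proof (rule integral_cong_AE)
    show "(\<lambda>x. wiener (jcoef (w t) i) x * \<psi>x t x) \<in> borel_measurable torus"
     using measurable_wiener_torus[OF integrable_ZM_of_dcoef[OF d]] borel_measurable_torus_borel[OF borel_measurable_continuous_onI[OF cx[OF elim(1)]]]
     by measurable
    show "(\<lambda>x. h3 (t, x)) \<in> borel_measurable torus" by (intro borel_measurable_torus_borel borel_pair_section m3)
    show "AE x in torus. wiener (jcoef (w t) i) x * \<psi>x t x = h3 (t, x)"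
     using ae inT by eventually_elim (use elim(1) in \<open>auto simp: h3_def\<close>)
   qed
   finally show ?case .
  qed
 qed
 also have "... = - (LINT z|cylinder T. h3 z)" using cylinder_Fubini_borel(4)[OF m3 i3] by simp
 finally show "- (LINT x|torus. wiener (u i) x * \<psi> 0 x) - (LINT (t, x)|cylinder T. wiener (gw t i) x * \<psi>t t x)
   = - (LINT (t, x)|cylinder T. J i t x * \<psi>x t x)" unfolding e1 e3 by simp
qed

end

section \<open>Estimates for single modes\<close>

lemma lebesgue_on_interval_subset:
 fixes f :: "real => 'b::{banach, second_countable_topology}"
 assumes "integrable (leb 0 T) f" "0 \<le> s" "t \<le> T"
 shows "integrable (leb s t) f"
 using assms by (intro lebesgue_on_subset(1)[of "{s..t}" T f]) auto

lemma lebesgue_on_interval_split: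
 fixes f :: "real => 'b::euclidean_space"
 assumes "integrable (leb a c) f" "a \<le> b" "b \<le> c"
 shows "(LINT x|leb a c. f x) = (LINT x|leb a b. f x) + (LINT x|leb b c. f x)"
 by (rule integral_combine[OF assms])

lemma small_integral:
 fixes f :: "real => real"
 assumes f: "integrable (leb 0 T) f" and x: "x \<in> {0..T}" and \<kappa>: "\<kappa> > 0"
 shows "\<exists>d>0. \<forall>s t. 0 \<le> s \<and> s \<le> x \<and> x \<le> t \<and> t \<le> T \<and> t - s < d \<longrightarrow> (LINT r|leb s t. f r) \<le> \<kappa>"
proof -
 have i: "f integrable_on {0..T}" by (rule integrable_on_lebesgue_on[OF f]) simp
 have "continuous_on {0..T} (\<lambda>t. integral {0..t} f)" by (rule indefinite_integral_continuous_1[OF i])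
 then obtain d where d: "d > 0" "\<And>y. y \<in> {0..T} ==> dist y x < d ==> dist (integral {0..y} f) (integral {0..x} f) < \<kappa> / 2"
  using x \<kappa> unfolding continuous_on_iff by (meson half_gt_zero)
 show ?thesis
 proof (intro exI[of _ d] conjI allI impI)
  fix s t assume st: "0 \<le> s \<and> s \<le> x \<and> x \<le> t \<and> t \<le> T \<and> t - s < d"
  have it: "integrable (leb 0 t) f" "integrable (leb 0 s) f" using lebesgue_on_interval_subset[OF f] st by auto
  have "(LINT r|leb 0 t. f r) = (LINT r|leb 0 s. f r) + (LINT r|leb s t. f r)"
   using st by (intro lebesgue_on_interval_split it) auto
  then have "(LINT r|leb s t. f r) = integral {0..t} f - integral {0..s} f"
   using lebesgue_integral_eq_integral[OF it(1)] lebesgue_integral_eq_integral[OF it(2)] by simp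
  moreover have "dist (integral {0..t} f) (integral {0..x} f) < \<kappa> / 2" "dist (integral {0..s} f) (integral {0..x} f) < \<kappa> / 2"
   using d(2)[of t] d(2)[of s] st by (auto simp: dist_real_def)
  ultimately show "(LINT r|leb s t. f r) \<le> \<kappa>" unfolding dist_real_def by linarith
 qed (rule d(1))
qed

text \<open>Continuation in time. By absolute continuity every time has a neighbourhood such that
  \<open>f\<close> has integral at most \<open>\<kappa>\<close> over each subinterval containing
  that time, and bisection chains such intervals. Smallness of an integral thus takes the place of
  continuity of the quantity being propagated.\<close>

lemma interval_induction [consumes 3, case_names start step]:
 fixes f :: "real => real"
 assumes "integrable (leb 0 T) f" "T \<ge> 0" "\<kappa> > 0"
  and "Q 0"
  and "\<And>s t. 0 \<le> s ==> s \<le> t ==> t \<le> T ==> (LINT r|leb s t. f r) \<le> \<kappa> ==> Q s ==> Q t"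
 shows "Q T"
proof -
 have "0 \<le> (0::real) \<and> T \<le> T \<and> Q 0 \<longrightarrow> Q T"
 proof (rule Bolzano[OF assms(2), where P = "\<lambda>a b. 0 \<le> a \<and> b \<le> T \<and> Q a \<longrightarrow> Q b"])
  fix a b c assume "0 \<le> a \<and> b \<le> T \<and> Q a \<longrightarrow> Q b" "0 \<le> b \<and> c \<le> T \<and> Q b \<longrightarrow> Q c" "a \<le> b" "b \<le> c"
  then show "0 \<le> a \<and> c \<le> T \<and> Q a \<longrightarrow> Q c" by auto
 next
  fix x assume "0 \<le> x" "x \<le> T"
  then obtain d where d: "d > 0" "\<forall>s t. 0 \<le> s \<and> s \<le> x \<and> x \<le> t \<and> t \<le> T \<and> t - s < d \<longrightarrow> (LINT r|leb s t. f r) \<le> \<kappa>"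
   using small_integral[OF assms(1) _ assms(3), of x] by auto
  show "\<exists>d>0. \<forall>a b. a \<le> x \<and> x \<le> b \<and> b - a < d \<longrightarrow> 0 \<le> a \<and> b \<le> T \<and> Q a \<longrightarrow> Q b"
  proof (intro exI[of _ d] conjI allI impI d(1))
   fix a b assume "a \<le> x \<and> x \<le> b \<and> b - a < d" "0 \<le> a \<and> b \<le> T \<and> Q a"
   then show "Q b" using d(2) assms(5)[of a b] by auto
  qed
 qed
 then show ?thesis using assms(4) by simp
qed

lemma integral_const_lebesgue_on: "a \<le> b ==> (LINT x|leb a b. k) = (b - a) *\<^sub>R (k :: 'b::{banach, second_countable_topology})"
 by (simp add: measure_restrict_space)

lemma integrable_const_lebesgue_on: "integrable (lebesgue_on {a..b::real}) (\<lambda>x. k :: 'b::{banach, second_countable_topology})"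
 by (intro finite_measure.integrable_const finite_measure_lebesgue_on) simp

lemma integrable_continuous_lebesgue_on':
 fixes f :: "real => complex"
 assumes "continuous_on {a..b} f"
 shows "integrable (leb a b) f"
proof -
 have "\<exists>B. \<forall>z\<in>{a..b}. norm (f z) \<le> B" by (rule compact_continuous_bounded[OF _ assms]) simp
 then obtain B where B: "\<And>t. t \<in> {a..b} ==> norm (f t) \<le> B" by blast
 show ?thesis
 proof (rule finite_measure.integrable_const_bound[OF finite_measure_lebesgue_on, where B = B])
  show "f \<in> borel_measurable (leb a b)" by (rule continuous_imp_measurable_on_sets_lebesgue[OF assms]) simp
 qed (use B in auto)
qed

text \<open>Integrated form of |y|' + l |y| \<le> |r| that never differentiates the modulus. On a
  short interval y b is (1 - l (b - a)) y a plus the integral of r, up to a small multiple of the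
  length. Such errors add up to the same multiple of the total length under bisection, and the
  multiple is arbitrary.\<close>

lemma damped_estimate:
 fixes y r :: "real => complex"
 assumes cont: "continuous_on {0..T} y" and r: "integrable (leb 0 T) r" and l: "l \<ge> 0"
  and eq: "\<And>t. t \<in> {0..T} ==> y t = y 0 + (LINT s|leb 0 t. r s - of_real l * y s)"
  and st: "0 \<le> s" "s \<le> t" "t \<le> T"
 shows "norm (y t) + l * (LINT x|leb s t. norm (y x)) \<le> norm (y s) + (LINT x|leb s t. norm (r x))"
proof -
 have yi: "integrable (leb a b) y" if "0 \<le> a" "b \<le> T" for a b
  by (rule lebesgue_on_interval_subset[OF integrable_continuous_lebesgue_on'[OF cont] that])
 have ri: "integrable (leb a b) r" if "0 \<le> a" "b \<le> T" for a b by (rule lebesgue_on_interval_subset[OF r that])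
 define \<Phi> where "\<Phi> b = norm (y b) + l * (LINT x|leb 0 b. norm (y x)) - (LINT x|leb 0 b. norm (r x))" for b
 have diff: "\<Phi> b - \<Phi> a = norm (y b) - norm (y a) + l * (LINT x|leb a b. norm (y x)) - (LINT x|leb a b. norm (r x))"
  if "0 \<le> a" "a \<le> b" "b \<le> T" for a b
  using lebesgue_on_interval_split[of 0 b "\<lambda>x. norm (y x)" a] lebesgue_on_interval_split[of 0 b "\<lambda>x. norm (r x)" a] yi[of 0 b] ri[of 0 b] that
  by (simp add: \<Phi>_def algebra_simps)
 have near: "\<exists>d>0. \<forall>a b. a \<le> x \<and> x \<le> b \<and> b - a < d \<longrightarrow> (s \<le> a \<and> b \<le> t \<longrightarrow> \<Phi> b - \<Phi> a \<le> \<epsilon> * (b - a))" if x: "s \<le> x" "x \<le> t" and \<epsilon>: "\<epsilon> > 0" for x \<epsilon>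
 proof -
  \<comment> \<open>The two errors below add up to 4 l \<epsilon>' times the length; the summand 1
    covers l = 0.\<close>
  define \<epsilon>' where "\<epsilon>' = \<epsilon> / (4 * (l + 1))"
  have e': "\<epsilon>' > 0" using \<epsilon> l by (auto simp: \<epsilon>'_def)
  have "x \<in> {0..T}" using x st by auto
  then obtain d0 where d0: "d0 > 0" "\<And>z. z \<in> {0..T} ==> dist z x < d0 ==> dist (y z) (y x) < \<epsilon>'"
   using cont e' unfolding continuous_on_iff by meson
  show ?thesis
  \<comment> \<open>The second bound on the length ensures l (b - a) \<le> 1, so that 1 - l (b - a)
    equals its modulus.\<close>
  proof (intro exI[of _ "min d0 (1 / (l + 1))"] conjI allI impI)
   show "min d0 (1 / (l + 1)) > 0" using d0 l by auto
   fix a b assume ab: "a \<le> x \<and> x \<le> b \<and> b - a < min d0 (1 / (l + 1))" "s \<le> a \<and> b \<le> t"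
   then have ab': "0 \<le> a" "a \<le> b" "b \<le> T" using st by auto
   have lab: "l * (b - a) \<le> 1"
   proof -
    have "(l + 1) * (b - a) \<le> 1" using ab l by (simp add: field_simps)
    then show ?thesis using ab' by (simp add: algebra_simps)
   qed
   have close: "norm (y z - y a) \<le> 2 * \<epsilon>'" if z: "z \<in> {a..b}" for z
   proof -
    have "dist (y z) (y x) < \<epsilon>'" "dist (y a) (y x) < \<epsilon>'" using d0(2)[of z] d0(2)[of a] z ab ab' by (auto simp: dist_real_def)
    then have "dist (y z) (y a) < \<epsilon>' + \<epsilon>'" using dist_triangle2[of "y z" "y a" "y x"] by linarith
    then show ?thesis by (simp add: dist_norm)
   qed
   let ?L = "leb a b"
   note iy = yi[OF ab'(1,3)] and ir = ri[OF ab'(1,3)]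
   have ic: "integrable ?L (\<lambda>z. y z - y a)" using iy integrable_const_lebesgue_on by auto
   have n1: "(LINT z|?L. norm (y z - y a)) \<le> 2 * \<epsilon>' * (b - a)"
   proof -
    have "(LINT z|?L. norm (y z - y a)) \<le> (LINT z|?L. 2 * \<epsilon>')"
     using close ic integrable_const_lebesgue_on by (intro integral_mono) auto
    then show ?thesis unfolding integral_const_lebesgue_on[OF ab'(2)] by (simp add: mult.commute)
   qed
   have n2: "(LINT z|?L. norm (y z)) \<le> norm (y a) * (b - a) + 2 * \<epsilon>' * (b - a)"
   proof -
    have "(LINT z|?L. norm (y z)) \<le> (LINT z|?L. norm (y a) + norm (y z - y a))"
     using iy ic integrable_const_lebesgue_on norm_triangle_sub by (intro integral_mono) auto
    also have "... = norm (y a) * (b - a) + (LINT z|?L. norm (y z - y a))"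
    proof -
     have "(LINT z|?L. norm (y a) + norm (y z - y a)) = (LINT z|?L. norm (y a)) + (LINT z|?L. norm (y z - y a))"
      by (rule B_itg_add[OF integrable_const_lebesgue_on integrable_norm[OF ic]])
     then show ?thesis unfolding integral_const_lebesgue_on[OF ab'(2)] by (simp add: mult.commute)
    qed
    finally show ?thesis using n1 by simp
   qed
   have inc: "y b = y a + (LINT z|?L. r z - of_real l * y z)"
   proof -
    have "integrable (leb 0 b) (\<lambda>z. r z - of_real l * y z)" using yi[of 0 b] ri[of 0 b] ab' by auto
    from lebesgue_on_interval_split[OF this ab'(1,2)] show ?thesis using eq[of a] eq[of b] ab' by simp
   qed
   have "(LINT z|?L. r z - of_real l * y z) = (LINT z|?L. r z) - of_real l * (LINT z|?L. y z)" using iy ir by simp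
   moreover have "(LINT z|?L. y z) = (LINT z|?L. y z - y a) + of_real (b - a) * y a"
   proof -
    have "(LINT z|?L. y z - y a) = (LINT z|?L. y z) - (LINT z|?L. y a)"
     by (rule B_itg_diff[OF iy integrable_const_lebesgue_on])
    then show ?thesis unfolding integral_const_lebesgue_on[OF ab'(2)] by (simp add: scaleR_conv_of_real)
   qed
   ultimately have "y b = of_real (1 - l * (b - a)) * y a + (LINT z|?L. r z) - of_real l * (LINT z|?L. y z - y a)"
    using inc by (simp add: algebra_simps)
   then have "norm (y b) \<le> norm (of_real (1 - l * (b - a)) * y a) + norm (LINT z|?L. r z) + norm (of_real l * (LINT z|?L. y z - y a))"
    using norm_triangle_ineq[of "of_real (1 - l * (b - a)) * y a" "LINT z|?L. r z"]
     norm_triangle_ineq4[of "of_real (1 - l * (b - a)) * y a + (LINT z|?L. r z)" "of_real l * (LINT z|?L. y z - y a)"] by simp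
   also have "norm (of_real (1 - l * (b - a)) * y a) = (1 - l * (b - a)) * norm (y a)" using lab unfolding norm_mult norm_of_real by simp
   also have "norm (LINT z|?L. r z) \<le> (LINT z|?L. norm (r z))" by (rule integral_norm_bound)
   also have "norm (of_real l * (LINT z|?L. y z - y a)) \<le> l * (2 * \<epsilon>' * (b - a))"
   proof -
    have "norm (LINT z|?L. y z - y a) \<le> (LINT z|?L. norm (y z - y a))" by (rule integral_norm_bound)
    then have "norm (LINT z|?L. y z - y a) \<le> 2 * \<epsilon>' * (b - a)" using n1 by (rule order_trans)
    from mult_left_mono[OF this l] show ?thesis using l by (simp add: norm_mult)
   qed
   finally have "norm (y b) \<le> (1 - l * (b - a)) * norm (y a) + (LINT z|?L. norm (r z)) + l * (2 * \<epsilon>' * (b - a))" by simp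
   then have "\<Phi> b - \<Phi> a \<le> l * (2 * \<epsilon>' * (b - a)) + l * (2 * \<epsilon>' * (b - a))"
    unfolding diff[OF ab'] using mult_left_mono[OF n2 l] by (simp add: algebra_simps)
   also have "... = (4 * l * \<epsilon>') * (b - a)" by simp
   also have "... \<le> \<epsilon> * (b - a)"
   proof (rule mult_right_mono)
    have "4 * l * \<epsilon>' = \<epsilon> * (l / (l + 1))" using l by (simp add: \<epsilon>'_def field_simps)
    also have "... \<le> \<epsilon> * 1" using l \<epsilon> by (intro mult_left_mono) auto
    finally show "4 * l * \<epsilon>' \<le> \<epsilon>" by simp
   qed (use ab' in simp)
   finally show "\<Phi> b - \<Phi> a \<le> \<epsilon> * (b - a)" .
  qed
 qed
 have "\<Phi> t - \<Phi> s \<le> \<epsilon> * (t - s)" if \<epsilon>: "\<epsilon> > 0" for \<epsilon>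
 proof -
  have "s \<le> s \<and> t \<le> t \<longrightarrow> \<Phi> t - \<Phi> s \<le> \<epsilon> * (t - s)"
  proof (rule Bolzano[OF st(2), where P = "\<lambda>a b. s \<le> a \<and> b \<le> t \<longrightarrow> \<Phi> b - \<Phi> a \<le> \<epsilon> * (b - a)"])
   fix a b c assume "s \<le> a \<and> b \<le> t \<longrightarrow> \<Phi> b - \<Phi> a \<le> \<epsilon> * (b - a)" "s \<le> b \<and> c \<le> t \<longrightarrow> \<Phi> c - \<Phi> b \<le> \<epsilon> * (c - b)" "a \<le> b" "b \<le> c"
   moreover have "\<epsilon> * (c - a) = \<epsilon> * (b - a) + \<epsilon> * (c - b)" by (simp add: algebra_simps)
   ultimately show "s \<le> a \<and> c \<le> t \<longrightarrow> \<Phi> c - \<Phi> a \<le> \<epsilon> * (c - a)" by auto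
  next
   fix x assume "s \<le> x" "x \<le> t"
   from near[OF this \<epsilon>]
   show "\<exists>d>0. \<forall>a b. a \<le> x \<and> x \<le> b \<and> b - a < d \<longrightarrow> s \<le> a \<and> b \<le> t \<longrightarrow> \<Phi> b - \<Phi> a \<le> \<epsilon> * (b - a)" .
  qed
  then show ?thesis by simp
 qed
 then have "\<Phi> t - \<Phi> s \<le> 0"
 proof -
  assume *: "\<And>\<epsilon>. \<epsilon> > 0 ==> \<Phi> t - \<Phi> s \<le> \<epsilon> * (t - s)"
  show ?thesis
  proof (rule ccontr)
   assume "\<not> ?thesis"
   then have p: "\<Phi> t - \<Phi> s > 0" by simp
   let ?e = "(\<Phi> t - \<Phi> s) / (2 * (t - s + 1))"
   have "?e > 0" using p st by (intro divide_pos_pos) auto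
   from *[OF this] have "\<Phi> t - \<Phi> s \<le> (\<Phi> t - \<Phi> s) * ((t - s) / (2 * (t - s + 1)))" by simp
   also have "... < (\<Phi> t - \<Phi> s) * 1" using p st by (intro mult_strict_left_mono) (auto simp: field_simps)
   finally show False by simp
  qed
 qed
 then show ?thesis unfolding diff[OF st] by simp
qed

section \<open>From linear growth of the modes to summability\<close>

lemma integrable_ZM_bounded_sums:
 fixes f :: "int => real"
 assumes "\<And>k. f k \<ge> 0" "\<And>A. finite A ==> (\<Sum>k\<in>A. f k) \<le> C"
 shows "integrable ZM f"
proof -
 have "f summable_on UNIV" by (rule nonneg_bdd_above_summable_on) (use assms in \<open>auto intro!: bdd_aboveI[where M = C]\<close>)
 then show ?thesis using infsum_ZM(1)[OF assms(1)] by simp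
qed

text \<open>The operator \<open>A \<mapsto> (\<lambda>k. \<bar>k\<bar> * \<Sum>q. high A e k q)\<close> contracts both in \<open>\<ell>\<^sup>1\<close> and in the sup-norm
 weighted by \<open>1/\<bar>k\<bar>\<close>, so that a merely linearly growing \<open>A\<close> is upgraded to a summable one.\<close>

definition high :: "(int => real) => (int => real) => int => int => real" where
 "high A e k q = (if q = 0 \<or> \<bar>k - q\<bar> > \<bar>q\<bar> then 0 else A (k - q) * e q / mag q)"

lemma high_le_lin:
 assumes A: "\<And>k. 0 \<le> A k" "\<And>k. A k \<le> C0 * mag k" and e: "\<And>k. e k \<ge> 0"
 shows "0 \<le> high A e k q" "high A e k q \<le> C0 * e q"
proof -
 show "0 \<le> high A e k q" using A e by (simp add: high_def)
 show "high A e k q \<le> C0 * e q"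
 proof (cases "q = 0 \<or> \<bar>k - q\<bar> > \<bar>q\<bar>")
  case True
  have "0 \<le> C0" using order_trans[OF A(1)[of 1] A(2)[of 1]] by simp
  then show ?thesis using True e by (auto simp: high_def)
 next
  case False
  have C0: "0 \<le> C0" using order_trans[OF A(1)[of 1] A(2)[of 1]] by simp
  have "mag (k - q) \<le> mag q" using False by linarith
  then have "A (k - q) \<le> C0 * mag q" using A(2)[of "k - q"] mult_left_mono[OF _ C0] by (meson order_trans)
  then have "A (k - q) * e q \<le> C0 * mag q * e q" using e by (intro mult_right_mono) auto
  then show ?thesis using False by (simp add: high_def divide_le_eq mult_ac)
 qed
qed

text \<open>On the pairs kept by \<open>high\<close> one has |k| \<le> 2 |q|, so the factor 1 / |q|
  pays for the outer |k|; summing over k and then over q gives the product of the two sums.\<close>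

lemma high_l1:
 assumes U: "\<And>k. 0 \<le> U k" "integrable ZM U" and e: "\<And>k. e k \<ge> 0" "integrable ZM e"
 shows "integrable ZM (\<lambda>q. high U e k q)"
  and "integrable ZM (\<lambda>k. mag k * (LINT q|ZM. high U e k q))"
  and "(LINT k|ZM. mag k * (LINT q|ZM. high U e k q)) \<le> 2 * (LINT k|ZM. U k) * (LINT k|ZM. e k)"
proof -
 define T where "T k q = 2 * U (k - q) * e q" for k q
 have le: "mag k * high U e k q \<le> T k q" for k q
 proof (cases "q = 0 \<or> \<bar>k - q\<bar> > \<bar>q\<bar>")
  case False
  have "mag k \<le> 2 * mag q" using False by linarith
  then have "mag k / mag q \<le> 2" using False by (simp add: divide_le_eq)
  from mult_right_mono[OF this, of "U (k - q) * e q"] show ?thesis using False U e by (simp add: high_def T_def mult_ac)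
 qed (use U e in \<open>auto simp: high_def T_def\<close>)
 have h0: "0 \<le> high U e k q" for k q using U e by (simp add: high_def)
 have Uk: "U k \<le> (LINT k|ZM. U k)" for k by (rule le_integral_ZM[OF U(2,1)])
 show ih: "integrable ZM (\<lambda>q. high U e k q)" for k
 proof (rule B_int_bound[where f = "\<lambda>q. (LINT k|ZM. U k) * e q"])
  show "AE q in ZM. norm (high U e k q) \<le> norm ((LINT k|ZM. U k) * e q)"
  proof (rule AE_I2)
   fix q
   have "high U e k q \<le> (LINT k|ZM. U k) * e q"
   proof (cases "q = 0 \<or> \<bar>k - q\<bar> > \<bar>q\<bar>")
    case False
    then have "1 \<le> mag q" by linarith
    then have "U (k - q) * e q / mag q \<le> U (k - q) * e q / 1" using U(1) e(1) by (intro divide_left_mono) auto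
    then have "U (k - q) * e q / mag q \<le> U (k - q) * e q" by simp
    also have "... \<le> (LINT k|ZM. U k) * e q" using Uk e by (intro mult_right_mono) auto
    finally show ?thesis using False by (simp add: high_def)
   qed (use order_trans[OF U(1) Uk] e in \<open>auto simp: high_def\<close>)
   then show "norm (high U e k q) \<le> norm ((LINT k|ZM. U k) * e q)" using h0[of k q] by simp
  qed
 qed (use e in auto)
 have sw: "(\<integral>\<^sup>+q. \<integral>\<^sup>+k. ennreal (norm (T k q)) \<partial>ZM \<partial>ZM) < \<infinity>" and
  val: "(\<integral>\<^sup>+q. \<integral>\<^sup>+k. ennreal (norm (T k q)) \<partial>ZM \<partial>ZM) = ennreal (2 * (LINT k|ZM. U k) * (LINT k|ZM. e k))"
 proof -
  have sx: "bij (\<lambda>k::int. k - q)" for q by (rule o_bij[where g = "\<lambda>k. k + q"]) auto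
  have "(\<integral>\<^sup>+k. ennreal (norm (T k q)) \<partial>ZM) = ennreal (2 * (LINT k|ZM. U k) * e q)" for q
  proof -
   have "integrable ZM (\<lambda>k. U (k - q))" "(LINT k|ZM. U (k - q)) = (LINT k|ZM. U k)"
    using integrable_bij_count_space[OF sx, of U] integral_bij_count_space[OF sx, of U] U by auto
   then show ?thesis using U e unfolding T_def by (subst nn_integral_eq_integral) auto
  qed
  then have "(\<integral>\<^sup>+q. \<integral>\<^sup>+k. ennreal (norm (T k q)) \<partial>ZM \<partial>ZM) = (\<integral>\<^sup>+q. ennreal (2 * (LINT k|ZM. U k) * e q) \<partial>ZM)" by simp
  also have "... = ennreal (2 * (LINT k|ZM. U k) * (LINT k|ZM. e k))"
   using e order_trans[OF U(1) Uk] by (subst nn_integral_eq_integral) auto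
  finally show "(\<integral>\<^sup>+q. \<integral>\<^sup>+k. ennreal (norm (T k q)) \<partial>ZM \<partial>ZM) = ennreal (2 * (LINT k|ZM. U k) * (LINT k|ZM. e k))" .
  then show "(\<integral>\<^sup>+q. \<integral>\<^sup>+k. ennreal (norm (T k q)) \<partial>ZM \<partial>ZM) < \<infinity>" by simp
 qed
 have "(\<integral>\<^sup>+k. ennreal (mag k * (LINT q|ZM. high U e k q)) \<partial>ZM) = (\<integral>\<^sup>+k. \<integral>\<^sup>+q. ennreal (mag k * high U e k q) \<partial>ZM \<partial>ZM)"
 proof (rule nn_integral_cong)
  fix k
  have "(\<integral>\<^sup>+q. ennreal (mag k * high U e k q) \<partial>ZM) = ennreal (LINT q|ZM. mag k * high U e k q)"
   using ih h0 by (intro nn_integral_eq_integral) auto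
  then show "ennreal (mag k * (LINT q|ZM. high U e k q)) = (\<integral>\<^sup>+q. ennreal (mag k * high U e k q) \<partial>ZM)" by simp
 qed
 also have "... \<le> (\<integral>\<^sup>+k. \<integral>\<^sup>+q. ennreal (norm (T k q)) \<partial>ZM \<partial>ZM)"
  using le by (intro nn_integral_mono ennreal_leI) (auto intro: order_trans[OF _ abs_ge_self])
 also have "... = (\<integral>\<^sup>+q. \<integral>\<^sup>+k. ennreal (norm (T k q)) \<partial>ZM \<partial>ZM)"
  by (rule nn_integral_count_space_nn_integral[symmetric]) auto
 also have "... = ennreal (2 * (LINT k|ZM. U k) * (LINT k|ZM. e k))" by (rule val)
 finally have nn: "(\<integral>\<^sup>+k. ennreal (mag k * (LINT q|ZM. high U e k q)) \<partial>ZM) \<le> ennreal (2 * (LINT k|ZM. U k) * (LINT k|ZM. e k))" .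
 have hq: "0 \<le> (LINT q|ZM. high U e k q)" for k using h0 by (intro integral_nonneg_AE) auto
 show "integrable ZM (\<lambda>k. mag k * (LINT q|ZM. high U e k q))" unfolding integrable_iff_bounded
  using order.strict_trans1[OF nn, of top] hq by (auto simp: abs_mult)
 show "(LINT k|ZM. mag k * (LINT q|ZM. high U e k q)) \<le> 2 * (LINT k|ZM. U k) * (LINT k|ZM. e k)"
  using nn U e by (intro integral_real_bounded) (auto intro!: mult_nonneg_nonneg integral_nonneg_AE)
qed

text \<open>\<open>A\<close> is bounded by a summable part plus a multiple of |k|. Inserting this in
  the inequality gives a new summable part with sum again at most 2 b, while the multiple is at
  least halved, since |k - q| \<le> |q| cancels 1 / |q|. On a finite set of modes the growing part
  disappears in the limit, which bounds all partial sums by 2 b.\<close>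

lemma discrete_bootstrap:
 assumes A: "\<And>k. 0 \<le> A k" "\<And>k. A k \<le> C0 * mag k"
  and B: "\<And>k. 0 \<le> B k" "integrable ZM B" and e: "\<And>k. e k \<ge> 0" "integrable ZM e"
  and C1: "C1 \<ge> 0" "4 * C1 * (LINT k|ZM. e k) \<le> 1"
  and ineq: "\<And>k. A k \<le> B k + C1 * (mag k * (LINT q|ZM. high A e k q))"
 shows "integrable ZM A"
proof -
 have C0: "0 \<le> C0" using order_trans[OF A(1)[of 1] A(2)[of 1]] by simp
 define b where "b = (LINT k|ZM. B k)"
 define \<kappa> where "\<kappa> = (LINT k|ZM. e k)"
 have b0: "b \<ge> 0" and \<kappa>0: "\<kappa> \<ge> 0" unfolding b_def \<kappa>_def using B(1) e(1) by (auto intro!: integral_nonneg_AE)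
 have "\<exists>U. (\<forall>k. 0 \<le> U k) \<and> integrable ZM U \<and> (LINT k|ZM. U k) \<le> 2 * b \<and> (\<forall>k. A k \<le> U k + C0 * (1/2)^N * mag k)" for N
 proof (induction N)
  case 0
  show ?case using A b0 by (intro exI[of _ "\<lambda>k. 0"]) auto
 next
  case (Suc N)
  then obtain U where U: "\<And>k. 0 \<le> U k" "integrable ZM U" "(LINT k|ZM. U k) \<le> 2 * b" "\<And>k. A k \<le> U k + C0 * (1/2)^N * mag k" by blast
  note h = high_l1[OF U(1,2) e]
  define U' where "U' k = B k + C1 * (mag k * (LINT q|ZM. high U e k q))" for k
  have hU: "0 \<le> (LINT q|ZM. high U e k q)" for k using U(1) e(1) by (intro integral_nonneg_AE) (auto simp: high_def)
  have "0 \<le> U' k" for k using B(1) C1(1) hU by (auto simp: U'_def)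
  moreover have "integrable ZM U'" unfolding U'_def using B(2) h(2) by auto
  moreover have "(LINT k|ZM. U' k) \<le> 2 * b"
  proof -
   have "(LINT k|ZM. U' k) = b + C1 * (LINT k|ZM. mag k * (LINT q|ZM. high U e k q))"
    unfolding U'_def b_def using B(2) h(2) by simp
   also have "... \<le> b + C1 * (2 * (LINT k|ZM. U k) * \<kappa>)" using h(3) C1(1) by (intro add_left_mono mult_left_mono) (auto simp: \<kappa>_def)
   also have "... \<le> b + C1 * (2 * (2 * b) * \<kappa>)" using U(3) C1(1) \<kappa>0 by (intro add_left_mono mult_left_mono mult_right_mono) auto
   also have "... = b + b * (4 * C1 * \<kappa>)" by simp
   also have "... \<le> b + b * 1" using C1(2) b0 by (intro add_left_mono mult_left_mono) (auto simp: \<kappa>_def)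
   finally show ?thesis by simp
  qed
  moreover have "A k \<le> U' k + C0 * (1/2)^Suc N * mag k" for k
  proof -
   let ?\<rho> = "C0 * (1/2)^N"
   have \<rho>: "?\<rho> \<ge> 0" using C0 by simp
   have iA: "integrable ZM (\<lambda>q. high A e k q)"
    by (rule B_int_bound[where f = "\<lambda>q. C0 * e q"])
      (use e high_le_lin[OF A e(1)] C0 in \<open>auto intro!: AE_I2\<close>)
   have hle: "high A e k q \<le> high U e k q + ?\<rho> * e q" for q
   proof (cases "q = 0 \<or> \<bar>k - q\<bar> > \<bar>q\<bar>")
    case False
    have "mag (k - q) \<le> mag q" using False by linarith
    then have "A (k - q) \<le> U (k - q) + ?\<rho> * mag q" using U(4)[of "k - q"] mult_left_mono[OF _ \<rho>] by (meson add_left_mono order_trans)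
    then have "A (k - q) * e q / mag q \<le> (U (k - q) + ?\<rho> * mag q) * e q / mag q"
     using e(1) by (intro divide_right_mono mult_right_mono) auto
    also have "... = U (k - q) * e q / mag q + ?\<rho> * e q" using False by (simp add: add_divide_distrib distrib_right)
    finally show ?thesis using False by (simp add: high_def)
   qed (use \<rho> e in \<open>auto simp: high_def\<close>)
   have "(LINT q|ZM. high A e k q) \<le> (LINT q|ZM. high U e k q + ?\<rho> * e q)"
    using iA h(1) e(2) hle by (intro integral_mono) auto
   also have "... = (LINT q|ZM. high U e k q) + ?\<rho> * \<kappa>" using h(1) e(2) by (simp add: \<kappa>_def)
   finally have "A k \<le> B k + C1 * (mag k * ((LINT q|ZM. high U e k q) + ?\<rho> * \<kappa>))"
    using ineq[of k] C1(1) by (meson abs_ge_zero add_left_mono mult_left_mono order_trans)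
   also have "... = U' k + ?\<rho> * mag k * (C1 * \<kappa>)" by (simp add: U'_def algebra_simps)
   also have "... \<le> U' k + ?\<rho> * mag k * (1/2)" using C1(2) \<rho> by (intro add_left_mono mult_left_mono) (auto simp: \<kappa>_def)
   finally show ?thesis by (simp add: mult_ac)
  qed
  ultimately show ?case by blast
 qed
 note iter = this
 show ?thesis
 proof (rule integrable_ZM_bounded_sums[OF A(1)])
  fix F :: "int set" assume F: "finite F"
  have "(\<Sum>k\<in>F. A k) \<le> 2 * b + C0 * (\<Sum>k\<in>F. mag k) * (1/2)^N" for N
  proof -
   obtain U where U: "\<And>k. 0 \<le> U k" "integrable ZM U" "(LINT k|ZM. U k) \<le> 2 * b" "\<And>k. A k \<le> U k + C0 * (1/2)^N * mag k" using iter[of N] by blast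
   have "(\<Sum>k\<in>F. A k) \<le> (\<Sum>k\<in>F. U k) + (\<Sum>k\<in>F. C0 * (1/2)^N * mag k)" using U(4) by (simp add: sum.distrib[symmetric] sum_mono)
   also have "(\<Sum>k\<in>F. U k) \<le> 2 * b" using sum_le_integral_ZM[OF U(2,1) F] U(3) by linarith
   finally show ?thesis by (simp add: sum_distrib_left mult_ac)
  qed
  moreover have "(\<lambda>N. 2 * b + C0 * (\<Sum>k\<in>F. mag k) * (1/2)^N) \<longlonglongrightarrow> 2 * b + C0 * (\<Sum>k\<in>F. mag k) * 0"
   by (intro tendsto_intros LIMSEQ_power_zero) auto
  ultimately have "(\<Sum>k\<in>F. A k) \<le> 2 * b + C0 * (\<Sum>k\<in>F. mag k) * 0"
   by (intro LIMSEQ_le_const) auto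
  then show "(\<Sum>k\<in>F. A k) \<le> 2 * b" by simp
 qed
qed

section \<open>Boundedness of integrable solutions\<close>

lemma AE_lebesgue_on_mono:
 assumes "AE x in lebesgue_on B. P x" "A \<subseteq> B" "A \<in> sets lebesgue" "B \<in> sets lebesgue"
 shows "AE x in lebesgue_on A. P x"
proof -
 have AB: "A \<inter> space lebesgue \<in> sets lebesgue" "B \<inter> space lebesgue \<in> sets lebesgue" using assms(3,4) by auto
 have "AE x in lebesgue. x \<in> B \<longrightarrow> P x" using assms(1) unfolding AE_restrict_space_iff[OF AB(2)] .
 then have "AE x in lebesgue. x \<in> A \<longrightarrow> P x" by eventually_elim (use assms(2) in blast)
 then show ?thesis unfolding AE_restrict_space_iff[OF AB(1)] .
qed

lemma sigma_finite_lebesgue_on_interval: "sigma_finite_measure (lebesgue_on {s..t::real})"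
 using finite_measure_lebesgue_on[of "{s..t}"] by (simp add: finite_measure_def)

definition amp :: "(bool => int => complex) => int => real" where
 "amp w k = norm (w True k) + norm (w False k)"

lemma amp_nonneg [simp]: "0 \<le> amp w k"
 by (simp add: amp_def)

lemma norm_le_amp: "norm (w i k) \<le> amp w k"
 by (cases i) (auto simp: amp_def)

text \<open>The half of the convolution in which the factor carrying the derivative has the higher
  frequency, or an equal one.\<close>

definition low_high :: "(int => real) => int => int => real" where
 "low_high a k q = (if \<bar>k - q\<bar> > \<bar>q\<bar> then 0 else a (k - q) * (mag q * a q))"

text \<open>Where |k - q| > |q|, the weight |q| is below |k - q|, and the term is dominated by its
  mirror image under the reflection of q to k - q, which lies in the kept half. At the price of a
  factor 2 the derivative always falls on the higher frequency.\<close>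

lemma fold_convolution:
 assumes a: "\<And>k. a k \<ge> 0" and i: "integrable ZM (\<lambda>q. a (k - q) * (mag q * a q))"
 shows "integrable ZM (low_high a k)"
  and "(LINT q|ZM. a (k - q) * (mag q * a q)) \<le> 2 * (LINT q|ZM. low_high a k q)"
proof -
 show iL: "integrable ZM (low_high a k)"
  by (rule B_int_bound[OF i]) (use a in \<open>auto intro!: AE_I2 simp: low_high_def\<close>)
 have bj: "bij (\<lambda>q::int. k - q)" by (rule o_bij[where g = "\<lambda>q. k - q"]) auto
 have iL': "integrable ZM (\<lambda>q. low_high a k (k - q))" and eL: "(LINT q|ZM. low_high a k (k - q)) = (LINT q|ZM. low_high a k q)"
  using integrable_bij_count_space[OF bj, of "low_high a k"] integral_bij_count_space[OF bj, of "low_high a k"] iL by auto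
 have le: "a (k - q) * (mag q * a q) \<le> low_high a k q + low_high a k (k - q)" for q
 proof (cases "\<bar>k - q\<bar> > \<bar>q\<bar>")
  case True
  have "mag q \<le> mag (k - q)" using True by linarith
  then have "mag q * (a q * a (k - q)) \<le> mag (k - q) * (a q * a (k - q))" using a by (intro mult_right_mono) auto
  then show ?thesis using True by (simp add: low_high_def mult_ac)
 next
  case False
  have "0 \<le> low_high a k (k - q)" using a by (simp add: low_high_def)
  then show ?thesis using False by (simp add: low_high_def)
 qed
 have "(LINT q|ZM. a (k - q) * (mag q * a q)) \<le> (LINT q|ZM. low_high a k q + low_high a k (k - q))"
  by (rule integral_mono[OF i B_int_add[OF iL iL'] le])
 then show "(LINT q|ZM. a (k - q) * (mag q * a q)) \<le> 2 * (LINT q|ZM. low_high a k q)"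
  using B_itg_add[OF iL iL'] eL by simp
qed

context film
begin

lemma pot_le_amp: "norm (pot i w k) \<le> c * amp w k"
proof -
 have "norm (pot i w k) \<le> \<alpha> i * norm (w True k) + \<beta> i * norm (w False k)"
  unfolding pot_def using pos(2,3)[of i] by (intro order_trans[OF norm_triangle_ineq]) (simp add: norm_mult)
 also have "... \<le> c * norm (w True k) + c * norm (w False k)" using coeff_le[of i] by (intro add_mono mult_right_mono) auto
 finally show ?thesis by (simp add: amp_def distrib_left)
qed

lemma amp_ell:
 assumes "\<And>i. ell s (w i)"
 shows "integrable ZM (\<lambda>k. mag k^s * amp w k)" "(LINT k|ZM. mag k^s * amp w k) = en s w"
 using en_eq_integral[of s w, OF assms] by (auto simp: amp_def)

lemma amp_rhs:
 assumes w: "\<And>i. ell 2 (w i)"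
 shows "norm (rhs w True k) + norm (rhs w False k) \<le> (M True + M False) * c * ((real_of_int k)^2 * amp w k)
   + 2 * c * (mag k * (LINT q|ZM. low_high (amp w) k q))"
  and "integrable ZM (low_high (amp w) k)"
proof -
 have w0: "\<And>i. ell 0 (w i)" by (rule ell_mono[OF w]) simp
 have w1: "\<And>i. ell 1 (w i)" by (rule ell_mono[OF w]) simp
 have a1: "integrable ZM (\<lambda>k. mag k * amp w k)" using amp_ell(1)[OF w1] by simp
 have ab: "amp w k \<le> en 0 w" for k using norm_le_l1_0[OF w0, of True k] norm_le_l1_0[OF w0, of False k] by (simp add: amp_def en_def)
 have ia: "integrable ZM (\<lambda>q. amp w (k - q) * (mag q * amp w q))"
  by (rule B_int_bound[OF integrable_mult_right[OF a1, of "en 0 w"]])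
    (use ab in \<open>auto intro!: AE_I2 mult_right_mono simp: abs_mult\<close>)
 show "integrable ZM (low_high (amp w) k)" by (rule fold_convolution(1)[OF amp_nonneg ia])
 note isum = integrable_flux_summand[OF w0 ell_pot(1)[OF w1]]
 have fl: "norm (flux (w True) (pot True w) k) + norm (flux (w False) (pot False w) k) \<le> c * (LINT q|ZM. amp w (k - q) * (mag q * amp w q))"
 proof -
  have "norm (flux (w i) (pot i w) k) \<le> (LINT q|ZM. norm (w i (k - q) * cmult (pot i w) q))" for i
   unfolding flux_def conv_def by (rule integral_norm_bound)
  from add_mono[OF this[of True] this[of False]]
  have "norm (flux (w True) (pot True w) k) + norm (flux (w False) (pot False w) k)
   \<le> (LINT q|ZM. norm (w True (k - q) * cmult (pot True w) q) + norm (w False (k - q) * cmult (pot False w) q))"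
   using integrable_norm[OF isum] by (subst B_itg_add) auto
  also have "... \<le> (LINT q|ZM. c * (amp w (k - q) * (mag q * amp w q)))"
  proof (rule integral_mono)
   fix q
   have "norm (w i (k - q) * cmult (pot i w) q) \<le> norm (w i (k - q)) * (mag q * (c * amp w q))" for i
    using pot_le_amp[of i w q] by (auto simp: cmult_def norm_mult intro!: mult_left_mono)
   from add_mono[OF this[of True] this[of False]]
   show "norm (w True (k - q) * cmult (pot True w) q) + norm (w False (k - q) * cmult (pot False w) q) \<le> c * (amp w (k - q) * (mag q * amp w q))"
    by (simp add: amp_def[of w "k - q"] algebra_simps)
  qed (use integrable_norm[OF isum] ia in auto)
  finally show ?thesis by simp
 qed
 have r: "norm (rhs w i k) \<le> M i * c * ((real_of_int k)^2 * amp w k) + mag k * norm (flux (w i) (pot i w) k)" for i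
 proof -
  have "norm (of_int k * of_real (M i) * pot i w k + flux (w i) (pot i w) k) \<le> mag k * M i * norm (pot i w k) + norm (flux (w i) (pot i w) k)"
   using pos(1)[of i] by (intro order_trans[OF norm_triangle_ineq]) (simp add: norm_mult)
  also have "... \<le> mag k * M i * (c * amp w k) + norm (flux (w i) (pot i w) k)"
   using pos(1)[of i] by (intro add_right_mono mult_left_mono pot_le_amp) auto
  finally have "mag k * norm (of_int k * of_real (M i) * pot i w k + flux (w i) (pot i w) k)
    \<le> mag k * (mag k * M i * (c * amp w k) + norm (flux (w i) (pot i w) k))" by (rule mult_left_mono) simp
  also have "... = M i * c * ((mag k)^2 * amp w k) + mag k * norm (flux (w i) (pot i w) k)"
   by (simp only: power2_eq_square algebra_simps)
  finally show ?thesis by (simp add: rhs_def norm_mult)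
 qed
 have "norm (rhs w True k) + norm (rhs w False k) \<le> (M True + M False) * c * ((real_of_int k)^2 * amp w k)
   + mag k * (norm (flux (w True) (pot True w) k) + norm (flux (w False) (pot False w) k))"
  using r[of True] r[of False] by (simp add: algebra_simps)
 also have "... \<le> (M True + M False) * c * ((real_of_int k)^2 * amp w k) + mag k * (c * (2 * (LINT q|ZM. low_high (amp w) k q)))"
  using fl fold_convolution(2)[OF amp_nonneg ia] c_pos
  by (intro add_left_mono mult_left_mono) (auto intro: order_trans mult_left_mono)
 finally show "norm (rhs w True k) + norm (rhs w False k) \<le> (M True + M False) * c * ((real_of_int k)^2 * amp w k)
   + 2 * c * (mag k * (LINT q|ZM. low_high (amp w) k q))" by (simp add: mult_ac)
qed

lemma integral_en2_modes:
 fixes w :: "'a => bool => int => complex"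
 assumes sf: "sigma_finite_measure L" and mw: "\<And>i k. (\<lambda>r. w r i k) \<in> borel_measurable L"
  and ae: "AE r in L. \<forall>i. ell 2 (w r i)" and i2: "integrable L (\<lambda>r. en 2 (w r))"
 shows "\<And>k. integrable L (\<lambda>r. (real_of_int k)^2 * amp (w r) k)"
  and "integrable ZM (\<lambda>k. LINT r|L. (real_of_int k)^2 * amp (w r) k)"
  and "(LINT r|L. en 2 (w r)) = (LINT k|ZM. LINT r|L. (real_of_int k)^2 * amp (w r) k)"
  and "(\<integral>\<^sup>+r. \<integral>\<^sup>+k. ennreal ((real_of_int k)^2 * amp (w r) k) \<partial>ZM \<partial>L) < \<infinity>"
proof -
 have "(\<integral>\<^sup>+r. \<integral>\<^sup>+k. ennreal ((real_of_int k)^2 * amp (w r) k) \<partial>ZM \<partial>L) = (\<integral>\<^sup>+r. ennreal (en 2 (w r)) \<partial>L)"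
 proof (rule nn_integral_cong_AE)
  show "AE r in L. (\<integral>\<^sup>+k. ennreal ((real_of_int k)^2 * amp (w r) k) \<partial>ZM) = ennreal (en 2 (w r))"
   using ae by eventually_elim (use amp_ell[of 2] in \<open>subst nn_integral_eq_integral, auto\<close>)
 qed
 also have "... = ennreal (LINT r|L. en 2 (w r))" using i2 by (intro nn_integral_eq_integral) auto
 finally show fin: "(\<integral>\<^sup>+r. \<integral>\<^sup>+k. ennreal ((real_of_int k)^2 * amp (w r) k) \<partial>ZM \<partial>L) < \<infinity>" by simp
 have m: "(\<lambda>r. (real_of_int k)^2 * amp (w r) k) \<in> borel_measurable L" for k
  unfolding amp_def using mw by measurable
 have fin': "(\<integral>\<^sup>+r. \<integral>\<^sup>+k. ennreal (norm ((real_of_int k)^2 * amp (w r) k)) \<partial>ZM \<partial>L) < \<infinity>" using fin by simp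
 note sw = integral_ZM_swap[OF sf m fin']
 show "\<And>k. integrable L (\<lambda>r. (real_of_int k)^2 * amp (w r) k)" by (rule sw(3))
 show "integrable ZM (\<lambda>k. LINT r|L. (real_of_int k)^2 * amp (w r) k)" by (rule sw(4))
 have "(LINT r|L. en 2 (w r)) = (LINT r|L. LINT k|ZM. (real_of_int k)^2 * amp (w r) k)"
 proof (rule integral_cong_AE)
  show "(\<lambda>r. en 2 (w r)) \<in> borel_measurable L" by (intro measurable_en mw)
  show "(\<lambda>r. LINT k|ZM. (real_of_int k)^2 * amp (w r) k) \<in> borel_measurable L" by (intro measurable_integral_ZM m)
  show "AE r in L. en 2 (w r) = (LINT k|ZM. (real_of_int k)^2 * amp (w r) k)"
   using ae by eventually_elim (use amp_ell(2)[of 2] in simp)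
 qed
 then show "(LINT r|L. en 2 (w r)) = (LINT k|ZM. LINT r|L. (real_of_int k)^2 * amp (w r) k)" using sw(5) by simp
qed

text \<open>What a weak solution in the uniqueness class provides for its modes. Summability is
  stated at time 0 only; at later times each mode is continuous, \<open>en 2\<close> is integrable,
  and the last clause expresses that the flux is integrable on the cylinder, whose outer derivative
  costs a factor |k|.\<close>

definition spectral :: "real => (real => bool => int => complex) => bool" where
 "spectral T w \<longleftrightarrow> (\<forall>i k. continuous_on {0..T} (\<lambda>t. w t i k)) \<and> (\<forall>t\<in>{0..T}. \<forall>i. w t i 0 = 0) \<and> (\<forall>i. ell 0 (w 0 i)) \<and>
   (AE t in leb 0 T. \<forall>i. ell 2 (w t i)) \<and> integrable (leb 0 T) (\<lambda>t. en 2 (w t)) \<and>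
   (\<forall>i k. integrable (leb 0 T) (\<lambda>t. rhs (w t) i k)) \<and>
   (\<forall>i k. \<forall>t\<in>{0..T}. w t i k = w 0 i k + (LINT s|leb 0 t. rhs (w s) i k)) \<and>
   (\<exists>C. \<forall>i k. (LINT t|leb 0 T. norm (rhs (w t) i k)) \<le> C * mag k)"

context
 fixes T w assumes sp: "spectral T w" and T0: "T \<ge> 0"
begin

lemma spectral_continuous: "continuous_on {0..T} (\<lambda>t. w t i k)"
 using sp unfolding spectral_def by blast

lemma spectral_zero: "t \<in> {0..T} ==> w t i 0 = 0"
 using sp unfolding spectral_def by blast

lemma spectral_ell: "ell 0 (w 0 i)"
 using sp unfolding spectral_def by blast

lemma spectral_measurable: "0 \<le> s ==> t \<le> T ==> (\<lambda>t. w t i k) \<in> borel_measurable (leb s t)"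
 by (rule continuous_imp_measurable_on_sets_lebesgue[OF continuous_on_subset[OF spectral_continuous]]) auto

lemma spectral_AE: "0 \<le> s ==> t \<le> T ==> AE t in leb s t. \<forall>i. ell 2 (w t i)"
 by (rule AE_lebesgue_on_mono[where B = "{0..T}"]) (use sp in \<open>simp_all add: spectral_def\<close>)

lemma spectral_en2: "0 \<le> s ==> t \<le> T ==> integrable (leb s t) (\<lambda>t. en 2 (w t))"
 by (rule lebesgue_on_interval_subset[of T]) (use sp in \<open>simp_all add: spectral_def\<close>)

lemma spectral_rhs: "0 \<le> s ==> t \<le> T ==> integrable (leb s t) (\<lambda>t. rhs (w t) i k)"
 by (rule lebesgue_on_interval_subset[of T]) (use sp in \<open>simp_all add: spectral_def\<close>)

lemma spectral_increment:
 assumes "0 \<le> s" "s \<le> t" "t \<le> T"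
 shows "w t i k = w s i k + (LINT r|leb s t. rhs (w r) i k)"
proof -
 have eq: "w r i k = w 0 i k + (LINT s|leb 0 r. rhs (w s) i k)" if "r \<in> {0..T}" for r using sp that unfolding spectral_def by blast
 have "(LINT r|leb 0 t. rhs (w r) i k) = (LINT r|leb 0 s. rhs (w r) i k) + (LINT r|leb s t. rhs (w r) i k)"
  using assms by (intro lebesgue_on_interval_split spectral_rhs) auto
 moreover have "w t i k = w 0 i k + (LINT s|leb 0 t. rhs (w s) i k)" by (rule eq) (use assms in auto)
 moreover have "w s i k = w 0 i k + (LINT s|leb 0 s. rhs (w s) i k)" by (rule eq) (use assms in auto)
 ultimately show ?thesis by simp
qed

text \<open>A merely integrable-in-time solution is uniformly summable: on short intervals the supremum over
 time of each mode satisfies the inequality of \<open>discrete_bootstrap\<close>.\<close>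

lemma spectral_dominated: "\<exists>D. integrable ZM D \<and> (\<forall>r\<in>{0..T}. \<forall>k. amp (w r) k \<le> D k)"
\<comment> \<open>The threshold is the smallness condition of \<open>discrete_bootstrap\<close> for
  C1 = 2 c, the factor in front of the convolution in \<open>amp_rhs\<close>.\<close>
proof (rule interval_induction[where \<kappa> = "1 / (8 * c)" and T = T and Q = "\<lambda>t. \<exists>D. integrable ZM D \<and> (\<forall>r\<in>{0..t}. \<forall>k. amp (w r) k \<le> D k)"])
 show "1 / (8 * c) > 0" using c_pos by simp
 show "integrable (leb 0 T) (\<lambda>t. en 2 (w t))" by (rule spectral_en2) auto
 show "\<exists>D. integrable ZM D \<and> (\<forall>r\<in>{0..0}. \<forall>k. amp (w r) k \<le> D k)"
  using amp_ell(1)[of 0 "w 0", OF spectral_ell] by (intro exI[of _ "amp (w 0)"]) auto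
 show "0 \<le> T" by (rule T0)
next
 fix s t :: real
 assume st: "0 \<le> s" "s \<le> t" "t \<le> T" and small: "(LINT r|leb s t. en 2 (w r)) \<le> 1 / (8 * c)"
  and IH: "\<exists>D. integrable ZM D \<and> (\<forall>r\<in>{0..s}. \<forall>k. amp (w r) k \<le> D k)"
 let ?L = "leb s t"
 obtain D where D: "integrable ZM D" "\<And>r k. r \<in> {0..s} ==> amp (w r) k \<le> D k" using IH by blast
 have ca: "continuous_on {s..t} (\<lambda>r. amp (w r) k)" for k
  unfolding amp_def using st by (intro continuous_intros continuous_on_subset[OF spectral_continuous]) auto
 have "\<exists>x\<in>{s..t}. \<forall>y\<in>{s..t}. amp (w y) k \<le> amp (w x) k" for k
  using st by (intro continuous_attains_sup ca) auto
 \<comment> \<open>\<open>R k\<close> is a time at which the k-th mode is largest, so that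
   \<open>A\<close> below consists of the suprema over the interval.\<close>
 then obtain R where R: "\<And>k. R k \<in> {s..t}" "\<And>k r. r \<in> {s..t} ==> amp (w r) k \<le> amp (w (R k)) k" by metis
 define A where "A k = amp (w (R k)) k" for k
 define e where "e k = (LINT r|?L. (real_of_int k)^2 * amp (w r) k)" for k
 have sf: "sigma_finite_measure ?L" by (rule sigma_finite_lebesgue_on_interval)
 note md = integral_en2_modes[OF sf spectral_measurable[OF st(1,3)] spectral_AE[OF st(1,3)] spectral_en2[OF st(1,3)]]
 have e: "\<And>k. e k \<ge> 0" "integrable ZM e" "(LINT k|ZM. e k) \<le> 1 / (8 * c)"
 proof -
  show "e k \<ge> 0" for k unfolding e_def by (rule integral_nonneg_AE) simp
  show "integrable ZM e" unfolding e_def by (rule md(2))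
  show "(LINT k|ZM. e k) \<le> 1 / (8 * c)" using md(3) small unfolding e_def by simp
 qed
 have A0: "0 \<le> A k" for k by (simp add: A_def)
 obtain C where C: "\<And>i k. (LINT t|leb 0 T. norm (rhs (w t) i k)) \<le> C * mag k"
  using sp unfolding spectral_def by blast
 \<comment> \<open>The growth bound from which the bootstrap starts: the increment of a mode is a
   time integral of \<open>rhs\<close>, at most C |k|.\<close>
 have lin: "amp (w r) k \<le> (en 0 (w 0) + 2 * C) * mag k" if r: "r \<in> {0..T}" for r k
 proof (cases "k = 0")
  case True
  then show ?thesis using spectral_zero[OF r] by (simp add: amp_def)
 next
  case False
  note w00 = spectral_ell
  have "norm (w r i k) \<le> norm (w 0 i k) + C * mag k" for i
  proof -
   have "w r i k = w 0 i k + (LINT q|leb 0 r. rhs (w q) i k)" using r by (intro spectral_increment) auto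
   then have "norm (w r i k) \<le> norm (w 0 i k) + norm (LINT q|leb 0 r. rhs (w q) i k)" by (simp add: norm_triangle_ineq)
   also have "norm (LINT q|leb 0 r. rhs (w q) i k) \<le> (LINT q|leb 0 r. norm (rhs (w q) i k))" by (rule integral_norm_bound)
   also have "... \<le> (LINT q|leb 0 T. norm (rhs (w q) i k))"
    using lebesgue_on_interval_split[OF integrable_norm[OF spectral_rhs[of 0 T i k]], of r] r by (auto intro!: integral_nonneg_AE)
   finally show ?thesis using C[of i k] by linarith
  qed
  from add_mono[OF this[of True] this[of False]]
  have "amp (w r) k \<le> amp (w 0) k + 2 * C * mag k" by (simp add: amp_def)
  moreover have "amp (w 0) k \<le> en 0 (w 0)" using norm_le_l1_0[OF w00, of True k] norm_le_l1_0[OF w00, of False k] by (simp add: amp_def en_def)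
  moreover have "en 0 (w 0) * 1 \<le> en 0 (w 0) * mag k" using False by (intro mult_left_mono) auto
  ultimately show ?thesis by (simp add: distrib_right)
 qed
 define C0 where "C0 = en 0 (w 0) + 2 * C"
 have A1: "A k \<le> C0 * mag k" for k unfolding A_def C0_def using R(1)[of k] st by (intro lin) auto
 define B where "B k = D k + (M True + M False) * c * e k" for k
 have "integrable ZM A"
 proof (rule discrete_bootstrap[OF A0 A1 _ _ e(1,2)])
  have "0 \<le> D k" for k using D(2)[of s k] st amp_nonneg[of "w s" k] by (simp add: order_trans[OF amp_nonneg])
  then show "0 \<le> B k" for k using e(1)[of k] c_pos pos(1)[of True] pos(1)[of False] by (auto simp: B_def)
  show "integrable ZM B" unfolding B_def using D(1) e(2) by auto
  show "0 \<le> 2 * c" using c_pos by simp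
  show "4 * (2 * c) * (LINT k|ZM. e k) \<le> 1" using e(3) c_pos by (simp add: field_simps)
  fix k
  have lh: "low_high (amp (w r)) k q \<le> A (k - q) / mag q * (of_int q ^ 2 * amp (w r) q)" if "r \<in> {s..t}" "\<not> (q = 0 \<or> \<bar>k - q\<bar> > \<bar>q\<bar>)" for r q
  proof -
   have "low_high (amp (w r)) k q = amp (w r) (k - q) * (mag q * amp (w r) q)" using that by (simp add: low_high_def)
   also have "... \<le> A (k - q) * (mag q * amp (w r) q)" unfolding A_def by (intro mult_right_mono R(2) that) auto
   also have "... = A (k - q) / mag q * (mag q ^ 2 * amp (w r) q)" 
   proof -
    have "mag q \<noteq> 0" using that by simp
    then show ?thesis unfolding power2_eq_square by (simp only: field_simps) (simp add: mult_ac)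
   qed
   finally show ?thesis by simp
  qed
  \<comment> \<open>The factor of lower frequency is replaced by its supremum in time, and |q| is
    written as q^2 / |q|; the time integral then falls on q^2 \<open>amp\<close> alone and produces
    \<open>high A e\<close>.\<close>
  define h where "h q r = (if q = 0 \<or> \<bar>k - q\<bar> > \<bar>q\<bar> then 0 else A (k - q) / mag q * (of_int q ^ 2 * amp (w r) q))" for q r
  have h0: "h q r \<ge> 0" for q r using A0 by (simp add: h_def)
  have hlh: "low_high (amp (w r)) k q \<le> h q r" if "r \<in> {s..t}" for r q
   using lh[OF that, of q] by (cases "q = 0 \<or> \<bar>k - q\<bar> > \<bar>q\<bar>") (auto simp: h_def low_high_def)
  have hm: "h q \<in> borel_measurable ?L" for q unfolding h_def[abs_def] amp_def using spectral_measurable[OF st(1,3)] by measurable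
  have C00: "C0 \<ge> 0" using order_trans[OF A0[of 1] A1[of 1]] by simp
  have hb: "h q r \<le> C0 * ((real_of_int q)^2 * amp (w r) q)" for q r
  proof (cases "q = 0 \<or> \<bar>k - q\<bar> > \<bar>q\<bar>")
   case False
   have "A (k - q) \<le> C0 * mag (k - q)" by (rule A1)
   also have "... \<le> C0 * mag q" using False C00 by (intro mult_left_mono) linarith+
   finally have "A (k - q) / mag q \<le> C0" using False by (simp add: divide_le_eq)
   from mult_right_mono[OF this, of "(real_of_int q)^2 * amp (w r) q"] show ?thesis using False by (simp add: h_def)
  qed (use C00 in \<open>auto simp: h_def\<close>)
  have fin: "(\<integral>\<^sup>+r. \<integral>\<^sup>+q. ennreal (norm (h q r)) \<partial>ZM \<partial>?L) < \<infinity>"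
  proof -
   have mm: "(\<lambda>r. \<integral>\<^sup>+q. ennreal ((real_of_int q)^2 * amp (w r) q) \<partial>ZM) \<in> borel_measurable ?L"
   proof -
    have "(\<lambda>(r, q). ennreal ((real_of_int q)^2 * amp (w r) q)) \<in> borel_measurable (?L \<Otimes>\<^sub>M ZM)"
     using measurable_compose[OF measurable_pair_ZM[of "\<lambda>q r. (real_of_int q)^2 * amp (w r) q" ?L] measurable_ennreal] spectral_measurable[OF st(1,3)]
     unfolding amp_def by (simp add: case_prod_unfold)
    from sigma_finite_measure.borel_measurable_nn_integral[OF sigma_finite_ZM this] show ?thesis .
   qed
   have "(\<integral>\<^sup>+r. \<integral>\<^sup>+q. ennreal (norm (h q r)) \<partial>ZM \<partial>?L) \<le> (\<integral>\<^sup>+r. \<integral>\<^sup>+q. ennreal C0 * ennreal ((real_of_int q)^2 * amp (w r) q) \<partial>ZM \<partial>?L)"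
    using h0 hb C00 by (intro nn_integral_mono) (auto simp: ennreal_mult[symmetric] intro!: ennreal_leI)
   also have "... = ennreal C0 * (\<integral>\<^sup>+r. \<integral>\<^sup>+q. ennreal ((real_of_int q)^2 * amp (w r) q) \<partial>ZM \<partial>?L)"
    using mm by (simp add: nn_integral_cmult)
   also have "... < \<infinity>" using md(4) by (simp add: ennreal_mult_less_top)
   finally show ?thesis .
  qed
  note sw = integral_ZM_swap[OF sf hm fin]
  have hint: "(LINT r|?L. h q r) = high A e k q" for q
   unfolding h_def high_def e_def by simp
  have bound: "amp (w r) k \<le> D k + (M True + M False) * c * e k + 2 * c * (mag k * (LINT q|ZM. high A e k q))" if r: "r \<in> {s..t}" for r
  proof -
   have ri: "integrable ?L (\<lambda>q. rhs (w q) i k)" for i by (rule spectral_rhs[OF st(1,3)])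
   have "norm (w r i k) \<le> norm (w s i k) + (LINT q|?L. norm (rhs (w q) i k))" for i
   proof -
    have "w r i k = w s i k + (LINT q|leb s r. rhs (w q) i k)" using r st by (intro spectral_increment) auto
    then have "norm (w r i k) \<le> norm (w s i k) + norm (LINT q|leb s r. rhs (w q) i k)" by (simp add: norm_triangle_ineq)
    also have "norm (LINT q|leb s r. rhs (w q) i k) \<le> (LINT q|leb s r. norm (rhs (w q) i k))" by (rule integral_norm_bound)
    also have "... \<le> (LINT q|?L. norm (rhs (w q) i k))"
     using lebesgue_on_interval_split[OF integrable_norm[OF ri[of i]], of r] r by (auto intro!: integral_nonneg_AE)
    finally show ?thesis by simp
   qed
   from add_mono[OF this[of True] this[of False]]
   have "amp (w r) k \<le> amp (w s) k + (LINT q|?L. norm (rhs (w q) True k) + norm (rhs (w q) False k))"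
    using integrable_norm[OF ri] by (simp add: amp_def)
   also have "(LINT q|?L. norm (rhs (w q) True k) + norm (rhs (w q) False k))
     \<le> (LINT r|?L. (M True + M False) * c * ((real_of_int k)^2 * amp (w r) k) + 2 * c * (mag k * (LINT q|ZM. h q r)))"
   proof (rule integral_mono_AE)
    note AE_leb[of s t]
    then show "AE r in ?L. norm (rhs (w r) True k) + norm (rhs (w r) False k)
      \<le> (M True + M False) * c * ((real_of_int k)^2 * amp (w r) k) + 2 * c * (mag k * (LINT q|ZM. h q r))"
     using spectral_AE[OF st(1,3)] sw(1)
    proof eventually_elim
     case (elim r)
     then have e2: "\<And>i. ell 2 (w r i)" by blast
     have "(LINT q|ZM. low_high (amp (w r)) k q) \<le> (LINT q|ZM. h q r)"
      by (rule integral_mono[OF amp_rhs(2)[OF e2] elim(3) hlh[OF elim(1)]])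
     then have "2 * c * (mag k * (LINT q|ZM. low_high (amp (w r)) k q)) \<le> 2 * c * (mag k * (LINT q|ZM. h q r))"
      using c_pos by (intro mult_left_mono) auto
     then show ?case using amp_rhs(1)[of "w r" k, OF e2] by linarith
    qed
   qed (use integrable_norm[OF ri] md(1) sw(2) in auto)
   also have "... = (M True + M False) * c * e k + 2 * c * (mag k * (LINT r|?L. LINT q|ZM. h q r))"
    using md(1)[of k] sw(2) by (simp add: e_def)
   also have "(LINT r|?L. LINT q|ZM. h q r) = (LINT q|ZM. high A e k q)" using sw(5) hint by simp
   finally show ?thesis using D(2)[of s k] st by simp
  qed
  show "A k \<le> B k + 2 * c * (mag k * (LINT q|ZM. high A e k q))"
   using bound[OF R(1)[of k]] by (simp add: A_def B_def)
 qed
 moreover have "amp (w r) k \<le> D k + A k" if "r \<in> {0..t}" for r k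
 proof (cases "r \<le> s")
  case True
  then show ?thesis using D(2)[of r k] A0[of k] that by simp
 next
  case False
  then have "amp (w r) k \<le> A k" using that unfolding A_def by (intro R(2)) auto
  moreover have "0 \<le> D k" using D(2)[of s k] st by (simp add: order_trans[OF amp_nonneg])
  ultimately show ?thesis by simp
 qed
 ultimately show "\<exists>D. integrable ZM D \<and> (\<forall>r\<in>{0..t}. \<forall>k. amp (w r) k \<le> D k)"
  using D(1) by (intro exI[of _ "\<lambda>k. D k + A k"]) auto
qed

end

end

context film
begin

section \<open>Uniqueness for the modes\<close>

text \<open>Size of the difference of two quadratic fluxes, split bilinearly. For w' = 0 it reduces
  to the flux of w itself, so that the a priori bound and uniqueness rest on the same energy
  estimate.\<close>

definition gap_nonlin :: "(bool => int => complex) => (bool => int => complex) => real" where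
 "gap_nonlin w w' = (\<Sum>i\<in>UNIV. l1 1 (flux (\<lambda>k. w i k - w' i k) (pot i w)) + l1 1 (flux (w' i) (pot i (\<lambda>i k. w i k - w' i k))))"

lemma rhs_diff:
 assumes "\<And>i. ell 2 (w i)" "\<And>i. ell 2 (w' i)"
 shows "rhs w i k - rhs w' i k = - of_int k * (of_int k * of_real (M i) * pot i (\<lambda>i k. w i k - w' i k) k
  + (flux (\<lambda>k. w i k - w' i k) (pot i w) k + flux (w' i) (pot i (\<lambda>i k. w i k - w' i k)) k))"
proof -
 have e: "\<And>i. ell 0 (w i)" "\<And>i. ell 0 (w' i)" "\<And>i. ell 1 (w i)" "\<And>i. ell 1 (w' i)"
  using ell_mono[OF assms(1)] ell_mono[OF assms(2)] by simp_all
 have "flux (w i) (pot i w) k - flux (w' i) (pot i w') k = flux (\<lambda>k. w i k - w' i k) (pot i w) k + flux (w' i) (pot i (\<lambda>i k. w i k - w' i k)) k"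
  unfolding flux_diff[OF e(1,2) ell_pot(1)[OF e(3)] ell_pot(1)[OF e(4)]] pot_diff[symmetric] ..
 then show ?thesis unfolding rhs_def pot_diff by (simp add: algebra_simps)
qed

lemma spectral_ell_0:
 assumes "spectral T w" "t \<in> {0..T}"
 shows "ell 0 (w t i)"
proof -
 obtain D where D: "integrable ZM D" "\<And>r k. r \<in> {0..T} ==> amp (w r) k \<le> D k"
  using spectral_dominated[OF assms(1)] assms(2) by auto
 show ?thesis unfolding ell_def
  by (rule B_int_bound[OF D(1)])
    (use D(2)[OF assms(2)] norm_le_amp[of "w t" i] in \<open>auto intro!: AE_I2 intro: order_trans[OF _ order_trans[OF _ abs_ge_self]]\<close>)
qed

text \<open>\<open>damped_estimate\<close> is applied to each mode of the difference with the
  diagonal linear term as damping; coupling and flux go to the right-hand side. Summation over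
  components and modes brings in \<open>gap\<close>. The majorant \<open>g\<close> stays abstract
  because the two applications bound the nonlinearity differently.\<close>

lemma spectral_diff_energy:
 assumes w: "spectral T w" and w': "spectral T w'" and st: "0 \<le> s" "s \<le> t" "t \<le> T"
  and g: "integrable (leb s t) g" and le: "AE r in leb s t. gap_nonlin (w r) (w' r) \<le> g r"
 shows "integrable (leb s t) (\<lambda>r. en 2 (\<lambda>i k. w r i k - w' r i k))"
  and "en 0 (\<lambda>i k. w t i k - w' t i k) + (2 * c * E0 + \<delta>) * (LINT r|leb s t. en 2 (\<lambda>i k. w r i k - w' r i k))
   \<le> en 0 (\<lambda>i k. w s i k - w' s i k) + (LINT r|leb s t. g r)"
proof -
 let ?L = "leb s t"
 have T0: "T \<ge> 0" using st by simp
 define d where "d r i k = w r i k - w' r i k" for r i k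
 note mw = spectral_measurable[OF w T0] and mw' = spectral_measurable[OF w' T0]
 have md: "(\<lambda>r. d r i k) \<in> borel_measurable (leb a b)" if "0 \<le> a" "b \<le> T" for a b i k
  unfolding d_def using mw[OF that] mw'[OF that] by measurable
 note md' = md[OF st(1,3)]
 have ed: "ell 2 (d r i)" if "ell 2 (w r i)" "ell 2 (w' r i)" for r i unfolding d_def[abs_def] by (rule ell_diff[OF that])
 note sf = sigma_finite_lebesgue_on_interval[of s t]
 have AEd: "AE r in ?L. \<forall>i. ell 2 (w r i) \<and> ell 2 (w' r i) \<and> ell 2 (d r i)"
  using spectral_AE[OF w T0 st(1,3)] spectral_AE[OF w' T0 st(1,3)] by eventually_elim (use ed in blast)
 have i2: "integrable ?L (\<lambda>r. en 2 (d r))"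
 proof (rule B_int_bound[OF B_int_add[OF spectral_en2[OF w T0 st(1,3)] spectral_en2[OF w' T0 st(1,3)]]])
  show "(\<lambda>r. en 2 (d r)) \<in> borel_measurable ?L" by (intro measurable_en md')
  show "AE r in ?L. norm (en 2 (d r)) \<le> norm (en 2 (w r) + en 2 (w' r))" using AEd
  proof eventually_elim
   case (elim r)
   have "l1 2 (d r i) \<le> l1 2 (w r i) + l1 2 (w' r i)" for i
    using ell_add_scale(2)[of 2 "w r i" "w' r i" 1 "-1"] elim unfolding d_def[abs_def] by simp
   from add_mono[OF this[of True] this[of False]] show ?case by (simp add: en_def)
  qed
 qed
 then show "integrable ?L (\<lambda>r. en 2 (\<lambda>i k. w r i k - w' r i k))" unfolding d_def[abs_def] .
 have "AE r in ?L. \<forall>i. ell 2 (d r i)" using AEd by eventually_elim blast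
 note modes = integral_en2_modes[OF sf md' this i2]
 define Z where "Z i k r = mag k * (norm (flux (d r i) (pot i (w r)) k) + norm (flux (w' r i) (pot i (d r)) k))" for i k r
 have Z0: "Z i k r \<ge> 0" for i k r by (simp add: Z_def)
 have mp: "(\<lambda>r. pot i (v r) k) \<in> borel_measurable ?L" if "\<And>i k. (\<lambda>r. v r i k) \<in> borel_measurable ?L" for v i k
  using that unfolding pot_def by measurable
 have mZ: "Z i k \<in> borel_measurable ?L" for i k
  unfolding Z_def[abs_def] using measurable_flux[OF md' mp[OF mw[OF st(1,3)]]] measurable_flux[OF mw'[OF st(1,3)] mp[OF md']]
  by measurable
 have ZN: "AE r in ?L. integrable ZM (\<lambda>k. Z True k r + Z False k r) \<and> (LINT k|ZM. Z True k r + Z False k r) = gap_nonlin (w r) (w' r)"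
  using AEd
 proof eventually_elim
  case (elim r)
  then have e: "\<And>i. ell 2 (w r i)" "\<And>i. ell 2 (w' r i)" "\<And>i. ell 2 (d r i)" by auto
  have f1: "ell 1 (flux (d r i) (pot i (w r)))" for i by (rule flux_bound(1)[OF e(3) ell_pot(1)[OF e(1)], of 1]) simp
  have f2: "ell 1 (flux (w' r i) (pot i (d r)))" for i by (rule flux_bound(1)[OF e(2) ell_pot(1)[OF e(3)], of 1]) simp
  have i: "integrable ZM (\<lambda>k. Z i k r)" for i using f1[of i] f2[of i] unfolding Z_def ell_def by (simp add: distrib_left)
  have v: "(LINT k|ZM. Z i k r) = l1 1 (flux (d r i) (pot i (w r))) + l1 1 (flux (w' r i) (pot i (d r)))" for i
   using f1[of i] f2[of i] unfolding Z_def ell_def l1_def by (simp add: distrib_left)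
  show ?case using i v[of True] v[of False] by (simp add: gap_nonlin_def UNIV_bool d_def[abs_def])
 qed
 have fin: "(\<integral>\<^sup>+r. \<integral>\<^sup>+k. ennreal (norm (Z True k r + Z False k r)) \<partial>ZM \<partial>?L) < \<infinity>"
 proof -
  have "(\<integral>\<^sup>+r. \<integral>\<^sup>+k. ennreal (norm (Z True k r + Z False k r)) \<partial>ZM \<partial>?L) \<le> (\<integral>\<^sup>+r. ennreal (norm (g r)) \<partial>?L)"
  proof (rule nn_integral_mono_AE)
   show "AE r in ?L. (\<integral>\<^sup>+k. ennreal (norm (Z True k r + Z False k r)) \<partial>ZM) \<le> ennreal (norm (g r))"
    using ZN le
   proof eventually_elim
    case (elim r)
    have "(\<integral>\<^sup>+k. ennreal (norm (Z True k r + Z False k r)) \<partial>ZM) = ennreal (gap_nonlin (w r) (w' r))"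
     using elim Z0 by (subst nn_integral_eq_integral) (auto intro!: add_nonneg_nonneg)
    also have "... \<le> ennreal (norm (g r))" using elim by (intro ennreal_leI) auto
    finally show ?case .
   qed
  qed
  also have "... < \<infinity>" using g unfolding integrable_iff_bounded by blast
  finally show ?thesis .
 qed
 have mZs: "(\<lambda>r. Z True k r + Z False k r) \<in> borel_measurable ?L" for k using mZ by measurable
 note sw = integral_ZM_swap[OF sf mZs fin]
 have iZ: "integrable ?L (Z i k)" for i k
  by (rule B_int_bound[OF sw(3)[of k] mZ]) (use Z0[of True] Z0[of False] in \<open>cases i; auto intro!: AE_I2 simp: add_nonneg_nonneg\<close>)
 define X where "X i k = (LINT r|?L. norm (d r i k))" for i k
 \<comment> \<open>\<open>lam\<close> is the coefficient of the own component, the damping;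
   \<open>lam'\<close> that of the other one, the coupling.\<close>
 define lam lam' where "lam i = (if i then \<alpha> i else \<beta> i)" "lam' i = (if i then \<beta> i else \<alpha> i)" for i :: bool
 have lp: "lam i > 0" "lam' i > 0" for i using pos(2,3) by (auto simp: lam_lam'_def)
 have cd: "continuous_on {0..T} (\<lambda>r. d r i k)" for i k
  unfolding d_def by (intro continuous_intros spectral_continuous[OF w T0] spectral_continuous[OF w' T0])
 have id: "integrable (leb a b) (\<lambda>r. d r i k)" if "0 \<le> a" "b \<le> T" for a b i k
  by (rule lebesgue_on_interval_subset[OF integrable_continuous_lebesgue_on'[OF cd] that])
 have mode: "norm (d t i k) + (real_of_int k)^2 * M i * lam i * X i k \<le> norm (d s i k) + ((real_of_int k)^2 * M i * lam' i * X (\<not> i) k + (LINT r|?L. Z i k r))" for i k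
 proof -
  define l where "l = (real_of_int k)^2 * M i * lam i"
  \<comment> \<open>The forcing that remains when the damping term is moved to the left-hand
    side.\<close>
  define \<rho> where "\<rho> r = rhs (w r) i k - rhs (w' r) i k + of_real l * d r i k" for r
  have l0: "l \<ge> 0" using lp[of i] pos(1)[of i] by (simp add: l_def)
  have i\<rho>: "integrable (leb a b) \<rho>" if "0 \<le> a" "b \<le> T" for a b
   unfolding \<rho>_def[abs_def] by (intro B_int_add B_int_diff integrable_mult_right
    spectral_rhs[OF w T0 that] spectral_rhs[OF w' T0 that] id[OF that])
  have eq: "d r i k = d 0 i k + (LINT q|leb 0 r. \<rho> q - of_real l * d q i k)" if r: "r \<in> {0..T}" for r
  proof -
   have "(LINT q|leb 0 r. \<rho> q - of_real l * d q i k) = (LINT q|leb 0 r. rhs (w q) i k - rhs (w' q) i k)"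
    by (simp add: \<rho>_def)
   also have "... = (LINT q|leb 0 r. rhs (w q) i k) - (LINT q|leb 0 r. rhs (w' q) i k)"
    using spectral_rhs[OF w T0, of 0 r] spectral_rhs[OF w' T0, of 0 r] r by (intro B_itg_diff) auto
   finally show ?thesis using spectral_increment[OF w T0, of 0 r i k] spectral_increment[OF w' T0, of 0 r i k] r by (simp add: d_def)
  qed
  have "norm (d t i k) + l * X i k \<le> norm (d s i k) + (LINT r|?L. norm (\<rho> r))"
   unfolding X_def by (rule damped_estimate[OF cd i\<rho> l0 eq st]) auto
  also have "(LINT r|?L. norm (\<rho> r)) \<le> (LINT r|?L. (real_of_int k)^2 * M i * lam' i * norm (d r (\<not> i) k) + Z i k r)"
  proof (rule integral_mono_AE)
   show "AE r in ?L. norm (\<rho> r) \<le> (real_of_int k)^2 * M i * lam' i * norm (d r (\<not> i) k) + Z i k r"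
    using AEd
   proof eventually_elim
    case (elim r)
    then have e: "\<And>i. ell 2 (w r i)" "\<And>i. ell 2 (w' r i)" by auto
    let ?p = "flux (d r i) (pot i (w r)) k" and ?q = "flux (w' r i) (pot i (d r)) k"
    have "\<rho> r = - of_int k * (of_int k * of_real (M i) * pot i (d r) k + (?p + ?q)) + of_real l * d r i k"
     unfolding \<rho>_def rhs_diff[of "w r" "w' r", OF e] d_def[abs_def] ..
    also have "... = - (of_real ((real_of_int k)^2 * M i * lam' i) * d r (\<not> i) k) - (of_int k * ?p + of_int k * ?q)"
     unfolding pot_def l_def lam_lam'_def by (cases i) (simp_all add: power2_eq_square algebra_simps)
    finally have "norm (\<rho> r) \<le> norm (of_real ((real_of_int k)^2 * M i * lam' i) * d r (\<not> i) k) + norm (of_int k * ?p + of_int k * ?q)"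
     using norm_triangle_ineq4[of "- (of_real ((real_of_int k)^2 * M i * lam' i) * d r (\<not> i) k)" "of_int k * ?p + of_int k * ?q"] by simp
    moreover have "norm (of_int k * ?p + of_int k * ?q) \<le> mag k * norm ?p + mag k * norm ?q"
     using norm_triangle_ineq[of "of_int k * ?p" "of_int k * ?q"] by (simp add: norm_mult)
    moreover have "norm (of_real ((real_of_int k)^2 * M i * lam' i) * d r (\<not> i) k) = (real_of_int k)^2 * M i * lam' i * norm (d r (\<not> i) k)"
     using lp(2)[of i] pos(1)[of i] unfolding norm_mult norm_of_real by simp
    ultimately show ?case by (simp add: Z_def distrib_left)
   qed
  qed (use integrable_norm[OF i\<rho>[OF st(1,3)]] integrable_norm[OF id[OF st(1,3)]] iZ in auto)
  also have "... = (real_of_int k)^2 * M i * lam' i * X (\<not> i) k + (LINT r|?L. Z i k r)"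
   using integrable_norm[OF id[OF st(1,3)]] iZ by (simp add: X_def)
  finally show ?thesis by (simp add: l_def)
 qed
 define e where "e k = (LINT r|?L. (real_of_int k)^2 * amp (d r) k)" for k
 have eX: "e k = (real_of_int k)^2 * X True k + (real_of_int k)^2 * X False k" for k
  using integrable_norm[OF id[OF st(1,3)]] unfolding e_def X_def amp_def by (simp add: distrib_left)
 have summed: "amp (d t) k + (2 * c * E0 + \<delta>) * e k \<le> amp (d s) k + (LINT r|?L. Z True k r + Z False k r)" for k
 proof -
  have X0: "0 \<le> (real_of_int k)^2 * X i k" for i unfolding X_def by (intro mult_nonneg_nonneg integral_nonneg_AE) auto
  have "(2 * c * E0 + \<delta>) * e k \<le> (M True * \<alpha> True - M False * \<alpha> False) * ((real_of_int k)^2 * X True k) + (M False * \<beta> False - M True * \<beta> True) * ((real_of_int k)^2 * X False k)"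
   unfolding eX distrib_left[of "2 * c * E0 + \<delta>"] using gap by (intro add_mono mult_right_mono X0)
  moreover have "(LINT r|?L. Z True k r + Z False k r) = (LINT r|?L. Z True k r) + (LINT r|?L. Z False k r)" using iZ by simp
  ultimately show ?thesis using mode[of True k] mode[of False k] by (simp add: amp_def lam_lam'_def algebra_simps)
 qed
 have d0: "ell 0 (d r i)" if "r \<in> {0..T}" for r i
  unfolding d_def[abs_def] by (intro ell_diff spectral_ell_0[OF w] spectral_ell_0[OF w'] that)
 have ad: "integrable ZM (amp (d r))" "(LINT k|ZM. amp (d r) k) = en 0 (d r)" if "r \<in> {0..T}" for r
  using amp_ell[of 0 "d r", OF d0[OF that]] by simp_all
 have tT: "t \<in> {0..T}" "s \<in> {0..T}" using st by auto
 have ie: "integrable ZM e" unfolding e_def by (rule modes(2))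
 have "en 0 (d t) + (2 * c * E0 + \<delta>) * (LINT r|?L. en 2 (d r)) = (LINT k|ZM. amp (d t) k + (2 * c * E0 + \<delta>) * e k)"
  using ad[OF tT(1)] ie unfolding modes(3) e_def[symmetric] by simp
 also have "... \<le> (LINT k|ZM. amp (d s) k + (LINT r|?L. Z True k r + Z False k r))"
  using ad[OF tT(1)] ad[OF tT(2)] ie sw(4) summed by (intro integral_mono B_int_add integrable_mult_right)
 also have "... = en 0 (d s) + (LINT r|?L. LINT k|ZM. Z True k r + Z False k r)"
  using ad[OF tT(2)] sw(4,5) by simp
 also have "(LINT r|?L. LINT k|ZM. Z True k r + Z False k r) \<le> (LINT r|?L. g r)"
 proof (rule integral_mono_AE[OF sw(2) g])
  show "AE r in ?L. (LINT k|ZM. Z True k r + Z False k r) \<le> g r" using ZN le by eventually_elim auto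
 qed
 finally show "en 0 (\<lambda>i k. w t i k - w' t i k) + (2 * c * E0 + \<delta>) * (LINT r|?L. en 2 (\<lambda>i k. w r i k - w' r i k))
   \<le> en 0 (\<lambda>i k. w s i k - w' s i k) + (LINT r|?L. g r)" unfolding d_def[abs_def] by simp
qed

text \<open>The zero state serves as the second solution when the difference estimate is used to
  bound a single one.\<close>

lemma spectral_0: "spectral T (\<lambda>t i k. 0)"
proof -
 have r: "rhs (\<lambda>i k. 0) = (\<lambda>i k. 0)" by (intro ext) (simp add: rhs_def pot_def flux_def conv_def cmult_def)
 have e: "en s (\<lambda>i k. 0) = 0" "ell s (\<lambda>k. 0)" for s by (auto simp: en_def l1_def ell_def)
 show ?thesis unfolding spectral_def r e(1) using e(2) by (auto intro!: exI[of _ 0])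
qed

lemma spectral_bounded_en:
 assumes "spectral T w" "T \<ge> 0"
 shows "\<exists>S. \<forall>r\<in>{0..T}. en 0 (w r) \<le> S"
proof -
 obtain D where D: "integrable ZM D" "\<And>r k. r \<in> {0..T} ==> amp (w r) k \<le> D k" using spectral_dominated[OF assms] by blast
 have "en 0 (w r) \<le> (LINT k|ZM. D k)" if "r \<in> {0..T}" for r
 proof -
  note a = amp_ell[of 0 "w r", OF spectral_ell_0[OF assms(1) that]]
  have "(LINT k|ZM. mag k^0 * amp (w r) k) \<le> (LINT k|ZM. D k)"
   by (rule integral_mono[OF a(1) D(1)]) (use D(2)[OF that] in simp)
  then show ?thesis unfolding a(2) .
 qed
 then show ?thesis by blast
qed

text \<open>Both a priori estimates compare the supremum of \<open>en 0\<close> over a short interval with itself.\<close>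

lemma spectral_en_le:
 assumes w: "spectral T w" and T: "T \<ge> 0" and E: "en 0 (w 0) \<le> E0"
 shows "\<forall>r\<in>{0..T}. en 0 (w r) \<le> E0"
proof (rule interval_induction[where \<kappa> = "1 / (8 * c)" and T = T and Q = "\<lambda>t. \<forall>r\<in>{0..t}. en 0 (w r) \<le> E0"])
 show "integrable (leb 0 T) (\<lambda>r. en 2 (w r))" by (rule spectral_en2[OF w T]) auto
 show "1 / (8 * c) > 0" using c_pos by simp
 show "\<forall>r\<in>{0..0}. en 0 (w r) \<le> E0" using E by simp
 show "0 \<le> T" by (rule T)
 fix s t assume st: "0 \<le> s" "s \<le> t" "t \<le> T" and small: "(LINT r|leb s t. en 2 (w r)) \<le> 1 / (8 * c)"
  and IH: "\<forall>r\<in>{0..s}. en 0 (w r) \<le> E0"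
 have bdd: "bdd_above ((\<lambda>r. en 0 (w r)) ` {s..t})" 
 proof -
  obtain B where "\<forall>r\<in>{0..T}. en 0 (w r) \<le> B" using spectral_bounded_en[OF w T] by blast
  then show ?thesis using st by (intro bdd_aboveI2[where M = B]) auto
 qed
 \<comment> \<open>Finite by \<open>spectral_bounded_en\<close>. Each \<open>en 0\<close> will be at
   most E0 plus a quarter of the excess of \<open>S\<close> over E0; taking the supremum leaves no
   excess.\<close>
 define S where "S = (SUP r\<in>{s..t}. en 0 (w r))"
 have S: "en 0 (w r) \<le> S" if "r \<in> {s..t}" for r unfolding S_def by (rule cSUP_upper[OF that bdd])
 have step: "en 0 (w r) \<le> E0 + max 0 (S - E0) / 4" if r: "r \<in> {s..t}" for r
 proof -
  let ?L = "leb s r"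
  have sr: "0 \<le> s" "s \<le> r" "r \<le> T" using r st by auto
  have i2: "integrable ?L (\<lambda>q. en 2 (w q))" by (rule spectral_en2[OF w T sr(1,3)])
  have le: "AE q in ?L. gap_nonlin (w q) (\<lambda>i k. 0) \<le> 2 * c * S * en 2 (w q)"
  proof -
   note AE_leb[of s r]
   then show ?thesis using spectral_AE[OF w T sr(1,3)]
   proof eventually_elim
    case (elim q)
    have "l1 1 (flux (\<lambda>k. 0) y) = 0" for y by (simp add: l1_def flux_def conv_def)
    then have "gap_nonlin (w q) (\<lambda>i k. 0) = (\<Sum>i\<in>UNIV. l1 1 (flux (w q i) (pot i (w q))))" by (simp add: gap_nonlin_def)
    also have "... \<le> 2 * c * en 0 (w q) * en 2 (w q)" using elim by (intro flux_energy) auto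
    also have "... \<le> 2 * c * S * en 2 (w q)" using S[of q] elim r c_pos by (intro mult_right_mono mult_left_mono) auto
    finally show ?case .
   qed
  qed
  have "en 0 (w r) + (2 * c * E0 + \<delta>) * (LINT q|?L. en 2 (w q)) \<le> en 0 (w s) + 2 * c * S * (LINT q|?L. en 2 (w q))"
   using spectral_diff_energy(2)[OF w spectral_0 sr _ le] i2 by simp
  then have "en 0 (w r) + (2 * c * E0 + \<delta>) * (LINT q|?L. en 2 (w q)) \<le> E0 + 2 * c * S * (LINT q|?L. en 2 (w q))"
  proof -
   assume "en 0 (w r) + (2 * c * E0 + \<delta>) * (LINT q|?L. en 2 (w q)) \<le> en 0 (w s) + 2 * c * S * (LINT q|?L. en 2 (w q))"
   moreover have "en 0 (w s) \<le> E0" using IH sr by simp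
   ultimately show ?thesis by linarith
  qed
  moreover have I0: "0 \<le> (LINT q|?L. en 2 (w q))" by (intro integral_nonneg_AE) simp
  moreover have I1: "(LINT q|?L. en 2 (w q)) \<le> 1 / (8 * c)"
  proof -
   have "0 \<le> (LINT q|leb r t. en 2 (w q))" by (intro integral_nonneg_AE) simp
   moreover have "(LINT q|leb s t. en 2 (w q)) = (LINT q|?L. en 2 (w q)) + (LINT q|leb r t. en 2 (w q))"
    using r by (intro lebesgue_on_interval_split spectral_en2[OF w T st(1,3)]) auto
   ultimately show ?thesis using small by linarith
  qed
  moreover have "2 * c * (S - E0) * (LINT q|?L. en 2 (w q)) \<le> max 0 (S - E0) / 4"
  proof -
   have "2 * c * (S - E0) * (LINT q|?L. en 2 (w q)) \<le> 2 * c * max 0 (S - E0) * (LINT q|?L. en 2 (w q))"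
    using I0 c_pos by (intro mult_right_mono mult_left_mono) auto
   also have "... \<le> 2 * c * max 0 (S - E0) * (1 / (8 * c))" using I1 c_pos by (intro mult_left_mono) auto
   also have "... = max 0 (S - E0) / 4" using c_pos by (simp add: field_simps)
   finally show ?thesis .
  qed
  moreover have "0 \<le> \<delta> * (LINT q|?L. en 2 (w q))" using I0 pos(4) by simp
  ultimately show ?thesis by (simp add: algebra_simps)
 qed
 have "S \<le> E0 + max 0 (S - E0) / 4" unfolding S_def using st by (intro cSUP_least) (auto intro!: step[unfolded S_def])
 then have "S \<le> E0" by (cases "S \<le> E0") (auto simp: max_def field_simps)
 show "\<forall>r\<in>{0..t}. en 0 (w r) \<le> E0"
 proof
  fix r assume "r \<in> {0..t}"
  then show "en 0 (w r) \<le> E0" using IH S[of r] \<open>S \<le> E0\<close> by (cases "r \<le> s") auto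
 qed
qed

text \<open>The term with \<open>en 2 d\<close> may cost at most 2 c E0, which dissipation absorbs.
  With \<theta> = 1/2 in the first flux and \<theta> = 1 in the second, its coefficients add up to
  1/2 + 5/4, below 2. The other terms carry \<open>en 0 d\<close> times a function integrable in
  time.\<close>

lemma gap_nonlin_le:
 assumes e: "\<And>i. ell 2 (w i)" "\<And>i. ell 2 (w' i)" and E: "en 0 w \<le> E0" "en 0 w' \<le> E0"
 defines "d \<equiv> \<lambda>i k. w i k - w' i k"
 shows "gap_nonlin w w' \<le> 2 * c * en 0 d * (en 2 w + en 2 w') + 2 * c * E0 * en 2 d"
proof -
 have ed: "\<And>i. ell 2 (d i)" unfolding d_def by (intro ell_diff e)
 have z: "\<And>i. ell 0 (w i)" "\<And>i. ell 0 (d i)" using ell_mono[OF e(1)] ell_mono[OF ed] by simp_all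
 have 1: "l1 1 (flux (d i) (pot i w)) \<le> 3/2 * l1 0 (d i) * (c * en 2 w) + 1/2 * l1 2 (d i) * (c * E0)" for i
 proof -
  have "l1 1 (flux (d i) (pot i w)) \<le> 3/2 * l1 0 (d i) * l1 2 (pot i w) + 1/2 * l1 2 (d i) * l1 0 (pot i w)"
   using flux_bound(2)[OF ed ell_pot(1)[OF e(1)], of "1/2" i i] by simp
  also have "... \<le> 3/2 * l1 0 (d i) * (c * en 2 w) + 1/2 * l1 2 (d i) * (c * E0)"
   using E(1) c_pos by (intro add_mono mult_left_mono l1_pot_le e order_trans[OF l1_pot_le[of 0 w, OF z(1)]]) auto
  finally show ?thesis .
 qed
 have 2: "l1 1 (flux (w' i) (pot i d)) \<le> 5/4 * l1 0 (w' i) * (c * en 2 d) + l1 2 (w' i) * (c * en 0 d)" for i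
 proof -
  have "l1 1 (flux (w' i) (pot i d)) \<le> 5/4 * l1 0 (w' i) * l1 2 (pot i d) + l1 2 (w' i) * l1 0 (pot i d)"
   using flux_bound(2)[OF e(2) ell_pot(1)[OF ed], of 1 i i] by simp
  also have "... \<le> 5/4 * l1 0 (w' i) * (c * en 2 d) + l1 2 (w' i) * (c * en 0 d)"
   by (intro add_mono mult_left_mono l1_pot_le ed z) auto
  finally show ?thesis .
 qed
 have "gap_nonlin w w' = (l1 1 (flux (d True) (pot True w)) + l1 1 (flux (d False) (pot False w))) + (l1 1 (flux (w' True) (pot True d)) + l1 1 (flux (w' False) (pot False d)))"
  by (simp add: gap_nonlin_def UNIV_bool d_def)
 also have "... \<le> (3/2 * en 0 d * (c * en 2 w) + 1/2 * en 2 d * (c * E0)) + (5/4 * en 0 w' * (c * en 2 d) + en 2 w' * (c * en 0 d))"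
  using add_mono[OF add_mono[OF 1[of True] 1[of False]] add_mono[OF 2[of True] 2[of False]]]
  by (simp only: en_def[of 0 d] en_def[of 2 d] en_def[of _ w'] distrib_left distrib_right add_ac mult_ac)
 also have "... \<le> (2 * en 0 d * (c * en 2 w) + 1/2 * en 2 d * (c * E0)) + (3/2 * E0 * (c * en 2 d) + 2 * (en 2 w' * (c * en 0 d)))"
 proof (intro add_mono mult_right_mono order_refl)
  show "5/4 * en 0 w' \<le> 3/2 * E0" using E(2) pos(5) by linarith
  show "en 2 w' * (c * en 0 d) \<le> 2 * (en 2 w' * (c * en 0 d))" using c_pos by simp
 qed (use c_pos pos(5) in auto)
 also have "... = 2 * c * en 0 d * (en 2 w + en 2 w') + 2 * c * E0 * en 2 d" by (simp add: algebra_simps)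
 finally show ?thesis .
qed

text \<open>After absorption, the growth of the difference on an interval is 2 c times its supremum
  S times the integral of \<open>en 2\<close> of both solutions. Where that integral is at most 1 /
  (8 c) this reads S \<le> S / 4, so S = 0.\<close>

lemma spectral_unique:
 assumes w: "spectral T w" and w': "spectral T w'" and T: "T \<ge> 0" and eq: "w 0 = w' 0" and E: "en 0 (w 0) \<le> E0"
  and t: "t \<in> {0..T}"
 shows "w t = w' t"
proof -
 define d where "d r i k = w r i k - w' r i k" for r i k
 have E1: "\<forall>r\<in>{0..T}. en 0 (w r) \<le> E0" by (rule spectral_en_le[OF w T E])
 have E2: "\<forall>r\<in>{0..T}. en 0 (w' r) \<le> E0" by (rule spectral_en_le[OF w' T]) (use E eq in simp)
 have ed0: "ell 0 (d r i)" if "r \<in> {0..T}" for r i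
  unfolding d_def[abs_def] by (intro ell_diff spectral_ell_0[OF w] spectral_ell_0[OF w'] that)
 have "\<forall>r\<in>{0..T}. en 0 (d r) = 0"
 proof (rule interval_induction[where \<kappa> = "1 / (8 * c)" and T = T and Q = "\<lambda>t. \<forall>r\<in>{0..t}. en 0 (d r) = 0"])
  show "integrable (leb 0 T) (\<lambda>r. en 2 (w r) + en 2 (w' r))"
   by (intro B_int_add spectral_en2[OF w T] spectral_en2[OF w' T]) auto
  show "1 / (8 * c) > 0" using c_pos by simp
  show "\<forall>r\<in>{0..0}. en 0 (d r) = 0" using eq by (simp add: d_def en_def l1_def)
  show "0 \<le> T" by (rule T)
  fix s t assume st: "0 \<le> s" "s \<le> t" "t \<le> T" and small: "(LINT r|leb s t. en 2 (w r) + en 2 (w' r)) \<le> 1 / (8 * c)"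
   and IH: "\<forall>r\<in>{0..s}. en 0 (d r) = 0"
  have dle: "en 0 (d r) \<le> 2 * E0" if "r \<in> {0..T}" for r
  proof -
   have "l1 0 (d r i) \<le> l1 0 (w r i) + l1 0 (w' r i)" for i
    using ell_add_scale(2)[OF spectral_ell_0[OF w that] spectral_ell_0[OF w' that], of 1 i "-1" i] unfolding d_def[abs_def] by simp
   from add_mono[OF this[of True] this[of False]] have "en 0 (d r) \<le> en 0 (w r) + en 0 (w' r)" by (simp add: en_def)
   then show ?thesis using E1 E2 that by (smt (verit))
  qed
  have bdd: "bdd_above ((\<lambda>r. en 0 (d r)) ` {s..t})" using dle st by (intro bdd_aboveI2[where M = "2 * E0"]) auto
  define S where "S = (SUP r\<in>{s..t}. en 0 (d r))"
  have S: "en 0 (d r) \<le> S" if "r \<in> {s..t}" for r unfolding S_def by (rule cSUP_upper[OF that bdd])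
  have S0: "S \<ge> 0" using order_trans[OF en_nonneg S[of s]] st by simp
  have step: "en 0 (d r) \<le> S / 4" if r: "r \<in> {s..t}" for r
  proof -
   let ?L = "leb s r"
   have sr: "0 \<le> s" "s \<le> r" "r \<le> T" using r st by auto
   have i2: "integrable ?L (\<lambda>q. en 2 (w q))" "integrable ?L (\<lambda>q. en 2 (w' q))"
    by (rule spectral_en2[OF w T sr(1,3)], rule spectral_en2[OF w' T sr(1,3)])
   define a where "a q = en 2 (w q) + en 2 (w' q)" for q
   have ia: "integrable ?L a" unfolding a_def[abs_def] using i2 by auto
   have sr0: "AE q in ?L. gap_nonlin (w q) (w' q) \<le> 2 * c * S * a q + 2 * c * E0 * en 2 (d q)"
   proof -
    note AE_leb[of s r]
    then show ?thesis using spectral_AE[OF w T sr(1,3)] spectral_AE[OF w' T sr(1,3)]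
    proof eventually_elim
     case (elim q)
     have "gap_nonlin (w q) (w' q) \<le> 2 * c * en 0 (d q) * a q + 2 * c * E0 * en 2 (d q)"
      unfolding a_def d_def[abs_def] by (rule gap_nonlin_le) (use elim E1 E2 sr in auto)
     also have "... \<le> 2 * c * S * a q + 2 * c * E0 * en 2 (d q)"
      using S[of q] elim r c_pos by (intro add_right_mono mult_right_mono mult_left_mono) (auto simp: a_def)
     finally show ?case .
    qed
   qed
   have id: "integrable ?L (\<lambda>q. en 2 (d q))"
   proof (rule B_int_bound[OF ia])
    show "(\<lambda>q. en 2 (d q)) \<in> borel_measurable ?L"
     unfolding d_def[abs_def] by (intro measurable_en borel_measurable_diff spectral_measurable[OF w T sr(1,3)] spectral_measurable[OF w' T sr(1,3)])
    show "AE q in ?L. norm (en 2 (d q)) \<le> norm (a q)"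
     using spectral_AE[OF w T sr(1,3)] spectral_AE[OF w' T sr(1,3)]
    proof eventually_elim
     case (elim q)
     have "l1 2 (d q i) \<le> l1 2 (w q i) + l1 2 (w' q i)" for i
      using ell_add_scale(2)[of 2 "w q i" "w' q i" 1 "-1"] elim unfolding d_def[abs_def] by simp
     from add_mono[OF this[of True] this[of False]] show ?case by (simp add: en_def a_def)
    qed
   qed
   have ig: "integrable ?L (\<lambda>q. 2 * c * S * a q + 2 * c * E0 * en 2 (d q))" using ia id by auto
   have "en 0 (d r) + (2 * c * E0 + \<delta>) * (LINT q|?L. en 2 (d q)) \<le> en 0 (d s) + (LINT q|?L. 2 * c * S * a q + 2 * c * E0 * en 2 (d q))"
    using spectral_diff_energy(2)[OF w w' sr ig sr0] unfolding d_def[abs_def] .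
   also have "en 0 (d s) = 0" using IH st by simp
   also have "(LINT q|?L. 2 * c * S * a q + 2 * c * E0 * en 2 (d q)) = 2 * c * S * (LINT q|?L. a q) + 2 * c * E0 * (LINT q|?L. en 2 (d q))"
    using ia id by simp
   finally have "en 0 (d r) + \<delta> * (LINT q|?L. en 2 (d q)) \<le> 2 * c * S * (LINT q|?L. a q)" by (simp add: algebra_simps)
   moreover have "0 \<le> \<delta> * (LINT q|?L. en 2 (d q))" using pos(4) by (intro mult_nonneg_nonneg integral_nonneg_AE) auto
   moreover have "2 * c * S * (LINT q|?L. a q) \<le> 2 * c * S * (1 / (8 * c))"
   proof (rule mult_left_mono)
    have ia': "integrable (leb s t) a" unfolding a_def[abs_def]
     by (intro B_int_add spectral_en2[OF w T st(1,3)] spectral_en2[OF w' T st(1,3)])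
    have "0 \<le> (LINT q|leb r t. a q)" by (intro integral_nonneg_AE) (simp add: a_def)
    moreover have "(LINT q|leb s t. a q) = (LINT q|?L. a q) + (LINT q|leb r t. a q)"
     using r by (intro lebesgue_on_interval_split ia') auto
    ultimately show "(LINT q|?L. a q) \<le> 1 / (8 * c)" using small unfolding a_def[symmetric] by linarith
   qed (use c_pos S0 in simp)
   moreover have "2 * c * S * (1 / (8 * c)) = S / 4" using c_pos by (simp add: field_simps)
   ultimately show ?thesis by linarith
  qed
  have "S \<le> S / 4" using st step by (subst S_def, intro cSUP_least) auto
  then have "S = 0" using S0 by simp
  show "\<forall>r\<in>{0..t}. en 0 (d r) = 0"
  proof
   fix r assume "r \<in> {0..t}"
   then show "en 0 (d r) = 0" using IH S[of r] \<open>S = 0\<close> en_nonneg[of 0 "d r"] by (cases "r \<le> s") (auto intro: antisym)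
  qed
 qed
 then have z: "en 0 (d t) = 0" using t by blast
 have "d t i k = 0" for i k
 proof -
  have "norm (d t i k) \<le> 0" using norm_le_l1_0[OF ed0[OF t], of i k] l1_le_en[of 0 "d t" i] z by linarith
  then show ?thesis by simp
 qed
 then show ?thesis by (auto simp: d_def fun_eq_iff)
qed

end

section \<open>From weak solutions to modes\<close>

text \<open>Squaring removes the corner of the positive part; this gives a C^1 cutoff in
  time.\<close>

lemma DERIV_max_0_sq: "((\<lambda>y::real. (max 0 y)^2) has_real_derivative 2 * max 0 y) (at y)"
proof -
 consider "y < 0" | "y = 0" | "y > 0" by linarith
 then show ?thesis
 proof cases
  case 1
  have "((\<lambda>y::real. 0) has_real_derivative 0) (at y)" by simp
  then have "((\<lambda>y::real. (max 0 y)^2) has_real_derivative 0) (at y)"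
   by (rule has_field_derivative_transform_within_open[where S = "{..<0}"]) (use 1 in auto)
  then show ?thesis using 1 by simp
 next
  case 2
  have "(\<lambda>h::real. (max 0 h)^2 / h) \<midarrow>0\<rightarrow> 0"
  proof (rule Lim_null_comparison)
   show "\<forall>\<^sub>F h in at 0. norm ((max 0 h)^2 / h) \<le> \<bar>h::real\<bar>"
    by (intro always_eventually allI) (auto simp: max_def power2_eq_square)
   show "((\<lambda>h::real. \<bar>h\<bar>) \<longlongrightarrow> 0) (at 0)" by (rule tendsto_eq_intros refl)+ simp
  qed
  then show ?thesis using 2 by (simp add: has_field_derivative_iff)
 next
  case 3
  have "((\<lambda>y::real. y^2) has_real_derivative 2 * y) (at y)" by (auto intro!: derivative_eq_intros)
  then have "((\<lambda>y::real. (max 0 y)^2) has_real_derivative 2 * y) (at y)"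
   by (rule has_field_derivative_transform_within_open[where S = "{0<..}"]) (use 3 in auto)
  then show ?thesis using 3 by simp
 qed
qed

text \<open>Time profile of a test function with prescribed derivative. Normalised to vanish late,
  it has at 0 minus the integral of \<open>\<eta>\<close> as value, which is how the initial datum
  enters. The derivative at 0 is one-sided, as in \<open>test_function\<close>.\<close>

lemma antiderivative_vanishing_late:
 fixes \<eta> :: "real => real"
 assumes c: "continuous_on UNIV \<eta>" and z: "\<And>t. t \<ge> d ==> \<eta> t = 0" and d: "d \<ge> 0"
 obtains \<zeta> where "\<And>t. t \<ge> 0 ==> (\<zeta> has_real_derivative \<eta> t) (at t within {0..})" "\<And>t. t \<ge> d ==> \<zeta> t = 0"
proof -
 define H where "H t = integral {0..t} \<eta>" for t
 have cc: "continuous_on {0..b} \<eta>" for b using c continuous_on_subset by blast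
 have D: "(H has_real_derivative \<eta> t) (at t within {0..})" if "t \<ge> 0" for t
 proof -
  have "(H has_real_derivative \<eta> t) (at t within {0..t + 1})"
   unfolding H_def[abs_def] using that by (intro integral_has_real_derivative cc) auto
  moreover have "at t within {0..t + 1} = at t within {0..}"
   by (rule at_within_nhd[where S = "{t - 1<..<t + 1}"]) auto
  ultimately show ?thesis by simp
 qed
 have Hd: "H t = H d" if t: "t \<ge> d" for t
 proof -
  have i: "\<eta> integrable_on {0..t}" by (rule integrable_continuous_real[OF cc])
  have "H d + integral {d..t} \<eta> = H t" unfolding H_def by (rule Henstock_Kurzweil_Integration.integral_combine[OF d t i])
  moreover have "integral {d..t} \<eta> = integral {d..t} (\<lambda>x. 0)" by (rule Henstock_Kurzweil_Integration.integral_cong) (use z in auto)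
  ultimately show ?thesis by simp
 qed
 show ?thesis
 proof (rule that[of "\<lambda>t. H t - H d"])
  show "((\<lambda>t. H t - H d) has_real_derivative \<eta> t) (at t within {0..})" if "t \<ge> 0" for t
   using DERIV_diff[OF D[OF that] DERIV_const[of "H d"]] by simp
  show "H t - H d = 0" if "t \<ge> d" for t using Hd[OF that] by simp
 qed
qed

text \<open>A single equation with a flux \<open>J\<close> that is merely measurable; its
  integrability has to be extracted from the tested form.\<close>

locale weak_scalar =
 fixes T :: real and p J :: "real => real => real" and u0 :: "real => real"
 assumes T: "T > 0" and p: "integrable (cylinder T) (\<lambda>(t, x). p t x)" and Jm: "(\<lambda>(t, x). J t x) \<in> borel_measurable (cylinder T)"
  and u0: "integrable torus u0"
  and weak: "\<And>\<phi> \<phi>t \<phi>x. test_function T \<phi> \<phi>t \<phi>x ==> integrable (cylinder T) (\<lambda>(t, x). J t x * \<phi>x t x) \<and>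
   - (LINT x|torus. u0 x * \<phi> 0 x) - (LINT (t, x)|cylinder T. p t x * \<phi>t t x) = - (LINT (t, x)|cylinder T. J t x * \<phi>x t x)"
begin

lemma product_test:
 assumes \<zeta>: "\<And>t. t \<ge> 0 ==> (\<zeta> has_real_derivative \<zeta>' t) (at t within {0..})" "continuous_on UNIV \<zeta>'" "\<And>t. t \<ge> d ==> \<zeta> t = 0" "d < T"
  and h: "\<And>x. (h has_real_derivative h' x) (at x)" "continuous_on UNIV h'" "periodic h"
 shows "test_function T (\<lambda>t x. \<zeta> t * h x) (\<lambda>t x. \<zeta>' t * h x) (\<lambda>t x. \<zeta> t * h' x)"
proof -
 have ch: "continuous_on UNIV h" using h(1) by (meson DERIV_continuous_on has_field_derivative_at_within)
 have c\<zeta>: "continuous_on {0..} \<zeta>" by (rule DERIV_continuous_on[OF \<zeta>(1)]) auto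
 have "continuous_on ({0..} \<times> UNIV) (\<lambda>z. \<zeta>' (fst z) * h (snd z))" "continuous_on ({0..} \<times> UNIV) (\<lambda>z. \<zeta> (fst z) * h' (snd z))"
  by (intro continuous_intros continuous_on_compose2[OF \<zeta>(2)] continuous_on_compose2[OF ch] continuous_on_compose2[OF c\<zeta>] continuous_on_compose2[OF h(2)]; auto)+
 then show ?thesis
  unfolding test_function_def using h \<zeta>
  by (auto simp: case_prod_unfold periodic_def intro!: derivative_eq_intros exI[of _ d])
qed

text \<open>Testing with a time profile times sin or cos makes the products of \<open>J\<close> with
  cos and sin integrable, and |cos| + |sin| \<ge> 1 removes these factors. Test functions vanish
  near T, so this reaches every T' < T but not T.\<close>

lemma cutoff_integrable:
 assumes "T' < T" shows "integrable (cylinder T) (\<lambda>(t, x). indicator {..T'} t * J t x)"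
proof -
 define d where "d = (max 0 T' + T) / 2"
 have d: "T' < d" "d < T" using assms T by (auto simp: d_def max_def field_simps)
 define \<zeta> where "\<zeta> t = (max 0 (d - t))^2" for t
 have D\<zeta>: "(\<zeta> has_real_derivative - 2 * max 0 (d - t)) (at t within {0..})" for t
 proof -
  have "((\<lambda>y. (max 0 (d - y))^2) has_real_derivative 2 * max 0 (d - t) * (- 1)) (at t within {0..})"
   by (rule DERIV_chain'[where g = "\<lambda>y. (max 0 y)^2", OF _ DERIV_max_0_sq]) (auto intro!: derivative_eq_intros)
  then show ?thesis by (simp add: \<zeta>_def[abs_def])
 qed
 have \<zeta>: "continuous_on UNIV (\<lambda>t. - 2 * max 0 (d - t))" "\<And>t. t \<ge> d ==> \<zeta> t = 0"
  by (auto intro!: continuous_intros simp: \<zeta>_def)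
 have per: "periodic sin" "periodic (\<lambda>x. - cos x)" by (auto simp: periodic_def)
 have i1: "integrable (cylinder T) (\<lambda>(t, x). J t x * (\<zeta> t * cos x))"
  by (rule weak[OF product_test[OF D\<zeta> \<zeta> d(2), of sin cos], THEN conjunct1]) (use per in \<open>auto intro!: continuous_intros derivative_eq_intros\<close>)
 have i2: "integrable (cylinder T) (\<lambda>(t, x). J t x * (\<zeta> t * sin x))"
  by (rule weak[OF product_test[OF D\<zeta> \<zeta> d(2), of "\<lambda>x. - cos x" sin], THEN conjunct1]) (use per in \<open>auto intro!: continuous_intros derivative_eq_intros\<close>)
 have bnd: "indicator {..T'} t * \<bar>J t x\<bar> \<le> (1 / (d - T')^2) * (\<bar>J t x * (\<zeta> t * cos x)\<bar> + \<bar>J t x * (\<zeta> t * sin x)\<bar>)" for t x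
 proof (cases "t \<le> T'")
  case True
  have "(d - T')^2 \<le> \<zeta> t" using True d by (auto simp: \<zeta>_def intro!: power_mono)
  moreover have "1 \<le> \<bar>cos x\<bar> + \<bar>sin x\<bar>"
  proof -
   have "\<bar>cos x\<bar>^2 \<le> \<bar>cos x\<bar>" "\<bar>sin x\<bar>^2 \<le> \<bar>sin x\<bar>"
    unfolding power2_eq_square by (intro mult_left_le; simp)+
   then show ?thesis using sin_cos_squared_add[of x] unfolding power2_abs by linarith
  qed
  ultimately have "(d - T')^2 * 1 \<le> \<zeta> t * (\<bar>cos x\<bar> + \<bar>sin x\<bar>)" by (intro mult_mono) (auto simp: \<zeta>_def)
  then have "\<bar>J t x\<bar> * (d - T')^2 \<le> \<bar>J t x\<bar> * (\<zeta> t * (\<bar>cos x\<bar> + \<bar>sin x\<bar>))" by (intro mult_left_mono) auto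
  moreover have "\<zeta> t \<ge> 0" by (simp add: \<zeta>_def)
  ultimately have "\<bar>J t x\<bar> * (d - T')^2 \<le> \<bar>J t x * (\<zeta> t * cos x)\<bar> + \<bar>J t x * (\<zeta> t * sin x)\<bar>" by (simp add: abs_mult distrib_left)
  then show ?thesis using True d by (simp add: pos_le_divide_eq)
 qed simp
 show ?thesis
 proof (rule B_int_bound[OF integrable_mult_right[OF B_int_add[OF integrable_abs[OF i1] integrable_abs[OF i2]], of "1 / (d - T')^2"]])
  have "(\<lambda>z. indicator {..T'} (fst z) :: real) \<in> borel_measurable (cylinder T)" 
   by (intro measurable_cylinder_borel measurable_compose[OF borel_measurable_continuous_onI[OF continuous_on_fst[OF continuous_on_id]]] borel_measurable_indicator) simp
  then show "(\<lambda>(t, x). indicator {..T'} t * J t x) \<in> borel_measurable (cylinder T)" using Jm unfolding case_prod_unfold by measurable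
  show "AE z in cylinder T. norm (case z of (t, x) => indicator {..T'} t * J t x)
    \<le> norm (1 / (d - T')^2 * (\<bar>case z of (t, x) => J t x * (\<zeta> t * cos x)\<bar> + \<bar>case z of (t, x) => J t x * (\<zeta> t * sin x)\<bar>))"
   using bnd by (intro AE_I2) (auto simp: abs_mult[of "indicator _ _"])
 qed
qed

lemma slice_integrable:
 assumes T': "T' < T" and h: "continuous_on UNIV h" "\<And>x. \<bar>h x\<bar> \<le> C"
 shows "integrable (cylinder T) (\<lambda>z. (indicator {..T'} (fst z) * J (fst z) (snd z)) * h (snd z))"
  and "integrable (leb 0 T') (\<lambda>t. LINT x|torus. J t x * h x)"
proof -
 have mh: "(\<lambda>z. h (snd z)) \<in> borel_measurable (cylinder T)"
  by (rule measurable_cylinder_borel, rule borel_measurable_continuous_onI, intro continuous_intros continuous_on_compose2[OF h(1)]) simp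
 show iQ: "integrable (cylinder T) (\<lambda>z. (indicator {..T'} (fst z) * J (fst z) (snd z)) * h (snd z))"
  using integrable_mult_bounded[OF cutoff_integrable[OF T'] mh, of C] h(2) by (simp add: case_prod_unfold)
 have "integrable (leb 0 T) (\<lambda>t. LINT x|torus. indicator {..T'} t * J t x * h x)" using cylinder_Fubini(2)[OF iQ] by simp
 then have "integrable (leb 0 T') (\<lambda>t. LINT x|torus. indicator {..T'} t * J t x * h x)"
  by (rule lebesgue_on_interval_subset) (use T' in auto)
 then show "integrable (leb 0 T') (\<lambda>t. LINT x|torus. J t x * h x)"
  by (rule B_int_cong[THEN iffD1, rotated -1]) auto
qed

text \<open>The defect g of the integrated equation is tested with an arbitrary continuous
  \<open>\<eta>\<close> of compact support. An antiderivative of \<open>\<eta>\<close> is the time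
  profile in the weak formulation, and integrating the term R by parts makes everything
  cancel.\<close>

lemma mode_real:
 assumes T': "0 < T'" "T' < T"
  and h: "\<And>x. (h has_real_derivative h' x) (at x)" "continuous_on UNIV h'" "periodic h" "\<And>x. \<bar>h x\<bar> \<le> C" "\<And>x. \<bar>h' x\<bar> \<le> C"
 shows "AE t in leb 0 T'. (LINT x|torus. p t x * h x) = (LINT x|torus. u0 x * h x) - (LINT s|leb 0 t. (LINT x|torus. J s x * h' x))"
proof -
 let ?I = "\<lambda>t. indicator {..T'} t :: real"
 have ch: "continuous_on UNIV h" using h(1) by (meson DERIV_continuous_on has_field_derivative_at_within)
 have mh: "(\<lambda>z. h (snd z)) \<in> borel_measurable (cylinder T)"
  by (rule measurable_cylinder_borel, rule borel_measurable_continuous_onI, intro continuous_intros continuous_on_compose2[OF ch]) simp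
 have iP: "integrable (cylinder T) (\<lambda>z. p (fst z) (snd z) * h (snd z))"
  using integrable_mult_bounded[OF p mh, of C] h(4) by (simp add: case_prod_unfold)
 have iQ: "integrable (cylinder T) (\<lambda>z. (?I (fst z) * J (fst z) (snd z)) * h' (snd z))"
  by (rule slice_integrable(1)[OF T'(2) h(2,5)])
 define P where "P t = (LINT x|torus. p t x * h x)" for t
 define Q where "Q t = (LINT x|torus. ?I t * J t x * h' x)" for t
 define U where "U = (LINT x|torus. u0 x * h x)"
 have P: "integrable (leb 0 T) P" using cylinder_Fubini(2)[OF iP] by (simp add: P_def[abs_def])
 have Q: "integrable (leb 0 T) Q" using cylinder_Fubini(2)[OF iQ] by (simp add: Q_def[abs_def])
 have QJ: "Q t = (LINT x|torus. J t x * h' x)" if "t \<le> T'" for t using that by (simp add: Q_def)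
 define R where "R t = (LINT s|leb 0 t. Q s)" for t
 have cR: "continuous_on {0..T} R"
 proof -
  have i: "Q integrable_on {0..T}" by (rule integrable_on_lebesgue_on[OF Q]) simp
  have "integral {0..t} Q = R t" if "t \<in> {0..T}" for t
   unfolding R_def using that by (intro lebesgue_integral_eq_integral[symmetric] lebesgue_on_interval_subset[OF Q]) auto
  then show ?thesis using indefinite_integral_continuous_1[OF i] continuous_on_cong[of "{0..T}" "{0..T}" "\<lambda>t. integral {0..t} Q" R] by simp
 qed
 define g where "g t = P t - U + R t" for t
 have iR: "integrable (leb 0 T) R" by (rule integrable_continuous_lebesgue_on[OF cR])
 have ig: "integrable (leb 0 T) g" unfolding g_def[abs_def]
  using P iR integrable_const_lebesgue_on by (intro B_int_add B_int_diff)
 have "AE t in leb 0 T'. g t = 0"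
 proof (rule AE_zero_if_test_zero)
  show "integrable (leb 0 T') g" by (rule lebesgue_on_interval_subset[OF ig]) (use T' in auto)
  fix \<eta> a b assume \<eta>: "continuous_on UNIV \<eta>" "0 < a" "b < T'" "\<And>x. x \<notin> {a..b} ==> \<eta> x = (0::real)"
  let ?d = "max b 0"
  have dT: "?d < T'" using \<eta>(3) T' by simp
  have \<eta>0: "\<eta> t = 0" if "t \<ge> (?d + T') / 2" for t using that \<eta>(3) T' by (intro \<eta>(4)) (auto simp: max_def field_simps split: if_splits)
  obtain \<zeta> where \<zeta>: "\<And>t. t \<ge> 0 ==> (\<zeta> has_real_derivative \<eta> t) (at t within {0..})" "\<And>t. t \<ge> (?d + T') / 2 ==> \<zeta> t = 0"
  proof -
   have "0 \<le> (?d + T') / 2" using T' by simp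
   from antiderivative_vanishing_late[OF \<eta>(1) \<eta>0 this] that show ?thesis by blast
  qed
  have D: "(\<zeta> has_real_derivative \<eta> t) (at t within {0..T})" if "t \<in> {0..T}" for t
   by (rule has_field_derivative_subset[OF \<zeta>(1)]) (use that in auto)
  have \<zeta>T: "\<zeta> T = 0" "\<And>t. t \<ge> T' ==> \<zeta> t = 0" using T' dT by (auto intro!: \<zeta>(2))
  have c\<eta>: "continuous_on {0..T} \<eta>" using \<eta>(1) continuous_on_subset by blast
  have dlt: "(?d + T') / 2 < T" using dT T' by simp
  note tf = product_test[OF \<zeta>(1) \<eta>(1) \<zeta>(2) dlt h(1,2,3)]
  have W: "- (LINT x|torus. u0 x * (\<zeta> 0 * h x)) - (LINT (t, x)|cylinder T. p t x * (\<eta> t * h x)) = - (LINT (t, x)|cylinder T. J t x * (\<zeta> t * h' x))"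
   by (rule weak[OF tf, THEN conjunct2])
  have m\<eta>: "(\<lambda>z. \<eta> (fst z)) \<in> borel_measurable (cylinder T)"
   by (rule measurable_cylinder_borel, rule borel_measurable_continuous_onI, intro continuous_intros continuous_on_compose2[OF \<eta>(1)]) auto
  obtain B1 where "\<forall>t\<in>{0..T}. norm (\<eta> t) \<le> B1"
   using compact_continuous_bounded[OF compact_Icc c\<eta>] by blast
  then have B: "\<And>t. t \<in> {0..T} ==> \<bar>\<eta> t\<bar> \<le> B1" by auto
  have sp: "fst z \<in> {0..T}" if "z \<in> space (cylinder T)" for z using that by (auto simp: cylinder_def space_restrict_space)
  have i1: "integrable (cylinder T) (\<lambda>z. p (fst z) (snd z) * h (snd z) * \<eta> (fst z))"
   by (rule integrable_mult_bounded[OF iP m\<eta>, of B1]) (use sp B in auto)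
  have "(LINT (t, x)|cylinder T. p t x * (\<eta> t * h x)) = (LINT z|cylinder T. p (fst z) (snd z) * h (snd z) * \<eta> (fst z))"
   by (simp add: case_prod_unfold mult_ac)
  also have "... = (LINT t|leb 0 T. P t * \<eta> t)" using cylinder_Fubini(3)[OF i1] by (simp add: P_def)
  finally have e1: "(LINT (t, x)|cylinder T. p t x * (\<eta> t * h x)) = (LINT t|leb 0 T. P t * \<eta> t)" .
  \<comment> \<open>\<open>\<zeta>\<close> vanishes beyond T', so the cutoff can be inserted in
    front of \<open>J\<close> and makes it an integrable function.\<close>
  have J\<zeta>: "J t x * (\<zeta> t * h' x) = ?I t * J t x * h' x * \<zeta> t" for t x using \<zeta>T(2)[of t] by (cases "t \<le> T'") auto
  have i2: "integrable (cylinder T) (\<lambda>z. ?I (fst z) * J (fst z) (snd z) * h' (snd z) * \<zeta> (fst z))"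
   using weak[OF tf, THEN conjunct1] unfolding J\<zeta> by (simp add: case_prod_unfold)
  have e2: "(LINT (t, x)|cylinder T. J t x * (\<zeta> t * h' x)) = (LINT t|leb 0 T. Q t * \<zeta> t)"
   unfolding J\<zeta> using cylinder_Fubini(3)[OF i2] by (simp add: Q_def case_prod_unfold)
  have e3: "(LINT x|torus. u0 x * (\<zeta> 0 * h x)) = - U * (LINT t|leb 0 T. \<eta> t)"
  proof -
   have "(LINT t|leb 0 T. \<eta> t) = \<zeta> T - \<zeta> 0" by (rule integral_derivative_lebesgue_on[OF _ D c\<eta>]) (use T in auto)
   moreover have "(LINT x|torus. u0 x * (\<zeta> 0 * h x)) = (LINT x|torus. (u0 x * h x) * \<zeta> 0)" by (simp add: mult_ac)
   ultimately show ?thesis using \<zeta>T(1) by (simp add: U_def)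
  qed
  have e4: "(LINT t|leb 0 T. \<eta> t * R t) = - (LINT t|leb 0 T. Q t * \<zeta> t)"
   using ac_by_parts(2)[OF _ Q D c\<eta> \<zeta>T(1)] T by (simp add: R_def mult.commute)
  have bm: "\<eta> \<in> borel_measurable (leb 0 T)" by (rule continuous_imp_measurable_on_sets_lebesgue[OF c\<eta>]) simp
  have iP': "integrable (leb 0 T) (\<lambda>t. P t * \<eta> t)" by (rule integrable_mult_bounded[OF P bm, of B1]) (use B in auto)
  have iR': "integrable (leb 0 T) (\<lambda>t. R t * \<eta> t)" by (rule integrable_mult_bounded[OF iR bm, of B1]) (use B in auto)
  have i\<eta>: "integrable (leb 0 T) \<eta>" by (rule integrable_continuous_lebesgue_on[OF c\<eta>])
  have "(LINT t|leb 0 T. g t * \<eta> t) = (LINT t|leb 0 T. (P t * \<eta> t - U * \<eta> t) + R t * \<eta> t)"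
   by (simp add: g_def algebra_simps)
  also have "... = (LINT t|leb 0 T. P t * \<eta> t) - U * (LINT t|leb 0 T. \<eta> t) + (LINT t|leb 0 T. R t * \<eta> t)"
   using iP' iR' i\<eta> by simp
  also have "... = 0" using W e1 e2 e3 e4 by (simp add: mult.commute)
  finally have "(LINT t|leb 0 T. g t * \<eta> t) = 0" .
  moreover have "(LINT t|leb 0 T'. g t * \<eta> t) = (LINT t|leb 0 T. indicator {0..T'} t *\<^sub>R (g t * \<eta> t))"
   by (rule lebesgue_on_subset(2)) (use T' integrable_mult_bounded[OF ig bm, of B1] B in auto)
  moreover have eqI: "indicator {0..T'} t *\<^sub>R (g t * \<eta> t) = g t * \<eta> t" if "t \<in> {0..T}" for t
   using that \<eta>(3) \<eta>(4)[of t] by (cases "t \<le> T'") auto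
  moreover have "(LINT t|leb 0 T. indicator {0..T'} t *\<^sub>R (g t * \<eta> t)) = (LINT t|leb 0 T. g t * \<eta> t)"
   by (intro B_itg_cong refl eqI) simp
  ultimately show "(LINT t|leb 0 T'. g t * \<eta> t) = 0" by simp
 qed
 moreover note AE_leb[of 0 T']
 ultimately show "AE t in leb 0 T'. (LINT x|torus. p t x * h x) = (LINT x|torus. u0 x * h x) - (LINT s|leb 0 t. (LINT x|torus. J s x * h' x))"
 proof eventually_elim
  case (elim t)
  have "R t = (LINT s|leb 0 t. (LINT x|torus. J s x * h' x))"
   unfolding R_def by (intro B_itg_cong refl QJ) (use elim in auto)
  then show ?case using elim by (simp add: g_def P_def U_def)
 qed
qed

lemma AE_slices: assumes "0 < T'" "T' < T" shows "AE t in leb 0 T'. integrable torus (p t) \<and> integrable torus (J t)"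
proof -
 have "AE t in leb 0 T. integrable torus (p t)" using cylinder_Fubini(1)[OF p] by simp
 moreover have "AE t in leb 0 T. integrable torus (\<lambda>x. indicator {..T'} t * J t x)" using cylinder_Fubini(1)[OF cutoff_integrable[OF assms(2)]] by simp
 ultimately have "AE t in leb 0 T. t \<le> T' \<longrightarrow> integrable torus (p t) \<and> integrable torus (J t)" by eventually_elim auto
 then have "AE t in leb 0 T'. t \<le> T' \<longrightarrow> integrable torus (p t) \<and> integrable torus (J t)"
  by (rule AE_lebesgue_on_mono) (use assms in auto)
 moreover note AE_leb[of 0 T']
 ultimately show ?thesis by eventually_elim auto
qed

lemma mode:
 assumes T': "0 < T'" "T' < T"
 shows "integrable (leb 0 T') (\<lambda>t. fourier (J t) k)"
  and "AE t in leb 0 T'. fourier (p t) k = fourier u0 k + (LINT s|leb 0 t. dcoef (fourier (J s)) k)"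
proof -
 define Jc Js where "Jc t = (LINT x|torus. J t x * cos (of_int k * x))" "Js t = (LINT x|torus. J t x * sin (of_int k * x))" for t
 have b: "\<bar>trig k a b x\<bar> \<le> \<bar>a\<bar> + \<bar>b\<bar>" for a b x
  unfolding trig_def by (rule order_trans[OF abs_triangle_ineq]) (auto simp: abs_mult intro!: add_mono mult_left_le)
 have m: "AE t in leb 0 T'. (LINT x|torus. p t x * trig k c d x) = (LINT x|torus. u0 x * trig k c d x)
   - (LINT s|leb 0 t. (LINT x|torus. J s x * trig k (d * of_int k) (- c * of_int k) x))" if "\<bar>c\<bar> + \<bar>d\<bar> \<le> 1" for c d
 proof (rule mode_real[OF T' DERIV_trig continuous_on_trig periodic_trig, where C = "1 + mag k"])
  show "\<bar>trig k c d x\<bar> \<le> 1 + mag k" for x using b[of c d x] that by linarith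
  have "\<bar>d * of_int k\<bar> + \<bar>- c * of_int k\<bar> = (\<bar>c\<bar> + \<bar>d\<bar>) * mag k" by (simp add: abs_mult algebra_simps)
  also have "... \<le> 1 * mag k" using that by (intro mult_right_mono) auto
  finally show "\<bar>trig k (d * of_int k) (- c * of_int k) x\<bar> \<le> 1 + mag k" for x
   using b[of "d * of_int k" "- c * of_int k" x] by linarith
 qed
 have pull: "(LINT x|torus. J t x * (- (of_int k * sin (of_int k * x)))) = - of_int k * Js t"
  "(LINT x|torus. J t x * (of_int k * cos (of_int k * x))) = of_int k * Jc t" for t
  unfolding Jc_Js_def by (simp_all add: mult.left_commute)
 have mc: "AE t in leb 0 T'. (LINT x|torus. p t x * cos (of_int k * x)) = (LINT x|torus. u0 x * cos (of_int k * x)) - (LINT s|leb 0 t. - of_int k * Js s)"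
  using m[of 1 0] unfolding pull[symmetric] by (simp add: trig_def)
 have ms: "AE t in leb 0 T'. (LINT x|torus. p t x * sin (of_int k * x)) = (LINT x|torus. u0 x * sin (of_int k * x)) - (LINT s|leb 0 t. of_int k * Jc s)"
  using m[of 0 1] unfolding pull[symmetric] by (simp add: trig_def)
 have cs: "continuous_on UNIV (\<lambda>x. cos (real_of_int k * x))" "continuous_on UNIV (\<lambda>x. sin (real_of_int k * x))" by (intro continuous_intros)+
 have J: "integrable (leb 0 T') Jc" "integrable (leb 0 T') Js"
  unfolding Jc_Js_def[abs_def] by (rule slice_integrable(2)[OF T'(2) cs(1), of 1] slice_integrable(2)[OF T'(2) cs(2), of 1]; simp)+
 have JF: "AE t in leb 0 T'. fourier (J t) k = (1 / (2 * pi)) * (of_real (Jc t) - \<i> * of_real (Js t))"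
  using AE_slices[OF T'] by eventually_elim (auto simp: fourier_cos_sin Jc_Js_def)
 have iG: "integrable (leb 0 T') (\<lambda>t. (1 / (2 * pi)) * (of_real (Jc t) - \<i> * of_real (Js t)) :: complex)"
  using J by (intro integrable_mult_right B_int_diff) auto
 have mF: "(\<lambda>t. fourier (J t) k) \<in> borel_measurable (leb 0 T')"
  by (rule lebesgue_on_AE_measurable[OF _ borel_measurable_integrable[OF iG]]) (use JF in auto)
 show iF: "integrable (leb 0 T') (\<lambda>t. fourier (J t) k)"
  using integrable_cong_AE[OF mF borel_measurable_integrable[OF iG] JF] iG by simp
 have F: "(LINT s|leb 0 t. dcoef (fourier (J s)) k) = (1 / (2 * pi)) * (of_real (real_of_int k * (LINT s|leb 0 t. Js s)) + \<i> * of_real (real_of_int k * (LINT s|leb 0 t. Jc s)))"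
  if t: "t \<in> {0..T'}" for t
 proof -
  have sub: "integrable (leb 0 t) Jc" "integrable (leb 0 t) Js" "integrable (leb 0 t) (\<lambda>t. fourier (J t) k)"
   by (rule lebesgue_on_interval_subset[OF J(1)] lebesgue_on_interval_subset[OF J(2)] lebesgue_on_interval_subset[OF iF]; use t in simp)+
  have JF': "AE s in leb 0 t. fourier (J s) k = (1 / (2 * pi)) * (of_real (Jc s) - \<i> * of_real (Js s))"
   by (rule AE_lebesgue_on_mono[OF JF]) (use t in auto)
  have iG': "integrable (leb 0 t) (\<lambda>t. (1 / (2 * pi)) * (of_real (Jc t) - \<i> * of_real (Js t)) :: complex)"
   by (rule lebesgue_on_interval_subset[OF iG]) (use t in auto)
  have "(LINT s|leb 0 t. fourier (J s) k) = (LINT s|leb 0 t. (1 / (2 * pi)) * (of_real (Jc s) - \<i> * of_real (Js s)))"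
   by (rule integral_cong_AE[OF borel_measurable_integrable[OF sub(3)] borel_measurable_integrable[OF iG'] JF'])
  also have "... = (1 / (2 * pi)) * (of_real (LINT s|leb 0 t. Jc s) - \<i> * of_real (LINT s|leb 0 t. Js s))"
   using sub by (subst B_itg_mult_right_zero, subst B_itg_diff) auto
  finally have "(LINT s|leb 0 t. fourier (J s) k) = (1 / (2 * pi)) * (of_real (LINT s|leb 0 t. Jc s) - \<i> * of_real (LINT s|leb 0 t. Js s))" .
  moreover have "\<i> * of_int k * (z * (of_real X - \<i> * of_real Y)) = z * (of_real (real_of_int k * Y) + \<i> * of_real (real_of_int k * X))" for z :: complex and X Y :: real
  proof -
   have "\<i> * of_int k * (z * (of_real X - \<i> * of_real Y)) = z * (\<i> * of_int k * of_real X - (\<i> * \<i>) * of_int k * of_real Y)"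
    by (simp only: algebra_simps)
   then show ?thesis by (simp add: algebra_simps)
  qed
  ultimately show ?thesis unfolding dcoef_def B_itg_mult_right_zero by (simp only:)
 qed
 note AE_leb[of 0 T']
 then show "AE t in leb 0 T'. fourier (p t) k = fourier u0 k + (LINT s|leb 0 t. dcoef (fourier (J s)) k)"
  using AE_slices[OF T'] mc ms
 proof eventually_elim
  case (elim t)
  have e: "fourier (p t) k = (1 / (2 * pi)) * (of_real (LINT x|torus. p t x * cos (of_int k * x)) - \<i> * of_real (LINT x|torus. p t x * sin (of_int k * x)))"
   using elim(2) by (intro fourier_cos_sin) auto
  have e0: "fourier u0 k = (1 / (2 * pi)) * (of_real (LINT x|torus. u0 x * cos (of_int k * x)) - \<i> * of_real (LINT x|torus. u0 x * sin (of_int k * x)))"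
   by (rule fourier_cos_sin[OF u0])
  show ?case unfolding e e0 F[OF elim(1)] elim(3) elim(4) B_itg_mult_right_zero by (simp add: algebra_simps add_divide_distrib diff_divide_distrib)
 qed
qed

text \<open>The coefficients of the flux are bounded by its L^1 norm, uniformly in k; the outer
  derivative contributes |k|. This supplies the last clause of \<open>spectral\<close>.\<close>

lemma mode_bound:
 assumes T': "0 < T'" "T' < T"
 shows "\<exists>C. \<forall>k. (LINT t|leb 0 T'. norm (dcoef (fourier (J t)) k)) \<le> C * mag k"
proof -
 define N where "N t = (LINT x|torus. \<bar>indicator {..T'} t * J t x\<bar>)" for t
 have "integrable (cylinder T) (\<lambda>z. \<bar>indicator {..T'} (fst z) * J (fst z) (snd z)\<bar>)"
  using integrable_abs[OF cutoff_integrable[OF T'(2)]] by (simp add: case_prod_unfold)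
 from cylinder_Fubini(2)[OF this] have "integrable (leb 0 T) N" by (simp add: N_def[abs_def])
 then have iN: "integrable (leb 0 T') N" by (rule lebesgue_on_interval_subset) (use T' in auto)
 have "(LINT t|leb 0 T'. norm (dcoef (fourier (J t)) k)) \<le> (LINT t|leb 0 T'. mag k * N t)" for k
 proof (rule integral_mono_AE)
  show "integrable (leb 0 T') (\<lambda>t. norm (dcoef (fourier (J t)) k))"
   unfolding dcoef_def by (intro integrable_norm integrable_mult_right mode(1) T')
  show "integrable (leb 0 T') (\<lambda>t. mag k * N t)" by (rule integrable_mult_right[OF iN])
  note AE_leb[of 0 T']
  then show "AE t in leb 0 T'. norm (dcoef (fourier (J t)) k) \<le> mag k * N t"
  proof eventually_elim
   case (elim t)
   have "norm (LINT x|torus. of_real (J t x) * cis (- (of_int k * x))) \<le> (LINT x|torus. norm (of_real (J t x) * cis (- (of_int k * x))))"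
    by (rule integral_norm_bound)
   then have "norm (LINT x|torus. of_real (J t x) * cis (- (of_int k * x))) \<le> N t" using elim by (simp add: N_def norm_mult)
   moreover have "norm (fourier (J t) k) = (1 / (2 * pi)) * norm (LINT x|torus. of_real (J t x) * cis (- (of_int k * x)))"
    unfolding fourier_cis by (simp add: norm_mult norm_divide)
   moreover have "1 / (2 * pi) \<le> 1" using pi_gt3 by (simp add: divide_le_eq)
   ultimately have "norm (fourier (J t) k) \<le> N t"
    using mult_right_mono[of "1 / (2 * pi)" 1 "norm (LINT x|torus. of_real (J t x) * cis (- (of_int k * x)))"] by simp
   then show ?case unfolding dcoef_def norm_mult by (simp add: mult_left_mono)
  qed
 qed
 then show ?thesis by (intro exI[of _ "LINT t|leb 0 T'. N t"]) (simp add: mult.commute)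
qed

end

context film
begin

lemma flux_of_weak_deriv:
 assumes v: "\<And>i. has_weak_deriv (v i) (vx i)" "\<And>i. ell 2 (fourier (v i))" "\<And>i. fourier (v i) 0 = 0"
 shows "fourier (\<lambda>x. (v i x + M i) * (\<alpha> i * vx True x + \<beta> i * vx False x)) k = jcoef (\<lambda>i. fourier (v i)) i k"
proof -
 define w where "w i = fourier (v i)" for i
 have g: "good (w i)" for i using v(2,3)[of i] hermitian_fourier[of "v i"] by (simp add: w_def good_def)
 note gd = goodD[OF g]
 have iv: "integrable torus (v i)" "integrable torus (vx i)" for i using v(1)[of i] by (auto simp: has_weak_deriv_def)
 have fx: "fourier (vx i) = dcoef (w i)" for i using fourier_weak_deriv[OF v(1)[of i]] by (auto simp: w_def dcoef_def)
 have av: "AE x in torus. v i x = wiener (w i) x" for i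
  unfolding w_def by (rule wiener_fourier_AE[OF iv(1)]) (use gd(4)[of i] in \<open>simp add: w_def\<close>)
 have ax: "AE x in torus. vx i x = wiener (dcoef (w i)) x" for i
  using wiener_fourier_AE[OF iv(2)[of i]] gd(5)[of i] by (simp add: fx)
 have eq: "AE x in torus. (v i x + M i) * (\<alpha> i * vx True x + \<beta> i * vx False x) = wiener (jcoef w i) x"
  using av[of i] ax[of True] ax[of False] wiener_jcoef[of w i, OF g] by eventually_elim simp
 have ij: "integrable ZM (jcoef w i)"
  using rhs_l1(1)[of w, OF gd(1) order_refl, of i] unfolding rhs_jcoef ell_0_iff by (rule integrable_ZM_of_dcoef)
 have "fourier (\<lambda>x. (v i x + M i) * (\<alpha> i * vx True x + \<beta> i * vx False x)) k = fourier (wiener (jcoef w i)) k"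
  using borel_measurable_integrable[OF iv(1)[of i]] borel_measurable_integrable[OF iv(2)[of True]] borel_measurable_integrable[OF iv(2)[of False]]
  by (intro fourier_AE_cong[OF eq] measurable_wiener_torus[OF ij] borel_measurable_times borel_measurable_add borel_measurable_const)
 also have "... = jcoef w i k" by (rule fourier_wiener[OF ij jcoef_hermitian[OF gd(7)]])
 finally show ?thesis by (simp add: w_def[abs_def])
qed

text \<open>Weak solutions satisfy the mode equations for almost every time. The integrated
  right-hand side defines a continuous representative \<open>y\<close>; as \<open>rhs\<close> of
  \<open>y\<close> agrees with the integrand almost everywhere, \<open>y\<close> satisfies the
  equation at every time.\<close>

lemma weak_spectral:
 assumes T': "0 < T'" "T' < T"
  and u: "\<And>i. ell 0 (fourier (u i))" "\<And>i. fourier (u i) 0 = 0"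
  and ws: "\<And>i. weak_scalar T (p i) (\<lambda>t x. (p i t x + M i) * (\<alpha> i * px True t x + \<beta> i * px False t x)) (u i)"
  and wd: "AE t in leb 0 T. \<forall>i. has_weak_deriv (p i t) (px i t) \<and> ell 2 (fourier (p i t)) \<and> fourier (p i t) 0 = 0"
  and i2: "integrable (leb 0 T) (\<lambda>t. en 2 (\<lambda>i. fourier (p i t)))"
 shows "\<exists>y. spectral T' y \<and> y 0 = (\<lambda>i. fourier (u i)) \<and> (AE t in leb 0 T'. \<forall>i k. fourier (p i t) k = y t i k)"
proof -
 define J where "J i t x = (p i t x + M i) * (\<alpha> i * px True t x + \<beta> i * px False t x)" for i t x
 let ?L = "leb 0 T'"
 have ws': "weak_scalar T (p i) (J i) (u i)" for i using ws[of i] by (simp add: J_def[abs_def])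
 note m1 = weak_scalar.mode(1)[OF ws' T'] and m2 = weak_scalar.mode(2)[OF ws' T'] and mb = weak_scalar.mode_bound[OF ws' T']
 define R where "R s i k = dcoef (fourier (J i s)) k" for s i k
 define y where "y t i k = fourier (u i) k + (LINT s|leb 0 t. R s i k)" for t i k
 have iR: "integrable ?L (\<lambda>s. R s i k)" for i k unfolding R_def dcoef_def by (rule integrable_mult_right[OF m1])
 have py: "AE t in ?L. \<forall>i k. fourier (p i t) k = y t i k"
  using m2 unfolding y_def R_def by (simp add: AE_all_countable)
 have wd': "AE t in ?L. \<forall>i. has_weak_deriv (p i t) (px i t) \<and> ell 2 (fourier (p i t)) \<and> fourier (p i t) 0 = 0"
  by (rule AE_lebesgue_on_mono[OF wd]) (use T' in auto)
 have Ry: "AE t in ?L. \<forall>i k. R t i k = rhs (y t) i k"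
  using wd' py
 proof eventually_elim
  case (elim t)
  have e: "(\<lambda>i. fourier (p i t)) = y t" using elim(2) by (intro ext) auto
  show ?case
  proof (intro allI)
   fix i k
   have "fourier (J i t) = jcoef (y t) i"
    using flux_of_weak_deriv[of "\<lambda>i. p i t" "\<lambda>i. px i t" i] elim(1) unfolding e J_def[abs_def] by (auto simp: fun_eq_iff)
   then show "R t i k = rhs (y t) i k" by (simp add: R_def rhs_jcoef)
  qed
 qed
 have cy: "continuous_on {0..T'} (\<lambda>t. y t i k)" for i k
 proof -
  have i: "(\<lambda>s. R s i k) integrable_on {0..T'}" by (rule integrable_on_lebesgue_on[OF iR]) simp
  have "(LINT s|leb 0 t. R s i k) = integral {0..t} (\<lambda>s. R s i k)" if "t \<in> {0..T'}" for t
   using that by (intro lebesgue_integral_eq_integral lebesgue_on_interval_subset[OF iR]) auto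
  then have "continuous_on {0..T'} (\<lambda>t. LINT s|leb 0 t. R s i k)"
   using indefinite_integral_continuous_1[OF i] by (subst continuous_on_cong[OF refl]) auto
  then show ?thesis unfolding y_def by (intro continuous_intros)
 qed
 have my: "(\<lambda>t. y t i k) \<in> borel_measurable ?L" for i k by (rule continuous_imp_measurable_on_sets_lebesgue[OF cy]) simp
 have y0: "y 0 = (\<lambda>i. fourier (u i))"
 proof -
  have "AE s in lebesgue_on {0..0::real}. R s i k = 0" for i k
  proof -
   have "AE s in (lebesgue :: real measure). s \<notin> {0}" by (rule AE_not_in) simp
   then have "AE s in lebesgue. s \<in> {0..0} \<longrightarrow> R s i k = 0" by eventually_elim simp
   then show ?thesis by (subst AE_restrict_space_iff) auto
  qed
  then have "(LINT s|leb 0 0. R s i k) = 0" for i k by (rule integral_eq_zero_AE)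
  then show ?thesis by (intro ext) (simp only: y_def add_0_right)
 qed
 have mrhs: "(\<lambda>s. rhs (y s) i k) \<in> borel_measurable ?L" for i k by (rule measurable_rhs[OF my])
 have RA: "AE s in ?L. R s i k = rhs (y s) i k" for i k using Ry by eventually_elim blast
 have irhs: "integrable ?L (\<lambda>s. rhs (y s) i k)" for i k
  using integrable_cong_AE[OF borel_measurable_integrable[OF iR] mrhs RA] iR by simp
 have e2: "AE t in ?L. \<forall>i. ell 2 (y t i)"
  using wd' py
 proof eventually_elim
  case (elim t)
  have "y t i = fourier (p i t)" for i using elim(2) by auto
  then show ?case using elim(1) by simp
 qed
 have ien: "integrable ?L (\<lambda>t. en 2 (y t))"
 proof -
  have i: "integrable ?L (\<lambda>t. en 2 (\<lambda>i. fourier (p i t)))" by (rule lebesgue_on_interval_subset[OF i2]) (use T' in auto)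
  have "AE t in ?L. en 2 (\<lambda>i. fourier (p i t)) = en 2 (y t)"
   using py
  proof eventually_elim
   case (elim t)
   have "(\<lambda>i. fourier (p i t)) = y t" using elim by (intro ext) auto
   then show ?case by simp
  qed
  from integrable_cong_AE[OF borel_measurable_integrable[OF i] measurable_en[OF my] this] i show ?thesis by simp
 qed
 have "spectral T' y"
  unfolding spectral_def
 proof (intro conjI allI ballI)
  show "continuous_on {0..T'} (\<lambda>t. y t i k)" for i k by (rule cy)
  show "y t i 0 = 0" for t i using u(2)[of i] by (simp add: y_def R_def dcoef_def)
  show "ell 0 (y 0 i)" for i using u(1) by (simp add: y0)
  show "AE t in ?L. \<forall>i. ell 2 (y t i)" by (rule e2)
  show "integrable ?L (\<lambda>t. en 2 (y t))" by (rule ien)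
  show "integrable ?L (\<lambda>t. rhs (y t) i k)" for i k by (rule irhs)
  show "y t i k = y 0 i k + (LINT s|leb 0 t. rhs (y s) i k)" if t: "t \<in> {0..T'}" for i k t
  proof -
   have "(LINT s|leb 0 t. R s i k) = (LINT s|leb 0 t. rhs (y s) i k)"
   proof (rule integral_cong_AE)
    show "(\<lambda>s. R s i k) \<in> borel_measurable (leb 0 t)"
     by (rule borel_measurable_integrable[OF lebesgue_on_interval_subset[OF iR]]) (use t in auto)
    show "(\<lambda>s. rhs (y s) i k) \<in> borel_measurable (leb 0 t)"
     by (rule borel_measurable_integrable[OF lebesgue_on_interval_subset[OF irhs]]) (use t in auto)
    show "AE s in leb 0 t. R s i k = rhs (y s) i k" by (rule AE_lebesgue_on_mono[OF RA]) (use t in auto)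
   qed
   then show ?thesis unfolding y0 by (simp add: y_def)
  qed
  have "\<exists>C. \<forall>i. \<forall>k. (LINT t|?L. norm (R t i k)) \<le> C * mag k"
  proof -
   obtain C1 C2 where C: "\<And>k. (LINT t|?L. norm (R t True k)) \<le> C1 * mag k" "\<And>k. (LINT t|?L. norm (R t False k)) \<le> C2 * mag k"
    using mb[of True] mb[of False] unfolding R_def by blast
   have "(LINT t|?L. norm (R t i k)) \<le> max C1 C2 * mag k" for i k
   proof -
    have "C1 * mag k \<le> max C1 C2 * mag k" "C2 * mag k \<le> max C1 C2 * mag k"
     by (intro mult_right_mono; simp)+
    then show ?thesis using C[of k] by (cases i) (auto intro: order_trans)
   qed
   then show ?thesis by blast
  qed
  moreover have "(LINT t|?L. norm (R t i k)) = (LINT t|?L. norm (rhs (y t) i k))" for i k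
  proof (rule integral_cong_AE)
   show "AE t in ?L. norm (R t i k) = norm (rhs (y t) i k)" using RA[of i k] by eventually_elim simp
  qed (use borel_measurable_integrable[OF integrable_norm[OF iR]] borel_measurable_integrable[OF integrable_norm[OF irhs]] in auto)
  ultimately show "\<exists>C. \<forall>i k. (LINT t|?L. norm (rhs (y t) i k)) \<le> C * mag k" by simp
 qed
 then show ?thesis using y0 py by blast
qed

lemma weak_unique:
 assumes u: "\<And>i. ell 0 (fourier (u i))" "\<And>i. fourier (u i) 0 = 0" "en 0 (\<lambda>i. fourier (u i)) \<le> E0"
  and p: "\<And>i. weak_scalar T (p i) (\<lambda>t x. (p i t x + M i) * (\<alpha> i * px True t x + \<beta> i * px False t x)) (u i)"
   "AE t in leb 0 T. \<forall>i. has_weak_deriv (p i t) (px i t) \<and> ell 2 (fourier (p i t)) \<and> fourier (p i t) 0 = 0"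
   "integrable (leb 0 T) (\<lambda>t. en 2 (\<lambda>i. fourier (p i t)))"
  and q: "\<And>i. weak_scalar T (q i) (\<lambda>t x. (q i t x + M i) * (\<alpha> i * qx True t x + \<beta> i * qx False t x)) (u i)"
   "AE t in leb 0 T. \<forall>i. has_weak_deriv (q i t) (qx i t) \<and> ell 2 (fourier (q i t)) \<and> fourier (q i t) 0 = 0"
   "integrable (leb 0 T) (\<lambda>t. en 2 (\<lambda>i. fourier (q i t)))"
 shows "AE t in leb 0 T. AE x in torus. p i t x = q i t x"
proof -
 have T: "T > 0" using p(1)[of True] by (simp add: weak_scalar_def)
 have part: "AE t in leb 0 T'. \<forall>k. fourier (p i t) k = fourier (q i t) k" if T': "0 < T'" "T' < T" for T'
 proof -
  obtain y where y: "spectral T' y" "y 0 = (\<lambda>i. fourier (u i))" "AE t in leb 0 T'. \<forall>i k. fourier (p i t) k = y t i k"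
   using weak_spectral[where p = p and px = px and u = u, OF T' u(1,2) p] by blast
  obtain z where z: "spectral T' z" "z 0 = (\<lambda>i. fourier (u i))" "AE t in leb 0 T'. \<forall>i k. fourier (q i t) k = z t i k"
   using weak_spectral[where p = q and px = qx and u = u, OF T' u(1,2) q] by blast
  have eq: "y t = z t" if "t \<in> {0..T'}" for t
   by (rule spectral_unique[OF y(1) z(1) _ _ _ that]) (use T' y(2) z(2) u(3) in auto)
  note AE_leb[of 0 T']
  then show ?thesis using y(3) z(3) by eventually_elim (simp add: eq)
 qed
 have "AE t in leb 0 T. t < T \<longrightarrow> (\<forall>k. fourier (p i t) k = fourier (q i t) k)"
 proof -
  \<comment> \<open>Countably many end times below T exhaust [0,T); n + 2 in the denominator keeps
    the first of them positive.\<close>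
  have "AE t in lebesgue. \<forall>n::nat. t \<in> {0..T * (1 - 1 / (real n + 2))} \<longrightarrow> (\<forall>k. fourier (p i t) k = fourier (q i t) k)"
   unfolding AE_all_countable
  proof
   fix n :: nat
   have "0 < T * (1 - 1 / (real n + 2))" "T * (1 - 1 / (real n + 2)) < T" using T by (auto simp: field_simps add_pos_nonneg)
   from part[OF this] show "AE t in lebesgue. t \<in> {0..T * (1 - 1 / (real n + 2))} \<longrightarrow> (\<forall>k. fourier (p i t) k = fourier (q i t) k)"
    by (subst (asm) AE_restrict_space_iff) auto
  qed
  then have "AE t in lebesgue. t \<in> {0..T} \<longrightarrow> t < T \<longrightarrow> (\<forall>k. fourier (p i t) k = fourier (q i t) k)"
  proof eventually_elim
   case (elim t)
   show ?case
   proof (intro impI)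
    assume t: "t \<in> {0..T}" "t < T"
    obtain n :: nat where n: "T / (T - t) < real n" using reals_Archimedean2 by blast
    then have "T < real n * (T - t)" using t by (simp add: divide_less_eq)
    also have "... \<le> (real n + 2) * (T - t)" using t by (intro mult_right_mono) auto
    finally have "t \<le> T * (1 - 1 / (real n + 2))" by (simp add: field_simps)
    then show "\<forall>k. fourier (p i t) k = fourier (q i t) k" using elim t by auto
   qed
  qed
  then show ?thesis by (subst AE_restrict_space_iff) auto
 qed
 moreover have "AE t in leb 0 T. t \<noteq> T"
 proof -
  have "AE s in (lebesgue :: real measure). s \<notin> {T}" by (rule AE_not_in) simp
  then have "AE s in lebesgue. s \<in> {0..T} \<longrightarrow> s \<noteq> T" by eventually_elim simp
  then show ?thesis by (subst AE_restrict_space_iff) auto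
 qed
 moreover note AE_leb[of 0 T]
 ultimately show ?thesis using p(2) q(2)
 proof eventually_elim
  case (elim t)
  have "integrable torus (p i t)" "integrable torus (q i t)" using elim(4,5) by (auto simp: has_weak_deriv_def)
  then show ?case by (rule fourier_unique2) (use elim in auto)
 qed
qed

end

section \<open>Transfer to the function spaces of the statement\<close>

lemma AE_cylinder_of_slices:
 fixes f g :: "real => real => real"
 assumes "(\<lambda>(t, x). f t x) \<in> borel_measurable (cylinder T)" "(\<lambda>(t, x). g t x) \<in> borel_measurable (cylinder T)"
  and ae: "AE t in leb 0 T. AE x in torus. f t x = g t x"
 shows "AE z in cylinder T. f (fst z) (snd z) = g (fst z) (snd z)"
proof -
 let ?h = "\<lambda>z. f (fst z) (snd z) - g (fst z) (snd z)"
 have hm: "?h \<in> borel_measurable (cylinder T)" using assms(1,2) unfolding case_prod_unfold by measurable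
 obtain d where d: "d \<in> borel_measurable borel" "AE z in cylinder T. ?h z = d z" by (rule cylinder_version[OF hm])
 have dm: "d \<in> borel_measurable (cylinder T)" by (rule measurable_cylinder_borel[OF d(1)])
 have "(\<integral>\<^sup>+z. ennreal \<bar>d z\<bar> \<partial>cylinder T) = (\<integral>\<^sup>+t. \<integral>\<^sup>+x. ennreal \<bar>d (t, x)\<bar> \<partial>torus \<partial>leb 0 T)" by (rule cylinder_Fubini_borel(1)[OF d(1)])
 also have "... = (\<integral>\<^sup>+t. 0 \<partial>leb 0 T)"
 proof (rule nn_integral_cong_AE)
  show "AE t in leb 0 T. (\<integral>\<^sup>+x. ennreal \<bar>d (t, x)\<bar> \<partial>torus) = 0"
   using ae AE_cylinder_slices(1)[OF d(2)]
  proof eventually_elim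
   case (elim t)
   then have "AE x in torus. ennreal \<bar>d (t, x)\<bar> = 0" by eventually_elim (metis abs_zero cancel_comm_monoid_add_class.diff_cancel ennreal_0 fst_conv snd_conv)
   then have "(\<integral>\<^sup>+x. ennreal \<bar>d (t, x)\<bar> \<partial>torus) = (\<integral>\<^sup>+x. 0 \<partial>torus)" by (rule nn_integral_cong_AE)
   then show ?case by simp
  qed
 qed
 finally have "(\<integral>\<^sup>+z. ennreal \<bar>d z\<bar> \<partial>cylinder T) = 0" by simp
 then have "AE z in cylinder T. ennreal \<bar>d z\<bar> = 0" using dm by (subst (asm) nn_integral_0_iff_AE) auto
 then show ?thesis using d(2) by eventually_elim auto
qed

text \<open>\<open>Adot\<close> uses real powers, for which 0 powr 0 = 0, while \<open>l1\<close>
  uses natural powers with 0 ^ 0 = 1. The two norms agree because the mean, and with it the mode k =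
  0, vanishes.\<close>

lemma Adot_facts:
 assumes "u \<in> elems (Adot (real s))"
 shows "integrable torus u" "fourier u 0 = 0" "ell s (fourier u)" "fnorm (Adot (real s)) u = l1 s (fourier u)"
proof -
 show iu: "integrable torus u" using assms by (simp add: Adot_def)
 show f0: "fourier u 0 = 0" using assms mean_eq_fourier[OF iu] by (simp add: Adot_def)
 have eq: "mag k powr real s * norm (fourier u k) = mag k^s * norm (fourier u k)" for k
  using f0 by (simp add: abs_powr_nat)
 have "(\<lambda>k. (1 + mag k powr real s) * norm (fourier u k)) summable_on UNIV" using assms by (simp add: Adot_def)
 then have i: "integrable ZM (\<lambda>k. (1 + mag k powr real s) * norm (fourier u k))"
  by (subst (asm) infsum_ZM(1)) auto
 show e: "ell s (fourier u)" unfolding ell_def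
 proof (rule B_int_bound[OF i])
  show "AE k in ZM. norm (mag k^s * norm (fourier u k)) \<le> norm ((1 + mag k powr real s) * norm (fourier u k))"
   unfolding eq[symmetric] by (intro AE_I2) (auto simp: abs_mult intro!: mult_right_mono)
 qed simp
 show "fnorm (Adot (real s)) u = l1 s (fourier u)"
  unfolding Adot_def l1_def fun_space.simps eq by (rule infsum_ZM(2)) (use e in \<open>auto simp: ell_def\<close>)
qed

text \<open>For functions of zero mean the second-order norm dominates the sup-norm of almost every
  slice, which also gives integrability on the cylinder.\<close>

lemma bochner_Adot_2:
 assumes "f \<in> bochner 1 T (Adot 2)"
 shows "AE t in leb 0 T. ell 2 (fourier (f t)) \<and> fourier (f t) 0 = 0"
  and "integrable (leb 0 T) (\<lambda>t. l1 2 (fourier (f t)))"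
  and "integrable (cylinder T) (\<lambda>(t, x). f t x)"
proof -
 have ae: "AE t in leb 0 T. f t \<in> elems (Adot 2)"
  using assms unfolding bochner_def strongly_measurable_def by (auto elim: eventually_mono)
 note A = Adot_facts[where s = 2, simplified]
 show "AE t in leb 0 T. ell 2 (fourier (f t)) \<and> fourier (f t) 0 = 0"
  using ae by eventually_elim (use A in blast)
 have i: "integrable (leb 0 T) (\<lambda>t. fnorm (Adot 2) (f t))" using assms by (simp add: bochner_def)
 have ieq: "AE t in leb 0 T. l1 2 (fourier (f t)) = fnorm (Adot 2) (f t)"
  using ae by eventually_elim (use A in simp)
 have "(\<lambda>t. l1 2 (fourier (f t))) \<in> borel_measurable (leb 0 T)"
  by (rule lebesgue_on_AE_measurable[OF ieq borel_measurable_integrable[OF i]])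
 then show i2: "integrable (leb 0 T) (\<lambda>t. l1 2 (fourier (f t)))"
  using integrable_cong_AE[OF _ borel_measurable_integrable[OF i] ieq] i by simp
 have m: "(\<lambda>(t, x). f t x) \<in> borel_measurable (cylinder T)" using assms by (simp add: bochner_def)
 show "integrable (cylinder T) (\<lambda>(t, x). f t x)"
 proof (rule cylinder_Tonelli[OF m _ i2])
  show "AE t in leb 0 T. AE x in torus. \<bar>case (t, x) of (t, x) => f t x\<bar> \<le> l1 2 (fourier (f t))"
   using ae
  proof eventually_elim
   case (elim t)
   note a = A[OF elim]
   have z: "integrable ZM (fourier (f t))" using ell_mono[OF a(3), of 0] by (simp add: ell_0_iff)
   have "l1 0 (fourier (f t)) \<le> l1 2 (fourier (f t))" by (rule l1_mono[OF a(3) _ a(2)]) simp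
   then have "\<bar>wiener (fourier (f t)) x\<bar> \<le> l1 2 (fourier (f t))" for x
    using abs_wiener_le[OF z, of x] by (simp add: l1_def)
   then show ?case using wiener_fourier_AE[OF a(1) z] by (auto elim: eventually_mono)
  qed
 qed
qed

context film
begin

text \<open>The assumption \<open>coeff\<close> matches the form of \<open>weak_solution\<close>,
  where one coefficient multiplies both derivatives in the second equation; distributing it brings
  that flux to the shape shared by both components.\<close>

lemma weak_solution_unique:
 assumes coeff: "\<alpha> False = \<beta> False"
  and u: "integrable torus u0" "integrable torus v0" "ell 0 (fourier u0)" "ell 0 (fourier v0)" "fourier u0 0 = 0" "fourier v0 0 = 0"
   "l1 0 (fourier u0) + l1 0 (fourier v0) \<le> E0"
  and T: "T > 0"
  and s1: "weak_solution (\<beta> True) (\<alpha> True) (\<alpha> False) (M True) (M False) T u0 v0 f1 g1"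
  and s2: "weak_solution (\<beta> True) (\<alpha> True) (\<alpha> False) (M True) (M False) T u0 v0 f2 g2"
  and reg: "{f1, g1, f2, g2} \<subseteq> bochner 1 T (Adot 2)"
 shows "AE (t, x) in cylinder T. f1 t x = f2 t x \<and> g1 t x = g2 t x"
proof -
 define u where "u i = (if i then u0 else v0)" for i :: bool
 define p where "p f g i = (if i then f else g)" for f g :: "real => real => real" and i :: bool
 have ex: "\<exists>fx gx. (\<forall>i. weak_scalar T (p f g i) (\<lambda>t x. (p f g i t x + M i) * (\<alpha> i * p fx gx True t x + \<beta> i * p fx gx False t x)) (u i)) \<and>
   (AE t in leb 0 T. \<forall>i. has_weak_deriv (p f g i t) (p fx gx i t) \<and> ell 2 (fourier (p f g i t)) \<and> fourier (p f g i t) 0 = 0) \<and>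
   integrable (leb 0 T) (\<lambda>t. en 2 (\<lambda>i. fourier (p f g i t)))"
  if s: "weak_solution (\<beta> True) (\<alpha> True) (\<alpha> False) (M True) (M False) T u0 v0 f g" and fg: "f \<in> bochner 1 T (Adot 2)" "g \<in> bochner 1 T (Adot 2)" for f g
 proof -
  note bf = bochner_Adot_2[OF fg(1)] and bg = bochner_Adot_2[OF fg(2)]
  obtain fx gx where m: "(\<lambda>(t, x). fx t x) \<in> borel_measurable (cylinder T)" "(\<lambda>(t, x). gx t x) \<in> borel_measurable (cylinder T)"
   and wd: "AE t in leb 0 T. has_weak_deriv (f t) (fx t) \<and> has_weak_deriv (g t) (gx t)"
   and w1: "\<And>\<phi> \<phi>t \<phi>x. test_function T \<phi> \<phi>t \<phi>x ==>
      integrable (cylinder T) (\<lambda>(t, x). (f t x + M True) * (\<alpha> True * fx t x + \<beta> True * gx t x) * \<phi>x t x) \<and>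
      - (LINT x|torus. u0 x * \<phi> 0 x) - (LINT (t, x)|cylinder T. f t x * \<phi>t t x)
       = - (LINT (t, x)|cylinder T. (f t x + M True) * (\<alpha> True * fx t x + \<beta> True * gx t x) * \<phi>x t x)"
   and w2: "\<And>\<phi> \<phi>t \<phi>x. test_function T \<phi> \<phi>t \<phi>x ==>
      integrable (cylinder T) (\<lambda>(t, x). (g t x + M False) * (\<alpha> False * (fx t x + gx t x)) * \<phi>x t x) \<and>
      - (LINT x|torus. v0 x * \<phi> 0 x) - (LINT (t, x)|cylinder T. g t x * \<phi>t t x)
       = - (LINT (t, x)|cylinder T. (g t x + M False) * (\<alpha> False * (fx t x + gx t x)) * \<phi>x t x)"
   using s unfolding weak_solution_def by auto
  have mf: "(\<lambda>(t, x). f t x) \<in> borel_measurable (cylinder T)" "(\<lambda>(t, x). g t x) \<in> borel_measurable (cylinder T)"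
   using fg by (auto simp: bochner_def)
  have Jm: "(\<lambda>(t, x). (h t x + a) * (b * fx t x + d * gx t x)) \<in> borel_measurable (cylinder T)"
   if "(\<lambda>(t, x). h t x) \<in> borel_measurable (cylinder T)" for h a b d
   using m that unfolding case_prod_unfold by measurable
  have dist: "\<alpha> False * (a + b) = \<alpha> False * a + \<beta> False * b" for a b by (simp add: coeff distrib_left)
  have 1: "weak_scalar T f (\<lambda>t x. (f t x + M True) * (\<alpha> True * fx t x + \<beta> True * gx t x)) u0"
   by standard (use T bf(3) u(1) w1 Jm[OF mf(1)] in auto)
  have 2: "weak_scalar T g (\<lambda>t x. (g t x + M False) * (\<alpha> False * fx t x + \<beta> False * gx t x)) v0"
   by standard (use T bg(3) u(2) w2[unfolded dist] Jm[OF mf(2)] in auto)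
  show ?thesis
  proof (rule exI[of _ fx], rule exI[of _ gx], intro conjI allI)
   show "weak_scalar T (p f g i) (\<lambda>t x. (p f g i t x + M i) * (\<alpha> i * p fx gx True t x + \<beta> i * p fx gx False t x)) (u i)" for i
    using 1 2 by (cases i) (auto simp: p_def u_def)
   show "AE t in leb 0 T. \<forall>i. has_weak_deriv (p f g i t) (p fx gx i t) \<and> ell 2 (fourier (p f g i t)) \<and> fourier (p f g i t) 0 = 0"
    using wd bf(1) bg(1) by eventually_elim (auto simp: p_def)
   show "integrable (leb 0 T) (\<lambda>t. en 2 (\<lambda>i. fourier (p f g i t)))"
    using bf(2) bg(2) by (simp add: en_def p_def)
  qed
 qed
 obtain f1x g1x where 1: "\<And>i. weak_scalar T (p f1 g1 i) (\<lambda>t x. (p f1 g1 i t x + M i) * (\<alpha> i * p f1x g1x True t x + \<beta> i * p f1x g1x False t x)) (u i)"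
   "AE t in leb 0 T. \<forall>i. has_weak_deriv (p f1 g1 i t) (p f1x g1x i t) \<and> ell 2 (fourier (p f1 g1 i t)) \<and> fourier (p f1 g1 i t) 0 = 0"
   "integrable (leb 0 T) (\<lambda>t. en 2 (\<lambda>i. fourier (p f1 g1 i t)))"
  using ex[OF s1] reg by blast
 obtain f2x g2x where 2: "\<And>i. weak_scalar T (p f2 g2 i) (\<lambda>t x. (p f2 g2 i t x + M i) * (\<alpha> i * p f2x g2x True t x + \<beta> i * p f2x g2x False t x)) (u i)"
   "AE t in leb 0 T. \<forall>i. has_weak_deriv (p f2 g2 i t) (p f2x g2x i t) \<and> ell 2 (fourier (p f2 g2 i t)) \<and> fourier (p f2 g2 i t) 0 = 0"
   "integrable (leb 0 T) (\<lambda>t. en 2 (\<lambda>i. fourier (p f2 g2 i t)))"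
  using ex[OF s2] reg by blast
 have u': "ell 0 (fourier (u i))" "fourier (u i) 0 = 0" "en 0 (\<lambda>i. fourier (u i)) \<le> E0" for i
  using u by (auto simp: u_def en_def)
 have eq: "AE t in leb 0 T. AE x in torus. p f1 g1 i t x = p f2 g2 i t x" for i
  by (rule weak_unique[where u = u and px = "p f1x g1x" and qx = "p f2x g2x", OF u' 1 2])
 have m: "(\<lambda>(t, x). p f g i t x) \<in> borel_measurable (cylinder T)" if "f \<in> bochner 1 T (Adot 2)" "g \<in> bochner 1 T (Adot 2)" for f g i
  using that by (auto simp: bochner_def p_def)
 have "AE z in cylinder T. p f1 g1 i (fst z) (snd z) = p f2 g2 i (fst z) (snd z)" for i
  by (rule AE_cylinder_of_slices[OF m m eq]) (use reg in auto)
 from this[of True] this[of False] show ?thesis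
  by eventually_elim (auto simp: p_def)
qed

end

context film_data
begin

lemma solution:
 assumes coeff: "\<alpha> False = \<beta> False"
  and u0: "integrable torus u0" "integrable torus v0" "fourier u0 = u True" "fourier v0 = u False"
  and T: "T > 0"
 shows "weak_solution (\<beta> True) (\<alpha> True) (\<alpha> False) (M True) (M False) T u0 v0 (\<lambda>t. wiener (gw t True)) (\<lambda>t. wiener (gw t False))"
proof -
 note gd = goodD[OF gw_good]
 \<comment> \<open>The initial datum agrees with its Fourier series almost everywhere only, so the
   initial terms are compared under the integral.\<close>
 have init: "(LINT x|torus. wiener (u i) x * h x) = (LINT x|torus. y x * h x)" if "integrable torus y" "fourier y = u i" "h \<in> borel_measurable torus" for y h i
 proof (rule integral_cong_AE)
  show "AE x in torus. wiener (u i) x * h x = y x * h x"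
   using wiener_fourier_AE[OF that(1)] u(1)[of i] that(2) by (auto elim: eventually_mono)
 qed (use that(1,3) measurable_wiener_torus[OF u(1)] in auto)
 have meas0: "\<phi> 0 \<in> borel_measurable torus" if "test_function T \<phi> \<phi>t \<phi>x" for \<phi> \<phi>t \<phi>x
 proof -
  have "(\<phi> 0 has_real_derivative \<phi>x 0 x) (at x)" for x using that by (simp add: test_function_def)
  then have "continuous_on UNIV (\<phi> 0)" by (meson DERIV_continuous_on has_field_derivative_at_within)
  then show ?thesis by (intro borel_measurable_torus_borel borel_measurable_continuous_onI)
 qed
 have mx: "(\<lambda>(t, x). wiener (dcoef (gw t i)) x) \<in> borel_measurable (cylinder T)" for i
  by (intro measurable_cylinder_borel borel_measurable_wiener_path borel_dcoef_gw)
 show ?thesis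
  unfolding weak_solution_def
 proof (intro conjI, goal_cases)
  case 1 show ?case by (rule wiener_path.bochner_W11[OF path])
 next
  case 2 show ?case by (rule wiener_path.bochner_W11[OF path])
 next
  case 3 show ?case using mean_wiener[OF gw_good] by simp
 next
  case 4 show ?case
 proof (rule exI[of _ "\<lambda>t. wiener (dcoef (gw t True))"], rule exI[of _ "\<lambda>t. wiener (dcoef (gw t False))"], intro conjI allI impI)
  show "(\<lambda>(t, x). wiener (dcoef (gw t True)) x) \<in> borel_measurable (cylinder T)" "(\<lambda>(t, x). wiener (dcoef (gw t False)) x) \<in> borel_measurable (cylinder T)"
   by (rule mx)+
  show "AE t in leb 0 T. has_weak_deriv (wiener (gw t True)) (wiener (dcoef (gw t True))) \<and> has_weak_deriv (wiener (gw t False)) (wiener (dcoef (gw t False)))"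
   using has_weak_deriv_wiener[OF gd(5)] by simp
 next
  fix \<psi> \<psi>t \<psi>x assume tf: "test_function T \<psi> \<psi>t \<psi>x"
  note e = weak_equation[OF tf T, of True, unfolded J_def init[OF u0(1,3) meas0[OF tf]]]
  show "integrable (cylinder T) (\<lambda>(t, x). (wiener (gw t True) x + M True) * (\<alpha> True * wiener (dcoef (gw t True)) x + \<beta> True * wiener (dcoef (gw t False)) x) * \<psi>x t x)"
   by (rule e(1))
  show "- (LINT x|torus. u0 x * \<psi> 0 x) - (LINT (t, x)|cylinder T. wiener (gw t True) x * \<psi>t t x)
   = - (LINT (t, x)|cylinder T. (wiener (gw t True) x + M True) * (\<alpha> True * wiener (dcoef (gw t True)) x + \<beta> True * wiener (dcoef (gw t False)) x) * \<psi>x t x)"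
   by (rule e(2))
 next
  fix \<psi> \<psi>t \<psi>x assume tf: "test_function T \<psi> \<psi>t \<psi>x"
  note e = weak_equation[OF tf T, of False, unfolded J_def init[OF u0(2,4) meas0[OF tf]] coeff[symmetric] distrib_left[symmetric]]
  show "integrable (cylinder T) (\<lambda>(t, x). (wiener (gw t False) x + M False) * (\<alpha> False * (wiener (dcoef (gw t True)) x + wiener (dcoef (gw t False)) x)) * \<psi>x t x)"
   by (rule e(1))
  show "- (LINT x|torus. v0 x * \<psi> 0 x) - (LINT (t, x)|cylinder T. wiener (gw t False) x * \<psi>t t x)
   = - (LINT (t, x)|cylinder T. (wiener (gw t False) x + M False) * (\<alpha> False * (wiener (dcoef (gw t True)) x + wiener (dcoef (gw t False)) x)) * \<psi>x t x)"
   by (rule e(2))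
 qed
 qed
qed

lemma decay:
 assumes "t \<ge> 0"
 shows "linf_enorm (wiener (gw t True)) + linf_enorm (wiener (gw t False)) \<le> ennreal (E0 * exp (- \<delta> * t))"
proof -
 have "linf_enorm (wiener (gw t True)) + linf_enorm (wiener (gw t False)) \<le> ennreal (l1 0 (gw t True)) + ennreal (l1 0 (gw t False))"
  by (intro add_mono linf_enorm_wiener goodD[OF gw_good])
 also have "... = ennreal (en 0 (gw t))" by (simp add: en_def)
 also have "... \<le> ennreal (E0 * exp (- \<delta> * t))" using en_gw_le[of 0 t] w_energy(2)[OF assms] by (intro ennreal_leI) simp
 finally show ?thesis .
qed

end

section \<open>Choice of the parameters and conclusion\<close>

theorem theorem2:
 fixes \<mu>\<^sub>p \<mu>\<^sub>m \<rho>\<^sub>p \<rho>\<^sub>m b b\<^sub>\<mu> b\<^sub>\<rho> \<sigma>\<^sub>1 \<sigma>\<^sub>2 :: real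
  and f\<^sub>0 g\<^sub>0 u\<^sub>0 v\<^sub>0 :: "real \<Rightarrow> real"
 assumes "\<mu>\<^sub>p > 0" "\<mu>\<^sub>m > 0" "\<rho>\<^sub>p > 0" "\<rho>\<^sub>m > 0"
  and "b = \<rho>\<^sub>p" "b\<^sub>\<mu> = \<mu>\<^sub>m / \<mu>\<^sub>p * b" "b\<^sub>\<rho> = \<rho>\<^sub>m / \<rho>\<^sub>p * b"
  and "periodic f\<^sub>0" "periodic g\<^sub>0" "\<forall>x. f\<^sub>0 x > 0" "\<forall>x. g\<^sub>0 x > 0"
  and "u\<^sub>0 = (\<lambda>x. f\<^sub>0 x - mean f\<^sub>0)" "v\<^sub>0 = (\<lambda>x. g\<^sub>0 x - mean g\<^sub>0)"
  and "u\<^sub>0 \<in> elems (Adot 0)" "v\<^sub>0 \<in> elems (Adot 0)"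
  and "\<sigma>\<^sub>1 = mean f\<^sub>0 * b\<^sub>\<rho> - mean g\<^sub>0 * b\<^sub>\<mu> - energy 0 u\<^sub>0 v\<^sub>0 * (2 * b\<^sub>\<rho> + 2 * b + 4 * b\<^sub>\<mu>)"
  and "\<sigma>\<^sub>2 = mean g\<^sub>0 * b\<^sub>\<mu> - mean f\<^sub>0 * b - energy 0 u\<^sub>0 v\<^sub>0 * (2 * b\<^sub>\<rho> + 2 * b + 4 * b\<^sub>\<mu>)"
  and "energy 0 u\<^sub>0 v\<^sub>0 < min (mean f\<^sub>0) (mean g\<^sub>0)"
  and "min \<sigma>\<^sub>1 \<sigma>\<^sub>2 > 0"
 shows "(\<exists>\<delta>>0. \<exists>f g.
      global_weak_solution b b\<^sub>\<rho> b\<^sub>\<mu> (mean f\<^sub>0) (mean g\<^sub>0) u\<^sub>0 v\<^sub>0 f g \<and>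
      (\<forall>T>0. \<forall>\<alpha>\<in>{0..<1/2}. f \<in> regularity_class T \<alpha> \<and> g \<in> regularity_class T \<alpha>) \<and>
      (AE T in lebesgue_on {0<..}.
        linf_enorm (f T) + linf_enorm (g T) \<le> ennreal (energy 0 u\<^sub>0 v\<^sub>0 * exp (- \<delta> * T)))) \<and>
     (\<forall>T>0. \<forall>f1 g1 f2 g2.
      weak_solution b b\<^sub>\<rho> b\<^sub>\<mu> (mean f\<^sub>0) (mean g\<^sub>0) T u\<^sub>0 v\<^sub>0 f1 g1 \<and>
      weak_solution b b\<^sub>\<rho> b\<^sub>\<mu> (mean f\<^sub>0) (mean g\<^sub>0) T u\<^sub>0 v\<^sub>0 f2 g2 \<and>
      {f1, g1, f2, g2} \<subseteq> bochner 1 T (Adot 2) \<longrightarrow>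
      (AE (t, x) in cylinder T. f1 t x = f2 t x \<and> g1 t x = g2 t x))"
proof -
 define E where "E = energy 0 u\<^sub>0 v\<^sub>0"
 note au = Adot_facts[where s = 0, simplified, OF assms(14)] and av = Adot_facts[where s = 0, simplified, OF assms(15)]
 have E: "E = l1 0 (fourier u\<^sub>0) + l1 0 (fourier v\<^sub>0)" using au(4) av(4) by (simp add: E_def energy_def)
 have E0: "E \<ge> 0" by (simp add: E)
 have bpos: "b > 0" "b\<^sub>\<mu> > 0" "b\<^sub>\<rho> > 0" using assms(1-7) by auto
 define M \<alpha> \<beta> where "M i = (if i then mean f\<^sub>0 else mean g\<^sub>0)" "\<alpha> i = (if i then b\<^sub>\<rho> else b\<^sub>\<mu>)" "\<beta> i = (if i then b else b\<^sub>\<mu>)" for i :: bool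
 note defs = M_\<alpha>_\<beta>_def
 define \<delta> where "\<delta> = min \<sigma>\<^sub>1 \<sigma>\<^sub>2"
 \<comment> \<open>The nonlinear cost is 2 c E with c =
   \<open>b\<^sub>\<rho> + b + b\<^sub>\<mu>\<close>. The coefficient of E in
   \<open>\<sigma>\<^sub>1\<close> and \<open>\<sigma>\<^sub>2\<close> dominates 2 c, so their
   minimum is an admissible decay rate.\<close>
 have slack: "2 * (b\<^sub>\<rho> + b + b\<^sub>\<mu>) * E \<le> E * (2 * b\<^sub>\<rho> + 2 * b + 4 * b\<^sub>\<mu>)"
  using mult_left_mono[of "2 * (b\<^sub>\<rho> + b + b\<^sub>\<mu>)" "2 * b\<^sub>\<rho> + 2 * b + 4 * b\<^sub>\<mu>" E] E0 bpos by (simp add: mult.commute)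
 \<comment> \<open>The sum serves as \<open>c\<close> because it dominates
   \<open>b\<^sub>\<rho>\<close>, \<open>b + b\<^sub>\<mu>\<close> and \<open>b\<^sub>\<mu>\<close>.
   Positivity of the two means comes from the bound on the initial energy.\<close>
 interpret film M \<alpha> \<beta> "b\<^sub>\<rho> + b + b\<^sub>\<mu>" E \<delta>
 proof
  show "M i > 0" for i using assms(18) E0 by (auto simp: defs E_def)
  show "\<alpha> i > 0" "\<beta> i > 0" for i using bpos by (auto simp: defs)
  show "\<delta> > 0" using assms(19) by (simp add: \<delta>_def)
  show "E \<ge> 0" by (rule E0)
  show "\<alpha> True \<le> b\<^sub>\<rho> + b + b\<^sub>\<mu>" "\<beta> True + \<alpha> False \<le> b\<^sub>\<rho> + b + b\<^sub>\<mu>" "\<beta> False \<le> b\<^sub>\<rho> + b + b\<^sub>\<mu>" using bpos by (auto simp: defs)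
  have "\<delta> \<le> \<sigma>\<^sub>1" "\<delta> \<le> \<sigma>\<^sub>2" by (auto simp: \<delta>_def)
  then show "2 * (b\<^sub>\<rho> + b + b\<^sub>\<mu>) * E + \<delta> \<le> M True * \<alpha> True - M False * \<alpha> False"
   "2 * (b\<^sub>\<rho> + b + b\<^sub>\<mu>) * E + \<delta> \<le> M False * \<beta> False - M True * \<beta> True"
   using slack unfolding assms(16,17) E_def[symmetric] by (auto simp: defs)
 qed
 define u where "u i = (if i then fourier u\<^sub>0 else fourier v\<^sub>0)" for i :: bool
 interpret film_data M \<alpha> \<beta> "b\<^sub>\<rho> + b + b\<^sub>\<mu>" E \<delta> u
 proof
  show "integrable ZM (u i)" "hermitian (u i)" "u i 0 = 0" for i
   using au av hermitian_fourier by (auto simp: u_def ell_0_iff)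
  show "en 0 u \<le> E" by (simp add: en_def u_def E)
 qed
 have coeff: "\<alpha> False = \<beta> False" by (simp add: defs)
 show ?thesis
 proof (intro conjI allI impI, goal_cases)
  case 1
  show ?case
  proof (rule exI[of _ \<delta>], intro conjI, rule pos(4), rule exI[of _ "\<lambda>t. wiener (gw t True)"], rule exI[of _ "\<lambda>t. wiener (gw t False)"], intro conjI allI impI ballI)
   show "global_weak_solution b b\<^sub>\<rho> b\<^sub>\<mu> (mean f\<^sub>0) (mean g\<^sub>0) u\<^sub>0 v\<^sub>0 (\<lambda>t. wiener (gw t True)) (\<lambda>t. wiener (gw t False))"
    unfolding global_weak_solution_def
    using solution[OF coeff au(1) av(1)] by (simp add: u_def defs)
   show "(\<lambda>t. wiener (gw t True)) \<in> regularity_class T a" "(\<lambda>t. wiener (gw t False)) \<in> regularity_class T a"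
    if "a \<in> {0..<1/2}" for T a by (rule wiener_path.regularity[OF path that])+
   have "AE T in lebesgue_on {0<..}. T \<in> {0<..}" by (rule AE_I2) (simp add: space_restrict_space)
   then show "AE T in lebesgue_on {0<..}. linf_enorm (wiener (gw T True)) + linf_enorm (wiener (gw T False)) \<le> ennreal (energy 0 u\<^sub>0 v\<^sub>0 * exp (- \<delta> * T))"
    unfolding E_def[symmetric] by eventually_elim (rule decay, simp)
  qed
 next
  case h: (2 T f1 g1 f2 g2)
  show ?case
  proof (rule weak_solution_unique[OF coeff au(1) av(1) au(3) av(3) au(2) av(2) _ h(1)])
   show "l1 0 (fourier u\<^sub>0) + l1 0 (fourier v\<^sub>0) \<le> E" by (simp add: E)
  qed (use h in \<open>auto simp: defs\<close>)
 qed
qed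

end
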